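(* Let $d\ge1$, let $G$ be a symmorphic magnetic space group in $\mathbb{R}^d$ (spinless, or double in the spinful case), and consider an elementary band representation of $G$ of rank $s$. (a) If the elementary band representation splits into bands one of which is a simple band that is not a band representation of $G$, then this simple band has nonvanishing first Chern class. (b) If $s\ge2$ and the elementary band representation splits into $s$ simple bands, then at least two of these $s$ simple bands have nonvanishing first Chern class; in particular, if $s=2$, both simple bands do.
   Context: Groups. $BL\subset\mathbb{R}^d$ is a full-rank lattice (Bravais lattice), $RL=\{K: K\cdot R\in2\pi\mathbb{Z}\ \forall R\in BL\}$, $T^d=\mathbb{R}^d/RL$ the Brillouin torus. The point group $\mathcal P$ is a finite group with a homomorphism $p\mapsto(\check p,s_p)\in O(d)\times\{\pm1\}$ such that $\check p\,BL=BL$ ($s_p=-1$ means $p$ involves time reversal). $G=\{(p|R):p\in\mathcal P,R\in BL\}$ with $(q|R')(p|R)=(qp|\check qR+R')$ is the symmorphic magnetic space group, acting by $(p|R)\circ r=\check pr+R$. Wavefunctions take values in $V_0^{\oplus m}$ ($m\ge1$ arbitrary), where $V_0$ is a finite-dimensional complex Hilbert space on which $\mathcal P$ acts by operators $D_p$ with $D_qD_p=D_{qp}$, $D_p$ unitary if $s_p=1$ and antiunitary if $s_p=-1$. Spinless case: $p\mapsto(\check p,s_p)$ is injective, $V_0=\mathbb{C}$, and $D_p$ is the identity or complex conjugation according to $s_p=1$ or $-1$. Spinful case: $G$ is a double group, i.e. the kernel of $p\mapsto(\check p,s_p)$ is $\{E,\bar E\}$ with $\bar E$ the $2\pi$ rotation,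 $V_0$ is the spinor space and $D_{\bar E}=-1$. For $g=(p|R)$, $(\hat gf)(r)=D_pf(g^{-1}\circ r)$. Bands. A Bloch function with wavevector $k$ is a locally square-integrable function with $\psi(r+R)=e^{ik\cdot R}\psi(r)$ for $R\in BL$. A rank-$N$ band with $G$ symmetry assigns to each $k\in\mathbb{R}^d$ an $N$-dimensional space $\mathcal E_k$ of Bloch functions with wavevector $k$, with orthogonal projection $P(k)$ (inner product over a unit cell), such that $P(k+K)=P(k)$ for $K\in RL$, $e^{-ik\cdot r}P(k)e^{ik\cdot r}$ is real-analytic in $k$, and $\hat g\mathcal E_k=\mathcal E_{s_p\check pk}$ for all $g=(p|R)\in G$. A simple band is a band of rank one. The first Chern class is that of the complex vector bundle over $T^d$ with fibre $\mathcal E_k$. A band splits into bands $\mathcal E^{(1)},\dots,\mathcal E^{(l)}$ with $G$ symmetry (each of positive rank, $l\ge2$) if at each $k$ its fibre is the orthogonal direct sum of the fibres $\mathcal E^{(j)}_k$. Band representation. An orthonormal frame of $\mathcal E_k$ is analytic if its members multiplied by $e^{-ik\cdot r}$ are real-analytic in $k$, and periodic if it is unchanged under $k\to k+K$, $K\in RL$; the Wannier functions of a frame member $\psi_k$ are $w_R(r)=|T^d|^{-1/2}\int_{T^d}e^{-ik\cdot R}\psi_k(r)\,dk$, $R\in BL$. A band with $G$ symmetry is a band representation (BR) of $G$ if there are points $\varpi_1,\dots,\varpi_M\in\mathbb{R}^d$, pairwise distinct modulo $BL$, with $X=\{\varpi_n+R\}_{n,R\in BL}$ invariant under $G$, and an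 analytic periodic orthonormal frame $\psi^\alpha_{n,k}$ indexed by $n$ and $\alpha$, such that, with $W_{\varpi_n+R}$ the span over $\alpha$ of the Wannier functions $w^\alpha_{n,R}$, one has $\hat gW_x=W_{g\circ x}$ for all $g\in G$, $x\in X$ (that is, the representation is induced from representations of site stabilizers on Wannier functions). An elementary band representation of $G$ is a BR of $G$ that cannot be split into two or more bands of smaller rank that are all BRs of $G$. *)

theory Defs
  imports "HOL-Analysis.Analysis" "HOL-Algebra.Group" "HOL-Library.Function_Algebras"
begin

instantiation "fun" :: (type, real_vector) real_vector
begin

definition scaleR_fun :: "real \<Rightarrow> ('a \<Rightarrow> 'b) \<Rightarrow> 'a \<Rightarrow> 'b" where
  "scaleR_fun c f = (\<lambda>x. c *\<^sub>R f x)"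

instance
  by standard (simp_all add: scaleR_fun_def fun_eq_iff scaleR_right_distrib scaleR_left_distrib)

end


section \<open>Hermitian structure of the value spaces\<close>

text \<open>
  A finite-dimensional complex Hilbert space \<open>V\<^sub>0\<close> is taken in orthonormal coordinates, as
  \<^typ>\<open>complex ^ 'v\<close>; wavefunctions are valued in the \<open>m\<close>-fold direct sum
  \<^typ>\<open>complex ^ 'v ^ 'm\<close>.
\<close>

definition cinner :: "complex ^ 'v \<Rightarrow> complex ^ 'v \<Rightarrow> complex" where
  "cinner x y = (\<Sum>i\<in>UNIV. cnj (x $ i) * y $ i)"

definition unitary_op :: "(complex ^ 'v \<Rightarrow> complex ^ 'v) \<Rightarrow> bool" where
  "unitary_op T \<longleftrightarrow> bij T \<and> (\<forall>x y. T (x + y) = T x + T y) \<and> (\<forall>c x. T (c *s x) = c *s T x)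
     \<and> (\<forall>x y. cinner (T x) (T y) = cinner x y)"

definition antiunitary_op :: "(complex ^ 'v \<Rightarrow> complex ^ 'v) \<Rightarrow> bool" where
  "antiunitary_op T \<longleftrightarrow> bij T \<and> (\<forall>x y. T (x + y) = T x + T y) \<and> (\<forall>c x. T (c *s x) = cnj c *s T x)
     \<and> (\<forall>x y. cinner (T x) (T y) = cnj (cinner x y))"

definition winner :: "complex ^ 'v ^ 'm \<Rightarrow> complex ^ 'v ^ 'm \<Rightarrow> complex" where
  "winner x y = (\<Sum>j\<in>UNIV. cinner (x $ j) (y $ j))"

definition cscale :: "complex \<Rightarrow> complex ^ 'v ^ 'm \<Rightarrow> complex ^ 'v ^ 'm" where
  "cscale c x = (\<chi> j. c *s (x $ j))"


section \<open>Lattices\<close>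

definition lattice_of :: "real ^ 'd ^ 'd \<Rightarrow> (real ^ 'd) set" where
  "lattice_of a = {\<Sum>i\<in>UNIV. real_of_int (n i) *\<^sub>R (a $ i) | n. True}"

definition full_lattice :: "(real ^ 'd) set \<Rightarrow> bool" where
  "full_lattice L \<longleftrightarrow> (\<exists>a. invertible a \<and> L = lattice_of a)"

definition dual_lattice :: "(real ^ 'd) set \<Rightarrow> (real ^ 'd) set" where
  "dual_lattice L = {K. \<forall>R\<in>L. \<exists>n::int. K \<bullet> R = 2 * pi * real_of_int n}"

text \<open>
  The half-open parallelepiped of some basis. Integrals of periodic functions over it do
  not depend on the basis.
\<close>

definition unit_cell :: "(real ^ 'd) set \<Rightarrow> (real ^ 'd) set" where
  "unit_cell L = (let a = (SOME a. invertible a \<and> L = lattice_of a) in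
     {\<Sum>i\<in>UNIV. t i *\<^sub>R (a $ i) | t. \<forall>i. 0 \<le> t i \<and> t i < (1::real)})"


section \<open>Symmorphic magnetic space groups\<close>

text \<open>
  \<open>rot p\<close> and \<open>trs p\<close> are the components of the homomorphism into \<open>O(d) \<times> {1, -1}\<close>, and
  \<open>rep p\<close> is the operator \<open>D\<^sub>p\<close> on \<open>V\<^sub>0\<close>.
\<close>

record ('p, 'd::finite, 'v::finite) msg =
  bravais :: "(real ^ 'd) set"
  point_group :: "'p monoid"
  rot :: "'p \<Rightarrow> real ^ 'd ^ 'd"
  trs :: "'p \<Rightarrow> real"
  rep :: "'p \<Rightarrow> complex ^ 'v \<Rightarrow> complex ^ 'v"

definition reciprocal :: "('p, 'd::finite, 'v::finite) msg \<Rightarrow> (real ^ 'd) set" where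
  "reciprocal G = dual_lattice (bravais G)"

definition symmorphic_msg :: "('p, 'd::finite, 'v::finite) msg \<Rightarrow> bool" where
  "symmorphic_msg G \<longleftrightarrow>
     full_lattice (bravais G) \<and> group (point_group G) \<and> finite (carrier (point_group G)) \<and>
     (\<forall>p\<in>carrier (point_group G).
        orthogonal_matrix (rot G p) \<and> (trs G p = 1 \<or> trs G p = -1) \<and>
        (*v) (rot G p) ` bravais G = bravais G \<and>
        (trs G p = 1 \<longrightarrow> unitary_op (rep G p)) \<and>
        (trs G p = -1 \<longrightarrow> antiunitary_op (rep G p))) \<and>
     (\<forall>q\<in>carrier (point_group G). \<forall>p\<in>carrier (point_group G).
        rot G (q \<otimes>\<^bsub>point_group G\<^esub> p) = rot G q ** rot G p \<and>
        trs G (q \<otimes>\<^bsub>point_group G\<^esub> p) = trs G q * trs G p \<and>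
        rep G (q \<otimes>\<^bsub>point_group G\<^esub> p) = rep G q \<circ> rep G p)"

definition spinless :: "('p, 'd::finite, 'v::finite) msg \<Rightarrow> bool" where
  "spinless G \<longleftrightarrow>
     inj_on (\<lambda>p. (rot G p, trs G p)) (carrier (point_group G)) \<and> CARD('v) = 1 \<and>
     (\<forall>p\<in>carrier (point_group G).
        rep G p = (if trs G p = 1 then (\<lambda>x. x) else (\<lambda>x. \<chi> i. cnj (x $ i))))"

text \<open>
  No dimension is prescribed for the spinor space \<open>V\<^sub>0\<close>: any \<open>V\<^sub>0\<close> carrying operators
  \<open>D\<^sub>p\<close> in which the \<open>2\<pi>\<close> rotation acts as \<open>-1\<close> is admitted.
\<close>

definition spinful :: "('p, 'd::finite, 'v::finite) msg \<Rightarrow> bool" where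
  "spinful G \<longleftrightarrow>
     (\<exists>Ebar\<in>carrier (point_group G). Ebar \<noteq> \<one>\<^bsub>point_group G\<^esub> \<and>
        {p \<in> carrier (point_group G). rot G p = mat 1 \<and> trs G p = 1}
          = {\<one>\<^bsub>point_group G\<^esub>, Ebar} \<and>
        rep G Ebar = uminus)"

definition space_group :: "('p, 'd::finite, 'v::finite) msg \<Rightarrow> ('p \<times> (real ^ 'd)) monoid" where
  "space_group G = \<lparr>carrier = carrier (point_group G) \<times> bravais G,
     monoid.mult = (\<lambda>(q, R') (p, R). (q \<otimes>\<^bsub>point_group G\<^esub> p, rot G q *v R + R')),
     one = (\<one>\<^bsub>point_group G\<^esub>, 0)\<rparr>"

definition act :: "('p, 'd::finite, 'v::finite) msg \<Rightarrow> 'p \<times> (real ^ 'd) \<Rightarrow> real ^ 'd \<Rightarrow> real ^ 'd" where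
  "act G g r = rot G (fst g) *v r + snd g"

definition hat :: "('p, 'd::finite, 'v::finite) msg \<Rightarrow> 'p \<times> (real ^ 'd) \<Rightarrow>
    (real ^ 'd \<Rightarrow> complex ^ 'v ^ 'm) \<Rightarrow> real ^ 'd \<Rightarrow> complex ^ 'v ^ 'm" where
  "hat G g f = (\<lambda>r. \<chi> j. rep G (fst g) (f (act G (inv\<^bsub>space_group G\<^esub> g) r) $ j))"


section \<open>Bloch functions\<close>

text \<open>
  Elements of \<open>L\<^sup>2\<close> are represented by Borel functions, and identities between them are
  required almost everywhere; spaces of such elements are sets of functions closed under
  almost-everywhere equality.
\<close>

type_synonym ('d, 'v, 'm) wavefun = "real ^ 'd \<Rightarrow> complex ^ 'v ^ 'm"

definition locally_L2 :: "('d::finite, 'v::finite, 'm::finite) wavefun set" where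
  "locally_L2 = {f \<in> borel_measurable lborel.
     \<forall>\<rho>. set_integrable lborel (cball 0 \<rho>) (\<lambda>r. (norm (f r))\<^sup>2)}"

definition bloch :: "(real ^ 'd) set \<Rightarrow> real ^ 'd \<Rightarrow>
    ('d::finite, 'v::finite, 'm::finite) wavefun set" where
  "bloch L k = {\<psi> \<in> locally_L2.
     \<forall>R\<in>L. AE r in lborel. \<psi> (r + R) = cscale (cis (k \<bullet> R)) (\<psi> r)}"

definition cell_inner :: "(real ^ 'd) set \<Rightarrow> ('d::finite, 'v::finite, 'm::finite) wavefun \<Rightarrow>
    ('d, 'v, 'm) wavefun \<Rightarrow> complex" where
  "cell_inner L f g = (LINT r:unit_cell L|lborel. winner (f r) (g r))"

definition cell_norm :: "(real ^ 'd) set \<Rightarrow> ('d::finite, 'v::finite, 'm::finite) wavefun \<Rightarrow> real" where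
  "cell_norm L f = sqrt (LINT r:unit_cell L|lborel. (norm (f r))\<^sup>2)"

definition phase_mult :: "real ^ 'd \<Rightarrow> ('d::finite, 'v::finite, 'm::finite) wavefun \<Rightarrow>
    ('d, 'v, 'm) wavefun" where
  "phase_mult k f = (\<lambda>r. cscale (cis (k \<bullet> r)) (f r))"

definition orthonormal_basis :: "(real ^ 'd) set \<Rightarrow> real ^ 'd \<Rightarrow> 'i set \<Rightarrow>
    ('i \<Rightarrow> ('d::finite, 'v::finite, 'm::finite) wavefun) \<Rightarrow> ('d, 'v, 'm) wavefun set \<Rightarrow> bool" where
  "orthonormal_basis L k I b S \<longleftrightarrow> finite I \<and> (\<forall>i\<in>I. b i \<in> bloch L k) \<and>
     (\<forall>i\<in>I. \<forall>j\<in>I. cell_inner L (b i) (b j) = (if i = j then 1 else 0)) \<and>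
     S = {f \<in> bloch L k. \<exists>c. AE r in lborel. f r = (\<Sum>i\<in>I. cscale (c i) (b i r))}"

definition proj :: "(real ^ 'd) set \<Rightarrow> ('d::finite, 'v::finite, 'm::finite) wavefun set \<Rightarrow>
    ('d, 'v, 'm) wavefun \<Rightarrow> ('d, 'v, 'm) wavefun" where
  "proj L S f = (SOME g. g \<in> S \<and> (\<forall>h\<in>S. cell_inner L h (f - g) = 0))"


section \<open>Real-analytic families\<close>

text \<open>
  \<open>u\<close> takes values in a vector space with a seminorm \<open>N\<close>; near every point it is the sum of
  an absolutely convergent power series in \<open>d\<close> variables with coefficients in \<open>S\<close>.
\<close>

definition real_analytic :: "'x::real_vector set \<Rightarrow> ('x \<Rightarrow> real) \<Rightarrow> (real ^ 'd::finite \<Rightarrow> 'x) \<Rightarrow> bool" where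
  "real_analytic S N u \<longleftrightarrow>
     (\<forall>k0. \<exists>\<rho>>0. \<exists>a :: ('d \<Rightarrow> nat) \<Rightarrow> 'x.
        range a \<subseteq> S \<and>
        (\<lambda>\<alpha>. N (a \<alpha>) * \<rho> ^ (\<Sum>i\<in>UNIV. \<alpha> i)) summable_on UNIV \<and>
        (\<forall>k. (\<forall>i. \<bar>(k - k0) $ i\<bar> < \<rho>) \<longrightarrow>
           ((\<lambda>A. N (u k - (\<Sum>\<alpha>\<in>A. (\<Prod>i\<in>UNIV. ((k - k0) $ i) ^ \<alpha> i) *\<^sub>R a \<alpha>))) \<longlongrightarrow> 0)
             (finite_subsets_at_top UNIV)))"

text \<open>Bounded operators on the space \<^term>\<open>bloch L 0\<close> of periodic functions.\<close>

definition bounded_ops :: "(real ^ 'd) set \<Rightarrow>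
    (('d::finite, 'v::finite, 'm::finite) wavefun \<Rightarrow> ('d, 'v, 'm) wavefun) set" where
  "bounded_ops L = {T. (\<forall>f\<in>bloch L 0. T f \<in> bloch L 0) \<and>
     (\<forall>f\<in>bloch L 0. \<forall>g\<in>bloch L 0. AE r in lborel. T (f + g) r = T f r + T g r) \<and>
     (\<forall>f\<in>bloch L 0. \<forall>c. AE r in lborel. T (\<lambda>x. cscale c (f x)) r = cscale c (T f r)) \<and>
     (\<exists>C. \<forall>f\<in>bloch L 0. cell_norm L (T f) \<le> C * cell_norm L f)}"

definition op_norm :: "(real ^ 'd) set \<Rightarrow>
    (('d::finite, 'v::finite, 'm::finite) wavefun \<Rightarrow> ('d, 'v, 'm) wavefun) \<Rightarrow> real" where
  "op_norm L T = Sup {cell_norm L (T f) | f. f \<in> bloch L 0 \<and> cell_norm L f \<le> 1}"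


section \<open>Bands with symmetry\<close>

text \<open>A band is given by its fibres \<open>E k\<close>; \<open>P(k + K) = P(k)\<close> is stated as equality of fibres.\<close>

type_synonym ('d, 'v, 'm) fibres = "real ^ 'd \<Rightarrow> ('d, 'v, 'm) wavefun set"

definition band :: "('p, 'd::finite, 'v::finite) msg \<Rightarrow> nat \<Rightarrow> ('d, 'v, 'm::finite) fibres \<Rightarrow> bool" where
  "band G N E \<longleftrightarrow>
     (\<forall>k. \<exists>b. orthonormal_basis (bravais G) k {..<N} b (E k)) \<and>
     (\<forall>k. \<forall>K\<in>reciprocal G. E (k + K) = E k) \<and>
     real_analytic (bounded_ops (bravais G)) (op_norm (bravais G))
       (\<lambda>k u. phase_mult (- k) (proj (bravais G) (E k) (phase_mult k u))) \<and>
     (\<forall>g\<in>carrier (space_group G). \<forall>k.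
        hat G g ` E k = E (trs G (fst g) *\<^sub>R (rot G (fst g) *v k)))"

definition simple_band :: "('p, 'd::finite, 'v::finite) msg \<Rightarrow> ('d, 'v, 'm::finite) fibres \<Rightarrow> bool" where
  "simple_band G E \<longleftrightarrow> band G 1 E"

definition splits_into :: "('p, 'd::finite, 'v::finite) msg \<Rightarrow> ('d, 'v, 'm::finite) fibres \<Rightarrow>
    nat \<Rightarrow> (nat \<Rightarrow> ('d, 'v, 'm) fibres) \<Rightarrow> bool" where
  "splits_into G E l F \<longleftrightarrow> 2 \<le> l \<and> (\<forall>j<l. \<exists>N\<ge>1. band G N (F j)) \<and>
     (\<forall>k. (\<forall>i<l. \<forall>j<l. i \<noteq> j \<longrightarrow>
              (\<forall>f\<in>F i k. \<forall>g\<in>F j k. cell_inner (bravais G) f g = 0)) \<and>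
          E k = {f \<in> bloch (bravais G) k.
                   \<exists>h. (\<forall>j<l. h j \<in> F j k) \<and> (AE r in lborel. f r = (\<Sum>j<l. h j r))})"


section \<open>First Chern class of a line bundle over the Brillouin torus\<close>

text \<open>
  The bundle is topologised as a subbundle of the bundle of Bloch functions, i.e. after
  multiplication by \<open>exp (- i k \<cdot> r)\<close>. Its pullback to \<open>\<real>\<^sup>d\<close> has a continuous unit
  section \<open>\<phi>\<close>, whence transition functions \<open>\<phi>\<^bsub>k+K\<^esub> = exp (2\<pi>i f\<^sub>K(k)) \<phi>\<^sub>k\<close>, with \<open>f\<^sub>K\<close> real and
  continuous. The connecting homomorphism of \<open>0 \<rightarrow> \<int> \<rightarrow> \<real> \<rightarrow> U(1) \<rightarrow> 0\<close> sends them to the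
  integral 2-cocycle
  \<open>n(K, K') = f\<^sub>K(k + K') + f\<^bsub>K'\<^esub>(k) - f\<^bsub>K+K'\<^esub>(k)\<close> of the deck group \<open>RL\<close>; its class in
  \<open>H\<^sup>2(RL, \<int>) = H\<^sup>2(T\<^sup>d, \<int>)\<close> is the first Chern class (up to the sign convention). Changing
  \<open>f\<close> or \<open>\<phi>\<close> changes \<open>n\<close> precisely by the coboundaries, so the set of all cocycles
  obtained is a coset of the coboundaries, i.e. an element of \<open>H\<^sup>2(RL, \<int>)\<close>.
\<close>

definition continuous_unit_section :: "('p, 'd::finite, 'v::finite) msg \<Rightarrow>
    ('d, 'v, 'm::finite) fibres \<Rightarrow> (real ^ 'd \<Rightarrow> ('d, 'v, 'm) wavefun) \<Rightarrow> bool" where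
  "continuous_unit_section G E \<phi> \<longleftrightarrow>
     (\<forall>k. \<phi> k \<in> E k \<and> cell_norm (bravais G) (\<phi> k) = 1) \<and>
     (\<forall>k0. ((\<lambda>k. cell_norm (bravais G) (phase_mult (- k) (\<phi> k) - phase_mult (- k0) (\<phi> k0)))
              \<longlongrightarrow> 0) (at k0))"

definition first_chern_class :: "('p, 'd::finite, 'v::finite) msg \<Rightarrow>
    ('d, 'v, 'm::finite) fibres \<Rightarrow> (real ^ 'd \<Rightarrow> real ^ 'd \<Rightarrow> int) set" where
  "first_chern_class G E = {n. \<exists>\<phi> f. continuous_unit_section G E \<phi> \<and>
     (\<forall>K\<in>reciprocal G. continuous_on UNIV (f K)) \<and>
     (\<forall>K\<in>reciprocal G. \<forall>k. AE r in lborel. \<phi> (k + K) r = cscale (cis (2 * pi * f K k)) (\<phi> k r)) \<and>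
     (\<forall>K\<in>reciprocal G. \<forall>K'\<in>reciprocal G. \<forall>k.
        real_of_int (n K K') = f K (k + K') + f K' k - f (K + K') k)}"

text \<open>A coset is nonzero iff it does not contain the zero cocycle.\<close>

definition nonvanishing_chern :: "('p, 'd::finite, 'v::finite) msg \<Rightarrow>
    ('d, 'v, 'm::finite) fibres \<Rightarrow> bool" where
  "nonvanishing_chern G E \<longleftrightarrow> (\<lambda>K K'. 0) \<notin> first_chern_class G E"


section \<open>Band representations\<close>

text \<open>
  A member \<open>\<psi>\<^sub>k\<close> of a frame is defined only up to null sets for each \<open>k\<close>, so the integral
  over \<open>k\<close> defining the Wannier function is taken weakly, against compactly supported
  square-integrable test functions. This determines \<open>w\<close> up to null sets.
\<close>

definition is_wannier :: "('p, 'd::finite, 'v::finite) msg \<Rightarrow>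
    (real ^ 'd \<Rightarrow> ('d, 'v, 'm::finite) wavefun) \<Rightarrow> real ^ 'd \<Rightarrow> ('d, 'v, 'm) wavefun \<Rightarrow> bool" where
  "is_wannier G \<psi> R w \<longleftrightarrow> w \<in> locally_L2 \<and>
     (\<forall>\<theta>\<in>locally_L2. bounded {r. \<theta> r \<noteq> 0} \<longrightarrow>
        (LINT r|lborel. winner (\<theta> r) (w r)) =
          complex_of_real (measure lborel (unit_cell (reciprocal G)) powr (-1/2)) *
          (LINT k:unit_cell (reciprocal G)|lborel.
             cis (- (k \<bullet> R)) * (LINT r|lborel. winner (\<theta> r) (\<psi> k r))))"

definition wannier_span :: "('p, 'd::finite, 'v::finite) msg \<Rightarrow> nat \<Rightarrow>
    (nat \<Rightarrow> real ^ 'd \<Rightarrow> ('d, 'v, 'm::finite) wavefun) \<Rightarrow> real ^ 'd \<Rightarrow> ('d, 'v, 'm) wavefun set" where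
  "wannier_span G q \<psi> R = {f \<in> locally_L2. \<exists>c w. (\<forall>\<alpha><q. is_wannier G (\<psi> \<alpha>) R (w \<alpha>)) \<and>
     (AE r in lborel. f r = (\<Sum>\<alpha><q. cscale (c \<alpha>) (w \<alpha> r)))}"

definition analytic_periodic_frame :: "('p, 'd::finite, 'v::finite) msg \<Rightarrow>
    ('d, 'v, 'm::finite) fibres \<Rightarrow> 'i set \<Rightarrow> ('i \<Rightarrow> real ^ 'd \<Rightarrow> ('d, 'v, 'm) wavefun) \<Rightarrow> bool" where
  "analytic_periodic_frame G E I \<psi> \<longleftrightarrow>
     (\<forall>k. orthonormal_basis (bravais G) k I (\<lambda>i. \<psi> i k) (E k)) \<and>
     (\<forall>i\<in>I. real_analytic (bloch (bravais G) 0) (cell_norm (bravais G))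
               (\<lambda>k. phase_mult (- k) (\<psi> i k))) \<and>
     (\<forall>i\<in>I. \<forall>k. \<forall>K\<in>reciprocal G. AE r in lborel. \<psi> i (k + K) r = \<psi> i k r)"

text \<open>
  The index \<open>\<alpha>\<close> ranges over \<open>q n\<close> values at the site \<open>\<omega> n\<close>. The centre \<open>x\<close> determines \<open>n\<close>
  and \<open>R\<close>, since the \<open>\<omega> n\<close> are distinct modulo the lattice.
\<close>

definition band_rep :: "('p, 'd::finite, 'v::finite) msg \<Rightarrow> nat \<Rightarrow>
    ('d, 'v, 'm::finite) fibres \<Rightarrow> bool" where
  "band_rep G N E \<longleftrightarrow> band G N E \<and>
     (\<exists>M. \<exists>\<omega> :: nat \<Rightarrow> real ^ 'd. \<exists>q :: nat \<Rightarrow> nat.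
      \<exists>\<psi> :: nat \<times> nat \<Rightarrow> real ^ 'd \<Rightarrow> ('d, 'v, 'm) wavefun.
      let X = {\<omega> n + R | n R. n < M \<and> R \<in> bravais G};
          W = (\<lambda>x. \<Union>{wannier_span G (q n) (\<lambda>\<alpha>. \<psi> (n, \<alpha>)) R | n R.
                        n < M \<and> R \<in> bravais G \<and> x = \<omega> n + R})
      in (\<forall>n<M. 1 \<le> q n) \<and>
         (\<forall>n<M. \<forall>n'<M. n \<noteq> n' \<longrightarrow> \<omega> n - \<omega> n' \<notin> bravais G) \<and>
         (\<forall>g\<in>carrier (space_group G). \<forall>x\<in>X. act G g x \<in> X) \<and>
         analytic_periodic_frame G E {(n, \<alpha>). n < M \<and> \<alpha> < q n} \<psi> \<and>
         (\<forall>g\<in>carrier (space_group G). \<forall>x\<in>X. hat G g ` W x = W (act G g x)))"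

definition elementary_band_rep :: "('p, 'd::finite, 'v::finite) msg \<Rightarrow> nat \<Rightarrow>
    ('d, 'v, 'm::finite) fibres \<Rightarrow> bool" where
  "elementary_band_rep G s E \<longleftrightarrow> band_rep G s E \<and>
     \<not> (\<exists>l F. splits_into G E l F \<and> (\<forall>j<l. \<exists>N<s. band_rep G N (F j)))"

end

theory Submission
  imports Defs
begin

text \<open>
  A simple band with vanishing first Chern class is a band representation. Such a band has a
  continuous periodic unit section, and averaging logarithms of the phases it acquires under the
  point group yields a phase that makes it covariant up to constants, about a Wannier centre \<open>- w\<close> that
  is fixed by the point group modulo the lattice. Projecting the periodization of a compactly
  supported, covariant function onto the band and normalising replaces this section by an analytic
  one with the same covariance, whose Wannier functions then transform by constants. For (b), at
  least one summand has nonvanishing class, since otherwise all summands are band representations;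
  and it cannot be the only one, because a frame of the whole band together with sections of all
  other summands gives a section of the last one by Cramer's rule.
\<close>

text \<open>The Chern class sees only continuous sections, while a band representation asks for an
  analytic one, so analyticity must come from elsewhere: the projections \<open>P(k)\<close> are
  analytic by the definition of a band, and the periodization of \<open>e^(-ikr) f\<close> is entire
  in \<open>k\<close> for \<open>f\<close> of bounded support. Applying the former to the latter
  could give zero at some \<open>k\<close>. It does not if the overlap of \<open>f\<close> with the
  continuous section has positive real part everywhere, a condition that survives sums and complex
  conjugation and hence averaging over a group that contains antiunitary elements; mere nonvanishing
  would not. Such an \<open>f\<close> exists because overlaps form a module over trigonometric
  polynomials in \<open>k\<close>, which can localise near any point of the torus. The logarithms of
  the phases obey the cocycle law only up to constants, and their signed average fails to be
  periodic by a homomorphism on the reciprocal lattice, that is by some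
  \<open>K \<bullet> w\<close>: this \<open>w\<close> is the origin of the Wannier centre. In (b)
  the frame trivialises the determinant of the whole band; Cramer's rule uses this with vectors
  instead of exterior powers.\<close>

declare transpose_matrix_vector [simp del]

subsection \<open>Hermitian values\<close>

lemma winner_sum: "winner x y = (\<Sum>j\<in>UNIV. \<Sum>i\<in>UNIV. cnj (x $ j $ i) * y $ j $ i)"
  by (simp add: winner_def cinner_def)

lemma cscale_nth [simp]: "cscale c x $ j $ i = c * x $ j $ i"
  by (simp add: cscale_def)

lemma wavevalue_eqI: "(\<And>j i. x $ j $ i = y $ j $ i) \<Longrightarrow> x = y" for x y :: "complex^'v^'m"
  by (simp add: vec_eq_iff)

lemma scaleR_nth: "(t *\<^sub>R x) $ j $ i = complex_of_real t * x $ j $ i"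
  by (simp add: scaleR_conv_of_real [where ?'a = complex])

lemma winner_add_right: "winner x (y + z) = winner x y + winner x z"
  and winner_add_left: "winner (x + y) z = winner x z + winner y z"
  and winner_diff_right: "winner x (y - z) = winner x y - winner x z"
  and winner_cscale_right: "winner x (cscale c y) = c * winner x y"
  and winner_cscale_left: "winner (cscale c x) y = cnj c * winner x y"
  and winner_scaleR_right: "winner x (t *\<^sub>R y) = t * winner x y"
  and winner_zero_right [simp]: "winner x 0 = 0"
  and winner_zero_left [simp]: "winner 0 y = 0"
  by (simp_all add: winner_sum algebra_simps sum.distrib sum_subtractf sum_distrib_left scaleR_nth del: vector_scaleR_component)

lemma winner_commute: "winner y x = cnj (winner x y)"
  by (simp add: winner_sum mult.commute)

lemma Re_winner: "Re (winner x y) = x \<bullet> y"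
  by (simp add: winner_sum inner_vec_def inner_complex_def)

lemma winner_self: "winner x x = of_real ((norm x)\<^sup>2)"
proof -
  have "Im (winner x x) = 0"
    by (simp add: winner_sum)
  moreover have "Re (winner x x) = (norm x)\<^sup>2"
    by (simp add: Re_winner power2_norm_eq_inner)
  ultimately show ?thesis by (simp add: complex_eq_iff)
qed

lemma cscale_cscale [simp]: "cscale a (cscale b x) = cscale (a * b) x"
  and cscale_1 [simp]: "cscale 1 x = x"
  and cscale_0 [simp]: "cscale 0 x = 0"
  and cscale_0_right [simp]: "cscale c 0 = 0"
  and cscale_add_right: "cscale c (x + y) = cscale c x + cscale c y"
  and cscale_diff_right: "cscale c (x - y) = cscale c x - cscale c y"
  and cscale_add_left: "cscale (a + b) x = cscale a x + cscale b x"
  and cscale_diff_left: "cscale (a - b) x = cscale a x - cscale b x"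
  and cscale_of_real: "cscale (of_real t) x = t *\<^sub>R x"
  and cscale_scaleR: "cscale c (t *\<^sub>R x) = cscale (c * of_real t) x"
  and scaleR_cscale: "t *\<^sub>R cscale c x = cscale (of_real t * c) x"
  by (rule wavevalue_eqI; simp add: algebra_simps scaleR_nth del: vector_scaleR_component)+

lemma cscale_sum_right: "cscale c (\<Sum>i\<in>A. f i) = (\<Sum>i\<in>A. cscale c (f i))"
  by (induction A rule: infinite_finite_induct) (simp_all add: cscale_add_right)

lemma cscale_sum_left: "cscale (\<Sum>i\<in>A. f i) x = (\<Sum>i\<in>A. cscale (f i) x)"
  by (induction A rule: infinite_finite_induct) (simp_all add: cscale_add_left)

lemma norm_cscale: "norm (cscale c x) = cmod c * norm x"
proof -
  have "complex_of_real ((norm (cscale c x))\<^sup>2) = of_real ((cmod c * norm x)\<^sup>2)"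
    unfolding winner_self [symmetric] winner_cscale_right winner_cscale_left
    using complex_norm_square [of c] by (simp add: winner_self power_mult_distrib)
  then show ?thesis
    by (metis abs_norm_cancel norm_mult of_real_eq_iff power2_eq_iff_nonneg norm_ge_zero mult_nonneg_nonneg)
qed

text \<open>A unimodular factor \<open>c\<close> rotates the product onto its modulus. Its real part
  is the Euclidean inner product, so the real Cauchy-Schwarz inequality applies.\<close>

lemma winner_le: "cmod (winner x y) \<le> norm x * norm y"
proof (cases "winner x y = 0")
  case False
  define c where "c = cnj (winner x y) / cmod (winner x y)"
  have "c * winner x y = cmod (winner x y)"
    using False by (simp add: c_def complex_norm_square [symmetric] power2_eq_square mult.commute)
  then have "cmod (winner x y) = Re (winner x (cscale c y))"
    by (simp add: winner_cscale_right)
  also have "\<dots> \<le> norm x * norm (cscale c y)"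
    unfolding Re_winner by (rule norm_cauchy_schwarz)
  also have "cmod c = 1" using False by (simp add: c_def norm_divide)
  then have "norm (cscale c y) = norm y" by (simp add: norm_cscale)
  finally show ?thesis .
qed simp

lemma continuous_on_cscale [continuous_intros]:
  assumes "continuous_on A c" "continuous_on A f"
  shows "continuous_on A (\<lambda>x. cscale (c x) (f x :: complex^'v^'m))"
  unfolding cscale_def vector_scalar_mult_def by (intro continuous_intros assms)

lemma continuous_on_winner [continuous_intros]:
  assumes "continuous_on A f" "continuous_on A g"
  shows "continuous_on A (\<lambda>x. winner (f x :: complex^'v^'m) (g x))"
  unfolding winner_sum by (intro continuous_intros assms)

lemma borel_measurable_winner [measurable (raw)]:
  assumes "f \<in> borel_measurable M" "g \<in> borel_measurable M"
  shows "(\<lambda>x. winner (f x :: complex^'v^'m) (g x)) \<in> borel_measurable M"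
  by (rule borel_measurable_continuous_Pair [OF assms]) (intro continuous_intros)

lemma borel_measurable_cscale [measurable (raw)]:
  assumes "c \<in> borel_measurable M" "f \<in> borel_measurable M"
  shows "(\<lambda>x. cscale (c x) (f x :: complex^'v^'m)) \<in> borel_measurable M"
  by (rule borel_measurable_continuous_Pair [OF assms]) (intro continuous_intros)

text \<open>The automorphism of the complex numbers with respect to which an operator of sign
  \<open>s\<close> is semilinear. It lets unitary and antiunitary operators be treated by the same
  lemmas.\<close>

definition conj_if :: "real \<Rightarrow> complex \<Rightarrow> complex" where
  "conj_if s c = (if s = 1 then c else cnj c)"

lemma conj_if_simps [simp]:
  "conj_if s (a + b) = conj_if s a + conj_if s b"
  "conj_if s (a * b) = conj_if s a * conj_if s b"
  "conj_if s (a / b) = conj_if s a / conj_if s b"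
  "conj_if s (of_real t) = of_real t"
  "conj_if s 0 = 0" "conj_if s 1 = 1"
  "Re (conj_if s a) = Re a" "cmod (conj_if s a) = cmod a"
  "conj_if 1 a = a" "conj_if (-1) a = cnj a"
  "conj_if s (cnj a) = cnj (conj_if s a)"
  by (simp_all add: conj_if_def)

lemma conj_if_cis: "s = 1 \<or> s = -1 \<Longrightarrow> conj_if s (cis t) = cis (s * t)"
  by (auto simp: conj_if_def cis_cnj)

lemma conj_if_conj_if: "s = 1 \<or> s = -1 \<Longrightarrow> t = 1 \<or> t = -1 \<Longrightarrow> conj_if s (conj_if t a) = conj_if (s * t) a"
  by (auto simp: conj_if_def)

lemma conj_if_sum: "conj_if s (\<Sum>i\<in>A. f i) = (\<Sum>i\<in>A. conj_if s (f i))"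
  by (simp add: conj_if_def)

section \<open>Componentwise action of unitary and antiunitary operators\<close>

definition lift_op :: "(complex^'v \<Rightarrow> complex^'v) \<Rightarrow> complex^'v^'m \<Rightarrow> complex^'v^'m" where
  "lift_op T x = (\<chi> j. T (x $ j))"

definition semiunitary :: "real \<Rightarrow> (complex^'v \<Rightarrow> complex^'v) \<Rightarrow> bool" where
  "semiunitary s T \<longleftrightarrow> (s = 1 \<longrightarrow> unitary_op T) \<and> (s = -1 \<longrightarrow> antiunitary_op T) \<and> (s = 1 \<or> s = -1)"

context
  fixes s :: real and T :: "complex^'v \<Rightarrow> complex^'v"
  assumes su: "semiunitary s T"
begin

lemma semiunitary_simps:
  "bij T" "T (x + y) = T x + T y" "T (c *s x) = conj_if s c *s T x"
  "cinner (T x) (T y) = conj_if s (cinner x y)"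
  using su by (auto simp: semiunitary_def unitary_op_def antiunitary_op_def)

lemma lift_op_add: "lift_op T (x + y) = lift_op T x + lift_op T y"
  by (simp add: lift_op_def vec_eq_iff semiunitary_simps)

lemma lift_op_cscale: "lift_op T (cscale c x) = cscale (conj_if s c) (lift_op T x)"
  by (simp add: lift_op_def cscale_def semiunitary_simps)

lemma lift_op_0 [simp]: "lift_op T 0 = 0"
  using lift_op_cscale [of 0 0] by simp

lemma lift_op_scaleR: "lift_op T (t *\<^sub>R x) = t *\<^sub>R lift_op T x"
  using lift_op_cscale [of "of_real t" x] by (simp add: cscale_of_real)

lemma lift_op_diff: "lift_op T (x - y) = lift_op T x - lift_op T y"
  using lift_op_add [of x "-1 *\<^sub>R y"] lift_op_scaleR [of "-1" y] by simp

lemma winner_lift_op: "winner (lift_op T x) (lift_op T y) = conj_if s (winner x y)"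
  by (simp add: winner_def lift_op_def semiunitary_simps conj_if_sum)

lemma norm_lift_op: "norm (lift_op T x) = norm x"
proof -
  have "complex_of_real ((norm (lift_op T x))\<^sup>2) = conj_if s (of_real ((norm x)\<^sup>2))"
    using winner_lift_op [of x x] unfolding winner_self .
  then have "(norm (lift_op T x))\<^sup>2 = (norm x)\<^sup>2"
    by (simp only: conj_if_simps(4) of_real_eq_iff)
  then show ?thesis by (rule power2_eq_imp_eq) simp_all
qed

lemma continuous_on_lift_op: "continuous_on A (lift_op T :: complex^'v^'m \<Rightarrow> _)"
proof (rule linear_continuous_on)
  show "bounded_linear (lift_op T :: complex^'v^'m \<Rightarrow> _)"
    by (rule bounded_linear_intro [where K = 1])
      (simp_all add: lift_op_add lift_op_scaleR norm_lift_op)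
qed

lemma borel_measurable_lift_op: "(lift_op T :: complex^'v^'m \<Rightarrow> _) \<in> borel_measurable borel"
  by (intro borel_measurable_continuous_onI continuous_on_lift_op)

end

subsection \<open>Invariance of Lebesgue measure under isometries\<close>

lemma nn_integral_lborel_translate:
  fixes f :: "'a::euclidean_space \<Rightarrow> ennreal"
  assumes [measurable]: "f \<in> borel_measurable borel"
  shows "(\<integral>\<^sup>+x. f (x + c) \<partial>lborel) = (\<integral>\<^sup>+x. f x \<partial>lborel)"
proof -
  have "(\<integral>\<^sup>+x. f x \<partial>lborel) = (\<integral>\<^sup>+x. f x \<partial>distr lborel borel ((+) c))"
    by (simp add: lborel_distr_plus)
  also have "\<dots> = (\<integral>\<^sup>+x. f (x + c) \<partial>lborel)"
    by (subst nn_integral_distr) (simp_all add: add.commute)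
  finally show ?thesis by simp
qed

lemma borel_measurable_matrix_vector [measurable]:
  "(\<lambda>x :: real^'d. A *v x) \<in> borel_measurable borel" for A :: "real^'d^'e"
  by (intro borel_measurable_continuous_onI linear_continuous_on) (rule matrix_vector_mul_bounded_linear)

lemma orthogonal_matrix_inverse_cancel:
  assumes "orthogonal_matrix (A :: real^'d^'d)"
  shows "A *v (transpose A *v x) = x" "transpose A *v (A *v x) = x"
  using assms by (simp_all add: matrix_vector_mul_assoc orthogonal_matrix_def)

lemma orthogonal_matrix_norm:
  assumes "orthogonal_matrix (A :: real^'d^'d)"
  shows "norm (A *v x) = norm x"
  using assms orthogonal_transformation_matrix [of "(*v) A"]
  by (auto simp: orthogonal_transformation matrix_vector_mul_linear)

lemma orthogonal_matrix_inner:
  assumes "orthogonal_matrix (A :: real^'d^'d)"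
  shows "(A *v x) \<bullet> y = x \<bullet> (transpose A *v y)"
    "(A *v x) \<bullet> (A *v y) = x \<bullet> y"
proof -
  show *: "(A *v x) \<bullet> y = x \<bullet> (transpose A *v y)" for y
    unfolding transpose_matrix_vector by (subst (1 2) inner_commute) (rule dot_lmul_matrix [symmetric])
  show "(A *v x) \<bullet> (A *v y) = x \<bullet> y"
    by (simp add: * orthogonal_matrix_inverse_cancel [OF assms])
qed

text \<open>Uniqueness of Haar measure: a translation-invariant measure agreeing with Lebesgue
  measure on the unit ball is Lebesgue measure.\<close>

lemma lborel_distr_orthogonal:
  assumes A: "orthogonal_matrix (A :: real^'d^'d)"
  shows "distr lborel borel ((*v) A) = lborel"
proof (rule measure_eqI)
  fix E :: "(real^'d) set"
  assume "E \<in> sets (distr lborel borel ((*v) A))"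
  then have E [measurable]: "E \<in> sets borel" by simp
  define F where "F = (ball 0 1 :: (real^'d) set)"
  have F [measurable]: "F \<in> sets borel" by (simp add: F_def)
  have Ffin1: "emeasure lborel F \<noteq> \<infinity>"
    using emeasure_lborel_ball_finite [of "0 :: real^'d" 1] unfolding F_def by simp
  have Ffin2: "emeasure lborel F \<noteq> 0"
  proof
    assume "emeasure lborel F = 0"
    then have "measure lborel F = 0" by (simp only: measure_def enn2real_0)
    then show False
      using content_ball_pos [of 1 "0 :: real^'d"] unfolding F_def by simp
  qed
  let ?iE = "indicator E :: real^'d \<Rightarrow> ennreal" and ?iF = "indicator F :: real^'d \<Rightarrow> ennreal"
  have "emeasure lborel F * emeasure (distr lborel borel ((*v) A)) E
      = (\<integral>\<^sup>+x. ?iF x \<partial>lborel) * (\<integral>\<^sup>+y. ?iE (A *v y) \<partial>lborel)"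
  proof -
    have "emeasure (distr lborel borel ((*v) A)) E = (\<integral>\<^sup>+y. ?iE y \<partial>distr lborel borel ((*v) A))"
      by (rule nn_integral_indicator [symmetric]) simp
    also have "\<dots> = (\<integral>\<^sup>+y. ?iE (A *v y) \<partial>lborel)"
      by (rule nn_integral_distr) measurable
    finally show ?thesis
      by (simp only: nn_integral_indicator [of F lborel] F sets_lborel)
  qed
  also have "\<dots> = (\<integral>\<^sup>+x. ?iF x * (\<integral>\<^sup>+y. ?iE (A *v y) \<partial>lborel) \<partial>lborel)"
    by (rule nn_integral_multc [symmetric]) measurable
  \<comment> \<open>For fixed \<open>x\<close> the integral of the indicator of \<open>E\<close>
    does not change when its argument moves by \<open>x\<close>, because that is a translation of
    \<open>y\<close> by \<open>transpose A *v x\<close>.\<close>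
  also have "\<dots> = (\<integral>\<^sup>+x. (\<integral>\<^sup>+y. ?iF x * ?iE (A *v y + x) \<partial>lborel) \<partial>lborel)"
  proof (rule nn_integral_cong)
    fix x
    have "(\<integral>\<^sup>+y. ?iE (A *v y) \<partial>lborel) = (\<integral>\<^sup>+y. ?iE (A *v (y + transpose A *v x)) \<partial>lborel)"
      by (rule nn_integral_lborel_translate [symmetric]) measurable
    also have "\<dots> = (\<integral>\<^sup>+y. ?iE (A *v y + x) \<partial>lborel)"
      by (simp add: matrix_vector_right_distrib orthogonal_matrix_inverse_cancel [OF A])
    finally show "?iF x * (\<integral>\<^sup>+y. ?iE (A *v y) \<partial>lborel) = (\<integral>\<^sup>+y. ?iF x * ?iE (A *v y + x) \<partial>lborel)"
      by (subst nn_integral_cmult) simp_all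
  qed
  also have "\<dots> = (\<integral>\<^sup>+y. (\<integral>\<^sup>+x. ?iF x * ?iE (A *v y + x) \<partial>lborel) \<partial>lborel)"
    by (rule lborel_pair.Fubini') measurable
  also have "\<dots> = (\<integral>\<^sup>+y. (\<integral>\<^sup>+x. ?iF (x - A *v y) * ?iE x \<partial>lborel) \<partial>lborel)"
  proof (rule nn_integral_cong)
    fix y
    have "(\<integral>\<^sup>+x. ?iF (x - A *v y) * ?iE x \<partial>lborel)
        = (\<integral>\<^sup>+x. ?iF ((x + A *v y) - A *v y) * ?iE (x + A *v y) \<partial>lborel)"
      by (rule nn_integral_lborel_translate [symmetric]) measurable
    then show "(\<integral>\<^sup>+x. ?iF x * ?iE (A *v y + x) \<partial>lborel) = (\<integral>\<^sup>+x. ?iF (x - A *v y) * ?iE x \<partial>lborel)"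
      by (simp add: add.commute)
  qed
  also have "\<dots> = (\<integral>\<^sup>+x. (\<integral>\<^sup>+y. ?iF (x - A *v y) * ?iE x \<partial>lborel) \<partial>lborel)"
    by (rule lborel_pair.Fubini' [symmetric]) measurable
  also have "\<dots> = (\<integral>\<^sup>+x. emeasure lborel F * ?iE x \<partial>lborel)"
  proof (rule nn_integral_cong)
    fix x
    have "(\<integral>\<^sup>+y. ?iF (x - A *v y) \<partial>lborel) = (\<integral>\<^sup>+y. ?iF (y + - (transpose A *v x)) \<partial>lborel)"
    proof (rule nn_integral_cong)
      fix y
      \<comment> \<open>\<open>A\<close> is an isometry and \<open>F\<close> a ball about 0, so
        \<open>x - A *v y\<close> lies in \<open>F\<close> exactly when
        \<open>y - transpose A *v x\<close> does. The inner integral is therefore the measure of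
        \<open>F\<close> whatever \<open>x\<close> is.\<close>
      have "norm (x - A *v y) = norm (A *v (y - transpose A *v x))"
        by (simp add: matrix_vector_mult_diff_distrib orthogonal_matrix_inverse_cancel [OF A] norm_minus_commute)
      then show "?iF (x - A *v y) = ?iF (y + - (transpose A *v x))"
        by (simp add: F_def orthogonal_matrix_norm [OF A] split: split_indicator)
    qed
    also have "\<dots> = emeasure lborel F"
      by (subst nn_integral_lborel_translate) auto
    finally show "(\<integral>\<^sup>+y. ?iF (x - A *v y) * ?iE x \<partial>lborel) = emeasure lborel F * ?iE x"
      by (subst nn_integral_multc) simp_all
  qed
  also have "\<dots> = emeasure lborel F * emeasure lborel E"
    by (subst nn_integral_cmult) (simp_all add: nn_integral_indicator)
  finally show "emeasure (distr lborel borel ((*v) A)) E = emeasure lborel E"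
    using Ffin1 Ffin2 by (simp add: ennreal_mult_cancel_left)
qed simp

lemma lborel_distr_isometry:
  assumes A: "orthogonal_matrix (A :: real^'d^'d)"
  shows "distr lborel borel (\<lambda>x. A *v x + b) = lborel"
proof -
  have "distr lborel borel (\<lambda>x. A *v x + b) = distr (distr lborel borel ((*v) A)) borel ((+) b)"
    by (subst distr_distr) (simp_all add: o_def add.commute)
  then show ?thesis by (simp add: lborel_distr_orthogonal [OF A] lborel_distr_plus)
qed

lemma
  fixes f :: "real^'d \<Rightarrow> 'b::{banach, second_countable_topology}"
  assumes A: "orthogonal_matrix (A :: real^'d^'d)" and [measurable]: "f \<in> borel_measurable borel"
  shows lborel_integral_isometry: "(LINT x|lborel. f (A *v x + b)) = (LINT x|lborel. f x)"
    and lborel_integrable_isometry: "integrable lborel (\<lambda>x. f (A *v x + b)) \<longleftrightarrow> integrable lborel f"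
proof -
  have m: "(\<lambda>x. A *v x + b) \<in> measurable lborel borel" by measurable
  show "(LINT x|lborel. f (A *v x + b)) = (LINT x|lborel. f x)"
    using integral_distr [OF m, of f] by (simp add: lborel_distr_isometry [OF A])
  show "integrable lborel (\<lambda>x. f (A *v x + b)) \<longleftrightarrow> integrable lborel f"
    using integrable_distr_eq [OF m, of f] by (simp add: lborel_distr_isometry [OF A])
qed

lemma AE_lborel_isometry:
  assumes A: "orthogonal_matrix (A :: real^'d^'d)" and "AE x in lborel. P x"
  shows "AE x in lborel. P (A *v x + b)"
proof -
  have m: "(\<lambda>x. A *v x + b) \<in> measurable lborel borel" by measurable
  obtain N where "{x \<in> space lborel. \<not> P x} \<subseteq> N" "emeasure lborel N = 0" "N \<in> sets lborel"
    using assms(2) by (rule AE_E)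
  then have N: "N \<in> null_sets lborel" "{x. \<not> P x} \<subseteq> N"
    by (auto intro: null_setsI)
  have "N \<in> null_sets (distr lborel borel (\<lambda>x. A *v x + b))"
    using N by (simp add: lborel_distr_isometry [OF A])
  then have "AE y in distr lborel borel (\<lambda>x. A *v x + b). y \<notin> N"
    by (rule AE_not_in)
  then have "AE x in lborel. A *v x + b \<notin> N"
    by (rule AE_distrD [OF m])
  then show ?thesis using N by (auto elim!: eventually_mono)
qed

lemma orthogonal_matrix_mat_1 [simp]: "orthogonal_matrix (mat 1 :: real^'d^'d)"
  by (rule orthogonal_matrix_id)

lemmas lborel_integral_translate = lborel_integral_isometry [OF orthogonal_matrix_mat_1, simplified]
  and AE_lborel_translate = AE_lborel_isometry [OF orthogonal_matrix_mat_1, simplified]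

subsection \<open>Lattices and their cells\<close>

text \<open>The very choice of basis made inside \<open>unit_cell\<close>, so that coordinates with
  respect to it describe that cell.\<close>

definition lattice_basis :: "(real^'d) set \<Rightarrow> real^'d^'d" where
  "lattice_basis L = (SOME a. invertible a \<and> L = lattice_of a)"

lemma
  assumes "invertible (A :: real^'d^'d)"
  shows matrix_inv_right: "A ** matrix_inv A = mat 1" and matrix_inv_left: "matrix_inv A ** A = mat 1"
proof -
  have "A ** matrix_inv A = mat 1 \<and> matrix_inv A ** A = mat 1"
    using assms unfolding invertible_def matrix_inv_def by (rule someI_ex)
  then show "A ** matrix_inv A = mat 1" "matrix_inv A ** A = mat 1" by blast+
qed

locale lattice =
  fixes L :: "(real^'d::finite) set"
  assumes full: "full_lattice L"
begin

abbreviation "cell \<equiv> unit_cell L"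
abbreviation "lbasis \<equiv> lattice_basis L"

text \<open>The basis vectors are the rows of \<open>lbasis\<close>, hence the transpose. In these
  coordinates the lattice is the integer grid and the cell the half-open unit cube.\<close>

definition coord :: "real^'d \<Rightarrow> real^'d" where
  "coord r = matrix_inv (transpose lbasis) *v r"

definition comb :: "real^'d \<Rightarrow> real^'d" where
  "comb t = transpose lbasis *v t"

lemma lbasis: "invertible lbasis" "lattice_of lbasis = L"
proof -
  have "\<exists>a. invertible a \<and> L = lattice_of a"
    using full by (simp add: full_lattice_def)
  from someI_ex [OF this] have "invertible lbasis \<and> L = lattice_of lbasis"
    unfolding lattice_basis_def .
  then show "invertible lbasis" "lattice_of lbasis = L"
    by (blast, rule conjunct2 [THEN sym])
qed

lemma comb_eq: "comb t = (\<Sum>i\<in>UNIV. t $ i *\<^sub>R (lbasis $ i))"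
  by (simp add: comb_def vec_eq_iff matrix_vector_mult_def transpose_def mult.commute)

lemma coord_comb [simp]: "coord (comb t) = t" and comb_coord [simp]: "comb (coord r) = r"
proof -
  have "invertible (transpose lbasis)" by (simp add: lbasis transpose_invertible)
  then show "coord (comb t) = t" "comb (coord r) = r"
    by (simp_all add: comb_def coord_def matrix_vector_mul_assoc matrix_inv_left matrix_inv_right)
qed

lemma coord_simps [simp]:
  "coord (x + y) = coord x + coord y" "coord (x - y) = coord x - coord y" "coord (- x) = - coord x"
  "coord (t *\<^sub>R x) = t *\<^sub>R coord x" "coord 0 = 0"
proof -
  have lin: "linear coord" by (simp add: coord_def [abs_def] matrix_vector_mul_linear)
  show "coord (x + y) = coord x + coord y" "coord (x - y) = coord x - coord y" "coord (- x) = - coord x"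
    "coord (t *\<^sub>R x) = t *\<^sub>R coord x" "coord 0 = 0"
    by (rule linear_add [OF lin] linear_diff [OF lin] linear_neg [OF lin] linear_cmul [OF lin] linear_0 [OF lin])+
qed

lemma mem_L_iff: "r \<in> L \<longleftrightarrow> (\<forall>i. coord r $ i \<in> \<int>)"
proof
  assume "r \<in> L"
  then obtain n where "r = (\<Sum>i\<in>UNIV. real_of_int (n i) *\<^sub>R (lbasis $ i))"
    using lbasis by (auto simp: lattice_of_def)
  then have "r = comb (\<chi> i. real_of_int (n i))" by (simp add: comb_eq)
  then show "\<forall>i. coord r $ i \<in> \<int>" by simp
next
  assume "\<forall>i. coord r $ i \<in> \<int>"
  then have "\<forall>i. \<exists>n. coord r $ i = real_of_int n" by (auto elim: Ints_cases)
  then obtain n where n: "\<And>i. coord r $ i = real_of_int (n i)" by metis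
  have "r = comb (coord r)" by simp
  also have "\<dots> = (\<Sum>i\<in>UNIV. real_of_int (n i) *\<^sub>R (lbasis $ i))" by (simp add: comb_eq n)
  finally show "r \<in> L" using lbasis by (auto simp: lattice_of_def)
qed

lemma L_coordE:
  assumes "R \<in> L"
  obtains n where "\<And>i. coord R $ i = real_of_int (n i)" "R = comb (\<chi> i. real_of_int (n i))"
proof -
  have "\<forall>i. \<exists>n. coord R $ i = real_of_int n"
    using assms by (auto simp: mem_L_iff elim: Ints_cases)
  then obtain n where n: "\<forall>i. coord R $ i = real_of_int (n i)" by (rule choice [THEN exE])
  then have "coord R = (\<chi> i. real_of_int (n i))" by (simp add: vec_eq_iff)
  then have "R = comb (\<chi> i. real_of_int (n i))" using comb_coord [of R] by simp
  with n show ?thesis by (intro that) auto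
qed

lemma mem_cell_iff: "r \<in> cell \<longleftrightarrow> (\<forall>i. 0 \<le> coord r $ i \<and> coord r $ i < 1)"
proof -
  have *: "cell = {\<Sum>i\<in>UNIV. t i *\<^sub>R (lbasis $ i) | t. \<forall>i. 0 \<le> t i \<and> t i < (1::real)}"
    by (simp add: unit_cell_def lattice_basis_def Let_def)
  show ?thesis
  proof
    assume "r \<in> cell"
    then obtain t where t: "r = (\<Sum>i\<in>UNIV. t i *\<^sub>R (lbasis $ i))" "\<forall>i. 0 \<le> t i \<and> t i < 1"
      unfolding * by blast
    then have "r = comb (\<chi> i. t i)" by (simp add: comb_eq)
    then have c: "coord r = (\<chi> i. t i)" by simp
    show "\<forall>i. 0 \<le> coord r $ i \<and> coord r $ i < 1" using t(2) by (simp add: c)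
  next
    assume "\<forall>i. 0 \<le> coord r $ i \<and> coord r $ i < 1"
    moreover have "r = (\<Sum>i\<in>UNIV. coord r $ i *\<^sub>R (lbasis $ i))"
      using comb_coord [of r] by (simp add: comb_eq)
    ultimately show "r \<in> cell" unfolding * by blast
  qed
qed

lemma L_closed [simp, intro]:
  "0 \<in> L" "x \<in> L \<Longrightarrow> y \<in> L \<Longrightarrow> x + y \<in> L" "x \<in> L \<Longrightarrow> y \<in> L \<Longrightarrow> x - y \<in> L" "x \<in> L \<Longrightarrow> - x \<in> L"
  by (auto simp: mem_L_iff)

lemma L_sum: "(\<And>i. i \<in> A \<Longrightarrow> f i \<in> L) \<Longrightarrow> sum f A \<in> L"
  by (induction A rule: infinite_finite_induct) auto

lemma ex_cell: "\<exists>R\<in>L. r - R \<in> cell"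
proof -
  define R where "R = comb (\<chi> i. of_int \<lfloor>coord r $ i\<rfloor>)"
  have "R \<in> L" "r - R \<in> cell"
    by (auto simp: R_def mem_L_iff mem_cell_iff less_diff_eq) (simp add: diff_less_eq add.commute floor_less_cancel)
  then show ?thesis by blast
qed

lemma cell_unique:
  assumes "R \<in> L" "R' \<in> L" "r - R \<in> cell" "r - R' \<in> cell"
  shows "R = R'"
proof -
  have "coord R $ i = coord R' $ i" for i
  proof -
    obtain m where m: "\<And>i. coord R $ i = real_of_int (m i)" by (rule L_coordE [OF assms(1)]) blast
    obtain n where n: "\<And>i. coord R' $ i = real_of_int (n i)" by (rule L_coordE [OF assms(2)]) blast
    have "0 \<le> coord r $ i - coord R $ i" "coord r $ i - coord R $ i < 1"
      "0 \<le> coord r $ i - coord R' $ i" "coord r $ i - coord R' $ i < 1"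
      using assms by (auto simp: mem_cell_iff)
    then have "real_of_int (m i) < real_of_int (n i) + 1" "real_of_int (n i) < real_of_int (m i) + 1"
      unfolding m n by linarith+
    then have "m i = n i" by linarith
    then show ?thesis by (simp add: m n)
  qed
  then have "coord R = coord R'" by (simp add: vec_eq_iff)
  then show ?thesis by (metis comb_coord)
qed

lemma cell_ex1: "\<exists>!R. R \<in> L \<and> r + R \<in> cell"
proof -
  obtain R where "R \<in> L" "r - R \<in> cell" using ex_cell by blast
  then show ?thesis
  proof (intro ex1I [of _ "-R"])
    fix R' assume "R' \<in> L \<and> r + R' \<in> cell"
    then have "- R' = R" using cell_unique [of "- R'" R r] \<open>R \<in> L\<close> \<open>r - R \<in> cell\<close> by simp
    then show "R' = - R" by auto
  qed simp
qed

lemma continuous_on_coord: "continuous_on A coord"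
  unfolding coord_def by (intro linear_continuous_on matrix_vector_mul_bounded_linear)

lemma cell_borel [measurable, simp]: "cell \<in> sets borel"
proof -
  have [measurable]: "(\<lambda>r. coord r $ i) \<in> borel_measurable borel" for i
    by (intro borel_measurable_continuous_onI continuous_intros continuous_on_coord)
  have "{r. 0 \<le> coord r $ i \<and> coord r $ i < 1} \<in> sets borel" for i
    by measurable
  then have "(\<Inter>i. {r. 0 \<le> coord r $ i \<and> coord r $ i < 1}) \<in> sets borel"
    by (intro sets.finite_INT) auto
  also have "(\<Inter>i. {r. 0 \<le> coord r $ i \<and> coord r $ i < 1}) = cell"
    by (auto simp: mem_cell_iff)
  finally show ?thesis .
qed

text \<open>Any bound on the norm over the cell would do; the triangle inequality gives this one for
  coordinates in the unit interval.\<close>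

definition cell_radius :: real where
  "cell_radius = (\<Sum>i\<in>UNIV. norm (lbasis $ i))"

lemma norm_cell_le: "r \<in> cell \<Longrightarrow> norm r \<le> cell_radius"
proof -
  assume r: "r \<in> cell"
  have "r = (\<Sum>i\<in>UNIV. coord r $ i *\<^sub>R (lbasis $ i))"
    using comb_coord [of r] by (simp add: comb_eq)
  then have "norm r \<le> (\<Sum>i\<in>UNIV. norm (coord r $ i *\<^sub>R (lbasis $ i)))"
    by (metis norm_sum)
  also have "\<dots> \<le> cell_radius"
    unfolding cell_radius_def
  proof (rule sum_mono)
    fix i
    have "0 \<le> coord r $ i" "coord r $ i \<le> 1" using r by (auto simp: mem_cell_iff intro: less_imp_le)
    then show "norm (coord r $ i *\<^sub>R (lbasis $ i)) \<le> norm (lbasis $ i)"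
      by (simp add: mult_left_le_one_le)
  qed
  finally show ?thesis .
qed

lemma cell_radius_nonneg: "0 \<le> cell_radius"
  by (simp add: cell_radius_def sum_nonneg)

lemma bounded_cell: "bounded cell"
  by (meson boundedI norm_cell_le)

lemma cell_subset_cball: "cell \<subseteq> cball 0 cell_radius"
  using norm_cell_le by auto

lemma ex_near_L: "\<exists>R\<in>L. norm (r - R) \<le> cell_radius"
  using ex_cell norm_cell_le by blast

text \<open>\<open>coord\<close> is a bounded linear map, so a bound on the norm confines the
  integer coordinates to a finite box.\<close>

lemma finite_L_cball: "finite {R \<in> L. norm R \<le> \<rho>}"
proof -
  obtain K where K: "\<And>x. norm (coord x) \<le> norm x * K" "K > 0"
    unfolding coord_def using bounded_linear.pos_bounded [OF matrix_vector_mul_bounded_linear] by blast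
  define N where "N = \<lceil>\<rho> * K\<rceil>"
  have "{R \<in> L. norm R \<le> \<rho>} \<subseteq> (\<lambda>n. comb (\<chi> i. real_of_int (n i))) ` (PiE UNIV (\<lambda>_. {-N..N}))"
  proof
    fix R assume R: "R \<in> {R \<in> L. norm R \<le> \<rho>}"
    then obtain n where n: "\<And>i. coord R $ i = real_of_int (n i)" "R = comb (\<chi> i. real_of_int (n i))"
      using L_coordE [of R] by blast
    have "real_of_int \<bar>n i\<bar> \<le> real_of_int N" for i
    proof -
      have "\<bar>coord R $ i\<bar> \<le> norm (coord R)" by (rule component_le_norm_cart)
      also have "\<dots> \<le> norm R * K" by (rule K)
      also have "\<dots> \<le> \<rho> * K" using R K by (intro mult_right_mono) auto
      also have "\<dots> \<le> real_of_int N" unfolding N_def by (rule le_of_int_ceiling)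
      finally show ?thesis by (simp add: n)
    qed
    then have "\<bar>n i\<bar> \<le> N" for i by (simp only: of_int_le_iff)
    then have "n \<in> PiE UNIV (\<lambda>_. {-N..N})" by (auto simp: abs_le_iff minus_le_iff)
    with n(2) show "R \<in> (\<lambda>n. comb (\<chi> i. real_of_int (n i))) ` (PiE UNIV (\<lambda>_. {-N..N}))" by blast
  qed
  then show ?thesis by (rule finite_subset) (simp add: finite_PiE)
qed

text \<open>The translates of the cell tile the space, so every point lies in exactly one of them.
  The hypothesis on \<open>S\<close> says that only finitely many translates meet the support, which
  keeps the decomposition a finite sum.\<close>

lemma integral_sum_over_cells:
  fixes g :: "real^'d \<Rightarrow> 'b::{banach, second_countable_topology}"
  assumes g: "integrable lborel g" and S: "finite S" "S \<subseteq> L"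
    and supp: "\<And>r R. r \<in> cell \<Longrightarrow> R \<in> L \<Longrightarrow> g (r + R) \<noteq> 0 \<Longrightarrow> R \<in> S"
  shows "(LINT r|lborel. g r) = (\<Sum>R\<in>S. LINT r:cell|lborel. g (r + R))"
proof -
  have gm [measurable]: "g \<in> borel_measurable borel" using g by (simp add: borel_measurable_integrable)
  have eq: "g r = (\<Sum>R\<in>S. indicator cell (r - R) *\<^sub>R g r)" for r
  proof -
    obtain R0 where R0: "R0 \<in> L" "r - R0 \<in> cell" using ex_cell by blast
    have u: "indicator cell (r - R) *\<^sub>R g r = (if R = R0 then g r else 0)" if "R \<in> S" for R
    proof -
      have "R \<in> L" using that S by blast
      then have "r - R \<in> cell \<longleftrightarrow> R = R0" using R0 cell_unique [of R R0 r] by blast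
      then show ?thesis by (simp add: indicator_def)
    qed
    show ?thesis
    proof (cases "R0 \<in> S")
      case False
      then have "g r = 0" using supp [of "r - R0" R0] R0 by auto
      then show ?thesis by simp
    qed (use S in \<open>simp add: u\<close>)
  qed
  have m: "{r. r - R \<in> cell} \<in> sets lborel" for R
    using measurable_sets_borel [of "\<lambda>r. r - R" borel cell] by (simp add: vimage_def)
  have int: "integrable lborel (\<lambda>r. indicator cell (r - R) *\<^sub>R g r)" for R
    using integrable_mult_indicator [OF m g, of R] by (simp add: indicator_def)
  have "(LINT r|lborel. g r) = (LINT r|lborel. (\<Sum>R\<in>S. indicator cell (r - R) *\<^sub>R g r))"
    by (subst eq) (rule refl)
  also have "\<dots> = (\<Sum>R\<in>S. LINT r|lborel. indicator cell (r - R) *\<^sub>R g r)"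
    by (rule Bochner_Integration.integral_sum) (rule int)
  also have "\<dots> = (\<Sum>R\<in>S. LINT r:cell|lborel. g (r + R))"
  proof (rule sum.cong)
    fix R assume "R \<in> S"
    have "(LINT r|lborel. indicator cell (r - R) *\<^sub>R g r)
        = (LINT r|lborel. indicator cell ((r + R) - R) *\<^sub>R g (r + R))"
      by (rule lborel_integral_translate [symmetric]) measurable
    then show "(LINT r|lborel. indicator cell (r - R) *\<^sub>R g r) = (LINT r:cell|lborel. g (r + R))"
      by (simp add: set_lebesgue_integral_def)
  qed simp
  finally show ?thesis .
qed

text \<open>Cut \<open>D\<close> along the translates of the cell and move each piece back into the
  cell; by periodicity the integrand does not notice, and by uniqueness of representatives the
  pieces fill the cell once. It is applied to images of a cell under isometries, which in general
  differ from the cell.\<close>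

lemma integral_fundamental_domain:
  fixes h :: "real^'d \<Rightarrow> 'b::{banach, second_countable_topology}"
  assumes D: "D \<in> sets borel" "bounded D" "\<And>r. \<exists>!R. R \<in> L \<and> r + R \<in> D"
    and h: "\<And>\<rho>. set_integrable lborel (cball 0 \<rho>) h"
    and per: "\<And>R. R \<in> L \<Longrightarrow> AE r in lborel. h (r + R) = h r"
  shows "(LINT r:D|lborel. h r) = (LINT r:cell|lborel. h r)"
proof -
  obtain \<rho> where \<rho>: "D \<subseteq> cball 0 \<rho>" using D(2) unfolding bounded_iff by (auto simp: subset_iff)
  \<comment> \<open>A translation that brings a point of the cell into \<open>D\<close> is the
    difference of two vectors of norm at most \<rho> and \<open>cell_radius\<close>.\<close>
  define S where "S = {R \<in> L. norm R \<le> \<rho> + cell_radius}"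
  have S: "finite S" "S \<subseteq> L" by (auto simp: S_def finite_L_cball)
  have inS: "R \<in> S" if "r \<in> cell" "R \<in> L" "r + R \<in> D" for r R
  proof -
    have "norm R \<le> norm (r + R) + norm r" using norm_triangle_ineq4 [of "r + R" r] by simp
    also have "\<dots> \<le> \<rho> + cell_radius" using that \<rho> norm_cell_le [of r] by (intro add_mono) auto
    finally show ?thesis using that by (simp add: S_def)
  qed
  have hD: "set_integrable lborel D h"
    by (rule set_integrable_subset [OF h]) (use D \<rho> in auto)
  have hC: "set_integrable lborel cell h"
    by (rule set_integrable_subset [OF h]) (use cell_subset_cball in auto)
  then have hCm: "(\<lambda>r. indicator cell r *\<^sub>R h r) \<in> borel_measurable borel"
    by (auto simp: set_integrable_def dest: borel_measurable_integrable)
  have mD: "{r. r + R \<in> D} \<in> sets lborel" for R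
    using measurable_sets_borel [of "\<lambda>r. r + R" borel D] D by (simp add: vimage_def)
  have "(LINT r:D|lborel. h r) = (LINT r|lborel. indicator D r *\<^sub>R h r)"
    by (simp add: set_lebesgue_integral_def)
  also have "\<dots> = (\<Sum>R\<in>S. LINT r:cell|lborel. indicator D (r + R) *\<^sub>R h (r + R))"
    by (rule integral_sum_over_cells [OF _ S])
      (use hD inS in \<open>auto simp: set_integrable_def split: split_indicator_asm\<close>)
  also have "\<dots> = (\<Sum>R\<in>S. LINT r|lborel. indicator {r. r + R \<in> D} r *\<^sub>R (indicator cell r *\<^sub>R h r))"
  proof (rule sum.cong)
    fix R assume "R \<in> S"
    then have R: "R \<in> L" using S by auto
    have hm: "indicator {r. r + R \<in> D} r *\<^sub>R (indicator cell r *\<^sub>R h (r + R))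
        = indicator cell r *\<^sub>R ((\<lambda>r. indicator D r *\<^sub>R h r) (r + R))" for r
      by (auto split: split_indicator)
    have "(\<lambda>r. indicator D r *\<^sub>R h r) \<in> borel_measurable borel"
      using hD by (auto simp: set_integrable_def dest: borel_measurable_integrable)
    then have m2: "(\<lambda>r. indicator cell r *\<^sub>R ((\<lambda>r. indicator D r *\<^sub>R h r) (r + R))) \<in> borel_measurable borel"
      by measurable
    show "(LINT r:cell|lborel. indicator D (r + R) *\<^sub>R h (r + R))
        = (LINT r|lborel. indicator {r. r + R \<in> D} r *\<^sub>R (indicator cell r *\<^sub>R h r))"
      unfolding set_lebesgue_integral_def
    proof (rule integral_cong_AE)
      show "(\<lambda>r. indicator {r. r + R \<in> D} r *\<^sub>R (indicator cell r *\<^sub>R h r)) \<in> borel_measurable lborel"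
        using borel_measurable_scaleR [OF borel_measurable_indicator hCm] mD by simp
      show "AE r in lborel. indicator cell r *\<^sub>R indicator D (r + R) *\<^sub>R h (r + R)
          = indicator {r. r + R \<in> D} r *\<^sub>R (indicator cell r *\<^sub>R h r)"
        using per [OF R] by eventually_elim (auto split: split_indicator)
    qed (use m2 in simp)
  qed simp
  also have "\<dots> = (LINT r|lborel. (\<Sum>R\<in>S. indicator {r. r + R \<in> D} r *\<^sub>R (indicator cell r *\<^sub>R h r)))"
    by (rule Bochner_Integration.integral_sum [symmetric])
      (rule integrable_mult_indicator [OF mD], use hC in \<open>simp add: set_integrable_def\<close>)
  also have "\<dots> = (LINT r:cell|lborel. h r)"
    unfolding set_lebesgue_integral_def
  proof (rule Bochner_Integration.integral_cong)
    fix r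
    show "(\<Sum>R\<in>S. indicator {r. r + R \<in> D} r *\<^sub>R (indicator cell r *\<^sub>R h r)) = indicator cell r *\<^sub>R h r"
    proof (cases "r \<in> cell")
      case True
      obtain R0 where R0: "R0 \<in> L" "r + R0 \<in> D" "\<And>R. R \<in> L \<Longrightarrow> r + R \<in> D \<Longrightarrow> R = R0"
        using D(3) [of r] by blast
      have "indicator {r. r + R \<in> D} r *\<^sub>R (indicator cell r *\<^sub>R h r)
          = (if R = R0 then indicator cell r *\<^sub>R h r else 0)" if "R \<in> S" for R
      proof -
        have "R \<in> L" using that S by blast
        then have "r + R \<in> D \<longleftrightarrow> R = R0" using R0 by blast
        then show ?thesis by (simp add: indicator_def)
      qed
      then show ?thesis using inS [OF True R0(1,2)] S by simp
    qed simp
  qed simp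
  finally show ?thesis .
qed

end

subsection \<open>Dual lattices\<close>

text \<open>A vector is determined by its inner products with the rows of an invertible matrix. If
  these are 2 pi times integers \<open>n i\<close>, the combination of the rows of \<open>b\<close>
  with coefficients \<open>n i\<close> has the same inner products.\<close>

lemma dual_lattice_of:
  fixes a b :: "real^'d^'d"
  assumes a: "invertible a" and ab: "\<And>i j. a $ i \<bullet> b $ j = (if i = j then 2 * pi else 0)"
  shows "dual_lattice (lattice_of a) = lattice_of b"
proof (intro subset_antisym subsetI)
  fix K assume "K \<in> dual_lattice (lattice_of a)"
  then have K: "\<exists>n::int. K \<bullet> R = 2 * pi * real_of_int n" if "R \<in> lattice_of a" for R
    using that by (auto simp: dual_lattice_def)
  have "a $ i \<in> lattice_of a" for i
  proof -
    have "a $ i = (\<Sum>j\<in>UNIV. real_of_int (if j = i then 1 else 0) *\<^sub>R (a $ j))"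
      by (simp add: if_distrib [where f = real_of_int] if_distrib [where f = "\<lambda>x. x *\<^sub>R _"] cong: if_cong)
    then show ?thesis unfolding lattice_of_def by (intro CollectI exI [of _ "\<lambda>j. if j = i then 1 else 0"]) simp
  qed
  then obtain n :: "'d \<Rightarrow> int" where n: "\<And>i. K \<bullet> a $ i = 2 * pi * real_of_int (n i)"
    using choice [of "\<lambda>i n. K \<bullet> a $ i = 2 * pi * real_of_int n"] K by blast
  define K' where "K' = (\<Sum>i\<in>UNIV. real_of_int (n i) *\<^sub>R (b $ i))"
  have "a $ i \<bullet> K' = a $ i \<bullet> K" for i
    by (simp add: K'_def inner_sum_right ab n if_distrib [where f = "\<lambda>x. _ * x"] inner_commute [of _ K] cong: if_cong)
  then have "a *v K' = a *v K"
    by (simp add: vec_eq_iff matrix_vector_mul_component)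
  then have "matrix_inv a *v (a *v K') = matrix_inv a *v (a *v K)" by simp
  then have "K' = K" by (simp add: matrix_vector_mul_assoc matrix_inv_left a)
  then show "K \<in> lattice_of b" by (auto simp: K'_def lattice_of_def)
next
  fix K assume "K \<in> lattice_of b"
  then obtain m where K: "K = (\<Sum>i\<in>UNIV. real_of_int (m i) *\<^sub>R (b $ i))" by (auto simp: lattice_of_def)
  have aK: "a $ i \<bullet> K = 2 * pi * real_of_int (m i)" for i
    by (simp add: K inner_sum_right ab if_distrib [where f = "\<lambda>x. _ * x"] cong: if_cong)
  show "K \<in> dual_lattice (lattice_of a)"
    unfolding dual_lattice_def
  proof (intro CollectI ballI)
    fix R assume "R \<in> lattice_of a"
    then obtain n where R: "R = (\<Sum>i\<in>UNIV. real_of_int (n i) *\<^sub>R (a $ i))" by (auto simp: lattice_of_def)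
    have "K \<bullet> R = 2 * pi * real_of_int (\<Sum>i\<in>UNIV. n i * m i)"
      by (simp add: R inner_sum_right inner_commute [of K] aK sum_distrib_left algebra_simps)
    then show "\<exists>n::int. K \<bullet> R = 2 * pi * real_of_int n" by blast
  qed
qed

context lattice
begin

definition dual_basis :: "real^'d^'d" where
  "dual_basis = (2 * pi) *\<^sub>R transpose (matrix_inv lbasis)"

lemma lbasis_dual_basis: "lbasis $ i \<bullet> dual_basis $ j = (if i = j then 2 * pi else 0)"
proof -
  have "lbasis $ i \<bullet> dual_basis $ j = 2 * pi * (lbasis ** matrix_inv lbasis) $ i $ j"
    by (simp add: dual_basis_def inner_vec_def matrix_matrix_mult_def transpose_def sum_distrib_left algebra_simps)
  then show ?thesis by (simp add: matrix_inv_right lbasis mat_def)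
qed

lemma invertible_dual_basis: "invertible dual_basis"
proof -
  have "transpose lbasis ** dual_basis = (2 * pi) *\<^sub>R mat 1"
    unfolding dual_basis_def matrix_scalar_ac
    by (simp add: matrix_transpose_mul [symmetric] matrix_inv_left lbasis scalar_matrix_assoc [symmetric])
  then have "((1 / (2 * pi)) *\<^sub>R transpose lbasis) ** dual_basis = mat 1"
    by (simp add: scalar_matrix_assoc [symmetric])
  then show ?thesis using invertible_left_inverse by blast
qed

lemma dual_lattice_eq: "dual_lattice L = lattice_of dual_basis"
  using dual_lattice_of [OF lbasis(1) lbasis_dual_basis] lbasis by simp

lemma full_dual_lattice: "full_lattice (dual_lattice L)"
  unfolding full_lattice_def dual_lattice_eq using invertible_dual_basis by blast

text \<open>The duality relation between the two bases is symmetric, so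
  \<open>dual_lattice_of\<close> applies with the roles exchanged. This turns integrality of phases
  over the reciprocal lattice into membership in the lattice.\<close>

lemma dual_dual: "dual_lattice (dual_lattice L) = L"
proof -
  have "dual_lattice (lattice_of dual_basis) = lattice_of lbasis"
    by (rule dual_lattice_of [OF invertible_dual_basis]) (use lbasis_dual_basis in \<open>auto simp: inner_commute\<close>)
  then show ?thesis by (simp add: dual_lattice_eq lbasis)
qed

lemma cis_dual: "K \<in> dual_lattice L \<Longrightarrow> R \<in> L \<Longrightarrow> cis (K \<bullet> R) = 1"
proof -
  assume "K \<in> dual_lattice L" "R \<in> L"
  then obtain n :: int where "K \<bullet> R = 2 * pi * n" by (auto simp: dual_lattice_def)
  then show ?thesis by (simp add: cis_multiple_2pi)
qed

end

subsection \<open>Square-integrable wavefunctions\<close>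

lemma scaleR_fun_apply [simp]: "(t *\<^sub>R f) x = t *\<^sub>R f x"
  by (simp add: scaleR_fun_def)

lemma sum_fun_apply: "(\<Sum>i\<in>A. f i) x = (\<Sum>i\<in>A. f i x)" for f :: "'i \<Rightarrow> 'a \<Rightarrow> 'b::comm_monoid_add"
  by (induction A rule: infinite_finite_induct) simp_all

lemma locally_L2_measurable [measurable_dest]:
  "f \<in> locally_L2 \<Longrightarrow> f \<in> borel_measurable borel"
  by (simp add: locally_L2_def)

lemma locally_L2_I:
  assumes "f \<in> borel_measurable borel"
    and "\<And>\<rho>. set_integrable lborel (cball 0 \<rho>) (\<lambda>r. (norm (f r))\<^sup>2)"
  shows "f \<in> locally_L2"
  using assms by (simp add: locally_L2_def)

lemma bounded_subset_cball_0: "bounded A \<Longrightarrow> \<exists>\<rho>. A \<subseteq> cball (0 :: 'a::real_normed_vector) \<rho>"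
  unfolding bounded_iff by (auto simp: subset_iff)

lemma locally_L2_norm_square:
  assumes f: "f \<in> locally_L2" and A: "A \<in> sets borel" "bounded A"
  shows "set_integrable lborel A (\<lambda>r. (norm (f r))\<^sup>2)"
proof -
  obtain \<rho> where \<rho>: "A \<subseteq> cball 0 \<rho>" using bounded_subset_cball_0 [OF A(2)] by blast
  have "set_integrable lborel (cball 0 \<rho>) (\<lambda>r. (norm (f r))\<^sup>2)"
    using f by (simp add: locally_L2_def)
  then show ?thesis
    by (rule set_integrable_subset) (use A \<rho> in simp_all)
qed

lemma set_borel_measurable_I:
  "A \<in> sets borel \<Longrightarrow> f \<in> borel_measurable borel \<Longrightarrow> set_borel_measurable lborel A f"
  for f :: "_ \<Rightarrow> 'b::{real_normed_vector, second_countable_topology}"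
  unfolding set_borel_measurable_def by (intro borel_measurable_scaleR borel_measurable_indicator) simp_all

text \<open>The square of a sum is at most twice the sum of the squares. Sums, scalar multiples,
  cut-offs and pointwise operators are all handled through this domination.\<close>

lemma locally_L2_dominated:
  assumes g [measurable]: "g \<in> borel_measurable borel" and f: "f1 \<in> locally_L2" "f2 \<in> locally_L2"
    and le: "AE r in lborel. norm (g r) \<le> C * (norm (f1 r) + norm (f2 r))"
  shows "g \<in> locally_L2"
proof (rule locally_L2_I [OF g])
  fix \<rho>
  have "set_integrable lborel (cball 0 \<rho>) (\<lambda>r. 2 * C\<^sup>2 * ((norm (f1 r))\<^sup>2 + (norm (f2 r))\<^sup>2))"
    by (intro set_integrable_mult_right set_integral_add locally_L2_norm_square f) auto
  then show "set_integrable lborel (cball 0 \<rho>) (\<lambda>r. (norm (g r))\<^sup>2)"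
  proof (rule set_integrable_bound)
    show "AE r in lborel. r \<in> cball 0 \<rho> \<longrightarrow>
        norm ((norm (g r))\<^sup>2) \<le> norm (2 * C\<^sup>2 * ((norm (f1 r))\<^sup>2 + (norm (f2 r))\<^sup>2))"
      using le
    proof eventually_elim
      case (elim r)
      have "(norm (g r))\<^sup>2 \<le> (C * (norm (f1 r) + norm (f2 r)))\<^sup>2"
        using elim by (rule power_mono) simp
      also have "\<dots> = C\<^sup>2 * (norm (f1 r) + norm (f2 r))\<^sup>2" by (rule power_mult_distrib)
      also have "\<dots> \<le> C\<^sup>2 * (2 * ((norm (f1 r))\<^sup>2 + (norm (f2 r))\<^sup>2))"
      proof (rule mult_left_mono)
        have "0 \<le> (norm (f1 r) - norm (f2 r))\<^sup>2" by simp
        then show "(norm (f1 r) + norm (f2 r))\<^sup>2 \<le> 2 * ((norm (f1 r))\<^sup>2 + (norm (f2 r))\<^sup>2)"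
          by (simp add: power2_sum power2_diff)
      qed simp
      finally show ?case by (auto simp: algebra_simps)
    qed
  qed (rule set_borel_measurable_I, auto)
qed

lemma locally_L2_zero [simp]: "(\<lambda>r. 0) \<in> locally_L2"
  by (rule locally_L2_I) (simp_all add: set_integrable_def)

lemma locally_L2_dominated1:
  assumes "g \<in> borel_measurable borel" "f \<in> locally_L2" "AE r in lborel. norm (g r) \<le> C * norm (f r)"
  shows "g \<in> locally_L2"
  using locally_L2_dominated [OF assms(1,2) locally_L2_zero, of C] assms(3) by simp

lemma locally_L2_plus [intro]:
  assumes "f \<in> locally_L2" "g \<in> locally_L2"
  shows "(\<lambda>r. f r + g r) \<in> locally_L2"
  by (rule locally_L2_dominated [where C = 1, OF _ assms])
    (use assms in \<open>auto intro!: borel_measurable_add locally_L2_measurable AE_I2 norm_triangle_ineq\<close>)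

lemma locally_L2_cscale_fun:
  assumes c: "c \<in> borel_measurable borel" "\<And>r. cmod (c r) \<le> B" and f: "f \<in> locally_L2"
  shows "(\<lambda>r. cscale (c r) (f r)) \<in> locally_L2"
proof (rule locally_L2_dominated1 [OF _ f, of _ B])
  show "(\<lambda>r. cscale (c r) (f r)) \<in> borel_measurable borel"
    using c(1) locally_L2_measurable [OF f] by measurable
  show "AE r in lborel. norm (cscale (c r) (f r)) \<le> B * norm (f r)"
    by (rule AE_I2) (simp add: norm_cscale mult_right_mono c)
qed

lemma locally_L2_cscale [intro]: "f \<in> locally_L2 \<Longrightarrow> (\<lambda>r. cscale c (f r)) \<in> locally_L2"
  by (rule locally_L2_cscale_fun [where B = "cmod c"]) simp_all

lemma locally_L2_scaleR [intro]: "f \<in> locally_L2 \<Longrightarrow> (\<lambda>r. t *\<^sub>R f r) \<in> locally_L2"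
  using locally_L2_cscale [of f "of_real t"] by (simp add: cscale_of_real)

lemma locally_L2_minus [intro]:
  assumes "f \<in> locally_L2" "g \<in> locally_L2"
  shows "(\<lambda>r. f r - g r) \<in> locally_L2"
  using locally_L2_plus [OF assms(1) locally_L2_scaleR [OF assms(2), of "-1"]] by simp

lemma locally_L2_sum [intro]:
  "(\<And>i. i \<in> A \<Longrightarrow> f i \<in> locally_L2) \<Longrightarrow> (\<lambda>r. \<Sum>i\<in>A. f i r) \<in> locally_L2"
  by (induction A rule: infinite_finite_induct) auto

lemma locally_L2_isometry:
  assumes A: "orthogonal_matrix A" and f: "f \<in> locally_L2"
  shows "(\<lambda>r. f (A *v r + b)) \<in> locally_L2"
proof (rule locally_L2_I)
  note [measurable] = locally_L2_measurable [OF f]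
  show "(\<lambda>r. f (A *v r + b)) \<in> borel_measurable borel" by measurable
  fix \<rho>
  \<comment> \<open>The enlarged radius makes the indicator at \<open>A *v r + b\<close> equal to 1
    for every \<open>r\<close> in the ball of radius \<rho>.\<close>
  let ?g = "\<lambda>r. indicator (cball 0 (\<rho> + norm b)) r *\<^sub>R (norm (f r))\<^sup>2"
  have "integrable lborel ?g"
    using locally_L2_norm_square [OF f, of "cball 0 (\<rho> + norm b)"] by (simp add: set_integrable_def)
  then have "integrable lborel (\<lambda>r. ?g (A *v r + b))"
    by (subst lborel_integrable_isometry [OF A]) (auto dest: borel_measurable_integrable)
  then show "set_integrable lborel (cball 0 \<rho>) (\<lambda>r. (norm (f (A *v r + b)))\<^sup>2)"
    unfolding set_integrable_def
  proof (rule Bochner_Integration.integrable_bound)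
    show "AE r in lborel. norm (indicator (cball 0 \<rho>) r *\<^sub>R (norm (f (A *v r + b)))\<^sup>2) \<le> norm (?g (A *v r + b))"
    proof (rule AE_I2)
      fix r
      have "A *v r + b \<in> cball 0 (\<rho> + norm b)" if "r \<in> cball 0 \<rho>"
        using norm_triangle_ineq [of "A *v r" b] that by (simp add: orthogonal_matrix_norm [OF A])
      then show "norm (indicator (cball 0 \<rho>) r *\<^sub>R (norm (f (A *v r + b)))\<^sup>2) \<le> norm (?g (A *v r + b))"
        by (simp add: indicator_def)
    qed
    have "(\<lambda>r. (norm (f (A *v r + b)))\<^sup>2) \<in> borel_measurable borel" by measurable
    then show "(\<lambda>r. indicator (cball 0 \<rho>) r *\<^sub>R (norm (f (A *v r + b)))\<^sup>2) \<in> borel_measurable lborel"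
      using set_borel_measurable_I [of "cball 0 \<rho>" "\<lambda>r. (norm (f (A *v r + b)))\<^sup>2"]
      by (simp add: set_borel_measurable_def)
  qed
qed

lemma locally_L2_translate: "f \<in> locally_L2 \<Longrightarrow> (\<lambda>r. f (r + b)) \<in> locally_L2"
  using locally_L2_isometry [OF orthogonal_matrix_mat_1, of f b] by simp

lemma locally_L2_lift_op:
  assumes su: "semiunitary s T" and f: "f \<in> locally_L2"
  shows "(\<lambda>r. lift_op T (f r)) \<in> locally_L2"
proof (rule locally_L2_dominated1 [OF _ f, of _ 1])
  show "(\<lambda>r. lift_op T (f r)) \<in> borel_measurable borel"
    using measurable_compose [OF locally_L2_measurable [OF f] borel_measurable_lift_op [OF su]] .
qed (simp add: norm_lift_op [OF su])

lemma winner_set_integrable: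
  assumes f: "f \<in> locally_L2" "g \<in> locally_L2" and A: "A \<in> sets borel" "bounded A"
  shows "set_integrable lborel A (\<lambda>r. winner (f r) (g r))"
proof (rule set_integrable_bound)
  note [measurable] = f[THEN locally_L2_measurable]
  show "set_integrable lborel A (\<lambda>r. (norm (f r))\<^sup>2 + (norm (g r))\<^sup>2)"
    by (intro set_integral_add locally_L2_norm_square assms)
  show "AE r in lborel. r \<in> A \<longrightarrow> norm (winner (f r) (g r)) \<le> norm ((norm (f r))\<^sup>2 + (norm (g r))\<^sup>2)"
  proof (intro AE_I2 impI)
    fix r
    have "0 \<le> norm (f r) * norm (g r)" by simp
    then have "norm (f r) * norm (g r) \<le> (norm (f r))\<^sup>2 + (norm (g r))\<^sup>2"
      using sum_squares_bound [of "norm (f r)" "norm (g r)"] by linarith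
    then show "norm (winner (f r) (g r)) \<le> norm ((norm (f r))\<^sup>2 + (norm (g r))\<^sup>2)"
      using winner_le [of "f r" "g r"] by simp
  qed
  show "set_borel_measurable lborel A (\<lambda>r. winner (f r) (g r))"
    by (rule set_borel_measurable_I) (use A in measurable)
qed

lemma winner_integrable:
  assumes f: "f \<in> locally_L2" "g \<in> locally_L2" and b: "bounded {r. f r \<noteq> 0} \<or> bounded {r. g r \<noteq> 0}"
  shows "integrable lborel (\<lambda>r. winner (f r) (g r))"
proof -
  obtain \<rho> where "{r. f r \<noteq> 0} \<subseteq> cball 0 \<rho> \<or> {r. g r \<noteq> 0} \<subseteq> cball 0 \<rho>"
    using b bounded_subset_cball_0 by metis
  then have "r \<in> cball 0 \<rho> \<or> f r = 0 \<or> g r = 0" for r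
    by blast
  then have "indicator (cball 0 \<rho>) r *\<^sub>R winner (f r) (g r) = winner (f r) (g r)" for r
    by (cases "r \<in> cball 0 \<rho>") (force simp: indicator_def)+
  then show ?thesis
    using winner_set_integrable [OF f, of "cball 0 \<rho>"] unfolding set_integrable_def by simp
qed

section \<open>Inner product and seminorm over a unit cell\<close>

context lattice
begin

lemma cell_norm_nonneg [simp]: "0 \<le> cell_norm L f"
  unfolding cell_norm_def set_lebesgue_integral_def by (simp add: integral_nonneg_AE)

lemma cell_norm_square: "(cell_norm L f)\<^sup>2 = (LINT r:cell|lborel. (norm (f r))\<^sup>2)"
  unfolding cell_norm_def set_lebesgue_integral_def by (simp add: integral_nonneg_AE)

lemma cell_inner_self: "cell_inner L f f = of_real ((cell_norm L f)\<^sup>2)"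
  unfolding cell_norm_square cell_inner_def winner_self by (rule set_integral_complex_of_real)

lemma cell_inner_commute: "cell_inner L g f = cnj (cell_inner L f g)"
proof -
  have "(\<lambda>r. indicator cell r *\<^sub>R winner (g r) (f r)) = (\<lambda>r. cnj (indicator cell r *\<^sub>R winner (f r) (g r)))"
    by (rule ext, subst winner_commute) simp
  then show ?thesis
    unfolding cell_inner_def set_lebesgue_integral_def by (simp only: Bochner_Integration.integral_cnj)
qed

lemma cell_inner_AE_cong:
  assumes "f \<in> locally_L2" "f' \<in> locally_L2" "g \<in> locally_L2" "g' \<in> locally_L2"
    and "AE r in lborel. f r = f' r" "AE r in lborel. g r = g' r"
  shows "cell_inner L f g = cell_inner L f' g'"
  unfolding cell_inner_def set_lebesgue_integral_def
proof (rule integral_cong_AE)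
  note [measurable] = assms(1-4)[THEN locally_L2_measurable]
  show "(\<lambda>r. indicator cell r *\<^sub>R winner (f r) (g r)) \<in> borel_measurable lborel"
    "(\<lambda>r. indicator cell r *\<^sub>R winner (f' r) (g' r)) \<in> borel_measurable lborel"
    by measurable
  show "AE r in lborel. indicator cell r *\<^sub>R winner (f r) (g r) = indicator cell r *\<^sub>R winner (f' r) (g' r)"
    using assms(5,6) by eventually_elim simp
qed

lemma cell_norm_AE_cong:
  assumes "f \<in> locally_L2" "f' \<in> locally_L2" "AE r in lborel. f r = f' r"
  shows "cell_norm L f = cell_norm L f'"
proof -
  have "complex_of_real ((cell_norm L f)\<^sup>2) = of_real ((cell_norm L f')\<^sup>2)"
    unfolding cell_inner_self [symmetric] by (rule cell_inner_AE_cong) (use assms in auto)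
  then have "(cell_norm L f)\<^sup>2 = (cell_norm L f')\<^sup>2" by (simp only: of_real_eq_iff)
  then show ?thesis by (rule power2_eq_imp_eq) simp_all
qed

context
  fixes f g h :: "real^'d \<Rightarrow> complex^'v^'m"
  assumes L2: "f \<in> locally_L2" "g \<in> locally_L2" "h \<in> locally_L2"
begin

lemma cell_inner_add_right: "cell_inner L f (\<lambda>r. g r + h r) = cell_inner L f g + cell_inner L f h"
  unfolding cell_inner_def winner_add_right
  by (intro set_integral_add winner_set_integrable L2) (simp_all add: bounded_cell)

lemma cell_inner_diff_right: "cell_inner L f (\<lambda>r. g r - h r) = cell_inner L f g - cell_inner L f h"
  unfolding cell_inner_def winner_diff_right
  by (intro set_integral_diff winner_set_integrable L2) (simp_all add: bounded_cell)

end

lemma cell_inner_cscale_right: "cell_inner L f (\<lambda>r. cscale c (g r)) = c * cell_inner L f g"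
  unfolding cell_inner_def winner_cscale_right by (rule set_integral_mult_right)

lemma cell_inner_cscale_left: "cell_inner L (\<lambda>r. cscale c (f r)) g = cnj c * cell_inner L f g"
  by (subst (1 2) cell_inner_commute) (simp add: cell_inner_cscale_right)

lemma cell_inner_scaleR_right: "cell_inner L f (\<lambda>r. t *\<^sub>R g r) = of_real t * cell_inner L f g"
  using cell_inner_cscale_right [of f "of_real t" g] by (simp add: cscale_of_real)

lemma cell_inner_scaleR_left: "cell_inner L (\<lambda>r. t *\<^sub>R f r) g = of_real t * cell_inner L f g"
  using cell_inner_cscale_left [of "of_real t" f g] by (simp add: cscale_of_real)

lemma cell_inner_zero_right [simp]: "cell_inner L f (\<lambda>r. 0) = 0"
  by (simp add: cell_inner_def set_lebesgue_integral_def)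

lemma cell_inner_add_left:
  "f \<in> locally_L2 \<Longrightarrow> g \<in> locally_L2 \<Longrightarrow> h \<in> locally_L2 \<Longrightarrow>
   cell_inner L (\<lambda>r. f r + g r) h = cell_inner L f h + cell_inner L g h"
  by (subst (1 2 3) cell_inner_commute) (simp add: cell_inner_add_right)

lemma cell_inner_diff_left:
  "f \<in> locally_L2 \<Longrightarrow> g \<in> locally_L2 \<Longrightarrow> h \<in> locally_L2 \<Longrightarrow>
   cell_inner L (\<lambda>r. f r - g r) h = cell_inner L f h - cell_inner L g h"
  by (subst (1 2 3) cell_inner_commute) (simp add: cell_inner_diff_right)

lemma cell_inner_sum_right:
  assumes "f \<in> locally_L2" "\<And>i. i \<in> A \<Longrightarrow> g i \<in> locally_L2"
  shows "cell_inner L f (\<lambda>r. \<Sum>i\<in>A. g i r) = (\<Sum>i\<in>A. cell_inner L f (g i))"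
  using assms(2)
proof (induction A rule: infinite_finite_induct)
  case (insert x F)
  then have "(\<lambda>r. \<Sum>i\<in>F. g i r) \<in> locally_L2" by (intro locally_L2_sum) auto
  then show ?case using insert assms(1) by (simp add: cell_inner_add_right)
qed simp_all

lemma cell_inner_sum_left:
  assumes "f \<in> locally_L2" "\<And>i. i \<in> A \<Longrightarrow> g i \<in> locally_L2"
  shows "cell_inner L (\<lambda>r. \<Sum>i\<in>A. g i r) f = (\<Sum>i\<in>A. cell_inner L (g i) f)"
  by (subst (1 2) cell_inner_commute) (simp add: cell_inner_sum_right [OF assms] cnj_sum)

text \<open>Cauchy-Schwarz from the nonnegative quadratic polynomial
  \<open>A - 2 * t * w + t\<^sup>2 * B\<close> in real \<open>t\<close>, the squared norm of
  \<open>f - t z g\<close>, where the phase \<open>z\<close> turns the inner product into its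
  modulus \<open>w\<close>.\<close>

lemma cell_inner_le:
  assumes f: "f \<in> locally_L2" and g: "g \<in> locally_L2"
  shows "cmod (cell_inner L f g) \<le> cell_norm L f * cell_norm L g"
proof -
  define w where "w = cmod (cell_inner L f g)"
  define z where "z = (if w = 0 then 1 else cnj (cell_inner L f g) / w)"
  have z: "cmod z = 1 \<and> z * cell_inner L f g = w"
  proof (cases "w = 0")
    case True
    then show ?thesis by (simp add: z_def w_def)
  next
    case False
    have "cnj (cell_inner L f g) * cell_inner L f g = of_real w * of_real w"
      unfolding w_def by (simp add: complex_norm_square [symmetric] mult.commute flip: of_real_mult power2_eq_square)
    then have "z * cell_inner L f g = w" using False by (simp add: z_def)
    moreover have "cmod z = 1" using False by (simp add: z_def norm_divide) (simp add: w_def)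
    ultimately show ?thesis by simp
  qed
  define A B where "A = (cell_norm L f)\<^sup>2" and "B = (cell_norm L g)\<^sup>2"
  have AB: "0 \<le> A" "0 \<le> B" by (simp_all add: A_def B_def)
  have zz: "z * cnj z = 1" using z by (simp add: complex_norm_square [symmetric])
  have quad: "0 \<le> A - 2 * t * w + t\<^sup>2 * B" for t :: real
  proof -
    let ?h = "\<lambda>r. f r - cscale (t * z) (g r)"
    have g': "(\<lambda>r. cscale (t * z) (g r)) \<in> locally_L2" using g by blast
    have h: "?h \<in> locally_L2" by (rule locally_L2_minus [OF f g'])
    have gf: "cell_inner L g f = cnj (cell_inner L f g)" by (rule cell_inner_commute)
    have cw: "cnj z * cnj (cell_inner L f g) = w" using z by (metis complex_cnj_complex_of_real complex_cnj_mult)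
    have "complex_of_real ((cell_norm L ?h)\<^sup>2) = cell_inner L f f - t * (z * cell_inner L f g)
        - t * (cnj z * cnj (cell_inner L f g)) + t\<^sup>2 * (z * cnj z) * cell_inner L g g"
      unfolding cell_inner_self [symmetric, of ?h] cell_inner_diff_left [OF f g' h]
        cell_inner_diff_right [OF f f g'] cell_inner_diff_right [OF g' f g']
        cell_inner_cscale_left cell_inner_cscale_right gf
      by (simp add: algebra_simps power2_eq_square)
    also have "\<dots> = of_real (A - 2 * t * w + t\<^sup>2 * B)"
      unfolding conjunct2 [OF z] cw zz cell_inner_self A_def B_def by simp
    finally have "(cell_norm L ?h)\<^sup>2 = A - 2 * t * w + t\<^sup>2 * B" by (simp only: of_real_eq_iff)
    then show ?thesis by (metis zero_le_power2)
  qed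
  have "w\<^sup>2 \<le> A * B"
  proof (cases "B = 0")
    case True
    have "w = 0"
    proof (rule ccontr)
      assume "w \<noteq> 0"
      \<comment> \<open>For \<open>B = 0\<close> the polynomial is linear, and at this
        \<open>t\<close> it equals \<open>- A - 2\<close>, which is negative.\<close>
      then have "2 * ((A + 1) / w) * w = 2 * (A + 1)" by simp
      with quad [of "(A + 1) / w"] have "0 \<le> A - 2 * (A + 1)" unfolding True by simp
      then show False using AB by simp
    qed
    then show ?thesis using AB by simp
  next
    case False
    \<comment> \<open>At \<open>t = w / B\<close> the polynomial attains its minimum
      \<open>A - w\<^sup>2 / B\<close>.\<close>
    then show ?thesis using quad [of "w / B"] AB by (simp add: field_simps power2_eq_square)
  qed
  then have "w\<^sup>2 \<le> (cell_norm L f * cell_norm L g)\<^sup>2" by (simp add: A_def B_def power_mult_distrib)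
  then show ?thesis unfolding w_def by (rule power2_le_imp_le) simp
qed

lemma cell_norm_cscale [simp]: "cell_norm L (\<lambda>r. cscale c (f r)) = cmod c * cell_norm L f"
proof -
  have "complex_of_real ((cell_norm L (\<lambda>r. cscale c (f r)))\<^sup>2) = of_real ((cmod c * cell_norm L f)\<^sup>2)"
    unfolding cell_inner_self [symmetric] cell_inner_cscale_left cell_inner_cscale_right
    using complex_norm_square [of c] by (simp add: cell_inner_self power_mult_distrib)
  then have "(cell_norm L (\<lambda>r. cscale c (f r)))\<^sup>2 = (cmod c * cell_norm L f)\<^sup>2"
    by (simp only: of_real_eq_iff)
  then show ?thesis by (rule power2_eq_imp_eq) simp_all
qed

lemma cell_norm_scaleR [simp]: "cell_norm L (\<lambda>r. t *\<^sub>R f r) = \<bar>t\<bar> * cell_norm L f"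
  using cell_norm_cscale [of "of_real t" f] by (simp add: cscale_of_real)

lemma cell_norm_zero [simp]: "cell_norm L (\<lambda>r. 0) = 0"
  by (simp add: cell_norm_def set_lebesgue_integral_def)

lemma cell_norm_triangle:
  assumes f: "f \<in> locally_L2" and g: "g \<in> locally_L2"
  shows "cell_norm L (\<lambda>r. f r + g r) \<le> cell_norm L f + cell_norm L g"
proof -
  have fg: "(\<lambda>r. f r + g r) \<in> locally_L2" using f g by blast
  have "complex_of_real ((cell_norm L (\<lambda>r. f r + g r))\<^sup>2)
      = cell_inner L f f + cell_inner L f g + (cell_inner L g f + cell_inner L g g)"
    unfolding cell_inner_self [symmetric, of "\<lambda>r. f r + g r"] cell_inner_add_left [OF f g fg]
      cell_inner_add_right [OF f f g] cell_inner_add_right [OF g f g] by simp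
  then have "(cell_norm L (\<lambda>r. f r + g r))\<^sup>2
      = Re (cell_inner L f f + cell_inner L f g + (cell_inner L g f + cell_inner L g g))"
    by (metis Re_complex_of_real)
  also have "\<dots> = (cell_norm L f)\<^sup>2 + (cell_norm L g)\<^sup>2 + 2 * Re (cell_inner L f g)"
    by (simp add: cell_inner_self cell_inner_commute [of g f] flip: of_real_power)
  also have "\<dots> \<le> (cell_norm L f)\<^sup>2 + (cell_norm L g)\<^sup>2 + 2 * (cell_norm L f * cell_norm L g)"
    using cell_inner_le [OF f g] complex_Re_le_cmod [of "cell_inner L f g"] by simp
  also have "\<dots> = (cell_norm L f + cell_norm L g)\<^sup>2" by (simp add: power2_sum)
  finally show ?thesis by (rule power2_le_imp_le) simp
qed

end

subsection \<open>Bloch functions\<close>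

context lattice
begin

lemma bloch_locally_L2: "f \<in> bloch L k \<Longrightarrow> f \<in> locally_L2"
  by (simp add: bloch_def)

lemma bloch_AE: "f \<in> bloch L k \<Longrightarrow> R \<in> L \<Longrightarrow> AE r in lborel. f (r + R) = cscale (cis (k \<bullet> R)) (f r)"
  by (simp add: bloch_def)

lemma bloch_I:
  assumes "f \<in> locally_L2" "\<And>R. R \<in> L \<Longrightarrow> AE r in lborel. f (r + R) = cscale (cis (k \<bullet> R)) (f r)"
  shows "f \<in> bloch L k"
  using assms by (simp add: bloch_def)

lemma bloch_zero [simp]: "(\<lambda>r. 0) \<in> bloch L k"
  by (rule bloch_I) simp_all

lemma bloch_plus:
  assumes "f \<in> bloch L k" "g \<in> bloch L k"
  shows "(\<lambda>r. f r + g r) \<in> bloch L k"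
proof (rule bloch_I)
  fix R assume R: "R \<in> L"
  show "AE r in lborel. f (r + R) + g (r + R) = cscale (cis (k \<bullet> R)) (f r + g r)"
    using bloch_AE [OF assms(1) R] bloch_AE [OF assms(2) R]
    by eventually_elim (simp add: cscale_add_right)
qed (intro locally_L2_plus bloch_locally_L2 [OF assms(1)] bloch_locally_L2 [OF assms(2)])

lemma bloch_cscale:
  assumes "f \<in> bloch L k"
  shows "(\<lambda>r. cscale c (f r)) \<in> bloch L k"
proof (rule bloch_I)
  fix R assume R: "R \<in> L"
  show "AE r in lborel. cscale c (f (r + R)) = cscale (cis (k \<bullet> R)) (cscale c (f r))"
    using bloch_AE [OF assms(1) R] by eventually_elim (simp add: mult.commute)
qed (intro locally_L2_cscale bloch_locally_L2 [OF assms])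

lemma bloch_scaleR: "f \<in> bloch L k \<Longrightarrow> (\<lambda>r. t *\<^sub>R f r) \<in> bloch L k"
  using bloch_cscale [of f k "of_real t"] by (simp add: cscale_of_real)

lemma bloch_minus: "f \<in> bloch L k \<Longrightarrow> g \<in> bloch L k \<Longrightarrow> (\<lambda>r. f r - g r) \<in> bloch L k"
  using bloch_plus [OF _ bloch_scaleR [of g k "-1"], of f] by simp

lemma bloch_sum: "(\<And>i. i \<in> A \<Longrightarrow> f i \<in> bloch L k) \<Longrightarrow> (\<lambda>r. \<Sum>i\<in>A. f i r) \<in> bloch L k"
  by (induction A rule: infinite_finite_induct) (simp_all add: bloch_plus)

end

lemma phase_mult_phase_mult [simp]: "phase_mult a (phase_mult b f) = phase_mult (a + b) f"
  by (simp add: phase_mult_def fun_eq_iff inner_add_left cis_mult)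

lemma phase_mult_0 [simp]: "phase_mult 0 f = f"
  by (simp add: phase_mult_def fun_eq_iff)

lemma phase_mult_simps:
  "phase_mult k (\<lambda>r. f r + g r) = (\<lambda>r. phase_mult k f r + phase_mult k g r)"
  "phase_mult k (\<lambda>r. f r - g r) = (\<lambda>r. phase_mult k f r - phase_mult k g r)"
  "phase_mult k (\<lambda>r. cscale c (f r)) = (\<lambda>r. cscale c (phase_mult k f r))"
  by (simp_all add: phase_mult_def fun_eq_iff cscale_add_right cscale_diff_right mult.commute)

lemma winner_phase_mult [simp]: "winner (phase_mult k f r) (phase_mult k g r) = winner (f r) (g r)"
proof -
  have "cis (k \<bullet> r) * cnj (cis (k \<bullet> r)) = 1"
    by (simp add: complex_norm_square [symmetric])
  then show ?thesis
    by (simp add: phase_mult_def winner_cscale_left winner_cscale_right mult.assoc [symmetric])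
qed

lemma norm_phase_mult [simp]: "norm (phase_mult k f r) = norm (f r)"
  by (simp add: phase_mult_def norm_cscale)

lemma phase_mult_locally_L2: "f \<in> locally_L2 \<Longrightarrow> phase_mult k f \<in> locally_L2"
  unfolding phase_mult_def
  by (rule locally_L2_cscale_fun [where B = 1])
    (simp_all add: borel_measurable_continuous_onI continuous_intros)

context lattice
begin

lemma cell_inner_phase_mult [simp]: "cell_inner L (phase_mult k f) (phase_mult k g) = cell_inner L f g"
  by (simp add: cell_inner_def)

lemma cell_norm_phase_mult [simp]: "cell_norm L (phase_mult k f) = cell_norm L f"
  by (simp add: cell_norm_def)

lemma phase_mult_bloch:
  assumes "f \<in> bloch L k"
  shows "phase_mult k' f \<in> bloch L (k' + k)"
proof (rule bloch_I)
  fix R assume R: "R \<in> L"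
  show "AE r in lborel. phase_mult k' f (r + R) = cscale (cis ((k' + k) \<bullet> R)) (phase_mult k' f r)"
    using bloch_AE [OF assms R]
  proof eventually_elim
    case (elim r)
    have "cis (k' \<bullet> (r + R)) * cis (k \<bullet> R) = cis ((k' + k) \<bullet> R) * cis (k' \<bullet> r)"
      by (simp add: cis_mult inner_add_left inner_add_right algebra_simps)
    then show ?case by (simp add: phase_mult_def elim)
  qed
qed (intro phase_mult_locally_L2 bloch_locally_L2 [OF assms])

lemma phase_mult_bloch_0: "f \<in> bloch L k \<Longrightarrow> phase_mult (- k) f \<in> bloch L 0"
  using phase_mult_bloch [of f k "-k"] by simp

lemma bloch_winner_periodic:
  assumes "f \<in> bloch L k" "g \<in> bloch L k" "R \<in> L"
  shows "AE r in lborel. winner (f (r + R)) (g (r + R)) = winner (f r) (g r)"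
  using bloch_AE [OF assms(1,3)] bloch_AE [OF assms(2,3)]
proof eventually_elim
  case (elim r)
  have "cis (k \<bullet> R) * cnj (cis (k \<bullet> R)) = 1"
    by (simp add: complex_norm_square [symmetric])
  then show ?case
    by (simp add: elim winner_cscale_left winner_cscale_right mult.assoc [symmetric])
qed

end

subsection \<open>The action of the space group\<close>

locale msg =
  fixes G :: "('p, 'd::finite, 'v::finite) msg"
  assumes sym: "symmorphic_msg G"
begin

sublocale lattice "bravais G"
  by unfold_locales (use sym in \<open>simp add: symmorphic_msg_def\<close>)

sublocale dual: lattice "reciprocal G"
  by unfold_locales (simp add: reciprocal_def full_dual_lattice)

abbreviation "P \<equiv> carrier (point_group G)"
abbreviation "A \<equiv> rot G"
abbreviation "sg \<equiv> trs G"

sublocale pg: group "point_group G"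
  using sym by (simp add: symmorphic_msg_def)

lemma finite_P: "finite P"
  using sym by (simp add: symmorphic_msg_def)

lemma
  assumes "p \<in> P"
  shows orth: "orthogonal_matrix (A p)" and sg_cases: "sg p = 1 \<or> sg p = -1"
    and rot_image: "(*v) (A p) ` bravais G = bravais G"
    and semi: "semiunitary (sg p) (rep G p)"
  using sym assms by (auto simp: symmorphic_msg_def semiunitary_def)

lemma
  assumes "q \<in> P" "p \<in> P"
  shows rot_mult: "A (q \<otimes>\<^bsub>point_group G\<^esub> p) = A q ** A p"
    and sg_mult: "sg (q \<otimes>\<^bsub>point_group G\<^esub> p) = sg q * sg p"
    and rep_mult: "rep G (q \<otimes>\<^bsub>point_group G\<^esub> p) = rep G q \<circ> rep G p"
  using sym assms by (simp_all add: symmorphic_msg_def)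

lemma sg_square [simp]: "p \<in> P \<Longrightarrow> sg p * sg p = 1"
  using sg_cases by force

lemma sg_mult_cancel [simp]: "p \<in> P \<Longrightarrow> sg p * (sg p * x) = x"
  by (simp add: mult.assoc [symmetric])

text \<open>The definition speaks of products only. That the unit acts trivially follows because its
  image is idempotent and invertible; the same argument serves the signs and the operators
  \<open>rep G\<close>.\<close>

lemma rot_one: "A \<one>\<^bsub>point_group G\<^esub> = mat 1"
proof -
  let ?e = "\<one>\<^bsub>point_group G\<^esub>"
  have "transpose (A ?e) ** A ?e = transpose (A ?e) ** (A ?e ** A ?e)"
    using rot_mult [of ?e ?e] by simp
  then show ?thesis
    using orth [of ?e] by (simp add: matrix_mul_assoc orthogonal_matrix_def)
qed

lemma sg_one: "sg \<one>\<^bsub>point_group G\<^esub> = 1"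
  using sg_mult [of "\<one>\<^bsub>point_group G\<^esub>" "\<one>\<^bsub>point_group G\<^esub>"] sg_cases [of "\<one>\<^bsub>point_group G\<^esub>"] by auto

lemma rep_one: "rep G \<one>\<^bsub>point_group G\<^esub> x = x"
proof -
  let ?e = "\<one>\<^bsub>point_group G\<^esub>"
  have "rep G ?e (rep G ?e x) = rep G ?e x"
    using rep_mult [of ?e ?e] by (simp add: fun_eq_iff)
  moreover have "inj (rep G ?e)"
    using semiunitary_simps(1) [OF semi [of ?e]] by (simp add: bij_def)
  ultimately show ?thesis by (simp add: inj_eq)
qed

lemma rot_inv: "p \<in> P \<Longrightarrow> A (inv\<^bsub>point_group G\<^esub> p) = transpose (A p)"
proof -
  assume p: "p \<in> P"
  have "A p ** A (inv\<^bsub>point_group G\<^esub> p) = mat 1"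
    using rot_mult [of p "inv\<^bsub>point_group G\<^esub> p"] p by (simp add: rot_one)
  then have "transpose (A p) ** (A p ** A (inv\<^bsub>point_group G\<^esub> p)) = transpose (A p)" by simp
  then show ?thesis
    using orth [OF p] by (simp add: matrix_mul_assoc orthogonal_matrix_def)
qed

lemma rot_mem: "p \<in> P \<Longrightarrow> R \<in> bravais G \<Longrightarrow> A p *v R \<in> bravais G"
  using rot_image by blast

lemma rot_transpose_mem: "p \<in> P \<Longrightarrow> R \<in> bravais G \<Longrightarrow> transpose (A p) *v R \<in> bravais G"
  using rot_mem [of "inv\<^bsub>point_group G\<^esub> p"] by (simp add: rot_inv)

lemma rot_cancel:
  assumes "p \<in> P"
  shows "A p *v (transpose (A p) *v x) = x" "transpose (A p) *v (A p *v x) = x"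
  using orthogonal_matrix_inverse_cancel [OF orth [OF assms]] by simp_all

lemma space_group_simps:
  "carrier (space_group G) = P \<times> bravais G"
  "(q, R') \<otimes>\<^bsub>space_group G\<^esub> (p, R) = (q \<otimes>\<^bsub>point_group G\<^esub> p, A q *v R + R')"
  "\<one>\<^bsub>space_group G\<^esub> = (\<one>\<^bsub>point_group G\<^esub>, 0)"
  by (simp_all add: space_group_def)

sublocale sgrp: group "space_group G"
proof (rule groupI)
  fix x assume x: "x \<in> carrier (space_group G)"
  obtain p R where [simp]: "x = (p, R)" by (cases x)
  show "\<one>\<^bsub>space_group G\<^esub> \<otimes>\<^bsub>space_group G\<^esub> x = x"
    using x by (simp add: space_group_simps rot_one)
  show "\<exists>y\<in>carrier (space_group G). y \<otimes>\<^bsub>space_group G\<^esub> x = \<one>\<^bsub>space_group G\<^esub>"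
    by (rule bexI [of _ "(inv\<^bsub>point_group G\<^esub> p, - (A (inv\<^bsub>point_group G\<^esub> p) *v R))"])
      (use x in \<open>simp_all add: space_group_simps rot_mem\<close>)
next
  fix x y z
  assume "x \<in> carrier (space_group G)" "y \<in> carrier (space_group G)" "z \<in> carrier (space_group G)"
  then show "x \<otimes>\<^bsub>space_group G\<^esub> y \<otimes>\<^bsub>space_group G\<^esub> z = x \<otimes>\<^bsub>space_group G\<^esub> (y \<otimes>\<^bsub>space_group G\<^esub> z)"
    by (cases x; cases y; cases z)
      (simp add: space_group_simps pg.m_assoc rot_mult matrix_vector_mul_assoc [symmetric] matrix_vector_right_distrib)
qed (auto simp: space_group_simps rot_mem)

lemma space_group_inv:
  "p \<in> P \<Longrightarrow> R \<in> bravais G \<Longrightarrow>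
   inv\<^bsub>space_group G\<^esub> (p, R) = (inv\<^bsub>point_group G\<^esub> p, - (transpose (A p) *v R))"
  by (rule sgrp.inv_equality) (simp_all add: space_group_simps rot_inv rot_transpose_mem)

lemma hat_eq:
  "p \<in> P \<Longrightarrow> R \<in> bravais G \<Longrightarrow>
   hat G (p, R) f r = lift_op (rep G p) (f (transpose (A p) *v (r - R)))"
  by (simp add: hat_def lift_op_def act_def space_group_inv rot_inv matrix_vector_mult_diff_distrib)

lemma hat_one: "hat G (\<one>\<^bsub>point_group G\<^esub>, 0) f = f"
proof
  fix r
  show "hat G (\<one>\<^bsub>point_group G\<^esub>, 0) f r = f r"
    by (subst hat_eq) (simp_all add: rot_one lift_op_def rep_one)
qed

lemma hat_translation: "R \<in> bravais G \<Longrightarrow> hat G (\<one>\<^bsub>point_group G\<^esub>, R) f r = f (r - R)"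
  by (subst hat_eq) (simp_all add: rot_one lift_op_def rep_one)

lemma hat_hat:
  assumes q: "q \<in> P" and p: "p \<in> P" and R: "R \<in> bravais G" "R' \<in> bravais G"
  shows "hat G (q, R') (hat G (p, R) f) = hat G (q \<otimes>\<^bsub>point_group G\<^esub> p, A q *v R + R') f"
proof
  fix r
  have "transpose (A p) *v (transpose (A q) *v (r - R') - R)
      = transpose (A p) *v (transpose (A q) *v (r - R' - A q *v R))"
    by (simp add: matrix_vector_mult_diff_distrib [of "transpose (A q)"] rot_cancel q)
  then show "hat G (q, R') (hat G (p, R) f) r = hat G (q \<otimes>\<^bsub>point_group G\<^esub> p, A q *v R + R') f r"
    by (simp add: hat_eq assms rot_mem rot_mult rep_mult matrix_transpose_mul lift_op_def
        matrix_vector_mul_assoc [symmetric] diff_diff_eq add.commute)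
qed

lemma hat_inv_cancel:
  assumes "g \<in> carrier (space_group G)"
  shows "hat G g (hat G (inv\<^bsub>space_group G\<^esub> g) f) = f" "hat G (inv\<^bsub>space_group G\<^esub> g) (hat G g f) = f"
proof -
  obtain p R where g: "g = (p, R)" "p \<in> P" "R \<in> bravais G"
    using assms by (auto simp: space_group_simps)
  show "hat G g (hat G (inv\<^bsub>space_group G\<^esub> g) f) = f" "hat G (inv\<^bsub>space_group G\<^esub> g) (hat G g f) = f"
    by (simp_all add: g space_group_inv hat_hat rot_transpose_mem rot_cancel hat_one rot_inv
        linear_neg [OF matrix_vector_mul_linear])
qed

text \<open>The action on wavevectors in the symmetry condition of \<open>band\<close>: an element
  with point part \<open>p\<close> maps the fibre at \<open>k\<close> to the fibre at
  \<open>kact p k\<close>.\<close>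

definition kact :: "'p \<Rightarrow> real^'d \<Rightarrow> real^'d" where
  "kact p k = sg p *\<^sub>R (A p *v k)"

lemma kact_simps [simp]:
  "kact p (x + y) = kact p x + kact p y" "kact p (x - y) = kact p x - kact p y" "kact p (- x) = - kact p x"
  by (simp_all add: kact_def matrix_vector_right_distrib matrix_vector_mult_diff_distrib
      scaleR_add_right scaleR_diff_right linear_neg [OF matrix_vector_mul_linear])

lemma kact_mult: "q \<in> P \<Longrightarrow> p \<in> P \<Longrightarrow> kact (q \<otimes>\<^bsub>point_group G\<^esub> p) k = kact q (kact p k)"
  by (simp add: kact_def rot_mult sg_mult matrix_vector_mult_scaleR matrix_vector_mul_assoc)

lemma kact_one: "kact \<one>\<^bsub>point_group G\<^esub> k = k"
  by (simp add: kact_def rot_one sg_one)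

lemma kact_inv:
  assumes "p \<in> P"
  shows "kact (inv\<^bsub>point_group G\<^esub> p) (kact p k) = k" "kact p (kact (inv\<^bsub>point_group G\<^esub> p) k) = k"
  using assms by (simp_all add: kact_one flip: kact_mult)

lemma kact_inner: "p \<in> P \<Longrightarrow> kact p k \<bullet> r = sg p * (k \<bullet> (transpose (A p) *v r))"
  by (simp add: kact_def orthogonal_matrix_inner [OF orth])

lemma kact_dual: "p \<in> P \<Longrightarrow> K \<in> reciprocal G \<Longrightarrow> kact p K \<in> reciprocal G"
  unfolding reciprocal_def dual_lattice_def
proof (intro CollectI ballI)
  fix R assume p: "p \<in> P" and K: "K \<in> {K. \<forall>R\<in>bravais G. \<exists>n::int. K \<bullet> R = 2 * pi * real_of_int n}"
    and R: "R \<in> bravais G"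
  obtain n :: int where n: "K \<bullet> (transpose (A p) *v R) = 2 * pi * real_of_int n"
    using K rot_transpose_mem [OF p R] by blast
  show "\<exists>n::int. kact p K \<bullet> R = 2 * pi * real_of_int n"
    using sg_cases [OF p] by (auto simp: kact_inner [OF p] n intro: exI [of _ n] exI [of _ "-n"])
qed

lemma continuous_on_kact: "continuous_on S (kact p)"
  unfolding kact_def by (intro continuous_intros linear_continuous_on matrix_vector_mul_bounded_linear)

lemma hat_locally_L2:
  assumes p: "p \<in> P" "R \<in> bravais G" and f: "f \<in> locally_L2"
  shows "hat G (p, R) f \<in> locally_L2"
proof -
  have "(\<lambda>r. f (transpose (A p) *v r + - (transpose (A p) *v R))) \<in> locally_L2"
    by (rule locally_L2_isometry [OF _ f]) (simp add: orth p)
  then have "(\<lambda>r. f (transpose (A p) *v (r - R))) \<in> locally_L2"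
    by (simp add: matrix_vector_mult_diff_distrib)
  from locally_L2_lift_op [OF semi [OF p(1)] this] show ?thesis
    by (simp add: hat_eq [OF p, abs_def])
qed

lemma hat_AE:
  assumes p: "p \<in> P" "R \<in> bravais G" and "AE r in lborel. f r = g r"
  shows "AE r in lborel. hat G (p, R) f r = hat G (p, R) g r"
proof -
  have "AE r in lborel. f (transpose (A p) *v r + - (transpose (A p) *v R))
      = g (transpose (A p) *v r + - (transpose (A p) *v R))"
    by (rule AE_lborel_isometry [OF _ assms(3)]) (simp add: orth p)
  then show ?thesis
    by eventually_elim (simp add: hat_eq p matrix_vector_mult_diff_distrib)
qed

lemma hat_cscale:
  assumes "p \<in> P" "R \<in> bravais G"
  shows "hat G (p, R) (\<lambda>r. cscale c (f r)) = (\<lambda>r. cscale (conj_if (sg p) c) (hat G (p, R) f r))"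
  by (rule ext) (simp add: hat_eq assms lift_op_cscale [OF semi])

lemma hat_minus:
  assumes "p \<in> P" "R \<in> bravais G"
  shows "hat G (p, R) (\<lambda>r. f r - g r) = (\<lambda>r. hat G (p, R) f r - hat G (p, R) g r)"
  by (rule ext) (simp add: hat_eq assms lift_op_diff [OF semi])

text \<open>An antiunitary operator conjugates the plane wave, which is the origin of the sign in
  \<open>kact\<close>; the translation part contributes only a constant phase.\<close>

lemma hat_phase_mult:
  assumes p: "p \<in> P" "R \<in> bravais G"
  shows "hat G (p, R) (phase_mult k f)
      = (\<lambda>r. cscale (cis (- (kact p k \<bullet> R))) (phase_mult (kact p k) (hat G (p, R) f) r))"
proof
  fix r
  have "conj_if (sg p) (cis (k \<bullet> (transpose (A p) *v (r - R)))) = cis (- (kact p k \<bullet> R)) * cis (kact p k \<bullet> r)"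
    by (simp add: conj_if_cis [OF sg_cases [OF p(1)]] cis_mult kact_inner [OF p(1), symmetric] inner_diff_right)
  then show "hat G (p, R) (phase_mult k f) r
      = cscale (cis (- (kact p k \<bullet> R))) (phase_mult (kact p k) (hat G (p, R) f) r)"
    by (simp add: hat_eq p phase_mult_def lift_op_cscale [OF semi])
qed

lemma hat_bloch:
  assumes p: "p \<in> P" "R \<in> bravais G" and f: "f \<in> bloch (bravais G) k"
  shows "hat G (p, R) f \<in> bloch (bravais G) (kact p k)"
proof (rule bloch_I)
  show "hat G (p, R) f \<in> locally_L2" by (intro hat_locally_L2 p bloch_locally_L2 [OF f])
  fix R' assume R': "R' \<in> bravais G"
  let ?T = "transpose (A p)"
  have "AE r in lborel. f ((?T *v r + - (?T *v R)) + ?T *v R') = cscale (cis (k \<bullet> (?T *v R'))) (f (?T *v r + - (?T *v R)))"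
    by (rule AE_lborel_isometry [OF _ bloch_AE [OF f]]) (simp_all add: orth p rot_transpose_mem R')
  then show "AE r in lborel. hat G (p, R) f (r + R') = cscale (cis (kact p k \<bullet> R')) (hat G (p, R) f r)"
  proof eventually_elim
    case (elim r)
    have "?T *v (r + R' - R) = (?T *v r + - (?T *v R)) + ?T *v R'"
      by (simp add: matrix_vector_mult_diff_distrib matrix_vector_right_distrib)
    then show ?case
      using elim by (simp add: hat_eq p lift_op_cscale [OF semi] conj_if_cis [OF sg_cases] kact_inner
          matrix_vector_mult_diff_distrib [of ?T r R])
  qed
qed

text \<open>Change of variables. The weight \<open>b\<close> serves two uses: the indicator of the
  cell gives inner products over the cell, the constant 1 gives integrals over the whole
  space.\<close>

lemma integral_hat:
  assumes p: "p \<in> P" "R \<in> bravais G" and f: "f \<in> locally_L2" "h \<in> locally_L2"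
    and b: "b \<in> borel_measurable borel"
  shows "(LINT r|lborel. b r * winner (hat G (p, R) f r) (hat G (p, R) h r))
      = (LINT r|lborel. b (A p *v r + R) * conj_if (sg p) (winner (f r) (h r)))"
proof -
  note [measurable] = f [THEN locally_L2_measurable] b
  have "conj_if (sg p) \<in> borel_measurable borel"
    by (rule borel_measurable_continuous_onI, cases "sg p = 1")
      (simp_all add: conj_if_def [abs_def] continuous_on_cnj continuous_on_id)
  then have [measurable]: "(\<lambda>r. conj_if (sg p) (winner (f r) (h r))) \<in> borel_measurable borel"
    by (rule measurable_compose [rotated]) measurable
  have [measurable]: "(\<lambda>r. b (A p *v r + R)) \<in> borel_measurable borel" by measurable
  have "(LINT r|lborel. b (A p *v r + R) * conj_if (sg p) (winner (f r) (h r)))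
      = (LINT r|lborel. (\<lambda>r. b (A p *v r + R) * conj_if (sg p) (winner (f r) (h r)))
          (transpose (A p) *v r + - (transpose (A p) *v R)))"
    by (rule lborel_integral_isometry [symmetric]) (simp_all add: orth p)
  also have "\<dots> = (LINT r|lborel. b r * winner (hat G (p, R) f r) (hat G (p, R) h r))"
    by (simp add: hat_eq p winner_lift_op [OF semi] rot_cancel matrix_vector_mult_diff_distrib
        matrix_vector_mult_diff_distrib [of "A p"])
  finally show ?thesis ..
qed

text \<open>The substitution replaces the cell by its preimage \<open>D\<close> under the isometry,
  another fundamental domain of the lattice; the integrand is periodic because both functions carry
  the same Bloch phase.\<close>

lemma cell_inner_hat:
  assumes p: "p \<in> P" "R \<in> bravais G" and f: "f \<in> bloch (bravais G) k" "h \<in> bloch (bravais G) k"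
  shows "cell_inner (bravais G) (hat G (p, R) f) (hat G (p, R) h) = conj_if (sg p) (cell_inner (bravais G) f h)"
proof -
  note L2 = f [THEN bloch_locally_L2]
  define D where "D = {r. A p *v r + R \<in> cell}"
  have D: "D \<in> sets borel"
    using measurable_sets_borel [of "\<lambda>r. A p *v r + R" borel cell] by (simp add: D_def vimage_def)
  have bD: "bounded D"
    unfolding bounded_iff
  proof (intro exI ballI)
    fix r assume "r \<in> D"
    then have "norm (A p *v r + R) \<le> cell_radius" by (simp add: D_def norm_cell_le)
    moreover have "norm (A p *v r) \<le> norm (A p *v r + R) + norm R"
      using norm_triangle_ineq4 [of "A p *v r + R" R] by simp
    ultimately show "norm r \<le> cell_radius + norm R" by (simp add: orthogonal_matrix_norm orth p)
  qed
  have uD: "\<exists>!R'. R' \<in> bravais G \<and> r + R' \<in> D" for r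
  proof -
    obtain R1 where R1: "R1 \<in> bravais G" "A p *v r + R + R1 \<in> cell"
      "\<And>R2. R2 \<in> bravais G \<Longrightarrow> A p *v r + R + R2 \<in> cell \<Longrightarrow> R2 = R1"
      using cell_ex1 [of "A p *v r + R"] by blast
    show ?thesis
    proof (intro ex1I [of _ "transpose (A p) *v R1"] conjI)
      show "r + transpose (A p) *v R1 \<in> D"
        using R1(2) by (simp add: D_def matrix_vector_right_distrib rot_cancel p ac_simps)
      fix R' assume R': "R' \<in> bravais G \<and> r + R' \<in> D"
      then have "A p *v R' = R1"
        by (intro R1(3)) (auto simp: D_def rot_mem p matrix_vector_right_distrib ac_simps)
      then show "R' = transpose (A p) *v R1" using rot_cancel(2) [OF p(1), of R'] by simp
    qed (simp add: rot_transpose_mem p R1)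
  qed
  have "cell_inner (bravais G) (hat G (p, R) f) (hat G (p, R) h)
      = (LINT r|lborel. complex_of_real (indicator cell r) * winner (hat G (p, R) f r) (hat G (p, R) h r))"
    by (simp add: cell_inner_def set_lebesgue_integral_def scaleR_conv_of_real)
  also have "\<dots> = (LINT r|lborel. complex_of_real (indicator cell (A p *v r + R)) * conj_if (sg p) (winner (f r) (h r)))"
    by (rule integral_hat [OF p L2]) simp
  also have "\<dots> = (LINT r|lborel. conj_if (sg p) (indicator D r *\<^sub>R winner (f r) (h r)))"
    by (simp add: D_def indicator_def scaleR_conv_of_real)
  also have "\<dots> = conj_if (sg p) (LINT r:D|lborel. winner (f r) (h r))"
    by (cases "sg p = 1")
      (simp_all only: set_lebesgue_integral_def conj_if_def Bochner_Integration.integral_cnj simp_thms if_True if_False)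
  also have "(LINT r:D|lborel. winner (f r) (h r)) = cell_inner (bravais G) f h"
    unfolding cell_inner_def
    by (rule integral_fundamental_domain [OF D bD uD winner_set_integrable [OF L2]])
      (simp_all add: bloch_winner_periodic [OF f])
  finally show ?thesis .
qed

lemma cell_norm_hat:
  assumes p: "p \<in> P" "R \<in> bravais G" and f: "f \<in> bloch (bravais G) k"
  shows "cell_norm (bravais G) (hat G (p, R) f) = cell_norm (bravais G) f"
proof -
  have "complex_of_real ((cell_norm (bravais G) (hat G (p, R) f))\<^sup>2) = conj_if (sg p) (of_real ((cell_norm (bravais G) f)\<^sup>2))"
    unfolding cell_inner_self [symmetric] by (rule cell_inner_hat [OF p f f])
  then have "(cell_norm (bravais G) (hat G (p, R) f))\<^sup>2 = (cell_norm (bravais G) f)\<^sup>2"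
    by (simp only: conj_if_simps(4) of_real_eq_iff)
  then show ?thesis by (rule power2_eq_imp_eq) simp_all
qed

end

subsection \<open>Power series in several variables\<close>

definition monomial :: "real^'d::finite \<Rightarrow> ('d \<Rightarrow> nat) \<Rightarrow> real" where
  "monomial x \<alpha> = (\<Prod>i\<in>UNIV. (x $ i) ^ \<alpha> i)"

definition total_degree :: "('d::finite \<Rightarrow> nat) \<Rightarrow> nat" where
  "total_degree \<alpha> = (\<Sum>i\<in>UNIV. \<alpha> i)"

lemma monomial_add: "monomial x (\<lambda>i. \<alpha> i + \<beta> i) = monomial x \<alpha> * monomial x \<beta>"
  by (simp add: monomial_def power_add prod.distrib)

lemma total_degree_add: "total_degree (\<lambda>i. \<alpha> i + \<beta> i) = total_degree \<alpha> + total_degree \<beta>"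
  by (simp add: total_degree_def sum.distrib)

lemma total_degree_eq_0: "total_degree \<alpha> = 0 \<longleftrightarrow> \<alpha> = (\<lambda>i. 0)"
  by (auto simp: total_degree_def)

lemma monomial_zero [simp]: "monomial x (\<lambda>i. 0) = 1"
  by (simp add: monomial_def)

lemma monomial_0: "monomial 0 \<alpha> = (if \<alpha> = (\<lambda>i. 0) then 1 else 0)"
proof (cases "\<alpha> = (\<lambda>i. 0)")
  case False
  then obtain i where "\<alpha> i \<noteq> 0" by auto
  then have "(0::real) ^ \<alpha> i = 0" by simp
  then show ?thesis using False by (auto simp: monomial_def)
qed simp

lemma abs_monomial_le:
  assumes "\<And>i. \<bar>x $ i\<bar> \<le> \<rho>"
  shows "\<bar>monomial x \<alpha>\<bar> \<le> \<rho> ^ total_degree \<alpha>"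
proof -
  have "\<bar>monomial x \<alpha>\<bar> = (\<Prod>i\<in>UNIV. \<bar>x $ i\<bar> ^ \<alpha> i)"
    by (simp add: monomial_def abs_prod power_abs)
  also have "\<dots> \<le> (\<Prod>i\<in>UNIV. \<rho> ^ \<alpha> i)"
    by (intro prod_mono conjI power_mono assms) simp_all
  finally show ?thesis by (simp add: total_degree_def power_sum)
qed

lemma summable_on_nonneg_bounded:
  fixes f :: "'i \<Rightarrow> real"
  assumes "\<And>x. x \<in> I \<Longrightarrow> 0 \<le> f x" "\<And>F. finite F \<Longrightarrow> F \<subseteq> I \<Longrightarrow> sum f F \<le> C"
  shows "f summable_on I"
  by (rule nonneg_bdd_above_summable_on) (use assms in \<open>auto intro!: bdd_aboveI2 [where M = C]\<close>)

text \<open>\<open>N\<close> is a seminorm on the subset \<open>S\<close> only: wavefunctions that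
  agree almost everywhere have distance 0 without being equal, and the function type is larger than
  the space of interest.\<close>

locale seminormed =
  fixes S :: "'x::real_vector set" and N :: "'x \<Rightarrow> real"
  assumes zero_mem: "0 \<in> S" and add_mem: "\<And>x y. x \<in> S \<Longrightarrow> y \<in> S \<Longrightarrow> x + y \<in> S"
    and scaleR_mem: "\<And>c x. x \<in> S \<Longrightarrow> c *\<^sub>R x \<in> S"
    and N_nonneg: "\<And>x. x \<in> S \<Longrightarrow> 0 \<le> N x"
    and N_triangle: "\<And>x y. x \<in> S \<Longrightarrow> y \<in> S \<Longrightarrow> N (x + y) \<le> N x + N y"
    and N_scaleR: "\<And>c x. x \<in> S \<Longrightarrow> N (c *\<^sub>R x) = \<bar>c\<bar> * N x"
begin

lemma diff_mem: "x \<in> S \<Longrightarrow> y \<in> S \<Longrightarrow> x - y \<in> S"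
  using add_mem [of x "-1 *\<^sub>R y"] scaleR_mem [of y "-1"] by simp

lemma sum_mem: "(\<And>i. i \<in> A \<Longrightarrow> f i \<in> S) \<Longrightarrow> sum f A \<in> S"
  by (induction A rule: infinite_finite_induct) (simp_all add: zero_mem add_mem)

lemma N_zero: "N 0 = 0"
  using N_scaleR [OF zero_mem, of 0] by simp

lemma N_diff: "x \<in> S \<Longrightarrow> y \<in> S \<Longrightarrow> N (x - y) \<le> N x + N y"
  using N_triangle [of x "-1 *\<^sub>R y"] scaleR_mem [of y "-1"] N_scaleR [of y "-1"] by simp

lemma N_sum: "(\<And>i. i \<in> A \<Longrightarrow> f i \<in> S) \<Longrightarrow> N (sum f A) \<le> (\<Sum>i\<in>A. N (f i))"
proof (induction A rule: infinite_finite_induct)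
  case (insert x F)
  then have "N (f x + sum f F) \<le> N (f x) + N (sum f F)"
    by (intro N_triangle sum_mem) auto
  also have "\<dots> \<le> N (f x) + (\<Sum>i\<in>F. N (f i))" using insert by simp
  finally show ?case using insert by simp
qed (simp_all add: N_zero)

text \<open>For an absolutely summable family, convergence along a cofinal collection of finite
  sets suffices.\<close>

lemma tendsto_sum_cofinal:
  assumes c: "\<And>i. i \<in> I \<Longrightarrow> c i \<in> S" and w: "w \<in> S"
    and sm: "(\<lambda>i. N (c i)) summable_on I"
    and app: "\<And>\<epsilon> F. 0 < \<epsilon> \<Longrightarrow> finite F \<Longrightarrow> F \<subseteq> I \<Longrightarrow>
      \<exists>A. finite A \<and> F \<subseteq> A \<and> A \<subseteq> I \<and> N (w - (\<Sum>i\<in>A. c i)) \<le> \<epsilon>"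
  shows "((\<lambda>A. N (w - (\<Sum>i\<in>A. c i))) \<longlongrightarrow> 0) (finite_subsets_at_top I)"
proof (rule tendstoI)
  fix \<epsilon> :: real assume e: "0 < \<epsilon>"
  \<comment> \<open>\<open>F\<close> exhausts the sum of the seminorms up to \<epsilon>/4. Terms
    outside a set containing \<open>F\<close> are then negligible, so one good set \<open>A\<close>
    above \<open>F\<close> controls every larger \<open>B\<close>.\<close>
  obtain F where F: "finite F" "F \<subseteq> I" "dist (\<Sum>i\<in>F. N (c i)) (infsum (\<lambda>i. N (c i)) I) \<le> \<epsilon> / 4"
    using infsum_finite_approximation [OF sm, of "\<epsilon> / 4"] e by auto
  obtain A where A: "finite A" "F \<subseteq> A" "A \<subseteq> I" "N (w - (\<Sum>i\<in>A. c i)) \<le> \<epsilon> / 4"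
    using app [of "\<epsilon> / 4" F] F e by auto
  show "\<forall>\<^sub>F B in finite_subsets_at_top I. dist (N (w - (\<Sum>i\<in>B. c i))) 0 < \<epsilon>"
    unfolding eventually_finite_subsets_at_top
  proof (intro exI [of _ A] conjI allI impI A)
    fix B assume B: "finite B \<and> A \<subseteq> B \<and> B \<subseteq> I"
    have mem: "(\<Sum>i\<in>C. c i) \<in> S" if "C \<subseteq> I" for C using that c by (intro sum_mem) auto
    have BA: "B - A \<subseteq> I" "B \<subseteq> I" using B by auto
    have "(\<Sum>i\<in>B - A. N (c i)) + (\<Sum>i\<in>F. N (c i)) = (\<Sum>i\<in>(B - A) \<union> F. N (c i))"
      by (rule sum.union_disjoint [symmetric]) (use A B F in auto)
    also have "\<dots> \<le> infsum (\<lambda>i. N (c i)) I"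
      by (rule finite_sum_le_infsum [OF sm]) (use B F c N_nonneg in auto)
    finally have tail: "(\<Sum>i\<in>B - A. N (c i)) \<le> \<epsilon> / 4"
      using F(3) unfolding dist_real_def by linarith
    have "(\<Sum>i\<in>B. c i) = (\<Sum>i\<in>A. c i) + (\<Sum>i\<in>B - A. c i)"
      using sum.subset_diff [of A B c] B by (simp add: add.commute)
    then have "w - (\<Sum>i\<in>B. c i) = (w - (\<Sum>i\<in>A. c i)) - (\<Sum>i\<in>B - A. c i)" by simp
    also have "N \<dots> \<le> N (w - (\<Sum>i\<in>A. c i)) + N (\<Sum>i\<in>B - A. c i)"
      by (rule N_diff) (intro diff_mem w mem A BA)+
    also have "N (\<Sum>i\<in>B - A. c i) \<le> (\<Sum>i\<in>B - A. N (c i))" by (rule N_sum) (use B c in auto)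
    finally have "N (w - (\<Sum>i\<in>B. c i)) \<le> \<epsilon> / 4 + \<epsilon> / 4" using A(4) tail by linarith
    moreover have "0 \<le> N (w - (\<Sum>i\<in>B. c i))" by (rule N_nonneg) (intro diff_mem w mem BA)
    ultimately show "dist (N (w - (\<Sum>i\<in>B. c i))) 0 < \<epsilon>" using e by simp
  qed
qed

end

text \<open>The condition of \<open>real_analytic\<close> at one point, recentred at the origin;
  \<rho> is both the half-width of the cube and the weight in the absolute convergence.\<close>

definition power_series_on :: "'x::real_vector set \<Rightarrow> ('x \<Rightarrow> real) \<Rightarrow> real \<Rightarrow>
    (real^'d::finite \<Rightarrow> 'x) \<Rightarrow> (('d \<Rightarrow> nat) \<Rightarrow> 'x) \<Rightarrow> bool" where
  "power_series_on S N \<rho> v a \<longleftrightarrow> range a \<subseteq> S \<and>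
     (\<lambda>\<alpha>. N (a \<alpha>) * \<rho> ^ total_degree \<alpha>) summable_on UNIV \<and>
     (\<forall>x. (\<forall>i. \<bar>x $ i\<bar> < \<rho>) \<longrightarrow>
        ((\<lambda>A. N (v x - (\<Sum>\<alpha>\<in>A. monomial x \<alpha> *\<^sub>R a \<alpha>))) \<longlongrightarrow> 0) (finite_subsets_at_top UNIV))"

lemma real_analytic_iff:
  "real_analytic S N u \<longleftrightarrow> (\<forall>k0. \<exists>\<rho>>0. \<exists>a. power_series_on S N \<rho> (\<lambda>x. u (k0 + x)) a)"
proof -
  have "(\<forall>k. (\<forall>i. \<bar>(k - k0) $ i\<bar> < \<rho>) \<longrightarrow> Q (k - k0) (u k)) \<longleftrightarrow>
      (\<forall>x. (\<forall>i. \<bar>x $ i\<bar> < \<rho>) \<longrightarrow> Q x (u (k0 + x)))" for k0 \<rho> Q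
    by (metis add_diff_cancel_left' add.commute diff_add_cancel)
  from this [where Q = "\<lambda>x y. ((\<lambda>A. N (y - (\<Sum>\<alpha>\<in>A. monomial x \<alpha> *\<^sub>R _ \<alpha>))) \<longlongrightarrow> 0) (finite_subsets_at_top UNIV)"]
  show ?thesis
    unfolding real_analytic_def power_series_on_def monomial_def total_degree_def by simp
qed

context seminormed
begin

lemma power_series_on_smaller:
  fixes v :: "real^'d::finite \<Rightarrow> 'x"
  assumes "power_series_on S N \<rho> v a" "0 < \<rho>'" "\<rho>' \<le> \<rho>"
  shows "power_series_on S N \<rho>' v a"
  unfolding power_series_on_def
proof (intro conjI allI impI)
  show "range a \<subseteq> S" using assms by (simp add: power_series_on_def)
  have "(\<lambda>\<alpha>. N (a \<alpha>) * \<rho> ^ total_degree \<alpha>) summable_on UNIV"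
    using assms by (simp add: power_series_on_def)
  then show "(\<lambda>\<alpha>. N (a \<alpha>) * \<rho>' ^ total_degree \<alpha>) summable_on UNIV"
    by (rule summable_on_comparison_test)
      (use assms \<open>range a \<subseteq> S\<close> N_nonneg in \<open>auto intro!: mult_left_mono power_mono mult_nonneg_nonneg\<close>)
  fix x :: "real^'d" assume "\<forall>i. \<bar>x $ i\<bar> < \<rho>'"
  then have "\<forall>i. \<bar>x $ i\<bar> < \<rho>" using assms(3) by (meson less_le_trans)
  then show "((\<lambda>A. N (v x - (\<Sum>\<alpha>\<in>A. monomial x \<alpha> *\<^sub>R a \<alpha>))) \<longlongrightarrow> 0) (finite_subsets_at_top UNIV)"
    using assms(1) by (simp add: power_series_on_def)
qed

text \<open>Terms may be indexed by anything as long as each exponent occurs finitely often; the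
  coefficient of a monomial is then a finite sum. It serves index pairs for products and lists of
  multi-indices for the binomial series.\<close>

lemma power_series_on_regroup:
  fixes e :: "'i \<Rightarrow> 'd::finite \<Rightarrow> nat"
  assumes rho: "0 < \<rho>" and c: "\<And>i. i \<in> I \<Longrightarrow> c i \<in> S"
    and fin: "\<And>\<gamma>. finite {i \<in> I. e i = \<gamma>}"
    and sm: "(\<lambda>i. N (c i) * \<rho> ^ total_degree (e i)) summable_on I"
    and conv: "\<And>x. (\<forall>i. \<bar>x $ i\<bar> < \<rho>) \<Longrightarrow>
      ((\<lambda>A. N (v x - (\<Sum>i\<in>A. monomial x (e i) *\<^sub>R c i))) \<longlongrightarrow> 0) (finite_subsets_at_top I)"
  shows "power_series_on S N \<rho> v (\<lambda>\<gamma>. \<Sum>i\<in>{i \<in> I. e i = \<gamma>}. c i)"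
proof -
  define pre where "pre C = {i \<in> I. e i \<in> C}" for C
  have pre_fin: "finite (pre C)" if "finite C" for C
  proof -
    have "pre C = (\<Union>\<gamma>\<in>C. {i \<in> I. e i = \<gamma>})" by (auto simp: pre_def)
    then show ?thesis using that fin by simp
  qed
  have group: "(\<Sum>\<gamma>\<in>C. \<Sum>i\<in>{i \<in> I. e i = \<gamma>}. h i) = (\<Sum>i\<in>pre C. h i)" if "finite C"
    for C and h :: "'i \<Rightarrow> 'z::comm_monoid_add"
  proof -
    have "(\<Sum>i\<in>pre C. h i) = (\<Sum>\<gamma>\<in>C. sum h {i \<in> pre C. e i = \<gamma>})"
      by (rule sum.group [symmetric]) (use that pre_fin in \<open>auto simp: pre_def\<close>)
    also have "\<dots> = (\<Sum>\<gamma>\<in>C. \<Sum>i\<in>{i \<in> I. e i = \<gamma>}. h i)"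
      by (intro sum.cong refl arg_cong [where f = "sum h"]) (auto simp: pre_def)
    finally show ?thesis ..
  qed
  show ?thesis
    unfolding power_series_on_def
  proof (intro conjI allI impI)
    show "range (\<lambda>\<gamma>. \<Sum>i\<in>{i \<in> I. e i = \<gamma>}. c i) \<subseteq> S" using c by (auto intro: sum_mem)
    show "(\<lambda>\<gamma>. N (\<Sum>i\<in>{i \<in> I. e i = \<gamma>}. c i) * \<rho> ^ total_degree \<gamma>) summable_on UNIV"
    proof (rule summable_on_nonneg_bounded)
      fix C :: "('d \<Rightarrow> nat) set" assume C: "finite C"
      have "(\<Sum>\<gamma>\<in>C. N (\<Sum>i\<in>{i \<in> I. e i = \<gamma>}. c i) * \<rho> ^ total_degree \<gamma>)
          \<le> (\<Sum>\<gamma>\<in>C. \<Sum>i\<in>{i \<in> I. e i = \<gamma>}. N (c i) * \<rho> ^ total_degree (e i))"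
      proof (rule sum_mono)
        fix \<gamma>
        have "N (\<Sum>i\<in>{i \<in> I. e i = \<gamma>}. c i) \<le> (\<Sum>i\<in>{i \<in> I. e i = \<gamma>}. N (c i))"
          by (rule N_sum) (use c in auto)
        then have "N (\<Sum>i\<in>{i \<in> I. e i = \<gamma>}. c i) * \<rho> ^ total_degree \<gamma>
            \<le> (\<Sum>i\<in>{i \<in> I. e i = \<gamma>}. N (c i)) * \<rho> ^ total_degree \<gamma>"
          using rho by (intro mult_right_mono) auto
        also have "\<dots> = (\<Sum>i\<in>{i \<in> I. e i = \<gamma>}. N (c i) * \<rho> ^ total_degree (e i))"
          by (simp add: sum_distrib_right)
        finally show "N (\<Sum>i\<in>{i \<in> I. e i = \<gamma>}. c i) * \<rho> ^ total_degree \<gamma>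
            \<le> (\<Sum>i\<in>{i \<in> I. e i = \<gamma>}. N (c i) * \<rho> ^ total_degree (e i))" .
      qed
      also have "\<dots> = (\<Sum>i\<in>pre C. N (c i) * \<rho> ^ total_degree (e i))" by (rule group [OF C])
      also have "\<dots> \<le> infsum (\<lambda>i. N (c i) * \<rho> ^ total_degree (e i)) I"
        by (rule finite_sum_le_infsum [OF sm pre_fin [OF C]])
          (use rho c N_nonneg in \<open>auto simp: pre_def\<close>)
      finally show "(\<Sum>\<gamma>\<in>C. N (\<Sum>i\<in>{i \<in> I. e i = \<gamma>}. c i) * \<rho> ^ total_degree \<gamma>)
        \<le> infsum (\<lambda>i. N (c i) * \<rho> ^ total_degree (e i)) I" .
    qed (intro mult_nonneg_nonneg N_nonneg sum_mem zero_le_power; use rho c in simp)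
    fix x :: "real^'d" assume x: "\<forall>i. \<bar>x $ i\<bar> < \<rho>"
    \<comment> \<open>The index sets \<open>pre C\<close> are cofinal among the finite index sets,
      so convergence of the ungrouped family passes to the grouped one.\<close>
    have "filterlim pre (finite_subsets_at_top I) (finite_subsets_at_top UNIV)"
      unfolding filterlim_iff eventually_finite_subsets_at_top
    proof (intro allI impI)
      fix Q assume "\<exists>X. finite X \<and> X \<subseteq> I \<and> (\<forall>Y. finite Y \<and> X \<subseteq> Y \<and> Y \<subseteq> I \<longrightarrow> Q Y)"
      then obtain X where "finite X \<and> X \<subseteq> I \<and> (\<forall>Y. finite Y \<and> X \<subseteq> Y \<and> Y \<subseteq> I \<longrightarrow> Q Y)" ..
      then have X: "finite X" "X \<subseteq> I" "\<And>Y. finite Y \<Longrightarrow> X \<subseteq> Y \<Longrightarrow> Y \<subseteq> I \<Longrightarrow> Q Y" by simp_all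
      show "\<exists>X. finite X \<and> X \<subseteq> UNIV \<and> (\<forall>Y. finite Y \<and> X \<subseteq> Y \<and> Y \<subseteq> UNIV \<longrightarrow> Q (pre Y))"
      proof (intro exI [of _ "e ` X"] conjI allI impI)
        fix Y :: "('d \<Rightarrow> nat) set" assume Y: "finite Y \<and> e ` X \<subseteq> Y \<and> Y \<subseteq> UNIV"
        show "Q (pre Y)"
        proof (rule X(3))
          show "finite (pre Y)" using Y by (simp add: pre_fin)
          show "X \<subseteq> pre Y" using Y X(2) unfolding pre_def by blast
          show "pre Y \<subseteq> I" unfolding pre_def by blast
        qed
      qed (use X(1) in simp_all)
    qed
    from filterlim_compose [OF conv [OF x] this]
    have "((\<lambda>C. N (v x - (\<Sum>i\<in>pre C. monomial x (e i) *\<^sub>R c i))) \<longlongrightarrow> 0) (finite_subsets_at_top UNIV)" .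
    moreover have "\<forall>\<^sub>F C in finite_subsets_at_top UNIV. N (v x - (\<Sum>i\<in>pre C. monomial x (e i) *\<^sub>R c i))
        = N (v x - (\<Sum>\<gamma>\<in>C. monomial x \<gamma> *\<^sub>R (\<Sum>i\<in>{i \<in> I. e i = \<gamma>}. c i)))"
      unfolding eventually_finite_subsets_at_top
    proof (intro exI [of _ "{}"] conjI allI impI)
      fix C :: "('d \<Rightarrow> nat) set" assume "finite C \<and> {} \<subseteq> C \<and> C \<subseteq> UNIV"
      then have "(\<Sum>i\<in>pre C. monomial x (e i) *\<^sub>R c i)
          = (\<Sum>\<gamma>\<in>C. \<Sum>i\<in>{i \<in> I. e i = \<gamma>}. monomial x (e i) *\<^sub>R c i)"
        by (intro group [symmetric]) simp
      also have "\<dots> = (\<Sum>\<gamma>\<in>C. monomial x \<gamma> *\<^sub>R (\<Sum>i\<in>{i \<in> I. e i = \<gamma>}. c i))"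
        by (intro sum.cong refl) (simp add: scaleR_sum_right)
      finally show "N (v x - (\<Sum>i\<in>pre C. monomial x (e i) *\<^sub>R c i))
        = N (v x - (\<Sum>\<gamma>\<in>C. monomial x \<gamma> *\<^sub>R (\<Sum>i\<in>{i \<in> I. e i = \<gamma>}. c i)))" by simp
    qed simp_all
    ultimately show "((\<lambda>C. N (v x - (\<Sum>\<gamma>\<in>C. monomial x \<gamma> *\<^sub>R (\<Sum>i\<in>{i \<in> I. e i = \<gamma>}. c i)))) \<longlongrightarrow> 0)
        (finite_subsets_at_top UNIV)"
      by (rule Lim_transform_eventually)
  qed
qed

text \<open>Families that differ by null elements share their expansions. Needed because
  representatives of Bloch functions are only determined almost everywhere.\<close>

lemma real_analytic_cong:
  assumes an: "real_analytic S N u" and w: "\<And>k. w k \<in> S" "\<And>k. u k \<in> S" "\<And>k. N (w k - u k) = 0"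
  shows "real_analytic S N w"
  unfolding real_analytic_iff
proof
  fix k0
  obtain \<rho> a where ra: "0 < \<rho>" "power_series_on S N \<rho> (\<lambda>x. u (k0 + x)) a"
    using an unfolding real_analytic_iff by blast
  have "N (w k - s) = N (u k - s)" if "s \<in> S" for k s
  proof (rule antisym)
    have "N ((w k - u k) + (u k - s)) \<le> N (w k - u k) + N (u k - s)"
      by (intro N_triangle diff_mem w that)
    then show "N (w k - s) \<le> N (u k - s)" by (simp add: w)
    have "N ((u k - s)) = N ((w k - s) - (w k - u k))" by simp
    also have "\<dots> \<le> N (w k - s) + N (w k - u k)" by (intro N_diff diff_mem w that)
    finally show "N (u k - s) \<le> N (w k - s)" by (simp add: w)
  qed
  moreover have "(\<Sum>\<alpha>\<in>A. monomial x \<alpha> *\<^sub>R a \<alpha>) \<in> S" for x A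
    using ra(2) by (intro sum_mem scaleR_mem) (auto simp: power_series_on_def)
  ultimately have "power_series_on S N \<rho> (\<lambda>x. w (k0 + x)) a"
    using ra(2) by (simp add: power_series_on_def)
  with ra(1) show "\<exists>\<rho>>0. \<exists>a. power_series_on S N \<rho> (\<lambda>x. w (k0 + x)) a" by blast
qed

end

text \<open>Bilinearity is asked up to null elements, since operators on representatives are
  additive and homogeneous only almost everywhere.\<close>

locale seminormed_bilinear = X: seminormed SX NX + Y: seminormed SY NY + Z: seminormed SZ NZ
  for SX :: "'x::real_vector set" and NX and SY :: "'y::real_vector set" and NY
    and SZ :: "'z::real_vector set" and NZ +
  fixes B :: "'x \<Rightarrow> 'y \<Rightarrow> 'z"
  assumes B_mem: "\<And>x y. x \<in> SX \<Longrightarrow> y \<in> SY \<Longrightarrow> B x y \<in> SZ"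
    and B_bound: "\<And>x y. x \<in> SX \<Longrightarrow> y \<in> SY \<Longrightarrow> NZ (B x y) \<le> NX x * NY y"
    and B_add_left: "\<And>x x' y. x \<in> SX \<Longrightarrow> x' \<in> SX \<Longrightarrow> y \<in> SY \<Longrightarrow> NZ (B (x + x') y - (B x y + B x' y)) = 0"
    and B_add_right: "\<And>x y y'. x \<in> SX \<Longrightarrow> y \<in> SY \<Longrightarrow> y' \<in> SY \<Longrightarrow> NZ (B x (y + y') - (B x y + B x y')) = 0"
    and B_scaleR_left: "\<And>t x y. x \<in> SX \<Longrightarrow> y \<in> SY \<Longrightarrow> NZ (B (t *\<^sub>R x) y - t *\<^sub>R B x y) = 0"
    and B_scaleR_right: "\<And>t x y. x \<in> SX \<Longrightarrow> y \<in> SY \<Longrightarrow> NZ (B x (t *\<^sub>R y) - t *\<^sub>R B x y) = 0"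
begin

lemma null_trans:
  assumes "x \<in> SZ" "y \<in> SZ" "z \<in> SZ" "NZ (x - y) = 0" "NZ (y - z) = 0"
  shows "NZ (x - z) = 0"
proof -
  have "NZ ((x - y) + (y - z)) \<le> NZ (x - y) + NZ (y - z)"
    by (intro Z.N_triangle Z.diff_mem assms)
  moreover have "0 \<le> NZ (x - z)" by (intro Z.N_nonneg Z.diff_mem assms)
  ultimately show ?thesis using assms by simp
qed

lemma null_add:
  assumes "x \<in> SZ" "y \<in> SZ" "x' \<in> SZ" "y' \<in> SZ" "NZ (x - y) = 0" "NZ (x' - y') = 0"
  shows "NZ ((x + x') - (y + y')) = 0"
proof -
  have "NZ ((x - y) + (x' - y')) \<le> NZ (x - y) + NZ (x' - y')"
    by (intro Z.N_triangle Z.diff_mem assms)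
  moreover have "0 \<le> NZ ((x - y) + (x' - y'))" by (intro Z.N_nonneg Z.add_mem Z.diff_mem assms)
  ultimately have "NZ ((x - y) + (x' - y')) = 0" using assms by simp
  then show ?thesis by (simp only: add_diff_add)
qed

lemma null_sum:
  assumes "finite A" "\<And>i. i \<in> A \<Longrightarrow> f i \<in> SZ" "\<And>i. i \<in> A \<Longrightarrow> g i \<in> SZ" "\<And>i. i \<in> A \<Longrightarrow> NZ (f i - g i) = 0"
  shows "NZ (sum f A - sum g A) = 0"
  using assms
proof (induction A rule: finite_induct)
  case (insert x F)
  have "NZ ((f x + sum f F) - (g x + sum g F)) = 0"
    by (rule null_add) (use insert in \<open>auto intro!: Z.sum_mem\<close>)
  then show ?case using insert by simp
qed (simp add: Z.N_zero)

lemma B_zero_right: "x \<in> SX \<Longrightarrow> NZ (B x 0) = 0"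
  using B_bound [of x 0] Z.N_nonneg [of "B x 0"] B_mem [of x 0] Y.zero_mem Y.N_zero by simp

lemma B_zero_left: "y \<in> SY \<Longrightarrow> NZ (B 0 y) = 0"
  using B_bound [of 0 y] Z.N_nonneg [of "B 0 y"] B_mem [of 0 y] X.zero_mem X.N_zero by simp

lemma B_lincomb_right:
  assumes "finite J" "x \<in> SX" "\<And>j. j \<in> J \<Longrightarrow> y j \<in> SY"
  shows "NZ (B x (\<Sum>j\<in>J. t j *\<^sub>R y j) - (\<Sum>j\<in>J. t j *\<^sub>R B x (y j))) = 0"
  using assms(1,3)
proof (induction J rule: finite_induct)
  case (insert j F)
  let ?s = "\<Sum>j\<in>F. t j *\<^sub>R y j"
  have m: "t j *\<^sub>R y j \<in> SY" "?s \<in> SY" using insert by (auto intro!: Y.scaleR_mem Y.sum_mem)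
  have m2: "B x (t j *\<^sub>R y j) \<in> SZ" "B x ?s \<in> SZ" "t j *\<^sub>R B x (y j) \<in> SZ" "(\<Sum>j\<in>F. t j *\<^sub>R B x (y j)) \<in> SZ"
    using insert assms(2) m by (auto intro!: B_mem Z.scaleR_mem Z.sum_mem)
  have "NZ (B x (t j *\<^sub>R y j + ?s) - (t j *\<^sub>R B x (y j) + (\<Sum>j\<in>F. t j *\<^sub>R B x (y j)))) = 0"
    by (rule null_trans [OF _ _ _ B_add_right [OF assms(2) m]])
      (use insert m m2 assms(2) in \<open>auto intro!: null_add B_scaleR_right B_mem Z.add_mem Y.add_mem\<close>)
  then show ?case using insert by simp
qed (simp add: B_zero_right assms)

lemma B_lincomb_left:
  assumes "finite J" "y \<in> SY" "\<And>j. j \<in> J \<Longrightarrow> x j \<in> SX"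
  shows "NZ (B (\<Sum>j\<in>J. t j *\<^sub>R x j) y - (\<Sum>j\<in>J. t j *\<^sub>R B (x j) y)) = 0"
  using assms(1,3)
proof (induction J rule: finite_induct)
  case (insert j F)
  let ?s = "\<Sum>j\<in>F. t j *\<^sub>R x j"
  have m: "t j *\<^sub>R x j \<in> SX" "?s \<in> SX" using insert by (auto intro!: X.scaleR_mem X.sum_mem)
  have m2: "B (t j *\<^sub>R x j) y \<in> SZ" "B ?s y \<in> SZ" "t j *\<^sub>R B (x j) y \<in> SZ" "(\<Sum>j\<in>F. t j *\<^sub>R B (x j) y) \<in> SZ"
    using insert assms(2) m by (auto intro!: B_mem Z.scaleR_mem Z.sum_mem)
  have "NZ (B (t j *\<^sub>R x j + ?s) y - (t j *\<^sub>R B (x j) y + (\<Sum>j\<in>F. t j *\<^sub>R B (x j) y))) = 0"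
    by (rule null_trans [OF _ _ _ B_add_left [OF m assms(2)]])
      (use insert m m2 assms(2) in \<open>auto intro!: null_add B_scaleR_left B_mem Z.add_mem X.add_mem\<close>)
  then show ?case using insert by simp
qed (simp add: B_zero_left assms)

lemma B_double_lincomb:
  assumes "finite I" "finite J" "\<And>i. i \<in> I \<Longrightarrow> x i \<in> SX" "\<And>j. j \<in> J \<Longrightarrow> y j \<in> SY"
  shows "NZ (B (\<Sum>i\<in>I. s i *\<^sub>R x i) (\<Sum>j\<in>J. t j *\<^sub>R y j)
    - (\<Sum>(i, j)\<in>I \<times> J. (s i * t j) *\<^sub>R B (x i) (y j))) = 0"
proof -
  let ?Y = "\<Sum>j\<in>J. t j *\<^sub>R y j"
  have Y: "?Y \<in> SY" using assms by (intro Y.sum_mem Y.scaleR_mem)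
  have X: "(\<Sum>i\<in>I. s i *\<^sub>R x i) \<in> SX" using assms by (intro X.sum_mem X.scaleR_mem)
  have mem: "(\<Sum>i\<in>I. s i *\<^sub>R B (x i) ?Y) \<in> SZ" "(\<Sum>i\<in>I. s i *\<^sub>R (\<Sum>j\<in>J. t j *\<^sub>R B (x i) (y j))) \<in> SZ"
    using assms Y by (auto intro!: Z.sum_mem Z.scaleR_mem B_mem)
  have "NZ ((\<Sum>i\<in>I. s i *\<^sub>R B (x i) ?Y) - (\<Sum>i\<in>I. s i *\<^sub>R (\<Sum>j\<in>J. t j *\<^sub>R B (x i) (y j)))) = 0"
  proof (rule null_sum)
    fix i assume i: "i \<in> I"
    show "NZ (s i *\<^sub>R B (x i) ?Y - s i *\<^sub>R (\<Sum>j\<in>J. t j *\<^sub>R B (x i) (y j))) = 0"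
      unfolding scaleR_diff_right [symmetric]
      using Z.N_scaleR [of "B (x i) ?Y - (\<Sum>j\<in>J. t j *\<^sub>R B (x i) (y j))" "s i"] i assms Y
        B_lincomb_right [of J "x i" y t]
      by (simp add: Z.diff_mem Z.sum_mem Z.scaleR_mem B_mem)
  qed (use assms Y in \<open>auto intro!: Z.sum_mem Z.scaleR_mem B_mem\<close>)
  moreover have "NZ (B (\<Sum>i\<in>I. s i *\<^sub>R x i) ?Y - (\<Sum>i\<in>I. s i *\<^sub>R B (x i) ?Y)) = 0"
    by (rule B_lincomb_left [OF assms(1) Y]) (rule assms(3))
  ultimately have "NZ (B (\<Sum>i\<in>I. s i *\<^sub>R x i) ?Y - (\<Sum>i\<in>I. s i *\<^sub>R (\<Sum>j\<in>J. t j *\<^sub>R B (x i) (y j)))) = 0"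
    using null_trans [OF B_mem [OF X Y] mem] by blast
  moreover have "(\<Sum>i\<in>I. s i *\<^sub>R (\<Sum>j\<in>J. t j *\<^sub>R B (x i) (y j))) = (\<Sum>(i, j)\<in>I \<times> J. (s i * t j) *\<^sub>R B (x i) (y j))"
    by (simp add: scaleR_sum_right sum.cartesian_product)
  ultimately show ?thesis by simp
qed

text \<open>Up to null elements the difference is
  \<open>B x (y - y') + B (x - x') y'\<close>.\<close>

lemma B_diff_bound:
  assumes "x \<in> SX" "x' \<in> SX" "y \<in> SY" "y' \<in> SY"
  shows "NZ (B x y - B x' y') \<le> NX x * NY (y - y') + NX (x - x') * NY y'"
proof -
  have d: "y - y' \<in> SY" "x - x' \<in> SX" using assms by (auto intro: X.diff_mem Y.diff_mem)
  have "NZ (B x (y' + (y - y')) - (B x y' + B x (y - y'))) = 0"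
    by (rule B_add_right) (use assms d in auto)
  then have 1: "NZ (B x y - (B x y' + B x (y - y'))) = 0" by simp
  have "NZ (B (x' + (x - x')) y' - (B x' y' + B (x - x') y')) = 0"
    by (rule B_add_left) (use assms d in auto)
  then have 2: "NZ (B x y' - (B x' y' + B (x - x') y')) = 0" by simp
  have "B x y - B x' y' = ((B x y - (B x y' + B x (y - y'))) + (B x y' - (B x' y' + B (x - x') y')))
      + (B x (y - y') + B (x - x') y')" by simp
  also have "NZ \<dots> \<le> NZ ((B x y - (B x y' + B x (y - y'))) + (B x y' - (B x' y' + B (x - x') y')))
      + NZ (B x (y - y') + B (x - x') y')"
    using assms d by (intro Z.N_triangle Z.add_mem Z.diff_mem B_mem)
  also have "NZ ((B x y - (B x y' + B x (y - y'))) + (B x y' - (B x' y' + B (x - x') y')))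
      \<le> NZ (B x y - (B x y' + B x (y - y'))) + NZ (B x y' - (B x' y' + B (x - x') y'))"
    using assms d by (intro Z.N_triangle Z.add_mem Z.diff_mem B_mem)
  also have "NZ (B x (y - y') + B (x - x') y') \<le> NZ (B x (y - y')) + NZ (B (x - x') y')"
    using assms d by (intro Z.N_triangle B_mem)
  finally show ?thesis
    using 1 2 B_bound [OF assms(1) d(1)] B_bound [OF d(2) assms(4)] by linarith
qed

text \<open>The Cauchy product: the coefficients \<open>B (a \<alpha>) (b \<beta>)\<close> have
  exponent \<alpha> + \<beta> and are regrouped. Convergence is checked only along rectangles of
  index pairs, where the partial sum is, up to a null element, \<open>B\<close> of two partial
  sums.\<close>

lemma real_analytic_bilinear:
  fixes u :: "real^'d::finite \<Rightarrow> 'x" and w :: "real^'d \<Rightarrow> 'y"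
  assumes u: "real_analytic SX NX u" "\<And>k. u k \<in> SX" and w: "real_analytic SY NY w" "\<And>k. w k \<in> SY"
  shows "real_analytic SZ NZ (\<lambda>k. B (u k) (w k))"
  unfolding real_analytic_iff
proof
  fix k0
  obtain \<rho>1 a where 1: "0 < \<rho>1" "power_series_on SX NX \<rho>1 (\<lambda>x. u (k0 + x)) a"
    using u(1) unfolding real_analytic_iff by blast
  obtain \<rho>2 b where 2: "0 < \<rho>2" "power_series_on SY NY \<rho>2 (\<lambda>x. w (k0 + x)) b"
    using w(1) unfolding real_analytic_iff by blast
  define \<rho> where "\<rho> = min \<rho>1 \<rho>2"
  have rho: "0 < \<rho>" using 1 2 by (simp add: \<rho>_def)
  have pa: "power_series_on SX NX \<rho> (\<lambda>x. u (k0 + x)) a"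
    by (rule X.power_series_on_smaller [OF 1(2) rho]) (simp add: \<rho>_def)
  have pb: "power_series_on SY NY \<rho> (\<lambda>x. w (k0 + x)) b"
    by (rule Y.power_series_on_smaller [OF 2(2) rho]) (simp add: \<rho>_def)
  have a: "a \<alpha> \<in> SX" and b: "b \<alpha> \<in> SY" for \<alpha> using pa pb by (auto simp: power_series_on_def)
  define e where "e = (\<lambda>(\<alpha> :: 'd \<Rightarrow> nat, \<beta>). (\<lambda>i. \<alpha> i + \<beta> i))"
  define c where "c = (\<lambda>(\<alpha>, \<beta>). B (a \<alpha>) (b \<beta>))"
  have cm: "c i \<in> SZ" for i by (cases i) (simp add: c_def B_mem a b)
  have fin: "finite {i \<in> UNIV. e i = \<gamma>}" for \<gamma>
  proof -
    have "{i \<in> UNIV. e i = \<gamma>} \<subseteq> (PiE UNIV (\<lambda>i. {..\<gamma> i})) \<times> (PiE UNIV (\<lambda>i. {..\<gamma> i}))"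
      by (auto simp: e_def)
    then show ?thesis by (rule finite_subset) (simp add: finite_PiE)
  qed
  define \<Sigma>a where "\<Sigma>a = infsum (\<lambda>\<alpha>. NX (a \<alpha>) * \<rho> ^ total_degree \<alpha>) UNIV"
  define \<Sigma>b where "\<Sigma>b = infsum (\<lambda>\<alpha>. NY (b \<alpha>) * \<rho> ^ total_degree \<alpha>) UNIV"
  have sm: "(\<lambda>i. NZ (c i) * \<rho> ^ total_degree (e i)) summable_on UNIV"
  proof (rule summable_on_nonneg_bounded)
    fix F :: "(('d \<Rightarrow> nat) \<times> ('d \<Rightarrow> nat)) set" assume F: "finite F"
    \<comment> \<open>A finite set of pairs is enlarged to the rectangle of its projections, where
      the majorant factors.\<close>
    have "(\<Sum>i\<in>F. NZ (c i) * \<rho> ^ total_degree (e i)) \<le> (\<Sum>i\<in>fst ` F \<times> snd ` F. NZ (c i) * \<rho> ^ total_degree (e i))"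
      by (rule sum_mono2) (use F rho cm Z.N_nonneg subset_fst_snd in simp_all)
    also have "\<dots> \<le> (\<Sum>(\<alpha>, \<beta>)\<in>fst ` F \<times> snd ` F. (NX (a \<alpha>) * \<rho> ^ total_degree \<alpha>) * (NY (b \<beta>) * \<rho> ^ total_degree \<beta>))"
    proof (intro sum_mono, clarify)
      fix \<alpha> \<beta>
      have "NZ (c (\<alpha>, \<beta>)) * \<rho> ^ total_degree (e (\<alpha>, \<beta>)) \<le> (NX (a \<alpha>) * NY (b \<beta>)) * \<rho> ^ total_degree (e (\<alpha>, \<beta>))"
        using rho by (intro mult_right_mono) (simp_all add: c_def B_bound a b)
      then show "NZ (c (\<alpha>, \<beta>)) * \<rho> ^ total_degree (e (\<alpha>, \<beta>))
          \<le> (NX (a \<alpha>) * \<rho> ^ total_degree \<alpha>) * (NY (b \<beta>) * \<rho> ^ total_degree \<beta>)"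
        by (simp add: e_def total_degree_add power_add mult_ac)
    qed
    also have "\<dots> = (\<Sum>\<alpha>\<in>fst ` F. NX (a \<alpha>) * \<rho> ^ total_degree \<alpha>) * (\<Sum>\<beta>\<in>snd ` F. NY (b \<beta>) * \<rho> ^ total_degree \<beta>)"
      by (simp add: sum_product sum.cartesian_product)
    also have "\<dots> \<le> \<Sigma>a * \<Sigma>b"
      unfolding \<Sigma>a_def \<Sigma>b_def
    proof (intro mult_mono finite_sum_le_infsum)
      show "0 \<le> infsum (\<lambda>\<alpha>. NX (a \<alpha>) * \<rho> ^ total_degree \<alpha>) UNIV"
        using rho by (intro infsum_nonneg) (simp add: X.N_nonneg a)
    qed (use F rho pa pb a b X.N_nonneg Y.N_nonneg in \<open>auto simp: power_series_on_def intro!: sum_nonneg\<close>)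
    finally show "(\<Sum>i\<in>F. NZ (c i) * \<rho> ^ total_degree (e i)) \<le> \<Sigma>a * \<Sigma>b" .
  qed (use rho cm Z.N_nonneg in auto)
  have "power_series_on SZ NZ \<rho> (\<lambda>x. B (u (k0 + x)) (w (k0 + x))) (\<lambda>\<gamma>. \<Sum>i\<in>{i \<in> UNIV. e i = \<gamma>}. c i)"
  proof (rule Z.power_series_on_regroup [OF rho cm fin sm])
    fix x :: "real^'d" assume x: "\<forall>i. \<bar>x $ i\<bar> < \<rho>"
    let ?u = "u (k0 + x)" and ?w = "w (k0 + x)"
    define ua where "ua A = (\<Sum>\<alpha>\<in>A. monomial x \<alpha> *\<^sub>R a \<alpha>)" for A
    define wb where "wb A = (\<Sum>\<alpha>\<in>A. monomial x \<alpha> *\<^sub>R b \<alpha>)" for A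
    have uam: "ua A \<in> SX" and wbm: "wb A \<in> SY" for A
      unfolding ua_def wb_def using a b by (auto intro: X.sum_mem X.scaleR_mem Y.sum_mem Y.scaleR_mem)
    have lim: "((\<lambda>A. NX (?u - ua A)) \<longlongrightarrow> 0) (finite_subsets_at_top UNIV)"
      "((\<lambda>A. NY (?w - wb A)) \<longlongrightarrow> 0) (finite_subsets_at_top UNIV)"
      using pa pb x by (simp_all add: power_series_on_def ua_def wb_def)
    have near: "\<exists>A. finite A \<and> F \<subseteq> A \<and> h A < \<delta>"
      if h: "(h \<longlongrightarrow> 0) (finite_subsets_at_top UNIV)" "0 < \<delta>" and fF: "finite F" for h :: "('d \<Rightarrow> nat) set \<Rightarrow> real" and \<delta> and F
    proof -
      obtain A where "finite A" "\<And>B. finite B \<Longrightarrow> A \<subseteq> B \<Longrightarrow> h B < \<delta>"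
        using order_tendstoD(2) [OF h] unfolding eventually_finite_subsets_at_top by auto
      then show ?thesis using fF by (intro exI [of _ "A \<union> F"]) auto
    qed
    have "((\<lambda>A. NZ (B ?u ?w - (\<Sum>i\<in>A. monomial x (e i) *\<^sub>R c i))) \<longlongrightarrow> 0) (finite_subsets_at_top UNIV)"
    proof (rule Z.tendsto_sum_cofinal)
      show "(\<lambda>i. NZ (monomial x (e i) *\<^sub>R c i)) summable_on UNIV"
      proof (rule summable_on_comparison_test [OF sm])
        fix i
        show "NZ (monomial x (e i) *\<^sub>R c i) \<le> NZ (c i) * \<rho> ^ total_degree (e i)"
          using mult_left_mono [OF abs_monomial_le [of x \<rho> "e i"] Z.N_nonneg [OF cm [of i]]] x
          by (simp add: Z.N_scaleR cm mult.commute less_imp_le)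
      qed (simp add: Z.N_nonneg Z.scaleR_mem cm)
    next
      fix \<epsilon> :: real and F :: "(('d \<Rightarrow> nat) \<times> ('d \<Rightarrow> nat)) set"
      assume e: "0 < \<epsilon>" and F: "finite F"
      have nu: "0 \<le> NX ?u" and nw: "0 \<le> NY ?w" by (simp_all add: X.N_nonneg Y.N_nonneg u w)
      \<comment> \<open>The bound 1 keeps the partial sum of \<open>w\<close> below
        \<open>NY ?w + 1\<close>, which is the factor that the choice of \<open>As\<close> has to
        compensate; each of the two errors is then at most \<epsilon>/2.\<close>
      obtain Bs where Bs: "finite Bs" "snd ` F \<subseteq> Bs" "NY (?w - wb Bs) < min 1 (\<epsilon> / (2 * (NX ?u + 1)))"
        using near [OF lim(2), of "min 1 (\<epsilon> / (2 * (NX ?u + 1)))" "snd ` F"] F e nu by auto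
      obtain As where As: "finite As" "fst ` F \<subseteq> As" "NX (?u - ua As) < \<epsilon> / (2 * (NY ?w + 1))"
        using near [OF lim(1), of "\<epsilon> / (2 * (NY ?w + 1))" "fst ` F"] F e nw by auto
      have "NY (wb Bs) = NY (?w - (?w - wb Bs))" by simp
      also have "\<dots> \<le> NY ?w + NY (?w - wb Bs)" by (intro Y.N_diff Y.diff_mem w wbm)
      finally have nwb: "NY (wb Bs) \<le> NY ?w + 1" using Bs(3) by linarith
      have nn: "0 \<le> NX (?u - ua As)" "0 \<le> NY (?w - wb Bs)"
        by (intro X.N_nonneg X.diff_mem Y.N_nonneg Y.diff_mem u w uam wbm)+
      have "NX ?u * NY (?w - wb Bs) \<le> (NX ?u + 1) * (\<epsilon> / (2 * (NX ?u + 1)))"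
        using nu Bs(3) nn by (intro mult_mono) auto
      also have "\<dots> = \<epsilon> / 2" using nu by (simp add: field_simps)
      finally have t1: "NX ?u * NY (?w - wb Bs) \<le> \<epsilon> / 2" .
      have "NX (?u - ua As) * NY (wb Bs) \<le> (\<epsilon> / (2 * (NY ?w + 1))) * (NY ?w + 1)"
        using nn As(3) nwb nw e by (intro mult_mono) (auto simp: Y.N_nonneg wbm)
      also have "\<dots> = \<epsilon> / 2" using nw by (simp add: field_simps)
      finally have t2: "NX (?u - ua As) * NY (wb Bs) \<le> \<epsilon> / 2" .
      have eq: "(\<Sum>i\<in>As \<times> Bs. monomial x (e i) *\<^sub>R c i)
          = (\<Sum>(\<alpha>, \<beta>)\<in>As \<times> Bs. (monomial x \<alpha> * monomial x \<beta>) *\<^sub>R B (a \<alpha>) (b \<beta>))"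
        by (intro sum.cong refl) (auto simp: e_def c_def monomial_add)
      have sm2: "(\<Sum>(\<alpha>, \<beta>)\<in>As \<times> Bs. (monomial x \<alpha> * monomial x \<beta>) *\<^sub>R B (a \<alpha>) (b \<beta>)) \<in> SZ"
        by (intro Z.sum_mem) (auto intro!: Z.scaleR_mem B_mem a b)
      have "B ?u ?w - (\<Sum>i\<in>As \<times> Bs. monomial x (e i) *\<^sub>R c i)
          = (B ?u ?w - B (ua As) (wb Bs)) + (B (ua As) (wb Bs)
            - (\<Sum>(\<alpha>, \<beta>)\<in>As \<times> Bs. (monomial x \<alpha> * monomial x \<beta>) *\<^sub>R B (a \<alpha>) (b \<beta>)))"
        by (simp add: eq)
      also have "NZ \<dots> \<le> NZ (B ?u ?w - B (ua As) (wb Bs)) + NZ (B (ua As) (wb Bs)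
            - (\<Sum>(\<alpha>, \<beta>)\<in>As \<times> Bs. (monomial x \<alpha> * monomial x \<beta>) *\<^sub>R B (a \<alpha>) (b \<beta>)))"
        by (intro Z.N_triangle Z.diff_mem B_mem u w uam wbm sm2)
      also have "NZ (B (ua As) (wb Bs)
            - (\<Sum>(\<alpha>, \<beta>)\<in>As \<times> Bs. (monomial x \<alpha> * monomial x \<beta>) *\<^sub>R B (a \<alpha>) (b \<beta>))) = 0"
        unfolding ua_def wb_def by (rule B_double_lincomb) (use As Bs a b in auto)
      also have "NZ (B ?u ?w - B (ua As) (wb Bs)) \<le> NX ?u * NY (?w - wb Bs) + NX (?u - ua As) * NY (wb Bs)"
        by (intro B_diff_bound u w uam wbm)
      finally have "NZ (B ?u ?w - (\<Sum>i\<in>As \<times> Bs. monomial x (e i) *\<^sub>R c i)) \<le> \<epsilon>" using t1 t2 by linarith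
      moreover have "F \<subseteq> As \<times> Bs" using subset_fst_snd [of F] Sigma_mono [OF As(2) Bs(2)] by (rule subset_trans)
      ultimately show "\<exists>A. finite A \<and> F \<subseteq> A \<and> A \<subseteq> UNIV \<and> NZ (B ?u ?w - (\<Sum>i\<in>A. monomial x (e i) *\<^sub>R c i)) \<le> \<epsilon>"
        using As(1) Bs(1) by (intro exI [of _ "As \<times> Bs"]) auto
    qed (simp_all add: Z.scaleR_mem cm B_mem u w)
    then show "((\<lambda>A. NZ (B ?u ?w - (\<Sum>i\<in>A. monomial x (e i) *\<^sub>R c i))) \<longlongrightarrow> 0) (finite_subsets_at_top UNIV)" .
  qed
  with rho show "\<exists>\<rho>>0. \<exists>a. power_series_on SZ NZ \<rho> (\<lambda>x. B (u (k0 + x)) (w (k0 + x))) a" by blast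
qed

end

subsection \<open>Inverse square roots of analytic functions\<close>

text \<open>The recursion multiplies by a factor of modulus \<open>(n + 1/2) / (n + 1)\<close>. The
  crude bound 1 suffices because the series is summed at arguments of modulus at most 1/2.\<close>

lemma abs_gbinomial_minus_half_le: "\<bar>(- 1 / 2 :: real) gchoose n\<bar> \<le> 1"
proof (induction n)
  case (Suc n)
  let ?a = "- 1 / 2 :: real"
  have "of_nat (Suc n) * (?a gchoose Suc n) = (?a - of_nat n) * (?a gchoose n)"
    using gbinomial_mult_1 [of ?a n] by (simp add: algebra_simps)
  then have "\<bar>of_nat (Suc n) * (?a gchoose Suc n)\<bar> = \<bar>?a - of_nat n\<bar> * \<bar>?a gchoose n\<bar>"
    by (simp add: abs_mult)
  also have "\<dots> \<le> of_nat (Suc n) * 1"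
    by (intro mult_mono Suc) auto
  finally show ?case by (simp add: abs_mult)
qed simp

text \<open>Summing over words instead of exponent vectors avoids multinomial coefficients.\<close>

lemma power_sum_lists:
  fixes b :: "'a \<Rightarrow> 'b::comm_semiring_1"
  assumes "finite J"
  shows "(\<Sum>j\<in>J. b j) ^ m = (\<Sum>xs\<in>{xs. set xs \<subseteq> J \<and> length xs = m}. prod_list (map b xs))"
proof (induction m)
  case 0
  have "{xs. set xs \<subseteq> J \<and> length xs = 0} = {[]}" by auto
  then show ?case by simp
next
  case (Suc m)
  have "(\<Sum>xs\<in>{xs. set xs \<subseteq> J \<and> length xs = Suc m}. prod_list (map b xs))
      = (\<Sum>(xs, j)\<in>{xs. set xs \<subseteq> J \<and> length xs = m} \<times> J. prod_list (map b xs) * b j)"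
    unfolding lists_length_Suc_eq by (subst sum.reindex) (auto simp: inj_on_def case_prod_beta mult.commute)
  also have "\<dots> = (\<Sum>xs\<in>{xs. set xs \<subseteq> J \<and> length xs = m}. prod_list (map b xs)) * (\<Sum>j\<in>J. b j)"
    by (simp add: sum_product sum.cartesian_product)
  finally show ?case using Suc by (simp add: mult.commute)
qed

lemma sum_lists_less:
  fixes b :: "'a \<Rightarrow> 'b::comm_semiring_1"
  assumes J: "finite J"
  shows "(\<Sum>xs\<in>{xs. set xs \<subseteq> J \<and> length xs < n}. f (length xs) * prod_list (map b xs))
    = (\<Sum>m<n. f m * (\<Sum>j\<in>J. b j) ^ m)"
proof -
  have "{xs. set xs \<subseteq> J \<and> length xs < n} = (\<Union>m<n. {xs. set xs \<subseteq> J \<and> length xs = m})" by auto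
  then have "(\<Sum>xs\<in>{xs. set xs \<subseteq> J \<and> length xs < n}. f (length xs) * prod_list (map b xs))
      = (\<Sum>m<n. \<Sum>xs\<in>{xs. set xs \<subseteq> J \<and> length xs = m}. f (length xs) * prod_list (map b xs))"
    by (simp only:) (rule sum.UNION_disjoint, auto intro: finite_lists_length_eq J)
  also have "\<dots> = (\<Sum>m<n. f m * (\<Sum>j\<in>J. b j) ^ m)"
    by (intro sum.cong refl) (simp add: power_sum_lists [OF J] sum_distrib_left)
  finally show ?thesis .
qed

interpretation real_seminormed: seminormed UNIV "abs :: real \<Rightarrow> real"
  by unfold_locales (simp_all add: abs_mult abs_triangle_ineq)

lemma abs_prod_list: "\<bar>prod_list (xs :: real list)\<bar> = prod_list (map abs xs)"
  by (induction xs) (simp_all add: abs_mult)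

lemma power_sum_list: "(x::'a::comm_monoid_mult) ^ sum_list (map g xs) = prod_list (map (\<lambda>a. x ^ g a) xs)"
  by (induction xs) (simp_all add: power_add)

lemma prod_list_map_mult:
  "prod_list (map f xs) * prod_list (map g xs) = prod_list (map (\<lambda>x. f x * g x :: 'a::comm_monoid_mult) xs)"
  by (induction xs) (simp_all add: mult_ac)

definition exponent_sum :: "('d \<Rightarrow> nat) list \<Rightarrow> 'd::finite \<Rightarrow> nat" where
  "exponent_sum xs = (\<lambda>i. sum_list (map (\<lambda>\<alpha>. \<alpha> i) xs))"

lemma monomial_exponent_sum: "monomial x (exponent_sum xs) = prod_list (map (monomial x) xs)"
  by (induction xs) (simp_all add: exponent_sum_def monomial_add)

lemma total_degree_exponent_sum: "total_degree (exponent_sum xs) = sum_list (map total_degree xs)"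
  by (induction xs) (simp_all add: exponent_sum_def total_degree_add, simp add: total_degree_def)

lemma finite_exponent_sum_fibre:
  "finite {xs \<in> {xs. (\<lambda>i. 0) \<notin> set xs}. exponent_sum xs = (\<gamma> :: 'd::finite \<Rightarrow> nat)}"
proof (rule finite_subset)
  show "{xs \<in> {xs. (\<lambda>i. 0) \<notin> set xs}. exponent_sum xs = \<gamma>}
      \<subseteq> {xs. set xs \<subseteq> PiE UNIV (\<lambda>i. {..\<gamma> i}) \<and> length xs \<le> total_degree \<gamma>}"
  proof (clarify, intro conjI)
    fix xs :: "('d \<Rightarrow> nat) list" assume xs: "(\<lambda>i. 0) \<notin> set xs"
    show "set xs \<subseteq> PiE UNIV (\<lambda>i. {..exponent_sum xs i})"
      by (auto simp: exponent_sum_def intro!: member_le_sum_list)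
    have "length xs \<le> sum_list (map total_degree xs)"
      using xs
    proof (induction xs)
      case (Cons \<alpha> xs)
      then have "total_degree \<alpha> \<noteq> 0" by (auto simp: total_degree_eq_0)
      with Cons show ?case by auto
    qed simp
    then show "length xs \<le> total_degree (exponent_sum xs)" by (simp add: total_degree_exponent_sum)
  qed
  show "finite {xs. set xs \<subseteq> PiE UNIV (\<lambda>i. {..\<gamma> i}) \<and> length xs \<le> total_degree \<gamma>}"
    by (rule finite_lists_length_le) (simp add: finite_PiE)
qed

text \<open>The binomial series for the exponent \<open>-1/2\<close>, expanded into a family of monomials indexed
  by lists of nonzero multi-indices.\<close>

lemma real_analytic_inverse_sqrt:
  fixes g :: "real^'d::finite \<Rightarrow> real"
  assumes an: "real_analytic UNIV abs g" and pos: "\<And>k. 0 < g k"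
  shows "real_analytic UNIV abs (\<lambda>k. 1 / sqrt (g k))"
  unfolding real_analytic_iff
proof
  fix k0
  obtain \<rho>0 a where \<rho>0: "0 < \<rho>0" and ps: "power_series_on UNIV abs \<rho>0 (\<lambda>x. g (k0 + x)) a"
    using an unfolding real_analytic_iff by blast
  have hs: "((\<lambda>\<alpha>. monomial x \<alpha> * a \<alpha>) has_sum g (k0 + x)) UNIV" if "\<forall>i. \<bar>x $ i\<bar> < \<rho>0" for x
  proof -
    have "((\<lambda>A. \<bar>g (k0 + x) - (\<Sum>\<alpha>\<in>A. monomial x \<alpha> * a \<alpha>)\<bar>) \<longlongrightarrow> 0) (finite_subsets_at_top UNIV)"
      using ps that by (simp add: power_series_on_def)
    then have "((\<lambda>A. g (k0 + x) - (\<Sum>\<alpha>\<in>A. monomial x \<alpha> * a \<alpha>)) \<longlongrightarrow> 0) (finite_subsets_at_top UNIV)"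
      by (rule tendsto_rabs_zero_cancel)
    from tendsto_diff [OF tendsto_const [of "g (k0 + x)"] this] show ?thesis
      unfolding has_sum_def by simp
  qed
  define z where "z = (\<lambda>i :: 'd. 0 :: nat)"
  define a0 where "a0 = a z"
  have "((\<lambda>\<alpha>. monomial 0 \<alpha> * a \<alpha>) has_sum g k0) UNIV"
    using hs [of 0] \<rho>0 by simp
  \<comment> \<open>At the centre only the constant term survives, so \<open>a0\<close> is the value
    of \<open>g\<close> there and is positive.\<close>
  moreover have "((\<lambda>\<alpha>. monomial 0 \<alpha> * a \<alpha>) has_sum a0) UNIV"
  proof -
    have "((\<lambda>\<alpha>. monomial 0 \<alpha> * a \<alpha>) has_sum (\<Sum>\<alpha>\<in>{z}. monomial 0 \<alpha> * a \<alpha>)) {z}"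
      by (rule has_sum_finite) simp
    then have "((\<lambda>\<alpha>. monomial 0 \<alpha> * a \<alpha>) has_sum a0) {z}" by (simp add: z_def a0_def)
    then show ?thesis
      by (rule has_sum_cong_neutral [THEN iffD1, rotated -1]) (auto simp: monomial_0 z_def)
  qed
  ultimately have "a0 = g k0" by (rule has_sum_unique [symmetric])
  then have a0: "a0 = g k0" "0 < a0" using pos [of k0] by simp_all
  \<comment> \<open>Coefficients of \<open>g / a0 - 1\<close>, the series without constant term that
    is substituted into the binomial series.\<close>
  define b where "b \<alpha> = (if \<alpha> = z then 0 else a \<alpha> / a0)" for \<alpha>
  have sb: "(\<lambda>\<alpha>. \<bar>b \<alpha>\<bar> * \<rho>0 ^ total_degree \<alpha>) summable_on UNIV"
  proof (rule summable_on_comparison_test)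
    have "(\<lambda>\<alpha>. \<bar>a \<alpha>\<bar> * \<rho>0 ^ total_degree \<alpha>) summable_on UNIV"
      using ps by (simp add: power_series_on_def)
    then show "(\<lambda>\<alpha>. (1 / a0) * (\<bar>a \<alpha>\<bar> * \<rho>0 ^ total_degree \<alpha>)) summable_on UNIV"
      by (rule summable_on_cmult_right)
  qed (use \<rho>0 a0 in \<open>auto simp: b_def abs_divide\<close>)
  define T where "T = infsum (\<lambda>\<alpha>. \<bar>b \<alpha>\<bar> * \<rho>0 ^ total_degree \<alpha>) UNIV"
  have T: "0 \<le> T" unfolding T_def by (intro infsum_nonneg) (use \<rho>0 in simp)
  \<comment> \<open>Every remaining term has degree at least 1, so shrinking the radius by
    \<open>t\<close> shrinks the sum of absolute values at least by \<open>t\<close>. This choice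
    brings it down to at most 1/2, inside the disc of convergence of the binomial series.\<close>
  define t where "t = 1 / (2 * (T + 1))"
  have t: "0 < t" "t \<le> 1" "t * T \<le> 1 / 2" using T by (auto simp: t_def field_simps)
  define \<rho> where "\<rho> = t * \<rho>0"
  have \<rho>: "0 < \<rho>" "\<rho> \<le> \<rho>0" using t \<rho>0 by (auto simp: \<rho>_def mult_le_cancel_right1)
  have term_le: "\<bar>b \<alpha>\<bar> * \<rho> ^ total_degree \<alpha> \<le> t * (\<bar>b \<alpha>\<bar> * \<rho>0 ^ total_degree \<alpha>)" for \<alpha>
  proof (cases "\<alpha> = z")
    case False
    then have "total_degree \<alpha> \<noteq> 0" by (simp add: total_degree_eq_0 z_def)
    then obtain n where n: "total_degree \<alpha> = Suc n" by (rule not0_implies_Suc [THEN exE])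
    have "t ^ Suc n \<le> t" using power_le_one [of t n] t by (simp add: mult_left_le)
    then have "t ^ Suc n * (\<bar>b \<alpha>\<bar> * \<rho>0 ^ Suc n) \<le> t * (\<bar>b \<alpha>\<bar> * \<rho>0 ^ Suc n)"
      by (rule mult_right_mono) (use \<rho>0 in simp)
    then show ?thesis unfolding n \<rho>_def power_mult_distrib by (simp only: mult_ac)
  qed (simp add: b_def)
  have half: "(\<Sum>\<alpha>\<in>F. \<bar>b \<alpha>\<bar> * \<rho> ^ total_degree \<alpha>) \<le> 1 / 2" if "finite F" for F
  proof -
    have "(\<Sum>\<alpha>\<in>F. \<bar>b \<alpha>\<bar> * \<rho> ^ total_degree \<alpha>) \<le> t * (\<Sum>\<alpha>\<in>F. \<bar>b \<alpha>\<bar> * \<rho>0 ^ total_degree \<alpha>)"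
      unfolding sum_distrib_left by (intro sum_mono term_le)
    also have "\<dots> \<le> t * T"
      unfolding T_def by (intro mult_left_mono finite_sum_le_infsum sb) (use t \<rho>0 that in auto)
    finally show ?thesis using t by linarith
  qed
  define K where "K = 1 / sqrt a0"
  have K: "0 < K" using a0 by (simp add: K_def)
  let ?G = "\<lambda>n. (- 1 / 2 :: real) gchoose n"
  define I where "I = {xs :: ('d \<Rightarrow> nat) list. z \<notin> set xs}"
  \<comment> \<open>The part of \<open>K * (1 + h) powr (- 1 / 2)\<close> obtained by picking one
    term of \<open>h\<close> for each factor of a power of \<open>h\<close>.\<close>
  define c where "c xs = K * ?G (length xs) * prod_list (map b xs)" for xs
  have "power_series_on UNIV abs \<rho> (\<lambda>x. 1 / sqrt (g (k0 + x))) (\<lambda>\<gamma>. \<Sum>xs\<in>{xs \<in> I. exponent_sum xs = \<gamma>}. c xs)"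
  proof (rule real_seminormed.power_series_on_regroup [OF \<rho>(1)])
    show "finite {xs \<in> I. exponent_sum xs = \<gamma>}" for \<gamma>
      unfolding I_def z_def by (rule finite_exponent_sum_fibre)
    show "(\<lambda>xs. \<bar>c xs\<bar> * \<rho> ^ total_degree (exponent_sum xs)) summable_on I"
    proof (rule summable_on_nonneg_bounded)
      fix F assume F: "finite F" "F \<subseteq> I"
      \<comment> \<open>Enlarging \<open>F\<close> to all words of length below \<open>n\<close>
        over the alphabet \<open>J\<close> turns the sum into a polynomial in one sum of absolute
        values, which is at most 1/2; a geometric series then bounds it by
        \<open>K * 2\<close>.\<close>
      define J where "J = (\<Union>xs\<in>F. set xs)"
      have J: "finite J" using F by (simp add: J_def)
      obtain n where n: "\<forall>m\<in>length ` F. m < n" using F finite_nat_set_iff_bounded by blast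
      let ?A = "{xs. set xs \<subseteq> J \<and> length xs < n}"
      have A: "finite ?A"
        by (rule finite_subset [OF _ finite_lists_length_le [OF J, of n]]) auto
      have eq: "\<bar>c xs\<bar> * \<rho> ^ total_degree (exponent_sum xs)
          = (K * \<bar>?G (length xs)\<bar>) * prod_list (map (\<lambda>\<alpha>. \<bar>b \<alpha>\<bar> * \<rho> ^ total_degree \<alpha>) xs)" for xs
        using K by (simp add: c_def abs_mult abs_prod_list total_degree_exponent_sum power_sum_list o_def
            prod_list_map_mult [symmetric])
      have "(\<Sum>xs\<in>F. \<bar>c xs\<bar> * \<rho> ^ total_degree (exponent_sum xs)) \<le> (\<Sum>xs\<in>?A. \<bar>c xs\<bar> * \<rho> ^ total_degree (exponent_sum xs))"
        by (rule sum_mono2 [OF A]) (use n \<rho> in \<open>auto simp: J_def\<close>)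
      also have "\<dots> = (\<Sum>m<n. K * \<bar>?G m\<bar> * (\<Sum>\<alpha>\<in>J. \<bar>b \<alpha>\<bar> * \<rho> ^ total_degree \<alpha>) ^ m)"
        unfolding eq by (rule sum_lists_less [OF J])
      also have "\<dots> \<le> (\<Sum>m<n. K * 1 * (1 / 2) ^ m)"
        using K \<rho> half [OF J] abs_gbinomial_minus_half_le
        by (intro sum_mono mult_mono power_mono sum_nonneg) (auto intro!: zero_le_power sum_nonneg)
      also have "\<dots> = K * (\<Sum>m<n. (1 / 2) ^ m)" by (simp add: sum_distrib_left)
      also have "\<dots> \<le> K * 2"
      proof (rule mult_left_mono)
        have "(\<Sum>m<n. (1 / 2 :: real) ^ m) = 2 - 2 * (1 / 2) ^ n"
          by (induction n) (simp_all add: field_simps)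
        then show "(\<Sum>m<n. (1 / 2 :: real) ^ m) \<le> 2" by simp
      qed (use K in simp)
      finally show "(\<Sum>xs\<in>F. \<bar>c xs\<bar> * \<rho> ^ total_degree (exponent_sum xs)) \<le> K * 2" .
    qed (use \<rho> in simp)
    then have sc: "(\<lambda>xs. \<bar>c xs\<bar> * \<rho> ^ total_degree (exponent_sum xs)) summable_on I" .
    fix x :: "real^'d" assume x: "\<forall>i. \<bar>x $ i\<bar> < \<rho>"
    define h where "h = g (k0 + x) / a0 - 1"
    have hb: "((\<lambda>\<alpha>. monomial x \<alpha> * b \<alpha>) has_sum h) UNIV"
    proof -
      have "((\<lambda>\<alpha>. (1 / a0) * (monomial x \<alpha> * a \<alpha>)) has_sum ((1 / a0) * g (k0 + x))) UNIV"
        by (rule has_sum_cmult_right [OF hs]) (use x \<rho> in \<open>auto intro: less_le_trans\<close>)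
      moreover have "((\<lambda>\<alpha>. if \<alpha> = z then 1 else 0 :: real) has_sum 1) UNIV"
      proof -
        have "((\<lambda>\<alpha>. if \<alpha> = z then 1 else 0 :: real) has_sum 1) {z}"
          using has_sum_finite [of "{z}" "\<lambda>\<alpha>. if \<alpha> = z then 1 else 0 :: real"] by simp
        then show ?thesis
          by (rule has_sum_cong_neutral [THEN iffD1, rotated -1]) auto
      qed
      ultimately have "((\<lambda>\<alpha>. (1 / a0) * (monomial x \<alpha> * a \<alpha>) + - (if \<alpha> = z then 1 else 0))
          has_sum ((1 / a0) * g (k0 + x) + - 1)) UNIV"
        by (intro has_sum_add has_sum_uminusI)
      moreover have "(1 / a0) * (monomial x \<alpha> * a \<alpha>) + - (if \<alpha> = z then 1 else 0) = monomial x \<alpha> * b \<alpha>" for \<alpha>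
        using a0 by (simp add: b_def a0_def z_def)
      ultimately show ?thesis by (simp add: h_def)
    qed
    have lim: "((\<lambda>J. \<Sum>\<alpha>\<in>J. monomial x \<alpha> * b \<alpha>) \<longlongrightarrow> h) (finite_subsets_at_top UNIV)"
      using hb by (simp add: has_sum_def)
    have part: "\<bar>\<Sum>\<alpha>\<in>J. monomial x \<alpha> * b \<alpha>\<bar> \<le> 1 / 2" if "finite J" for J
    proof -
      have "\<bar>\<Sum>\<alpha>\<in>J. monomial x \<alpha> * b \<alpha>\<bar> \<le> (\<Sum>\<alpha>\<in>J. \<bar>monomial x \<alpha> * b \<alpha>\<bar>)" by (rule sum_abs)
      also have "\<dots> \<le> (\<Sum>\<alpha>\<in>J. \<bar>b \<alpha>\<bar> * \<rho> ^ total_degree \<alpha>)"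
      proof (rule sum_mono)
        fix \<alpha>
        have "\<bar>monomial x \<alpha>\<bar> \<le> \<rho> ^ total_degree \<alpha>" by (rule abs_monomial_le) (use x in \<open>simp add: less_imp_le\<close>)
        then show "\<bar>monomial x \<alpha> * b \<alpha>\<bar> \<le> \<bar>b \<alpha>\<bar> * \<rho> ^ total_degree \<alpha>"
          by (simp add: abs_mult mult.commute mult_left_mono)
      qed
      also have "\<dots> \<le> 1 / 2" by (rule half [OF that])
      finally show ?thesis .
    qed
    have h: "\<bar>h\<bar> \<le> 1 / 2"
    proof (rule tendsto_upperbound [OF tendsto_rabs [OF lim]])
      show "\<forall>\<^sub>F J in finite_subsets_at_top UNIV. \<bar>\<Sum>\<alpha>\<in>J. monomial x \<alpha> * b \<alpha>\<bar> \<le> 1 / 2"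
        unfolding eventually_finite_subsets_at_top
        by (intro exI [of _ "{}"] conjI allI impI) (rule part | simp)+
    qed simp
    have w: "1 / sqrt (g (k0 + x)) = K * (1 + h) powr (- 1 / 2)"
    proof -
      have "g (k0 + x) = a0 * (1 + h)" using a0(2) by (simp add: h_def)
      moreover have "0 < 1 + h" using h by linarith
      ultimately show ?thesis
        using a0(2) by (simp add: K_def real_sqrt_mult powr_minus_divide powr_half_sqrt)
    qed
    have ser: "(\<lambda>n. \<Sum>m<n. ?G m * h ^ m) \<longlonglongrightarrow> (1 + h) powr (- 1 / 2)"
      using gen_binomial_real [of h "- 1 / 2"] h by (simp add: sums_def)
    show "((\<lambda>A. \<bar>1 / sqrt (g (k0 + x)) - (\<Sum>xs\<in>A. monomial x (exponent_sum xs) *\<^sub>R c xs)\<bar>) \<longlongrightarrow> 0)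
        (finite_subsets_at_top I)"
    proof (rule real_seminormed.tendsto_sum_cofinal)
      show "(\<lambda>xs. \<bar>monomial x (exponent_sum xs) *\<^sub>R c xs\<bar>) summable_on I"
      proof (rule summable_on_comparison_test [OF sc])
        fix xs
        have "\<bar>monomial x (exponent_sum xs)\<bar> \<le> \<rho> ^ total_degree (exponent_sum xs)"
          by (rule abs_monomial_le) (use x in \<open>simp add: less_imp_le\<close>)
        then show "\<bar>monomial x (exponent_sum xs) *\<^sub>R c xs\<bar> \<le> \<bar>c xs\<bar> * \<rho> ^ total_degree (exponent_sum xs)"
          by (simp add: abs_mult mult.commute mult_left_mono)
      qed simp
    next
      fix \<epsilon> :: real and F assume e: "0 < \<epsilon>" and F: "finite F" "F \<subseteq> I"
      have e': "0 < \<epsilon> / (2 * K)" using e K by simp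
      obtain n1 where n1: "\<forall>m\<in>length ` F. m < n1" using F finite_nat_set_iff_bounded by blast
      \<comment> \<open>One half of the error pays for truncating the binomial series at degree
        \<open>n\<close>, the other for replacing \<open>h\<close> by a finite partial sum in the
        truncated polynomial.\<close>
      obtain n2 where n2: "\<And>n. n2 \<le> n \<Longrightarrow> \<bar>(\<Sum>m<n. ?G m * h ^ m) - (1 + h) powr (- 1 / 2)\<bar> < \<epsilon> / (2 * K)"
        using LIMSEQ_D [OF ser e'] by auto
      define n where "n = max n1 n2"
      define p where "p y = (\<Sum>m<n. ?G m * y ^ m)" for y
      have "((\<lambda>J. p (\<Sum>\<alpha>\<in>J. monomial x \<alpha> * b \<alpha>)) \<longlongrightarrow> p h) (finite_subsets_at_top UNIV)"
        unfolding p_def by (intro tendsto_intros lim)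
      from tendstoD [OF this e'] obtain J1 where J1: "finite J1"
        "\<And>J. finite J \<Longrightarrow> J1 \<subseteq> J \<Longrightarrow> dist (p (\<Sum>\<alpha>\<in>J. monomial x \<alpha> * b \<alpha>)) (p h) < \<epsilon> / (2 * K)"
        unfolding eventually_finite_subsets_at_top by auto
      define J where "J = J1 \<union> (\<Union>xs\<in>F. set xs)"
      have J: "finite J" using F J1 by (simp add: J_def)
      \<comment> \<open>The zero index has coefficient 0; leaving it out keeps all words inside
        \<open>I\<close>.\<close>
      have "(\<Sum>\<alpha>\<in>J. monomial x \<alpha> * b \<alpha>) = (\<Sum>\<alpha>\<in>J - {z}. monomial x \<alpha> * b \<alpha>)"
        by (rule sum.mono_neutral_right) (use J in \<open>auto simp: b_def\<close>)
      then have near: "\<bar>p (\<Sum>\<alpha>\<in>J - {z}. monomial x \<alpha> * b \<alpha>) - p h\<bar> < \<epsilon> / (2 * K)"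
        using J1(2) [OF J] by (simp add: J_def dist_real_def)
      let ?A = "{xs. set xs \<subseteq> J - {z} \<and> length xs < n}"
      have "(\<Sum>xs\<in>?A. monomial x (exponent_sum xs) *\<^sub>R c xs)
          = (\<Sum>xs\<in>?A. (K * ?G (length xs)) * prod_list (map (\<lambda>\<alpha>. monomial x \<alpha> * b \<alpha>) xs))"
        by (intro sum.cong refl)
          (simp add: c_def monomial_exponent_sum prod_list_map_mult [symmetric] mult_ac)
      also have "\<dots> = (\<Sum>m<n. K * ?G m * (\<Sum>\<alpha>\<in>J - {z}. monomial x \<alpha> * b \<alpha>) ^ m)"
        using J by (intro sum_lists_less) simp
      also have "\<dots> = K * p (\<Sum>\<alpha>\<in>J - {z}. monomial x \<alpha> * b \<alpha>)"
        by (simp add: p_def sum_distrib_left mult.assoc)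
      finally have A: "(\<Sum>xs\<in>?A. monomial x (exponent_sum xs) *\<^sub>R c xs) = K * p (\<Sum>\<alpha>\<in>J - {z}. monomial x \<alpha> * b \<alpha>)" .
      have "\<bar>(1 + h) powr (- 1 / 2) - p (\<Sum>\<alpha>\<in>J - {z}. monomial x \<alpha> * b \<alpha>)\<bar> \<le> \<epsilon> / (2 * K) + \<epsilon> / (2 * K)"
        using near n2 [of n] unfolding p_def [of h] by (simp add: n_def)
      then have "K * \<bar>(1 + h) powr (- 1 / 2) - p (\<Sum>\<alpha>\<in>J - {z}. monomial x \<alpha> * b \<alpha>)\<bar> \<le> \<epsilon>"
        using K by (simp add: field_simps)
      then have "\<bar>1 / sqrt (g (k0 + x)) - (\<Sum>xs\<in>?A. monomial x (exponent_sum xs) *\<^sub>R c xs)\<bar> \<le> \<epsilon>"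
        unfolding A w right_diff_distrib [symmetric] using K by (simp add: abs_mult)
      moreover have "finite ?A"
        by (rule finite_subset [OF _ finite_lists_length_le [OF J, of n]]) auto
      moreover have "F \<subseteq> ?A"
      proof
        fix xs assume xs: "xs \<in> F"
        have "length xs < n" using n1 xs by (auto simp: n_def)
        moreover have "z \<notin> set xs" using xs F(2) by (auto simp: I_def)
        ultimately show "xs \<in> ?A" using xs by (auto simp: J_def)
      qed
      moreover have "?A \<subseteq> I" by (auto simp: I_def)
      ultimately show "\<exists>A. finite A \<and> F \<subseteq> A \<and> A \<subseteq> I \<and>
          \<bar>1 / sqrt (g (k0 + x)) - (\<Sum>xs\<in>A. monomial x (exponent_sum xs) *\<^sub>R c xs)\<bar> \<le> \<epsilon>"
        by blast
    qed simp_all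
  qed simp
  with \<rho>(1) show "\<exists>\<rho>>0. \<exists>a. power_series_on UNIV abs \<rho> (\<lambda>x. 1 / sqrt (g (k0 + x))) a" by blast
qed

subsection \<open>Seminormed spaces of Bloch functions and operators\<close>

context lattice
begin

lemma plus_bloch: "f \<in> bloch L k \<Longrightarrow> g \<in> bloch L k \<Longrightarrow> f + g \<in> bloch L k"
  using bloch_plus [of f k g] by (simp add: plus_fun_def)

lemma scaleR_bloch: "f \<in> bloch L k \<Longrightarrow> t *\<^sub>R f \<in> bloch L k"
  using bloch_scaleR [of f k t] by (simp add: scaleR_fun_def)

lemma zero_bloch: "0 \<in> bloch L k"
  using bloch_zero [of k] by (simp add: zero_fun_def)

lemma seminormed_bloch: "seminormed (bloch L 0 :: (real^'d \<Rightarrow> complex^'v::finite^'m::finite) set) (cell_norm L)"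
proof
  fix x y :: "real^'d \<Rightarrow> complex^'v^'m" and c :: real
  assume x: "x \<in> bloch L 0"
  show "c *\<^sub>R x \<in> bloch L 0" "0 \<le> cell_norm L x" using x by (simp_all add: scaleR_bloch)
  show "cell_norm L (c *\<^sub>R x) = \<bar>c\<bar> * cell_norm L x"
    using cell_norm_scaleR [of c x] by (simp add: scaleR_fun_def)
  assume y: "y \<in> bloch L 0"
  show "x + y \<in> bloch L 0" using x y by (rule plus_bloch)
  show "cell_norm L (x + y) \<le> cell_norm L x + cell_norm L y"
    using cell_norm_triangle [OF bloch_locally_L2 [OF x] bloch_locally_L2 [OF y]] by (simp add: plus_fun_def)
qed (rule zero_bloch)

lemmas BS_N_zero = seminormed.N_zero [OF seminormed_bloch]
  and BS_N_scaleR = seminormed.N_scaleR [OF seminormed_bloch]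
  and BS_N_triangle = seminormed.N_triangle [OF seminormed_bloch]

lemma cell_norm_null:
  assumes "f \<in> locally_L2" "AE r in lborel. f r = 0"
  shows "cell_norm L f = 0"
  using cell_norm_AE_cong [OF assms(1) locally_L2_zero assms(2)] by simp

lemma cell_norm_diff_null:
  assumes "f \<in> locally_L2" "g \<in> locally_L2" "AE r in lborel. f r = g r"
  shows "cell_norm L (f - g) = 0"
  unfolding fun_diff_def by (rule cell_norm_null) (use assms in \<open>auto intro: locally_L2_minus\<close>)

section \<open>Bounded operators and the operator seminorm\<close>

lemma bounded_opsD:
  fixes f g :: "real^'d \<Rightarrow> complex^'v::finite^'m::finite"
  assumes "T \<in> bounded_ops L"
  shows "f \<in> bloch L 0 \<Longrightarrow> T f \<in> bloch L 0"
    "f \<in> bloch L 0 \<Longrightarrow> g \<in> bloch L 0 \<Longrightarrow> AE r in lborel. T (f + g) r = T f r + T g r"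
    "f \<in> bloch L 0 \<Longrightarrow> AE r in lborel. T (\<lambda>x. cscale c (f x)) r = cscale c (T f r)"
    "\<exists>C. 0 \<le> C \<and> (\<forall>f\<in>bloch L 0. cell_norm L (T f) \<le> C * cell_norm L f)"
proof -
  obtain C where C: "\<forall>f\<in>bloch L 0. cell_norm L (T f) \<le> C * cell_norm L f"
    using assms by (auto simp: bounded_ops_def)
  have "\<forall>f\<in>bloch L 0. cell_norm L (T f) \<le> \<bar>C\<bar> * cell_norm L f"
  proof
    fix f :: "real^'d \<Rightarrow> complex^'v^'m" assume "f \<in> bloch L 0"
    then have "cell_norm L (T f) \<le> C * cell_norm L f" using C by blast
    also have "\<dots> \<le> \<bar>C\<bar> * cell_norm L f" by (intro mult_right_mono) simp_all
    finally show "cell_norm L (T f) \<le> \<bar>C\<bar> * cell_norm L f" .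
  qed
  then show "\<exists>C. 0 \<le> C \<and> (\<forall>f\<in>bloch L 0. cell_norm L (T f) \<le> C * cell_norm L f)"
    by (intro exI [of _ "\<bar>C\<bar>"]) simp
qed (use assms in \<open>auto simp: bounded_ops_def\<close>)

lemma bounded_ops_I:
  assumes "\<And>f. f \<in> bloch L 0 \<Longrightarrow> T f \<in> bloch L 0"
    "\<And>f g. f \<in> bloch L 0 \<Longrightarrow> g \<in> bloch L 0 \<Longrightarrow> AE r in lborel. T (f + g) r = T f r + T g r"
    "\<And>f c. f \<in> bloch L 0 \<Longrightarrow> AE r in lborel. T (\<lambda>x. cscale c (f x)) r = cscale c (T f r)"
    "\<And>f. f \<in> bloch L 0 \<Longrightarrow> cell_norm L (T f) \<le> C * cell_norm L f"
  shows "T \<in> bounded_ops L"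
  unfolding bounded_ops_def
  by (intro CollectI conjI ballI allI exI [of _ C]) (fact assms(1) assms(2) assms(3) assms(4))+

lemma bounded_ops_scaleR:
  assumes T: "T \<in> bounded_ops L" and f: "f \<in> bloch L 0"
  shows "AE r in lborel. T (t *\<^sub>R f) r = t *\<^sub>R T f r"
  using bounded_opsD(3) [OF T f, of "of_real t"] by (simp add: cscale_of_real scaleR_fun_def)

abbreviation op_values :: "((real^'d \<Rightarrow> complex^'v::finite^'m::finite) \<Rightarrow> real^'d \<Rightarrow> complex^'v^'m) \<Rightarrow> real set" where
  "op_values T \<equiv> {cell_norm L (T f) | f. f \<in> bloch L 0 \<and> cell_norm L f \<le> 1}"

lemma op_values:
  fixes T :: "(real^'d \<Rightarrow> complex^'v::finite^'m::finite) \<Rightarrow> real^'d \<Rightarrow> complex^'v^'m"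
  assumes "T \<in> bounded_ops L"
  shows "bdd_above (op_values T)" "cell_norm L (T 0) \<in> op_values T"
proof -
  obtain C where C: "0 \<le> C" "\<forall>f\<in>bloch L 0. cell_norm L (T f) \<le> C * cell_norm L f"
    using bounded_opsD(4) [OF assms] by blast
  show "bdd_above (op_values T)"
  proof (rule bdd_aboveI [of _ C])
    fix v assume "v \<in> op_values T"
    then obtain f where f: "v = cell_norm L (T f)" "f \<in> bloch L 0" "cell_norm L f \<le> 1" by blast
    have "v \<le> C * cell_norm L f" using f C by simp
    also have "\<dots> \<le> C * 1" using f C by (intro mult_left_mono) simp_all
    finally show "v \<le> C" by simp
  qed
  show "cell_norm L (T 0) \<in> op_values T"
    using zero_bloch BS_N_zero by (intro CollectI exI [of _ 0]) (simp add: zero_bloch BS_N_zero)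
qed

lemma op_norm_nonneg: "T \<in> bounded_ops L \<Longrightarrow> 0 \<le> op_norm L T"
  using cSup_upper [OF op_values(2) op_values(1), of T] cell_norm_nonneg [of "T 0"]
  unfolding op_norm_def by linarith

lemma op_norm_least:
  assumes "T \<in> bounded_ops L" "\<And>f. f \<in> bloch L 0 \<Longrightarrow> cell_norm L f \<le> 1 \<Longrightarrow> cell_norm L (T f) \<le> C"
  shows "op_norm L T \<le> C"
  unfolding op_norm_def by (rule cSup_least) (use op_values(2) [OF assms(1)] assms(2) in auto)

text \<open>Scaling to norm 1 needs a nonzero norm. If the norm of \<open>f\<close> is 0,
  boundedness of \<open>T\<close> makes \<open>T f\<close> null.\<close>

lemma op_norm_bound:
  assumes T: "T \<in> bounded_ops L" and f: "f \<in> bloch L 0"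
  shows "cell_norm L (T f) \<le> op_norm L T * cell_norm L f"
proof (cases "cell_norm L f = 0")
  case True
  obtain C where "\<forall>f\<in>bloch L 0. cell_norm L (T f) \<le> C * cell_norm L f"
    using bounded_opsD(4) [OF T] by blast
  then show ?thesis using f True by force
next
  case False
  then have n: "0 < cell_norm L f" using cell_norm_nonneg [of f] by linarith
  define t where "t = 1 / cell_norm L f"
  have tf: "t *\<^sub>R f \<in> bloch L 0" by (rule scaleR_bloch [OF f])
  have nt: "cell_norm L (t *\<^sub>R f) = 1" using n BS_N_scaleR [OF f, of t] by (simp add: t_def)
  have "cell_norm L (T (t *\<^sub>R f)) = cell_norm L (\<lambda>r. t *\<^sub>R T f r)"
    by (rule cell_norm_AE_cong [OF _ _ bounded_ops_scaleR [OF T f]])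
      (use bounded_opsD(1) [OF T] tf f in \<open>auto intro: bloch_locally_L2 locally_L2_scaleR\<close>)
  also have "\<dots> = t * cell_norm L (T f)" using n by (simp add: t_def)
  finally have "t * cell_norm L (T f) = cell_norm L (T (t *\<^sub>R f))" by simp
  also have "\<dots> \<le> op_norm L T"
    unfolding op_norm_def by (rule cSup_upper [OF _ op_values(1) [OF T]]) (use tf nt in auto)
  finally show ?thesis using n by (simp add: t_def field_simps)
qed

lemma zero_bounded_ops: "0 \<in> bounded_ops L"
  by (auto simp: bounded_ops_def zero_bloch BS_N_zero intro!: exI [of _ 0])

lemma plus_bounded_ops:
  fixes S T :: "(real^'d \<Rightarrow> complex^'v::finite^'m::finite) \<Rightarrow> real^'d \<Rightarrow> complex^'v^'m"
  assumes S: "S \<in> bounded_ops L" and T: "T \<in> bounded_ops L"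
  shows "S + T \<in> bounded_ops L"
proof -
  obtain C D where CD: "\<forall>f\<in>bloch L 0. cell_norm L (S f) \<le> C * cell_norm L f"
    "\<forall>f\<in>bloch L 0. cell_norm L (T f) \<le> D * cell_norm L f"
    using bounded_opsD(4) [OF S] bounded_opsD(4) [OF T] by blast
  show ?thesis
  proof (rule bounded_ops_I)
    fix f g :: "real^'d \<Rightarrow> complex^'v^'m" and c assume f: "f \<in> bloch L 0"
    show "(S + T) f \<in> bloch L 0"
      using plus_bloch [OF bounded_opsD(1) [OF S f] bounded_opsD(1) [OF T f]] by simp
    have "cell_norm L (S f + T f) \<le> cell_norm L (S f) + cell_norm L (T f)"
      by (rule BS_N_triangle [OF bounded_opsD(1) [OF S f] bounded_opsD(1) [OF T f]])
    also have "\<dots> \<le> C * cell_norm L f + D * cell_norm L f" by (intro add_mono CD [rule_format] f)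
    finally show "cell_norm L ((S + T) f) \<le> (C + D) * cell_norm L f" by (simp add: distrib_right)
    show "AE r in lborel. (S + T) (\<lambda>x. cscale c (f x)) r = cscale c ((S + T) f r)"
      using bounded_opsD(3) [OF S f, of c] bounded_opsD(3) [OF T f, of c]
      by eventually_elim (simp add: cscale_add_right)
    assume g: "g \<in> bloch L 0"
    show "AE r in lborel. (S + T) (f + g) r = (S + T) f r + (S + T) g r"
      using bounded_opsD(2) [OF S f g] bounded_opsD(2) [OF T f g] by eventually_elim simp
  qed
qed

lemma scaleR_bounded_ops:
  fixes T :: "(real^'d \<Rightarrow> complex^'v::finite^'m::finite) \<Rightarrow> real^'d \<Rightarrow> complex^'v^'m"
  assumes T: "T \<in> bounded_ops L"
  shows "t *\<^sub>R T \<in> bounded_ops L"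
proof -
  obtain C where C: "\<forall>f\<in>bloch L 0. cell_norm L (T f) \<le> C * cell_norm L f"
    using bounded_opsD(4) [OF T] by blast
  show ?thesis
  proof (rule bounded_ops_I)
    fix f g :: "real^'d \<Rightarrow> complex^'v^'m" and c assume f: "f \<in> bloch L 0"
    show "(t *\<^sub>R T) f \<in> bloch L 0" using scaleR_bloch [OF bounded_opsD(1) [OF T f], of t] by simp
    have "\<bar>t\<bar> * cell_norm L (T f) \<le> \<bar>t\<bar> * (C * cell_norm L f)"
      by (intro mult_left_mono C [rule_format] f) simp
    then show "cell_norm L ((t *\<^sub>R T) f) \<le> (\<bar>t\<bar> * C) * cell_norm L f"
      using BS_N_scaleR [OF bounded_opsD(1) [OF T f], of t] by (simp add: mult.assoc)
    show "AE r in lborel. (t *\<^sub>R T) (\<lambda>x. cscale c (f x)) r = cscale c ((t *\<^sub>R T) f r)"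
      using bounded_opsD(3) [OF T f, of c]
      by eventually_elim (simp add: cscale_scaleR scaleR_cscale mult.commute)
    assume g: "g \<in> bloch L 0"
    show "AE r in lborel. (t *\<^sub>R T) (f + g) r = (t *\<^sub>R T) f r + (t *\<^sub>R T) g r"
      using bounded_opsD(2) [OF T f g] by eventually_elim (simp add: scaleR_add_right)
  qed
qed

lemma op_norm_scaleR_le:
  fixes T :: "(real^'d \<Rightarrow> complex^'v::finite^'m::finite) \<Rightarrow> real^'d \<Rightarrow> complex^'v^'m"
  assumes T: "T \<in> bounded_ops L"
  shows "op_norm L (t *\<^sub>R T) \<le> \<bar>t\<bar> * op_norm L T"
proof (rule op_norm_least [OF scaleR_bounded_ops [OF T]])
  fix f :: "real^'d \<Rightarrow> complex^'v^'m" assume f: "f \<in> bloch L 0" "cell_norm L f \<le> 1"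
  have "cell_norm L ((t *\<^sub>R T) f) = \<bar>t\<bar> * cell_norm L (T f)"
    using BS_N_scaleR [OF bounded_opsD(1) [OF T f(1)], of t] by simp
  also have "\<dots> \<le> \<bar>t\<bar> * (op_norm L T * 1)"
    using op_norm_bound [OF T f(1)] mult_left_mono [OF f(2) op_norm_nonneg [OF T]]
    by (intro mult_left_mono) simp_all
  finally show "cell_norm L ((t *\<^sub>R T) f) \<le> \<bar>t\<bar> * op_norm L T" by simp
qed

lemma seminormed_bounded_ops:
  "seminormed (bounded_ops L :: ((real^'d \<Rightarrow> complex^'v::finite^'m::finite) \<Rightarrow> _) set) (op_norm L)"
proof
  fix S T :: "(real^'d \<Rightarrow> complex^'v^'m) \<Rightarrow> real^'d \<Rightarrow> complex^'v^'m" and c :: real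
  assume S: "S \<in> bounded_ops L"
  show "c *\<^sub>R S \<in> bounded_ops L" by (rule scaleR_bounded_ops [OF S])
  show "0 \<le> op_norm L S" by (rule op_norm_nonneg [OF S])
  show "op_norm L (c *\<^sub>R S) = \<bar>c\<bar> * op_norm L S"
  proof (cases "c = 0")
    case True
    then show ?thesis
      using op_norm_scaleR_le [OF S, of c] op_norm_nonneg [OF scaleR_bounded_ops [OF S], of c] by simp
  next
    case False
    have "op_norm L ((1 / c) *\<^sub>R (c *\<^sub>R S)) \<le> \<bar>1 / c\<bar> * op_norm L (c *\<^sub>R S)"
      by (rule op_norm_scaleR_le [OF scaleR_bounded_ops [OF S]])
    then have "\<bar>c\<bar> * op_norm L S \<le> op_norm L (c *\<^sub>R S)" using False by (simp add: field_simps)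
    then show ?thesis using op_norm_scaleR_le [OF S, of c] by linarith
  qed
  assume T: "T \<in> bounded_ops L"
  show ST: "S + T \<in> bounded_ops L" by (rule plus_bounded_ops [OF S T])
  show "op_norm L (S + T) \<le> op_norm L S + op_norm L T"
  proof (rule op_norm_least [OF ST])
    fix f :: "real^'d \<Rightarrow> complex^'v^'m" assume f: "f \<in> bloch L 0" "cell_norm L f \<le> 1"
    have "cell_norm L (S f + T f) \<le> cell_norm L (S f) + cell_norm L (T f)"
      by (rule BS_N_triangle [OF bounded_opsD(1) [OF S f(1)] bounded_opsD(1) [OF T f(1)]])
    also have "\<dots> \<le> op_norm L S * 1 + op_norm L T * 1"
      using op_norm_bound [OF S f(1)] mult_left_mono [OF f(2) op_norm_nonneg [OF S]]
        op_norm_bound [OF T f(1)] mult_left_mono [OF f(2) op_norm_nonneg [OF T]] by linarith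
    finally show "cell_norm L ((S + T) f) \<le> op_norm L S + op_norm L T" by simp
  qed
qed (rule zero_bounded_ops)

text \<open>Evaluation of operators is a bounded bilinear map, where linearity in the function holds
  only almost everywhere.\<close>

lemma real_analytic_apply:
  fixes T :: "real^'e::finite \<Rightarrow> (real^'d \<Rightarrow> complex^'v::finite^'m::finite) \<Rightarrow> _"
  assumes "real_analytic (bounded_ops L) (op_norm L) T" "\<And>k. T k \<in> bounded_ops L"
    and "real_analytic (bloch L 0) (cell_norm L) u" "\<And>k. u k \<in> bloch L 0"
  shows "real_analytic (bloch L 0) (cell_norm L) (\<lambda>k. T k (u k))"
proof -
  interpret OS: seminormed "bounded_ops L :: ((real^'d \<Rightarrow> complex^'v^'m) \<Rightarrow> _) set" "op_norm L"
    by (rule seminormed_bounded_ops)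
  interpret BS: seminormed "bloch L 0 :: (real^'d \<Rightarrow> complex^'v^'m) set" "cell_norm L"
    by (rule seminormed_bloch)
  interpret seminormed_bilinear "bounded_ops L :: ((real^'d \<Rightarrow> complex^'v^'m) \<Rightarrow> _) set" "op_norm L"
    "bloch L 0" "cell_norm L" "bloch L 0" "cell_norm L" "\<lambda>T f. T f"
  proof
    fix T T' :: "(real^'d \<Rightarrow> complex^'v^'m) \<Rightarrow> real^'d \<Rightarrow> complex^'v^'m"
      and f g :: "real^'d \<Rightarrow> complex^'v^'m" and t :: real
    assume T: "T \<in> bounded_ops L" and f: "f \<in> bloch L 0"
    show "T f \<in> bloch L 0" by (rule bounded_opsD(1) [OF T f])
    show "cell_norm L (T f) \<le> op_norm L T * cell_norm L f" by (rule op_norm_bound [OF T f])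
    show "cell_norm L ((t *\<^sub>R T) f - t *\<^sub>R T f) = 0" using BS_N_zero by simp
    show "cell_norm L (T (t *\<^sub>R f) - t *\<^sub>R T f) = 0"
      by (rule cell_norm_diff_null)
        (use bounded_ops_scaleR [OF T f] in \<open>auto intro!: bloch_locally_L2 [of _ 0] bounded_opsD(1) [OF T] scaleR_bloch f\<close>)
    show "cell_norm L ((T + T') f - (T f + T' f)) = 0" using BS_N_zero by simp
    assume g: "g \<in> bloch L 0"
    show "cell_norm L (T (f + g) - (T f + T g)) = 0"
      by (rule cell_norm_diff_null)
        (use bounded_opsD(2) [OF T f g] in \<open>auto intro!: bloch_locally_L2 [of _ 0] bounded_opsD(1) [OF T] plus_bloch f g\<close>)
  qed
  show ?thesis by (rule real_analytic_bilinear [OF assms])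
qed

text \<open>Over real scalars the sesquilinear inner product is bilinear; its real part has the
  range that the inverse square root requires.\<close>

lemma real_analytic_inner:
  fixes u w :: "real^'e::finite \<Rightarrow> real^'d \<Rightarrow> complex^'v::finite^'m::finite"
  assumes "real_analytic (bloch L 0) (cell_norm L) u" "\<And>k. u k \<in> bloch L 0"
    and "real_analytic (bloch L 0) (cell_norm L) w" "\<And>k. w k \<in> bloch L 0"
  shows "real_analytic UNIV abs (\<lambda>k. Re (cell_inner L (u k) (w k)))"
proof -
  interpret BS: seminormed "bloch L 0 :: (real^'d \<Rightarrow> complex^'v^'m) set" "cell_norm L"
    by (rule seminormed_bloch)
  interpret seminormed_bilinear "bloch L 0 :: (real^'d \<Rightarrow> complex^'v^'m) set" "cell_norm L"
    "bloch L 0" "cell_norm L" "UNIV :: real set" abs "\<lambda>f g. Re (cell_inner L f g)"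
  proof
    fix f f' g g' :: "real^'d \<Rightarrow> complex^'v^'m" and t :: real
    assume f: "f \<in> bloch L 0" and g: "g \<in> bloch L 0"
    note L2 = f [THEN bloch_locally_L2] g [THEN bloch_locally_L2]
    show "\<bar>Re (cell_inner L f g)\<bar> \<le> cell_norm L f * cell_norm L g"
      using abs_Re_le_cmod [of "cell_inner L f g"] cell_inner_le [OF L2] by linarith
    show "\<bar>Re (cell_inner L (t *\<^sub>R f) g) - t *\<^sub>R Re (cell_inner L f g)\<bar> = 0"
      using cell_inner_scaleR_left [of t f g] by (simp add: scaleR_fun_def)
    show "\<bar>Re (cell_inner L f (t *\<^sub>R g)) - t *\<^sub>R Re (cell_inner L f g)\<bar> = 0"
      using cell_inner_scaleR_right [of f t g] by (simp add: scaleR_fun_def)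
    show "\<bar>Re (cell_inner L (f + f') g) - (Re (cell_inner L f g) + Re (cell_inner L f' g))\<bar> = 0"
      if "f' \<in> bloch L 0"
      using cell_inner_add_left [OF L2(1) bloch_locally_L2 [OF that] L2(2)] by (simp add: plus_fun_def)
    show "\<bar>Re (cell_inner L f (g + g')) - (Re (cell_inner L f g) + Re (cell_inner L f g'))\<bar> = 0"
      if "g' \<in> bloch L 0"
      using cell_inner_add_right [OF L2 bloch_locally_L2 [OF that]] by (simp add: plus_fun_def)
  qed simp
  show ?thesis by (rule real_analytic_bilinear [OF assms])
qed

lemma real_analytic_scaleR:
  fixes u :: "real^'e::finite \<Rightarrow> real^'d \<Rightarrow> complex^'v::finite^'m::finite"
  assumes "real_analytic UNIV abs g"
    and "real_analytic (bloch L 0) (cell_norm L) u" "\<And>k. u k \<in> bloch L 0"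
  shows "real_analytic (bloch L 0) (cell_norm L) (\<lambda>k. g k *\<^sub>R u k)"
proof -
  interpret BS: seminormed "bloch L 0 :: (real^'d \<Rightarrow> complex^'v^'m) set" "cell_norm L"
    by (rule seminormed_bloch)
  interpret seminormed_bilinear "UNIV :: real set" abs "bloch L 0 :: (real^'d \<Rightarrow> complex^'v^'m) set" "cell_norm L"
    "bloch L 0" "cell_norm L" "\<lambda>t f. t *\<^sub>R f"
    by unfold_locales
      (simp_all add: scaleR_bloch BS_N_scaleR scaleR_add_left scaleR_add_right BS_N_zero mult.commute)
  show ?thesis by (rule real_analytic_bilinear [OF assms(1) UNIV_I assms(2,3)])
qed

end

subsection \<open>Periodization\<close>

context lattice
begin

text \<open>Restricting the range to nonzero terms makes the lattice sum finite whenever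
  \<open>f\<close> has bounded support, so no infinite sum is needed.\<close>

definition periodize :: "(real^'d \<Rightarrow> 'b::real_vector) \<Rightarrow> real^'d \<Rightarrow> 'b" where
  "periodize f r = (\<Sum>R\<in>{R \<in> L. f (r - R) \<noteq> 0}. f (r - R))"

lemma periodize_eq:
  assumes f: "\<And>r. f r \<noteq> 0 \<Longrightarrow> norm r \<le> \<rho>" and S: "finite S" "S \<subseteq> L" "{R \<in> L. norm R \<le> norm r + \<rho>} \<subseteq> S"
  shows "periodize f r = (\<Sum>R\<in>S. f (r - R))"
  unfolding periodize_def
proof (rule sum.mono_neutral_left [OF S(1)])
  show "{R \<in> L. f (r - R) \<noteq> 0} \<subseteq> S"
  proof clarify
    fix R assume R: "R \<in> L" "f (r - R) \<noteq> 0"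
    have "norm R \<le> norm r + norm (r - R)" using norm_triangle_ineq4 [of r "r - R"] by simp
    then have "norm R \<le> norm r + \<rho>" using f [OF R(2)] by linarith
    then show "R \<in> S" using R(1) S(3) by blast
  qed
  show "\<forall>R\<in>S - {R \<in> L. f (r - R) \<noteq> 0}. f (r - R) = 0" using S(2) by blast
qed

lemma periodize_shift:
  assumes "R0 \<in> L"
  shows "periodize f (r + R0) = periodize f r"
  unfolding periodize_def
  by (rule sum.reindex_bij_witness [of _ "\<lambda>R. R + R0" "\<lambda>R. R - R0"]) (use assms in \<open>auto simp: algebra_simps\<close>)

context
  fixes f :: "real^'d \<Rightarrow> complex^'v::finite^'m::finite" and \<rho> :: real
  assumes f: "f \<in> locally_L2" and supp: "\<And>r. f r \<noteq> 0 \<Longrightarrow> norm r \<le> \<rho>"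
begin

lemma translate_locally_L2: "(\<lambda>r. f (r - R)) \<in> locally_L2"
  using locally_L2_translate [OF f, of "- R"] by simp

lemma periodize_eq_on_cball:
  "norm r \<le> \<sigma> \<Longrightarrow> periodize f r = (\<Sum>R\<in>{R \<in> L. norm R \<le> \<sigma> + \<rho>}. f (r - R))"
  by (rule periodize_eq [OF supp]) (auto simp: finite_L_cball)

text \<open>The range of summation depends on the point. The function is the pointwise limit of sums
  over fixed finite sets, eventually constant at each point.\<close>

lemma periodize_measurable: "periodize f \<in> borel_measurable borel"
proof (rule borel_measurable_LIMSEQ_metric)
  fix n :: nat
  show "(\<lambda>r. \<Sum>R\<in>{R \<in> L. norm R \<le> real n + \<rho>}. f (r - R)) \<in> borel_measurable borel"
    by (intro borel_measurable_sum locally_L2_measurable translate_locally_L2)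
next
  fix r :: "real^'d"
  obtain N :: nat where N: "norm r \<le> real N" using real_arch_simple by blast
  show "(\<lambda>n. \<Sum>R\<in>{R \<in> L. norm R \<le> real n + \<rho>}. f (r - R)) \<longlonglongrightarrow> periodize f r"
  proof (rule tendsto_eventually, rule eventually_sequentiallyI [of N])
    fix n assume "N \<le> n"
    then have "norm r \<le> real n" using N by linarith
    then show "(\<Sum>R\<in>{R \<in> L. norm R \<le> real n + \<rho>}. f (r - R)) = periodize f r"
      by (rule periodize_eq_on_cball [symmetric])
  qed
qed

lemma periodize_bloch: "periodize f \<in> bloch L 0"
proof (rule bloch_I)
  show "periodize f \<in> locally_L2"
  proof (rule locally_L2_I [OF periodize_measurable])
    fix \<sigma> :: real
    let ?h = "\<lambda>r. \<Sum>R\<in>{R \<in> L. norm R \<le> \<sigma> + \<rho>}. f (r - R)"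
    have "?h \<in> locally_L2" by (intro locally_L2_sum translate_locally_L2)
    then have "set_integrable lborel (cball 0 \<sigma>) (\<lambda>r. (norm (?h r))\<^sup>2)"
      by (rule locally_L2_norm_square) auto
    moreover have eq: "indicator (cball 0 \<sigma>) r *\<^sub>R (norm (?h r))\<^sup>2 = indicator (cball 0 \<sigma>) r *\<^sub>R (norm (periodize f r))\<^sup>2" for r
      by (cases "r \<in> cball 0 \<sigma>") (simp_all add: periodize_eq_on_cball)
    ultimately show "set_integrable lborel (cball 0 \<sigma>) (\<lambda>r. (norm (periodize f r))\<^sup>2)"
      unfolding set_integrable_def by (simp only: eq)
  qed
qed (simp add: periodize_shift)

end

lemma cell_norm_mono:
  assumes "g \<in> locally_L2" "h \<in> locally_L2" "\<And>r. r \<in> cell \<Longrightarrow> norm (g r) \<le> norm (h r)"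
  shows "cell_norm L g \<le> cell_norm L h"
  unfolding cell_norm_def
proof (rule real_sqrt_le_mono, rule set_integral_mono)
  show "set_integrable lborel cell (\<lambda>r. (norm (g r))\<^sup>2)" "set_integrable lborel cell (\<lambda>r. (norm (h r))\<^sup>2)"
    by (rule locally_L2_norm_square; use assms bounded_cell in simp)+
qed (simp add: assms(3) power_mono)

text \<open>If a function is bounded pointwise by \<open>C\<close> times \<open>f\<close>, its
  periodization has cell seminorm at most \<open>C\<close> times this number. The range contains all
  lattice vectors whose translates of the support reach the cell.\<close>

definition periodize_bound :: "(real^'d \<Rightarrow> complex^'v::finite^'m::finite) \<Rightarrow> real \<Rightarrow> real" where
  "periodize_bound f \<rho> = (\<Sum>R\<in>{R \<in> L. norm R \<le> cell_radius + \<rho>}. cell_norm L (\<lambda>r. f (r - R)))"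

lemma cell_norm_periodize_le:
  fixes f g :: "real^'d \<Rightarrow> complex^'v::finite^'m::finite"
  assumes f: "f \<in> locally_L2" "\<And>r. f r \<noteq> 0 \<Longrightarrow> norm r \<le> \<rho>" and g: "g \<in> locally_L2"
    and le: "\<And>r. norm (g r) \<le> C * norm (f r)" and C: "0 \<le> C"
  shows "cell_norm L (periodize g) \<le> C * periodize_bound f \<rho>"
proof -
  let ?S = "{R \<in> L. norm R \<le> cell_radius + \<rho>}"
  have gs: "norm r \<le> \<rho>" if "g r \<noteq> 0" for r
  proof (rule f(2))
    show "f r \<noteq> 0" using that le [of r] by auto
  qed
  have gL: "(\<lambda>r. g (r - R)) \<in> locally_L2" and fL: "(\<lambda>r. f (r - R)) \<in> locally_L2" for R
    using locally_L2_translate [OF g, of "- R"] locally_L2_translate [OF f(1), of "- R"] by simp_all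
  have eq: "cell_norm L (periodize g) = cell_norm L (\<Sum>R\<in>?S. (\<lambda>r. g (r - R)))"
  proof -
    have eq: "indicator cell r *\<^sub>R (norm (periodize g r))\<^sup>2 = indicator cell r *\<^sub>R (norm ((\<Sum>R\<in>?S. (\<lambda>r. g (r - R))) r))\<^sup>2" for r
      by (cases "r \<in> cell") (simp_all add: periodize_eq_on_cball [OF g gs norm_cell_le] sum_fun_apply)
    show ?thesis unfolding cell_norm_def set_lebesgue_integral_def eq ..
  qed
  have tri: "cell_norm L (\<Sum>R\<in>A. (\<lambda>r. g (r - R))) \<le> (\<Sum>R\<in>A. cell_norm L (\<lambda>r. g (r - R)))" if "finite A" for A
    using that
  proof (induction A rule: finite_induct)
    case (insert R F)
    have eqF: "(\<Sum>R\<in>F. (\<lambda>r. g (r - R))) = (\<lambda>r. \<Sum>R\<in>F. g (r - R))"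
      by (rule ext) (rule sum_fun_apply)
    have F: "(\<Sum>R\<in>F. (\<lambda>r. g (r - R))) \<in> locally_L2"
      by (rule ssubst [OF eqF]) (rule locally_L2_sum, rule gL)
    have "cell_norm L ((\<lambda>r. g (r - R)) + (\<Sum>R\<in>F. (\<lambda>r. g (r - R))))
        \<le> cell_norm L (\<lambda>r. g (r - R)) + cell_norm L (\<Sum>R\<in>F. (\<lambda>r. g (r - R)))"
      using cell_norm_triangle [OF gL [of R] F] unfolding plus_fun_def .
    also have "\<dots> \<le> cell_norm L (\<lambda>r. g (r - R)) + (\<Sum>R\<in>F. cell_norm L (\<lambda>r. g (r - R)))"
      by (rule add_left_mono) (rule insert.IH)
    finally show ?case unfolding sum.insert [OF insert.hyps] .
  qed (simp only: sum.empty BS_N_zero order_refl)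
  have "cell_norm L (periodize g) \<le> (\<Sum>R\<in>?S. cell_norm L (\<lambda>r. g (r - R)))"
    unfolding eq by (rule tri [OF finite_L_cball])
  also have "\<dots> \<le> (\<Sum>R\<in>?S. C * cell_norm L (\<lambda>r. f (r - R)))"
  proof (rule sum_mono)
    fix R
    have "cell_norm L (\<lambda>r. g (r - R)) \<le> cell_norm L (\<lambda>r. C *\<^sub>R f (r - R))"
      by (rule cell_norm_mono [OF gL locally_L2_scaleR [OF fL]]) (use C le in simp_all)
    then show "cell_norm L (\<lambda>r. g (r - R)) \<le> C * cell_norm L (\<lambda>r. f (r - R))" using C by simp
  qed
  also have "\<dots> = C * periodize_bound f \<rho>"
    by (simp only: periodize_bound_def sum_distrib_left)
  finally show ?thesis .
qed

end

subsection \<open>The exponential as a power series in several variables\<close>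

text \<open>A finite set of exponents lies in a box, over which the sum factors into partial sums of
  one-variable exponential series.\<close>

lemma multi_exp_summable_bound:
  fixes y :: "'d::finite \<Rightarrow> real"
  assumes y: "\<And>i. 0 \<le> y i" and F: "finite F"
  shows "(\<Sum>\<alpha>\<in>F. \<Prod>i\<in>UNIV. y i ^ \<alpha> i / fact (\<alpha> i)) \<le> (\<Prod>i\<in>UNIV. exp (y i))"
proof -
  define n where "n = Suc (\<Sum>\<alpha>\<in>F. total_degree \<alpha>)"
  have sub: "F \<subseteq> PiE UNIV (\<lambda>_. {..<n})"
  proof
    fix \<alpha> assume a: "\<alpha> \<in> F"
    have "\<alpha> i < n" for i
    proof -
      have "\<alpha> i \<le> total_degree \<alpha>" unfolding total_degree_def by (rule member_le_sum) simp_all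
      also have "\<dots> \<le> (\<Sum>\<alpha>\<in>F. total_degree \<alpha>)" by (rule member_le_sum) (use a F in simp_all)
      finally show ?thesis by (simp add: n_def)
    qed
    then show "\<alpha> \<in> PiE UNIV (\<lambda>_. {..<n})" by auto
  qed
  have "(\<Sum>\<alpha>\<in>F. \<Prod>i\<in>UNIV. y i ^ \<alpha> i / fact (\<alpha> i)) \<le> (\<Sum>\<alpha>\<in>PiE UNIV (\<lambda>_. {..<n}). \<Prod>i\<in>UNIV. y i ^ \<alpha> i / fact (\<alpha> i))"
    by (rule sum_mono2 [OF _ sub]) (auto simp: finite_PiE y intro!: prod_nonneg)
  also have "\<dots> = (\<Prod>i\<in>UNIV. \<Sum>m<n. y i ^ m / fact m)"
    by (rule prod_sum_PiE [symmetric]) simp_all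
  also have "\<dots> \<le> (\<Prod>i\<in>UNIV. exp (y i))"
  proof (intro prod_mono conjI)
    fix i
    have "summable (\<lambda>m. y i ^ m / fact m)"
      using summable_exp [of "y i"] by (simp add: field_simps)
    moreover have "exp (y i) = (\<Sum>m. y i ^ m / fact m)"
      by (simp add: exp_def divide_inverse mult.commute)
    ultimately show "(\<Sum>m<n. y i ^ m / fact m) \<le> exp (y i)"
      using sum_le_suminf [of "\<lambda>m. y i ^ m / fact m" "{..<n}"] y by simp
  qed (simp add: y sum_nonneg)
  finally show ?thesis .
qed

lemma has_sum_multi_exp:
  fixes y :: "'d::finite \<Rightarrow> 'a::{banach, real_normed_field}"
  shows "((\<lambda>\<alpha>. \<Prod>i\<in>UNIV. y i ^ \<alpha> i / fact (\<alpha> i)) has_sum exp (\<Sum>i\<in>UNIV. y i)) UNIV"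
proof -
  let ?f = "\<lambda>i n. y i ^ n / fact n :: 'a"
  have f_eq: "?f i = (\<lambda>n. y i ^ n /\<^sub>R fact n)" for i
    by (rule ext) (simp add: scaleR_conv_of_real divide_inverse mult.commute)
  have hs: "(?f i has_sum exp (y i)) UNIV" for i
    unfolding f_eq by (rule norm_summable_imp_has_sum [OF summable_norm_exp exp_converges])
  have ab: "?f i abs_summable_on UNIV" for i
    using summable_norm_exp [of "y i"] unfolding f_eq
    by (subst summable_on_UNIV_nonneg_real_iff) (simp_all add: norm_divide norm_mult norm_inverse divide_inverse mult.commute)
  have PU: "PiE UNIV (\<lambda>_. UNIV) = (UNIV :: ('d \<Rightarrow> nat) set)" by auto
  have "(\<lambda>\<alpha>. norm (\<Prod>i\<in>UNIV. ?f i (\<alpha> i))) summable_on UNIV"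
  proof (rule summable_on_nonneg_bounded)
    fix F :: "('d \<Rightarrow> nat) set" assume "finite F"
    then show "(\<Sum>\<alpha>\<in>F. norm (\<Prod>i\<in>UNIV. ?f i (\<alpha> i))) \<le> (\<Prod>i\<in>UNIV. exp (norm (y i)))"
      using multi_exp_summable_bound [of "\<lambda>i. norm (y i)" F]
      by (simp add: prod_norm [symmetric] norm_divide norm_power)
  qed simp
  then have sm: "(\<lambda>\<alpha>. \<Prod>i\<in>UNIV. ?f i (\<alpha> i)) summable_on UNIV"
    by (rule abs_summable_summable)
  have "infsum (\<lambda>\<alpha>. \<Prod>i\<in>UNIV. ?f i (\<alpha> i)) (PiE UNIV (\<lambda>_. UNIV)) = (\<Prod>i\<in>UNIV. infsum (?f i) UNIV)"
    by (rule infsum_prod_PiE_abs) (use ab in simp_all)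
  also have "\<dots> = exp (\<Sum>i\<in>UNIV. y i)"
    using infsumI [OF hs] by (simp add: exp_sum)
  finally show ?thesis using has_sum_infsum [OF sm] unfolding PU by simp
qed

text \<open>Termwise domination by the series at \<open>B\<close>. The bound does not depend on
  \<open>y\<close>, which yields convergence uniform over a bounded support.\<close>

lemma multi_exp_tail:
  fixes y :: "'d::finite \<Rightarrow> complex"
  assumes y: "\<And>i. cmod (y i) \<le> B" and A: "finite A"
  shows "cmod (exp (\<Sum>i\<in>UNIV. y i) - (\<Sum>\<alpha>\<in>A. \<Prod>i\<in>UNIV. y i ^ \<alpha> i / fact (\<alpha> i)))
    \<le> exp (\<Sum>i\<in>(UNIV :: 'd set). B) - (\<Sum>\<alpha>\<in>A. \<Prod>i\<in>UNIV. B ^ \<alpha> i / fact (\<alpha> i))"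
proof (rule norm_infsum_le)
  show "((\<lambda>\<alpha>. \<Prod>i\<in>UNIV. y i ^ \<alpha> i / fact (\<alpha> i)) has_sum
      (exp (\<Sum>i\<in>UNIV. y i) - (\<Sum>\<alpha>\<in>A. \<Prod>i\<in>UNIV. y i ^ \<alpha> i / fact (\<alpha> i)))) (UNIV - A)"
    by (rule has_sum_Diff [OF has_sum_multi_exp has_sum_finite [OF A]]) simp
  show "((\<lambda>\<alpha>. \<Prod>i\<in>UNIV. B ^ \<alpha> i / fact (\<alpha> i)) has_sum
      (exp (\<Sum>i\<in>(UNIV :: 'd set). B) - (\<Sum>\<alpha>\<in>A. \<Prod>i\<in>UNIV. B ^ \<alpha> i / fact (\<alpha> i)))) (UNIV - A)"
    by (rule has_sum_Diff [OF has_sum_multi_exp [of "\<lambda>_. B"] has_sum_finite [OF A]]) simp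
  show "cmod (\<Prod>i\<in>UNIV. y i ^ \<alpha> i / fact (\<alpha> i)) \<le> (\<Prod>i\<in>UNIV. B ^ \<alpha> i / fact (\<alpha> i))" for \<alpha>
    unfolding prod_norm [symmetric]
    by (intro prod_mono conjI) (auto simp: norm_divide norm_power intro!: divide_right_mono power_mono y)
qed

context lattice
begin

text \<open>On the bounded support the factor \<open>cis (- (x \<bullet> r))\<close> has a power
  series in \<open>x\<close> that converges uniformly in \<open>r\<close>, so the coefficients are
  periodizations of \<open>F\<close> times polynomials.\<close>

lemma real_analytic_periodize:
  fixes f :: "real^'d \<Rightarrow> complex^'v::finite^'m::finite"
  assumes f: "f \<in> locally_L2" and supp: "\<And>r. f r \<noteq> 0 \<Longrightarrow> norm r \<le> \<rho>"
  shows "real_analytic (bloch L 0) (cell_norm L) (\<lambda>k. periodize (phase_mult (- k) f))"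
  unfolding real_analytic_iff
proof
  fix k0 :: "real^'d"
  define F where "F = phase_mult (- k0) f"
  have F: "F \<in> locally_L2" unfolding F_def by (rule phase_mult_locally_L2 [OF f])
  have Fs: "norm r \<le> \<rho>" if "F r \<noteq> 0" for r
    using that supp [of r] by (cases "f r = 0") (auto simp: F_def phase_mult_def)
  \<comment> \<open>Clipped at 0 because \<rho> may be negative, in which case \<open>f\<close>
    vanishes.\<close>
  define B where "B = max \<rho> 0"
  \<comment> \<open>The coefficient of \<open>monomial x \<alpha>\<close> in the expansion of
    \<open>cis (- (x \<bullet> r))\<close>.\<close>
  define q where "q \<alpha> r = (\<Prod>i\<in>UNIV. (- (\<i> * complex_of_real (r $ i))) ^ \<alpha> i / fact (\<alpha> i))"
    for \<alpha> :: "'d \<Rightarrow> nat" and r :: "real^'d"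
  define M where "M \<alpha> = (\<Prod>i\<in>UNIV. B ^ \<alpha> i / fact (\<alpha> i))" for \<alpha> :: "'d \<Rightarrow> nat"
  define a where "a \<alpha> = periodize (\<lambda>r. cscale (q \<alpha> r) (F r))" for \<alpha>
  have mult_L2: "(\<lambda>r. cscale (e r) (F r)) \<in> locally_L2"
    if "e \<in> borel_measurable borel" "\<And>r. norm r \<le> \<rho> \<Longrightarrow> cmod (e r) \<le> C" "0 \<le> C" for e C
  proof (rule locally_L2_dominated1 [OF _ F, of _ C])
    show "(\<lambda>r. cscale (e r) (F r)) \<in> borel_measurable borel"
      using that(1) locally_L2_measurable [OF F] by measurable
    show "AE r in lborel. norm (cscale (e r) (F r)) \<le> C * norm (F r)"
    proof (rule AE_I2)
      fix r show "norm (cscale (e r) (F r)) \<le> C * norm (F r)"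
        by (cases "F r = 0") (simp_all add: norm_cscale mult_right_mono that(2) Fs)
    qed
  qed
  have mult_le: "norm (cscale (e r) (F r)) \<le> C * norm (F r)"
    if "\<And>r. norm r \<le> \<rho> \<Longrightarrow> cmod (e r) \<le> C" for e C r
    by (cases "F r = 0") (simp_all add: norm_cscale mult_right_mono that Fs)
  have rB: "\<bar>r $ i\<bar> \<le> B" if "norm r \<le> \<rho>" for r :: "real^'d" and i
    using component_le_norm_cart [of r i] that by (simp add: B_def)
  have B0: "0 \<le> B" by (simp add: B_def)
  have q_meas: "q \<alpha> \<in> borel_measurable borel" for \<alpha>
    unfolding q_def by (intro borel_measurable_continuous_onI continuous_intros) simp_all
  have q_le: "cmod (q \<alpha> r) \<le> M \<alpha>" if "norm r \<le> \<rho>" for \<alpha> r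
    unfolding q_def M_def prod_norm [symmetric]
    by (intro prod_mono conjI) (auto simp: norm_divide norm_power norm_mult intro!: divide_right_mono power_mono rB that)
  have M0: "0 \<le> M \<alpha>" for \<alpha> unfolding M_def by (intro prod_nonneg) (simp add: B0)
  have qF_L2: "(\<lambda>r. cscale (q \<alpha> r) (F r)) \<in> locally_L2" for \<alpha>
    by (rule mult_L2 [OF q_meas q_le M0])
  have sF: "norm r \<le> \<rho>" if "cscale (e r) (F r) \<noteq> 0" for e r
    using that Fs [of r] by (cases "F r = 0") auto
  let ?PB = "periodize_bound F \<rho>"
  have M_sum: "(M has_sum exp (\<Sum>i\<in>(UNIV :: 'd set). B)) UNIV"
    using has_sum_multi_exp [of "\<lambda>_ :: 'd. B"] unfolding M_def [abs_def] by simp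
  \<comment> \<open>The exponential series converges everywhere, so the radius 1 is a convenience:
    it keeps the products of coordinates of \<open>x\<close> and \<open>r\<close> below
    \<open>B\<close> in the tail estimate.\<close>
  have "power_series_on (bloch L 0) (cell_norm L) 1 (\<lambda>x. periodize (phase_mult (- (k0 + x)) f)) a"
    unfolding power_series_on_def
  proof (intro conjI allI impI)
    show "range a \<subseteq> bloch L 0"
      using periodize_bloch [OF qF_L2 sF] by (auto simp: a_def)
    have Na: "cell_norm L (a \<alpha>) \<le> M \<alpha> * ?PB" for \<alpha>
      unfolding a_def by (rule cell_norm_periodize_le [OF F Fs qF_L2]) (assumption, rule mult_le, erule q_le, rule M0)
    have "(\<lambda>\<alpha>. M \<alpha> * ?PB) summable_on UNIV"
      by (rule summable_on_cmult_left) (use M_sum has_sum_imp_summable in blast)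
    then show "(\<lambda>\<alpha>. cell_norm L (a \<alpha>) * 1 ^ total_degree \<alpha>) summable_on UNIV"
      by (rule summable_on_comparison_test) (simp_all add: Na)
    fix x :: "real^'d" assume x: "\<forall>i. \<bar>x $ i\<bar> < 1"
    define e where "e A r = cis (- (x \<bullet> r)) - (\<Sum>\<alpha>\<in>A. complex_of_real (monomial x \<alpha>) * q \<alpha> r)" for A r
    have e_meas: "e A \<in> borel_measurable borel" for A
      unfolding e_def
      by (intro borel_measurable_diff borel_measurable_sum borel_measurable_times q_meas)
        (auto intro!: borel_measurable_continuous_onI continuous_intros)
    let ?T = "exp (\<Sum>i\<in>(UNIV :: 'd set). B)"
    have e_le: "cmod (e A r) \<le> ?T - (\<Sum>\<alpha>\<in>A. M \<alpha>)" if "finite A" "norm r \<le> \<rho>" for A r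
    proof -
      let ?y = "\<lambda>i. - (\<i> * complex_of_real (x $ i * r $ i))"
      have "cmod (?y i) \<le> B" for i
        using mult_mono [of "\<bar>x $ i\<bar>" 1 "\<bar>r $ i\<bar>" B] x rB [OF that(2), of i]
        by (simp add: norm_mult abs_mult less_imp_le)
      note multi_exp_tail [of ?y B A, OF this that(1)]
      moreover have "exp (\<Sum>i\<in>UNIV. ?y i) = cis (- (x \<bullet> r))"
        by (simp add: cis_conv_exp inner_vec_def sum_negf sum_distrib_left)
      moreover have "(\<Prod>i\<in>UNIV. ?y i ^ \<alpha> i / fact (\<alpha> i)) = complex_of_real (monomial x \<alpha>) * q \<alpha> r" for \<alpha>
      proof -
        have t: "?y i ^ \<alpha> i / fact (\<alpha> i) = complex_of_real (x $ i ^ \<alpha> i) * ((- (\<i> * complex_of_real (r $ i))) ^ \<alpha> i / fact (\<alpha> i))" for i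
        proof -
          have "?y i = complex_of_real (x $ i) * (- (\<i> * complex_of_real (r $ i)))" by simp
          then show ?thesis by (simp only: power_mult_distrib of_real_power times_divide_eq_right)
        qed
        show ?thesis by (simp only: t monomial_def q_def of_real_prod prod.distrib)
      qed
      ultimately show ?thesis by (simp add: e_def M_def)
    qed
    have Tpos: "0 \<le> ?T - (\<Sum>\<alpha>\<in>A. M \<alpha>)" if "finite A" for A
      using finite_sum_le_has_sum [OF M_sum that] M0 by simp
    have diff: "periodize (phase_mult (- (k0 + x)) f) - (\<Sum>\<alpha>\<in>A. monomial x \<alpha> *\<^sub>R a \<alpha>)
        = periodize (\<lambda>r. cscale (e A r) (F r))" for A
    proof
      fix r :: "real^'d"
      let ?S = "{R \<in> L. norm R \<le> norm r + \<rho>}"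
      have per: "periodize (\<lambda>r. cscale (c r) (F r)) r = (\<Sum>R\<in>?S. cscale (c (r - R)) (F (r - R)))" for c
        by (rule periodize_eq [OF sF]) (auto simp: finite_L_cball)
      have ph: "phase_mult (- (k0 + x)) f = (\<lambda>r. cscale (cis (- (x \<bullet> r))) (F r))"
        by (simp add: F_def phase_mult_def fun_eq_iff cis_mult inner_add_left inner_diff_left add.commute)
      have "(\<Sum>\<alpha>\<in>A. monomial x \<alpha> *\<^sub>R a \<alpha>) r = (\<Sum>\<alpha>\<in>A. \<Sum>R\<in>?S. cscale (complex_of_real (monomial x \<alpha>) * q \<alpha> (r - R)) (F (r - R)))"
        by (simp add: sum_fun_apply a_def per scaleR_sum_right scaleR_cscale)
      also have "\<dots> = (\<Sum>R\<in>?S. \<Sum>\<alpha>\<in>A. cscale (complex_of_real (monomial x \<alpha>) * q \<alpha> (r - R)) (F (r - R)))"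
        by (rule sum.swap)
      finally have sum_eq: "(\<Sum>\<alpha>\<in>A. monomial x \<alpha> *\<^sub>R a \<alpha>) r
          = (\<Sum>R\<in>?S. \<Sum>\<alpha>\<in>A. cscale (complex_of_real (monomial x \<alpha>) * q \<alpha> (r - R)) (F (r - R)))" .
      show "(periodize (phase_mult (- (k0 + x)) f) - (\<Sum>\<alpha>\<in>A. monomial x \<alpha> *\<^sub>R a \<alpha>)) r
        = periodize (\<lambda>r. cscale (e A r) (F r)) r"
        unfolding minus_apply ph per sum_eq
        by (simp add: e_def cscale_diff_left cscale_sum_left sum_subtractf)
    qed
    have "((\<lambda>A. (?T - (\<Sum>\<alpha>\<in>A. M \<alpha>)) * ?PB) \<longlongrightarrow> (?T - ?T) * ?PB) (finite_subsets_at_top UNIV)"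
      using M_sum unfolding has_sum_def by (intro tendsto_intros)
    then have lim: "((\<lambda>A. (?T - (\<Sum>\<alpha>\<in>A. M \<alpha>)) * ?PB) \<longlongrightarrow> 0) (finite_subsets_at_top UNIV)" by simp
    show "((\<lambda>A. cell_norm L (periodize (phase_mult (- (k0 + x)) f) - (\<Sum>\<alpha>\<in>A. monomial x \<alpha> *\<^sub>R a \<alpha>))) \<longlongrightarrow> 0)
        (finite_subsets_at_top UNIV)"
    proof (rule tendsto_sandwich [OF _ _ tendsto_const lim])
      show "\<forall>\<^sub>F A in finite_subsets_at_top UNIV.
          cell_norm L (periodize (phase_mult (- (k0 + x)) f) - (\<Sum>\<alpha>\<in>A. monomial x \<alpha> *\<^sub>R a \<alpha>))
          \<le> (?T - (\<Sum>\<alpha>\<in>A. M \<alpha>)) * ?PB"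
        unfolding eventually_finite_subsets_at_top
      proof (intro exI [of _ "{}"] conjI allI impI)
        fix A :: "('d \<Rightarrow> nat) set" assume "finite A \<and> {} \<subseteq> A \<and> A \<subseteq> UNIV"
        then have A: "finite A" by simp
        show "cell_norm L (periodize (phase_mult (- (k0 + x)) f) - (\<Sum>\<alpha>\<in>A. monomial x \<alpha> *\<^sub>R a \<alpha>))
          \<le> (?T - (\<Sum>\<alpha>\<in>A. M \<alpha>)) * ?PB"
          unfolding diff
        proof (rule cell_norm_periodize_le [OF F])
          show "(\<lambda>r. cscale (e A r) (F r)) \<in> locally_L2"
            by (rule mult_L2 [OF e_meas e_le [OF A] Tpos [OF A]])
          show "norm (cscale (e A r) (F r)) \<le> (?T - (\<Sum>\<alpha>\<in>A. M \<alpha>)) * norm (F r)" for r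
            by (rule mult_le) (rule e_le [OF A])
        qed (rule Fs, assumption, rule Tpos [OF A])
      qed simp_all
    qed (simp add: always_eventually)
  qed
  then show "\<exists>\<rho>>0. \<exists>a. power_series_on (bloch L 0) (cell_norm L) \<rho> (\<lambda>x. periodize (phase_mult (- (k0 + x)) f)) a"
    by (intro exI [of _ 1] conjI exI) simp_all
qed

end

subsection \<open>Continuous families\<close>

context lattice
begin

text \<open>Continuity in the seminorm over a cell. The distance to \<open>u k0\<close> vanishes at
  \<open>k0\<close>, so \<open>isCont\<close> says that it tends to 0. The parameter space is
  general in order to allow pairs of wavevectors.\<close>

definition ncont :: "('a::t2_space \<Rightarrow> real^'d \<Rightarrow> complex^'v::finite^'m::finite) \<Rightarrow> bool" where
  "ncont u \<longleftrightarrow> (\<forall>k. u k \<in> locally_L2) \<and> (\<forall>k0. isCont (\<lambda>k. cell_norm L (\<lambda>r. u k r - u k0 r)) k0)"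

lemma ncont_I:
  assumes "\<And>k. u k \<in> locally_L2" "\<And>k0. ((\<lambda>k. cell_norm L (\<lambda>r. u k r - u k0 r)) \<longlongrightarrow> 0) (at k0)"
  shows "ncont u"
  using assms by (simp add: ncont_def isCont_def)

lemma ncont_tendsto: "ncont u \<Longrightarrow> ((\<lambda>k. cell_norm L (\<lambda>r. u k r - u k0 r)) \<longlongrightarrow> 0) (at k0)"
  by (simp add: ncont_def isCont_def)

lemma ncont_compose:
  assumes u: "ncont u" and g: "continuous_on UNIV g"
  shows "ncont (\<lambda>x. u (g x))"
  unfolding ncont_def
proof (intro conjI allI)
  fix x show "u (g x) \<in> locally_L2" using u by (simp add: ncont_def)
  have "isCont g x" using g by (simp add: continuous_on_eq_continuous_at)
  moreover have "isCont (\<lambda>k. cell_norm L (\<lambda>r. u k r - u (g x) r)) (g x)" using u by (simp add: ncont_def)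
  ultimately show "isCont (\<lambda>y. cell_norm L (\<lambda>r. u (g y) r - u (g x) r)) x" by (rule isCont_o2)
qed

lemma continuous_on_cell_inner:
  assumes u: "ncont u" and w: "ncont w"
  shows "continuous_on UNIV (\<lambda>k. cell_inner L (u k) (w k))"
  unfolding continuous_on_eq_continuous_at [OF open_UNIV] isCont_def
proof
  fix k0
  have L2: "u k \<in> locally_L2" "w k \<in> locally_L2" for k using u w by (auto simp: ncont_def)
  let ?a = "\<lambda>k. cell_norm L (\<lambda>r. u k r - u k0 r)" and ?b = "\<lambda>k. cell_norm L (\<lambda>r. w k r - w k0 r)"
  have "((\<lambda>k. cell_inner L (u k) (w k) - cell_inner L (u k0) (w k0)) \<longlongrightarrow> 0) (at k0)"
  proof (rule Lim_null_comparison)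
    show "((\<lambda>k. ?a k * (cell_norm L (w k0) + ?b k) + cell_norm L (u k0) * ?b k) \<longlongrightarrow> 0) (at k0)"
      using ncont_tendsto [OF u, of k0] ncont_tendsto [OF w, of k0]
      by (auto intro!: tendsto_eq_intros)
    show "\<forall>\<^sub>F k in at k0. norm (cell_inner L (u k) (w k) - cell_inner L (u k0) (w k0))
        \<le> ?a k * (cell_norm L (w k0) + ?b k) + cell_norm L (u k0) * ?b k"
    proof (rule always_eventually, rule allI)
      fix k
      have du: "(\<lambda>r. u k r - u k0 r) \<in> locally_L2" and dw: "(\<lambda>r. w k r - w k0 r) \<in> locally_L2"
        by (intro locally_L2_minus L2)+
      have "cell_inner L (u k) (w k) - cell_inner L (u k0) (w k0)
          = cell_inner L (\<lambda>r. u k r - u k0 r) (w k) + cell_inner L (u k0) (\<lambda>r. w k r - w k0 r)"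
        by (simp add: cell_inner_diff_left L2 cell_inner_diff_right)
      then have "norm (cell_inner L (u k) (w k) - cell_inner L (u k0) (w k0))
          \<le> norm (cell_inner L (\<lambda>r. u k r - u k0 r) (w k)) + norm (cell_inner L (u k0) (\<lambda>r. w k r - w k0 r))"
        by (simp only: norm_triangle_ineq)
      also have "\<dots> \<le> ?a k * cell_norm L (w k) + cell_norm L (u k0) * ?b k"
        by (intro add_mono cell_inner_le L2 du dw)
      also have "cell_norm L (w k) \<le> cell_norm L (w k0) + ?b k"
        using cell_norm_triangle [OF L2(2) [of k0] dw] by simp
      finally show "norm (cell_inner L (u k) (w k) - cell_inner L (u k0) (w k0))
        \<le> ?a k * (cell_norm L (w k0) + ?b k) + cell_norm L (u k0) * ?b k"
        by (simp add: mult_left_mono)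
    qed
  qed
  then show "((\<lambda>k. cell_inner L (u k) (w k)) \<longlongrightarrow> cell_inner L (u k0) (w k0)) (at k0)"
    by (simp add: LIM_zero_iff)
qed

text \<open>Chord against arc: the chord has length 2 |sin ((a - b) / 2)|.\<close>

lemma cmod_cis_diff_le: "cmod (cis a - cis b) \<le> \<bar>a - b\<bar>"
proof -
  have "(cmod (cis a - cis b))\<^sup>2 = (cos a - cos b)\<^sup>2 + (sin a - sin b)\<^sup>2"
    by (simp add: cmod_power2)
  also have "\<dots> = 2 - 2 * cos (a - b)"
  proof -
    have "(cos a - cos b)\<^sup>2 + (sin a - sin b)\<^sup>2
        = ((sin a)\<^sup>2 + (cos a)\<^sup>2) + ((sin b)\<^sup>2 + (cos b)\<^sup>2) - 2 * (cos a * cos b + sin a * sin b)"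
      by (simp add: power2_diff algebra_simps)
    then show ?thesis by (simp add: cos_diff)
  qed
  also have "\<dots> = 4 * (sin ((a - b) / 2))\<^sup>2"
  proof -
    have "2 * ((a - b) / 2) = a - b" by simp
    then show ?thesis using cos_double_sin [of "(a - b) / 2"] by (simp only:) simp
  qed
  also have "\<dots> \<le> 4 * ((a - b) / 2)\<^sup>2"
  proof -
    have "\<bar>sin ((a - b) / 2)\<bar> \<le> \<bar>(a - b) / 2\<bar>" by (rule abs_sin_x_le_abs_x)
    then show ?thesis by (simp only: abs_le_square_iff mult_left_mono)
  qed
  also have "\<dots> = \<bar>a - b\<bar>\<^sup>2" by (simp add: power_divide)
  finally show ?thesis by (rule power2_le_imp_le) simp
qed

text \<open>Passing from periodic parts to Bloch functions preserves continuity because on the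
  bounded cell the plane wave is Lipschitz in \<open>k\<close> with constant
  \<open>cell_radius\<close>.\<close>

lemma ncont_phase_mult:
  fixes u :: "real^'d \<Rightarrow> real^'d \<Rightarrow> complex^'v::finite^'m::finite"
  assumes u: "ncont u"
  shows "ncont (\<lambda>k. phase_mult k (u k))"
proof (rule ncont_I)
  have L2: "u k \<in> locally_L2" for k using u by (simp add: ncont_def)
  then show "phase_mult k (u k) \<in> locally_L2" for k by (rule phase_mult_locally_L2)
  fix k0
  let ?b = "\<lambda>k. cell_norm L (\<lambda>r. u k r - u k0 r) + cell_radius * norm (k - k0) * cell_norm L (u k0)"
  show "((\<lambda>k. cell_norm L (\<lambda>r. phase_mult k (u k) r - phase_mult k0 (u k0) r)) \<longlongrightarrow> 0) (at k0)"
  proof (rule tendsto_sandwich [of "\<lambda>_. 0", OF _ _ tendsto_const])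
    show "\<forall>\<^sub>F k in at k0. cell_norm L (\<lambda>r. phase_mult k (u k) r - phase_mult k0 (u k0) r) \<le> ?b k"
    proof (rule always_eventually, rule allI)
      fix k
      let ?g1 = "\<lambda>r. phase_mult k (\<lambda>r. u k r - u k0 r) r" and ?g2 = "\<lambda>r. phase_mult k (u k0) r - phase_mult k0 (u k0) r"
      have m: "?g1 \<in> locally_L2" "?g2 \<in> locally_L2"
        by (intro locally_L2_minus phase_mult_locally_L2 L2)+
      have "(\<lambda>r. phase_mult k (u k) r - phase_mult k0 (u k0) r) = (\<lambda>r. ?g1 r + ?g2 r)"
        by (simp add: phase_mult_simps)
      then have "cell_norm L (\<lambda>r. phase_mult k (u k) r - phase_mult k0 (u k0) r) \<le> cell_norm L ?g1 + cell_norm L ?g2"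
        using cell_norm_triangle [OF m] by simp
      also have "cell_norm L ?g1 = cell_norm L (\<lambda>r. u k r - u k0 r)" by (rule cell_norm_phase_mult)
      also have "cell_norm L ?g2 \<le> cell_norm L (\<lambda>r. (cell_radius * norm (k - k0)) *\<^sub>R u k0 r)"
      proof (rule cell_norm_mono [OF m(2) locally_L2_scaleR [OF L2]])
        fix r assume r: "r \<in> cell"
        have "norm (?g2 r) = cmod (cis (k \<bullet> r) - cis (k0 \<bullet> r)) * norm (u k0 r)"
          by (simp add: phase_mult_def cscale_diff_left [symmetric] norm_cscale)
        also have "\<dots> \<le> (cell_radius * norm (k - k0)) * norm (u k0 r)"
        proof (rule mult_right_mono)
          have "cmod (cis (k \<bullet> r) - cis (k0 \<bullet> r)) \<le> \<bar>(k - k0) \<bullet> r\<bar>"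
            using cmod_cis_diff_le by (simp add: inner_diff_left)
          also have "\<dots> \<le> norm (k - k0) * norm r" by (rule Cauchy_Schwarz_ineq2)
          also have "\<dots> \<le> norm (k - k0) * cell_radius"
            by (intro mult_left_mono norm_cell_le r) simp
          finally show "cmod (cis (k \<bullet> r) - cis (k0 \<bullet> r)) \<le> cell_radius * norm (k - k0)" by (simp add: mult.commute)
        qed simp
        finally show "norm (?g2 r) \<le> norm ((cell_radius * norm (k - k0)) *\<^sub>R u k0 r)"
          using cell_radius_nonneg by simp
      qed
      finally show "cell_norm L (\<lambda>r. phase_mult k (u k) r - phase_mult k0 (u k0) r) \<le> ?b k"
        using cell_radius_nonneg by simp
    qed
    show "(?b \<longlongrightarrow> 0) (at k0)"
      using ncont_tendsto [OF u, of k0] by (auto intro!: tendsto_eq_intros)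
  qed (simp_all add: always_eventually)
qed

lemma ncont_cscale:
  assumes u: "ncont u" and c: "continuous_on UNIV c"
  shows "ncont (\<lambda>k r. cscale (c k) (u k r))"
proof (rule ncont_I)
  have L2: "u k \<in> locally_L2" for k using u by (simp add: ncont_def)
  then show "(\<lambda>r. cscale (c k) (u k r)) \<in> locally_L2" for k by (rule locally_L2_cscale)
  fix k0
  let ?b = "\<lambda>k. cmod (c k) * cell_norm L (\<lambda>r. u k r - u k0 r) + cmod (c k - c k0) * cell_norm L (u k0)"
  show "((\<lambda>k. cell_norm L (\<lambda>r. cscale (c k) (u k r) - cscale (c k0) (u k0 r))) \<longlongrightarrow> 0) (at k0)"
  proof (rule tendsto_sandwich [of "\<lambda>_. 0", OF _ _ tendsto_const])
    show "\<forall>\<^sub>F k in at k0. cell_norm L (\<lambda>r. cscale (c k) (u k r) - cscale (c k0) (u k0 r)) \<le> ?b k"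
    proof (rule always_eventually, rule allI)
      fix k
      have "(\<lambda>r. cscale (c k) (u k r) - cscale (c k0) (u k0 r))
          = (\<lambda>r. cscale (c k) (u k r - u k0 r) + cscale (c k - c k0) (u k0 r))"
        by (simp add: cscale_diff_left cscale_diff_right)
      then show "cell_norm L (\<lambda>r. cscale (c k) (u k r) - cscale (c k0) (u k0 r)) \<le> ?b k"
        using cell_norm_triangle [OF locally_L2_cscale [OF locally_L2_minus [OF L2 L2]] locally_L2_cscale [OF L2],
            of "c k" k k0 "c k - c k0" k0] by simp
    qed
    have "(c \<longlongrightarrow> c k0) (at k0)" using c by (simp add: continuous_on_eq_continuous_at isCont_def)
    then show "(?b \<longlongrightarrow> 0) (at k0)"
      using ncont_tendsto [OF u, of k0] by (auto intro!: tendsto_eq_intros)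
  qed (simp_all add: always_eventually)
qed

lemma ncont_sum:
  assumes "\<And>i. i \<in> I \<Longrightarrow> ncont (u i)"
  shows "ncont (\<lambda>k r. \<Sum>i\<in>I. u i k r)"
  using assms
proof (induction I rule: infinite_finite_induct)
  case (insert i I)
  define U where "U = (\<lambda>k r. \<Sum>i\<in>I. u i k r)"
  have U: "ncont U" and ui: "ncont (u i)" using insert by (auto simp: U_def)
  have "ncont (\<lambda>k r. u i k r + U k r)"
  proof (rule ncont_I)
    have L2: "u i k \<in> locally_L2" "U k \<in> locally_L2" for k using U ui by (auto simp: ncont_def)
    then show "(\<lambda>r. u i k r + U k r) \<in> locally_L2" for k by (intro locally_L2_plus)
    fix k0
    let ?b = "\<lambda>k. cell_norm L (\<lambda>r. u i k r - u i k0 r) + cell_norm L (\<lambda>r. U k r - U k0 r)"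
    show "((\<lambda>k. cell_norm L (\<lambda>r. u i k r + U k r - (u i k0 r + U k0 r))) \<longlongrightarrow> 0) (at k0)"
    proof (rule tendsto_sandwich [of "\<lambda>_. 0", OF _ _ tendsto_const])
      show "\<forall>\<^sub>F k in at k0. cell_norm L (\<lambda>r. u i k r + U k r - (u i k0 r + U k0 r)) \<le> ?b k"
      proof (rule always_eventually, rule allI)
        fix k
        show "cell_norm L (\<lambda>r. u i k r + U k r - (u i k0 r + U k0 r)) \<le> ?b k"
          using cell_norm_triangle [OF locally_L2_minus [OF L2(1) L2(1)] locally_L2_minus [OF L2(2) L2(2)], of k k0 k k0]
          by (simp add: add_diff_add)
      qed
      show "(?b \<longlongrightarrow> 0) (at k0)"
        using ncont_tendsto [OF U, of k0] ncont_tendsto [OF ui, of k0] by (auto intro!: tendsto_eq_intros)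
    qed (simp_all add: always_eventually)
  qed
  then show ?case using insert by (simp add: U_def)
qed (simp_all add: ncont_def)

end

subsection \<open>Simple bands\<close>

context msg
begin

abbreviation "ip \<equiv> cell_inner (bravais G)"
abbreviation "nm \<equiv> cell_norm (bravais G)"

lemma band_hat:
  assumes "band G N E" "p \<in> P" "R \<in> bravais G" "f \<in> E k"
  shows "hat G (p, R) f \<in> E (kact p k)"
proof -
  have "(p, R) \<in> carrier (space_group G)" using assms by (simp add: space_group_simps)
  then have "hat G (p, R) ` E k = E (kact p k)"
    using assms(1) unfolding band_def kact_def by auto
  then show ?thesis using assms(4) by blast
qed

lemma ip_self_unit: "nm f = 1 \<Longrightarrow> ip f f = 1"
  by (simp add: cell_inner_self)

lemma simple_band_frame:
  assumes "band G 1 E"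
  obtains b where "b \<in> bloch (bravais G) k" "nm b = 1" "b \<in> E k"
    "E k = {f \<in> bloch (bravais G) k. \<exists>c. AE r in lborel. f r = cscale c (b r)}"
proof -
  obtain b' :: "nat \<Rightarrow> _" where ob: "orthonormal_basis (bravais G) k {..<1} b' (E k)"
    using assms unfolding band_def by blast
  define b where "b = b' 0"
  have b: "b \<in> bloch (bravais G) k" and b1: "ip b b = 1"
    using ob by (auto simp: orthonormal_basis_def b_def)
  have "of_real ((nm b)\<^sup>2) = (1 :: complex)" using b1 by (simp add: cell_inner_self)
  then have "(nm b)\<^sup>2 = 1" by (simp only: of_real_eq_1_iff)
  then have n: "nm b = 1" using cell_norm_nonneg [of b] by (simp add: power2_eq_1_iff)
  have E: "E k = {f \<in> bloch (bravais G) k. \<exists>c. AE r in lborel. f r = cscale c (b r)}"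
  proof -
    have "(\<exists>c :: nat \<Rightarrow> complex. AE r in lborel. f r = (\<Sum>i\<in>{..<1}. cscale (c i) (b' i r)))
        \<longleftrightarrow> (\<exists>c. AE r in lborel. f r = cscale c (b r))" for f
    proof
      assume "\<exists>c. AE r in lborel. f r = cscale c (b r)"
      then obtain c where "AE r in lborel. f r = cscale c (b r)" ..
      then show "\<exists>c :: nat \<Rightarrow> complex. AE r in lborel. f r = (\<Sum>i\<in>{..<1}. cscale (c i) (b' i r))"
        by (intro exI [of _ "\<lambda>_. c"]) (simp add: b_def)
    qed (auto simp: b_def)
    then show ?thesis using ob unfolding orthonormal_basis_def by simp
  qed
  have "b \<in> E k" unfolding E using b by (intro CollectI conjI exI [of _ 1]) simp_all
  with b n E show ?thesis by (intro that)
qed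

lemma simple_band_span:
  assumes band: "band G 1 E" and phi: "\<phi> \<in> E k" "nm \<phi> = 1"
  shows "\<phi> \<in> bloch (bravais G) k"
    and "\<psi> \<in> E k \<Longrightarrow> \<psi> \<in> bloch (bravais G) k \<and> (AE r in lborel. \<psi> r = cscale (ip \<phi> \<psi>) (\<phi> r))"
    and "g \<in> bloch (bravais G) k \<Longrightarrow> AE r in lborel. g r = cscale c (\<phi> r) \<Longrightarrow> g \<in> E k"
proof -
  obtain b where b: "b \<in> bloch (bravais G) k" "nm b = 1"
    "E k = {f \<in> bloch (bravais G) k. \<exists>c. AE r in lborel. f r = cscale c (b r)}" and "b \<in> E k"
    by (rule simple_band_frame [OF band, of k])
  obtain d where d: "\<phi> \<in> bloch (bravais G) k" "AE r in lborel. \<phi> r = cscale d (b r)"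
    using phi(1) unfolding b(3) by blast
  show "\<phi> \<in> bloch (bravais G) k" by (rule d(1))
  have bL: "b \<in> locally_L2" and phiL: "\<phi> \<in> locally_L2"
    using b(1) d(1) by (simp_all add: bloch_locally_L2)
  have "nm \<phi> = nm (\<lambda>r. cscale d (b r))"
    by (rule cell_norm_AE_cong [OF phiL locally_L2_cscale [OF bL] d(2)])
  then have d1: "cmod d = 1" using phi b by simp
  then have dd: "cnj d * d = 1" by (simp add: complex_norm_square [symmetric] mult.commute)
  show "g \<in> E k" if "g \<in> bloch (bravais G) k" "AE r in lborel. g r = cscale c (\<phi> r)"
  proof -
    have "AE r in lborel. g r = cscale (c * d) (b r)" using that(2) d(2) by eventually_elim simp
    then show ?thesis unfolding b(3) using that(1) by blast
  qed
  assume "\<psi> \<in> E k"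
  then obtain c where c: "\<psi> \<in> bloch (bravais G) k" "AE r in lborel. \<psi> r = cscale c (b r)"
    unfolding b(3) by blast
  have "ip \<phi> \<psi> = ip (\<lambda>r. cscale d (b r)) (\<lambda>r. cscale c (b r))"
    by (rule cell_inner_AE_cong) (use c d bL phiL in \<open>auto intro: bloch_locally_L2\<close>)
  also have "\<dots> = c * cnj d" by (simp add: cell_inner_cscale_left cell_inner_cscale_right ip_self_unit b)
  finally have ip: "ip \<phi> \<psi> = c * cnj d" .
  have "AE r in lborel. \<psi> r = cscale (ip \<phi> \<psi>) (\<phi> r)"
    using c(2) d(2) by eventually_elim (simp add: ip mult.assoc dd)
  with c(1) show "\<psi> \<in> bloch (bravais G) k \<and> (AE r in lborel. \<psi> r = cscale (ip \<phi> \<psi>) (\<phi> r))" by blast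
qed

text \<open>\<open>proj\<close> picks some element of the fibre with orthogonal remainder. The fibre
  is a complex line, so any such pick agrees almost everywhere with the rank one formula.\<close>

lemma simple_band_proj:
  assumes band: "band G 1 E" and phi: "\<phi> \<in> E k" "nm \<phi> = 1" and f: "f \<in> bloch (bravais G) k"
  shows "proj (bravais G) (E k) f \<in> E k"
    and "AE r in lborel. proj (bravais G) (E k) f r = cscale (ip \<phi> f) (\<phi> r)"
proof -
  note span = simple_band_span [OF band phi]
  have phiL: "\<phi> \<in> locally_L2" and fL: "f \<in> locally_L2" using span(1) f by (simp_all add: bloch_locally_L2)
  let ?g = "\<lambda>r. cscale (ip \<phi> f) (\<phi> r)"
  have gL: "?g \<in> locally_L2" using phiL by (rule locally_L2_cscale)
  have gE: "?g \<in> E k" by (rule span(3) [of _ "ip \<phi> f"]) (simp_all add: bloch_cscale span(1))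
  have orth0: "ip h (\<lambda>r. f r - ?g r) = 0" if h: "h \<in> E k" for h
  proof -
    have hL: "h \<in> locally_L2" and ae: "AE r in lborel. h r = cscale (ip \<phi> h) (\<phi> r)"
      using span(2) [OF h] by (auto intro: bloch_locally_L2)
    have "ip h (\<lambda>r. f r - ?g r) = ip (\<lambda>r. cscale (ip \<phi> h) (\<phi> r)) (\<lambda>r. f r - ?g r)"
      by (rule cell_inner_AE_cong [OF hL locally_L2_cscale [OF phiL] _ _ ae])
        (intro locally_L2_minus fL gL, intro locally_L2_minus fL gL, simp)
    also have "\<dots> = cnj (ip \<phi> h) * (ip \<phi> f - ip \<phi> f)"
      by (simp only: cell_inner_cscale_left cell_inner_diff_right [OF phiL fL gL] cell_inner_cscale_right
          ip_self_unit [OF phi(2)] mult_1_right)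
    finally show ?thesis by simp
  qed
  let ?Q = "\<lambda>g. g \<in> E k \<and> (\<forall>h\<in>E k. ip h (f - g) = 0)"
  have "?Q ?g" using gE orth0 by (simp add: fun_diff_def)
  then have Q: "?Q (proj (bravais G) (E k) f)" unfolding proj_def by (rule someI [of ?Q])
  then show pE: "proj (bravais G) (E k) f \<in> E k" by blast
  have pL: "proj (bravais G) (E k) f \<in> locally_L2" using span(2) [OF pE] by (auto intro: bloch_locally_L2)
  have "ip \<phi> (\<lambda>r. f r - proj (bravais G) (E k) f r) = 0"
    using Q phi(1) by (simp add: fun_diff_def)
  then have "ip \<phi> (proj (bravais G) (E k) f) = ip \<phi> f"
    by (simp add: cell_inner_diff_right [OF phiL fL pL])
  then show "AE r in lborel. proj (bravais G) (E k) f r = cscale (ip \<phi> f) (\<phi> r)"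
    using span(2) [OF pE] by simp
qed

lemma section_ncont:
  assumes "continuous_unit_section G E \<phi>" "\<And>k. \<phi> k \<in> bloch (bravais G) k"
  shows "ncont (\<lambda>k. phase_mult (- k) (\<phi> k))"
  by (rule ncont_I)
    (use assms in \<open>auto simp: continuous_unit_section_def fun_diff_def intro: phase_mult_locally_L2 bloch_locally_L2\<close>)

lemma section_phase:
  assumes band: "band G 1 E" and sec: "continuous_unit_section G E \<phi>" and a: "continuous_on UNIV a"
  shows "continuous_unit_section G E (\<lambda>k r. cscale (cis (a k)) (\<phi> k r))"
proof -
  have phi: "\<phi> k \<in> E k" "nm (\<phi> k) = 1" for k using sec by (auto simp: continuous_unit_section_def)
  note span = simple_band_span [OF band phi]
  have "continuous_on UNIV (\<lambda>k. cis (a k))" by (intro continuous_intros a)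
  from ncont_cscale [OF section_ncont [OF sec span(1)] this]
  have "ncont (\<lambda>k r. cscale (cis (a k)) (phase_mult (- k) (\<phi> k) r))" .
  from ncont_tendsto [OF this] show ?thesis
    unfolding continuous_unit_section_def
    by (auto simp: phase_mult_simps fun_diff_def phi intro!: span(3) bloch_cscale span(1))
qed

end

subsection \<open>A periodic section from a vanishing Chern class\<close>

context msg
begin

text \<open>A vanishing integral cocycle makes \<open>f\<close> an additive cocycle of the
  reciprocal lattice with values in real continuous functions. Averaging it with a partition of
  unity, here an unnormalised \<open>bump\<close> summed over the lattice, writes it as the
  coboundary of a continuous \<open>g\<close>; a phase built from \<open>- g\<close> then removes
  the transition functions.\<close>

lemma periodic_section:
  fixes E :: "('d, 'v, 'm::finite) fibres"
  assumes band: "band G 1 E" and chern: "(\<lambda>K K'. 0) \<in> first_chern_class G E"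
  obtains \<phi> where "continuous_unit_section G E \<phi>"
    "\<And>k K. K \<in> reciprocal G \<Longrightarrow> AE r in lborel. \<phi> (k + K) r = \<phi> k r"
proof -
  obtain \<phi>0 f where sec: "continuous_unit_section G E \<phi>0"
    and fc: "\<And>K. K \<in> reciprocal G \<Longrightarrow> continuous_on UNIV (f K)"
    and tr: "\<And>K k. K \<in> reciprocal G \<Longrightarrow> AE r in lborel. \<phi>0 (k + K) r = cscale (cis (2 * pi * f K k)) (\<phi>0 k r)"
    and cc0: "\<And>K K' k. K \<in> reciprocal G \<Longrightarrow> K' \<in> reciprocal G \<Longrightarrow>
      real_of_int 0 = f K (k + K') + f K' k - f (K + K') k"
    using chern unfolding first_chern_class_def by blast
  \<comment> \<open>The cocycle identity with integer part 0, solved for the term that a shift of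
    the argument by \<open>K'\<close> will produce.\<close>
  have cc: "f (K - K') (k + K') = f K k - f K' k" if "K \<in> reciprocal G" "K' \<in> reciprocal G" for K K' k
    using cc0 [of "K - K'" K' k] that by simp
  \<comment> \<open>One more than the covering radius, so that every point has a translate at which
    \<open>bump\<close> is at least 1.\<close>
  define \<rho> where "\<rho> = dual.cell_radius + 1"
  define bump where "bump x = max 0 (\<rho> - norm x)" for x :: "real^'d"
  define S where "S \<sigma> = {K \<in> reciprocal G. norm K \<le> \<sigma>}" for \<sigma>
  have S: "finite (S \<sigma>)" "S \<sigma> \<subseteq> reciprocal G" for \<sigma> by (auto simp: S_def dual.finite_L_cball)
  \<comment> \<open>The sum of \<open>bump (k + K) * h K k\<close> over all reciprocal vectors
    \<open>K\<close>; the finite range contains all nonzero terms.\<close>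
  define T where "T h k = (\<Sum>K\<in>S (norm k + \<rho>). bump (k + K) * h K k)" for h :: "real^'d \<Rightarrow> real^'d \<Rightarrow> real" and k
  have T_eq: "T h k = (\<Sum>K\<in>A. bump (k + K) * h K k)" if A: "finite A" "A \<subseteq> reciprocal G" "S (norm k + \<rho>) \<subseteq> A" for h k A
    unfolding T_def
  proof (rule sum.mono_neutral_left [OF A(1,3)], rule ballI)
    fix K assume "K \<in> A - S (norm k + \<rho>)"
    then have "norm k + \<rho> < norm K" using A(2) by (auto simp: S_def)
    then have "\<rho> < norm (k + K)" using norm_triangle_ineq4 [of "k + K" k] by simp
    then show "bump (k + K) * h K k = 0" by (simp add: bump_def)
  qed
  have T_cont: "continuous_on UNIV (T h)" if h: "\<And>K. K \<in> reciprocal G \<Longrightarrow> continuous_on UNIV (h K)" for h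
    unfolding continuous_on_eq_continuous_at [OF open_UNIV]
  proof
    fix k0 :: "real^'d"
    let ?A = "S (norm k0 + 1 + \<rho>)"
    have "continuous_on (ball k0 1) (\<lambda>k. \<Sum>K\<in>?A. bump (k + K) * h K k)"
      unfolding bump_def using S(2) by (intro continuous_intros continuous_on_subset [OF h]) auto
    moreover have "T h k = (\<Sum>K\<in>?A. bump (k + K) * h K k)" if "k \<in> ball k0 1" for k
    proof (rule T_eq [OF S])
      have "norm k \<le> norm k0 + 1"
        using that norm_triangle_ineq2 [of k k0] by (simp add: dist_norm norm_minus_commute)
      then show "S (norm k + \<rho>) \<subseteq> ?A" by (auto simp: S_def)
    qed
    ultimately have "continuous_on (ball k0 1) (T h)"
      using continuous_on_cong [of "ball k0 1" "ball k0 1" "T h"] by simp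
    then show "isCont (T h) k0"
      by (simp add: continuous_on_eq_continuous_at)
  qed
  have T_shift: "T h (k + K') = T (\<lambda>K x. h (K - K') (x + K')) k" if K': "K' \<in> reciprocal G" for h k K'
  proof -
    let ?A = "S (norm k + norm K' + \<rho>)"
    have "T h (k + K') = (\<Sum>K\<in>?A. bump (k + K' + K) * h K (k + K'))"
    proof (rule T_eq [OF S])
      show "S (norm (k + K') + \<rho>) \<subseteq> ?A"
        using norm_triangle_ineq [of k K'] by (auto simp: S_def)
    qed
    also have "\<dots> = (\<Sum>K\<in>(\<lambda>K. K + K') ` ?A. bump (k + K) * h (K - K') (k + K'))"
      by (subst sum.reindex) (auto simp: inj_on_def ac_simps)
    also have "\<dots> = T (\<lambda>K x. h (K - K') (x + K')) k"
    proof (rule T_eq [symmetric])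
      show "finite ((\<lambda>K. K + K') ` ?A)" by (simp add: S)
      show "(\<lambda>K. K + K') ` ?A \<subseteq> reciprocal G" using S(2) K' by (auto simp: S_def)
      show "S (norm k + \<rho>) \<subseteq> (\<lambda>K. K + K') ` ?A"
      proof
        fix K assume K: "K \<in> S (norm k + \<rho>)"
        then have "K - K' \<in> ?A"
          using norm_triangle_ineq4 [of K K'] K' by (auto simp: S_def)
        then show "K \<in> (\<lambda>K. K + K') ` ?A" by (rule rev_image_eqI) simp
      qed
    qed
    finally show ?thesis .
  qed
  define W where "W = T (\<lambda>_ _. 1)"
  have W_shift: "W (k + K') = W k" if "K' \<in> reciprocal G" for k K'
    unfolding W_def by (rule T_shift [OF that])
  have W_pos: "0 < W k" for k
  proof -
    obtain K where K: "K \<in> reciprocal G" "norm (- k - K) \<le> dual.cell_radius"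
      using dual.ex_near_L by blast
    have "norm (- k - K) = norm (k + K)" by (metis minus_add_distrib norm_minus_cancel uminus_add_conv_diff add.commute)
    then have n: "norm (k + K) \<le> dual.cell_radius" using K by simp
    have "norm K \<le> norm (k + K) + norm k" using norm_triangle_ineq4 [of "k + K" k] by simp
    then have "K \<in> S (norm k + \<rho>)" using K n by (simp add: S_def \<rho>_def)
    then have "bump (k + K) \<le> W k"
      unfolding W_def T_def using member_le_sum [of K "S (norm k + \<rho>)" "\<lambda>K. bump (k + K) * 1"] S
      by (simp add: bump_def)
    moreover have "1 \<le> bump (k + K)" using n by (simp add: bump_def \<rho>_def)
    ultimately show ?thesis by linarith
  qed
  define F where "F = T f"
  have F_shift: "F (k + K') = F k - f K' k * W k" if K': "K' \<in> reciprocal G" for k K'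
  proof -
    have "F (k + K') = T (\<lambda>K x. f (K - K') (x + K')) k"
      unfolding F_def by (rule T_shift [OF K'])
    also have "\<dots> = (\<Sum>K\<in>S (norm k + \<rho>). bump (k + K) * f (K - K') (k + K'))"
      by (rule T_def)
    also have "\<dots> = (\<Sum>K\<in>S (norm k + \<rho>). bump (k + K) * f K k - f K' k * (bump (k + K) * 1))"
    proof (rule sum.cong)
      fix K assume "K \<in> S (norm k + \<rho>)"
      then have "K \<in> reciprocal G" using S(2) by blast
      then show "bump (k + K) * f (K - K') (k + K') = bump (k + K) * f K k - f K' k * (bump (k + K) * 1)"
        unfolding cc [OF \<open>K \<in> reciprocal G\<close> K'] by (simp add: algebra_simps)
    qed simp
    finally show ?thesis
      by (simp add: F_def W_def T_def sum_subtractf sum_distrib_left)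
  qed
  \<comment> \<open>By \<open>F_shift\<close> and the invariance of \<open>W\<close>, this weighted
    average has \<open>f\<close> as its coboundary.\<close>
  define g where "g k = - F k / W k" for k
  have g_shift: "g (k + K) = g k + f K k" if "K \<in> reciprocal G" for k K
    unfolding g_def F_shift [OF that] W_shift [OF that] using W_pos [of k] by (simp add: field_simps)
  have g_cont: "continuous_on UNIV g"
    unfolding g_def [abs_def]
  proof (intro continuous_intros)
    show "continuous_on UNIV F" unfolding F_def by (rule T_cont [OF fc])
    show "continuous_on UNIV W" unfolding W_def by (rule T_cont) (rule continuous_on_const)
    show "\<forall>x\<in>UNIV. W x \<noteq> 0" using W_pos by (metis less_irrefl)
  qed
  define \<phi> where "\<phi> = (\<lambda>k r. cscale (cis (- (2 * pi * g k))) (\<phi>0 k r))"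
  show ?thesis
  proof (rule that [of \<phi>])
    show "continuous_unit_section G E \<phi>"
      unfolding \<phi>_def by (rule section_phase [OF band sec]) (intro continuous_intros g_cont)
    fix k K assume K: "K \<in> reciprocal G"
    have e: "- (2 * pi * g (k + K)) + 2 * pi * f K k = - (2 * pi * g k)"
      unfolding g_shift [OF K] by (simp add: algebra_simps)
    show "AE r in lborel. \<phi> (k + K) r = \<phi> k r"
      using tr [OF K, of k]
    proof eventually_elim
      case (elim r)
      then show ?case by (simp only: \<phi>_def elim cscale_cscale cis_mult e)
    qed
  qed
qed

end

subsection \<open>A covariant section\<close>

context lattice
begin

text \<open>Additivity extends to integer multiples, so \<open>m\<close> is determined by its values
  on the basis; expanding in the dual basis gives \<open>w\<close>.\<close>

lemma additive_on_lattice_inner: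
  fixes m :: "real^'d \<Rightarrow> real"
  assumes add: "\<And>x y. x \<in> L \<Longrightarrow> y \<in> L \<Longrightarrow> m (x + y) = m x + m y"
  shows "\<exists>w. \<forall>x\<in>L. m x = x \<bullet> w"
proof -
  have bL: "lbasis $ i \<in> L" for i
  proof -
    have "lbasis $ i = comb (\<chi> j. if j = i then 1 else 0)"
      by (simp add: comb_eq if_distrib [where f = "\<lambda>x. x *\<^sub>R _"] cong: if_cong)
    then have "coord (lbasis $ i) = (\<chi> j. if j = i then 1 else 0)" by simp
    then show ?thesis by (simp add: mem_L_iff)
  qed
  have nat_mem: "real n *\<^sub>R x \<in> L" if "x \<in> L" for n x
    using that by (induction n) (simp_all add: scaleR_add_left)
  have m0: "m 0 = 0" using add [of 0 0] by simp
  have m_nat: "m (real n *\<^sub>R x) = real n * m x" if "x \<in> L" for n x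
    by (induction n) (simp_all add: m0 scaleR_add_left add that nat_mem distrib_right)
  have m_neg: "m (- x) = - m x" if "x \<in> L" for x
    using add [of x "- x"] that m0 by simp
  have int_mem: "real_of_int n *\<^sub>R x \<in> L" if "x \<in> L" for n x
    by (cases n rule: int_cases2) (use nat_mem [OF that] in auto)
  have m_int: "m (real_of_int n *\<^sub>R x) = real_of_int n * m x" if "x \<in> L" for n x
    by (cases n rule: int_cases2) (use nat_mem [OF that] m_nat [OF that] m_neg in auto)
  define w where "w = (\<Sum>j\<in>UNIV. (m (lbasis $ j) / (2 * pi)) *\<^sub>R (dual_basis $ j))"
  have bw: "lbasis $ i \<bullet> w = m (lbasis $ i)" for i
    by (simp add: w_def inner_sum_right lbasis_dual_basis if_distrib [where f = "\<lambda>x. _ * x"] cong: if_cong)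
  show ?thesis
  proof (intro exI ballI)
    fix x assume "x \<in> L"
    then obtain n where n: "x = comb (\<chi> i. real_of_int (n i))" by (rule L_coordE)
    have "m (\<Sum>i\<in>I. real_of_int (n i) *\<^sub>R (lbasis $ i)) = (\<Sum>i\<in>I. real_of_int (n i) * m (lbasis $ i))"
      if "finite I" for I
      using that
    proof (induction I rule: finite_induct)
      case (insert i I)
      have "(\<Sum>i\<in>I. real_of_int (n i) *\<^sub>R (lbasis $ i)) \<in> L" by (intro L_sum int_mem bL)
      then show ?case using insert by (simp add: add int_mem bL m_int)
    qed (simp add: m0)
    then show "m x = x \<bullet> w"
      by (simp add: n comb_eq inner_sum_left bw)
  qed
qed

end

lemma cis_eq_1_imp: "cis x = 1 \<Longrightarrow> \<exists>n::int. x = 2 * pi * real_of_int n"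
proof -
  assume "cis x = 1"
  then have "cos x = 1" by (metis cis.simps(1) one_complex.simps(1))
  then obtain n :: int where "x = real_of_int n * 2 * pi" unfolding cos_one_2pi_int by blast
  then show ?thesis by (intro exI [of _ n]) simp
qed

text \<open>A continuous function on a connected space with values in the discrete set of multiples
  of 2 pi.\<close>

lemma continuous_cis_eq_1_constant:
  fixes h :: "'a::real_normed_vector \<Rightarrow> real"
  assumes h: "continuous_on UNIV h" and c: "\<And>k. cis (h k) = 1"
  shows "h k = h k'"
proof -
  have "h constant_on UNIV"
  proof (rule continuous_discrete_range_constant [OF connected_UNIV h])
    fix x
    show "\<exists>e>0. \<forall>y. y \<in> UNIV \<and> h y \<noteq> h x \<longrightarrow> e \<le> norm (h y - h x)"
    proof (intro exI [of _ "2 * pi"] conjI allI impI)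
      fix y assume y: "y \<in> UNIV \<and> h y \<noteq> h x"
      obtain m n :: int where mn: "h y = 2 * pi * real_of_int m" "h x = 2 * pi * real_of_int n"
        using cis_eq_1_imp [OF c [of x]] cis_eq_1_imp [OF c [of y]] by blast
      then have "m \<noteq> n" using y by auto
      then have "1 \<le> \<bar>real_of_int m - real_of_int n\<bar>"
        by (metis of_int_diff of_int_abs of_int_1_le_iff zero_less_abs_iff int_one_le_iff_zero_less right_minus_eq)
      moreover have "norm (h y - h x) = 2 * pi * \<bar>real_of_int m - real_of_int n\<bar>"
        by (simp add: mn abs_mult right_diff_distrib [symmetric])
      ultimately show "2 * pi \<le> norm (h y - h x)" by simp
    qed simp
  qed
  then show ?thesis unfolding constant_on_def by auto
qed

text \<open>The domain is contractible, so a continuous logarithm exists; it is purely imaginary for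
  unimodular values.\<close>

lemma continuous_unit_log:
  fixes l :: "'a::real_normed_vector \<Rightarrow> complex"
  assumes l: "continuous_on UNIV l" and u: "\<And>k. cmod (l k) = 1"
  shows "\<exists>\<theta>. continuous_on UNIV \<theta> \<and> (\<forall>k. l k = cis (\<theta> k))"
proof -
  have "l k \<noteq> 0" for k using u [of k] by auto
  then obtain g where g: "continuous_on UNIV g" "\<And>k. l k = exp (g k)"
    using continuous_logarithm_on_contractible [OF l contractible_UNIV] by auto
  have "Re (g k) = 0" for k
    using u [of k] g(2) [of k] by simp
  then have "l k = cis (Im (g k))" for k
    by (simp add: g(2) exp_eq_polar)
  moreover have "continuous_on UNIV (\<lambda>k. Im (g k))" by (intro continuous_intros g(1))
  ultimately show ?thesis by blast
qed

context msg
begin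

text \<open>The logarithms \<open>\<theta> p\<close> of the phases form a twisted cocycle up to
  constants, and a real cocycle of a finite group is a coboundary, obtained by averaging. The
  correcting phase becomes periodic after a linear term \<open>k \<bullet> w\<close> is included;
  that term reappears as the translation \<open>A p *v w - w\<close>.\<close>

lemma covariant_section:
  fixes E :: "('d, 'v, 'm::finite) fibres"
  assumes band: "band G 1 E" and sec: "continuous_unit_section G E \<phi>"
    and per: "\<And>k K. K \<in> reciprocal G \<Longrightarrow> AE r in lborel. \<phi> (k + K) r = \<phi> k r"
  obtains \<phi>' w \<gamma> where "continuous_unit_section G E \<phi>'"
    "\<And>k K. K \<in> reciprocal G \<Longrightarrow> AE r in lborel. \<phi>' (k + K) r = \<phi>' k r"
    "\<And>p. p \<in> P \<Longrightarrow> A p *v w - w \<in> bravais G"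
    "\<And>p. p \<in> P \<Longrightarrow> cmod (\<gamma> p) = 1"
    "\<And>p k. p \<in> P \<Longrightarrow> AE r in lborel. hat G (p, A p *v w - w) (\<phi>' k) r = cscale (\<gamma> p) (\<phi>' (kact p k) r)"
proof -
  have phi: "\<phi> k \<in> E k" "nm (\<phi> k) = 1" for k using sec by (auto simp: continuous_unit_section_def)
  note span = simple_band_span [OF band phi]
  have phiL: "\<phi> k \<in> locally_L2" for k by (rule bloch_locally_L2 [OF span(1)])
  define U where "U k = phase_mult (- k) (\<phi> k)" for k
  have Ub: "U k \<in> bloch (bravais G) 0" for k unfolding U_def by (rule phase_mult_bloch_0 [OF span(1)])
  have Un: "ncont U" unfolding U_def [abs_def] by (rule section_ncont [OF sec span(1)])
  define l where "l p k = ip (\<phi> (kact p k)) (hat G (p, 0) (\<phi> k))" for p k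
  have hE: "hat G (p, 0) (\<phi> k) \<in> E (kact p k)" if "p \<in> P" for p k
    by (rule band_hat [OF band that _ phi(1)]) simp
  have hL: "hat G (p, 0) (\<phi> k) \<in> locally_L2" if "p \<in> P" for p k
    by (rule hat_locally_L2 [OF that _ phiL]) simp
  have rel: "AE r in lborel. hat G (p, 0) (\<phi> k) r = cscale (l p k) (\<phi> (kact p k) r)" if "p \<in> P" for p k
    using span(2) [OF hE [OF that]] unfolding l_def by blast
  have l1: "cmod (l p k) = 1" if p: "p \<in> P" for p k
  proof -
    have "nm (hat G (p, 0) (\<phi> k)) = nm (\<lambda>r. cscale (l p k) (\<phi> (kact p k) r))"
      by (rule cell_norm_AE_cong [OF hL [OF p] locally_L2_cscale [OF phiL] rel [OF p]])
    then show ?thesis using cell_norm_hat [OF p _ span(1), of 0 k] by (simp add: phi)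
  qed
  \<comment> \<open>In terms of periodic parts the phase is an inner product of two continuous
    families, from which the continuity of \<open>l p\<close> follows.\<close>
  have lU: "l p k = ip (U (kact p k)) (hat G (p, 0) (U k))" if p: "p \<in> P" for p k
  proof -
    have "hat G (p, 0) (U k) = phase_mult (- kact p k) (hat G (p, 0) (\<phi> k))"
      unfolding U_def by (subst hat_phase_mult [OF p]) simp_all
    then show ?thesis by (simp add: l_def U_def)
  qed
  have lc: "continuous_on UNIV (l p)" if p: "p \<in> P" for p
  proof -
    have "ncont (\<lambda>k. hat G (p, 0) (U k))"
    proof (rule ncont_I)
      show "hat G (p, 0) (U k) \<in> locally_L2" for k
        by (rule hat_locally_L2 [OF p _ bloch_locally_L2 [OF Ub]]) simp
      fix k0
      have "nm (\<lambda>r. hat G (p, 0) (U k) r - hat G (p, 0) (U k0) r) = nm (\<lambda>r. U k r - U k0 r)" for k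
        unfolding hat_minus [OF p L_closed(1), symmetric]
        by (rule cell_norm_hat [OF p L_closed(1) bloch_minus [OF Ub Ub]])
      then show "((\<lambda>k. nm (\<lambda>r. hat G (p, 0) (U k) r - hat G (p, 0) (U k0) r)) \<longlongrightarrow> 0) (at k0)"
        using ncont_tendsto [OF Un, of k0] by simp
    qed
    from continuous_on_cell_inner [OF ncont_compose [OF Un continuous_on_kact [of UNIV p]] this]
    show ?thesis using lU [OF p] by (simp add: fun_eq_iff [symmetric])
  qed
  have "\<forall>p\<in>P. \<exists>\<theta>. continuous_on UNIV \<theta> \<and> (\<forall>k. l p k = cis (\<theta> k))"
    using continuous_unit_log [OF lc l1] by blast
  then obtain \<theta> where th: "\<forall>p\<in>P. continuous_on UNIV (\<theta> p) \<and> (\<forall>k. l p k = cis (\<theta> p k))"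
    by (rule bchoice [THEN exE])
  have thc: "continuous_on UNIV (\<theta> p)" and thl: "l p k = cis (\<theta> p k)" if "p \<in> P" for p k
    using th that by blast+
  \<comment> \<open>\<open>l p\<close> is periodic, so a reciprocal translation changes its
    logarithm by a multiple of 2 pi, and by continuity this multiple does not depend on
    \<open>k\<close>.\<close>
  have th_shift: "\<theta> p (k + K) = \<theta> p k + (\<theta> p K - \<theta> p 0)" if p: "p \<in> P" and K: "K \<in> reciprocal G" for p k K
  proof -
    have c: "continuous_on UNIV (\<lambda>k. \<theta> p (k + K) - \<theta> p k)"
      by (intro continuous_intros thc [OF p] continuous_on_compose2 [OF thc [OF p], of UNIV "\<lambda>k. k + K"]) simp_all
    have "cis (\<theta> p (k + K) - \<theta> p k) = 1" for k
    proof -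
      have "l p (k + K) = l p k"
        unfolding l_def
      proof (rule cell_inner_AE_cong)
        show "AE r in lborel. \<phi> (kact p (k + K)) r = \<phi> (kact p k) r"
          using per [OF kact_dual [OF p K], of "kact p k"] by simp
        show "AE r in lborel. hat G (p, 0) (\<phi> (k + K)) r = hat G (p, 0) (\<phi> k) r"
          by (rule hat_AE [OF p L_closed(1) per [OF K]])
      qed (intro phiL hL p)+
      then have "cis (\<theta> p (k + K)) = cis (\<theta> p k)" by (simp add: thl p)
      then show ?thesis by (simp add: cis_divide [symmetric])
    qed
    from continuous_cis_eq_1_constant [OF c this, of k 0] show ?thesis by simp
  qed
  \<comment> \<open>The operator of \<open>q\<close> is antilinear if \<open>sg q = -1\<close> and
    then conjugates the phase of \<open>p\<close>; in logarithms this becomes the factor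
    \<open>sg q\<close>.\<close>
  have l_mult: "l (q \<otimes>\<^bsub>point_group G\<^esub> p) k = conj_if (sg q) (l p k) * l q (kact p k)"
    if q: "q \<in> P" and p: "p \<in> P" for q p k
  proof -
    have h1: "hat G (q \<otimes>\<^bsub>point_group G\<^esub> p, 0) (\<phi> k) = hat G (q, 0) (hat G (p, 0) (\<phi> k))"
      by (subst hat_hat [OF q p]) simp_all
    have h2: "AE r in lborel. hat G (q, 0) (hat G (p, 0) (\<phi> k)) r
        = cscale (conj_if (sg q) (l p k)) (hat G (q, 0) (\<phi> (kact p k)) r)"
      using hat_AE [OF q L_closed(1) rel [OF p, of k]] unfolding hat_cscale [OF q L_closed(1)] .
    have "AE r in lborel. hat G (q \<otimes>\<^bsub>point_group G\<^esub> p, 0) (\<phi> k) r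
        = cscale (conj_if (sg q) (l p k) * l q (kact p k)) (\<phi> (kact q (kact p k)) r)"
      using h2 rel [OF q, of "kact p k"] unfolding h1 by eventually_elim simp
    then have "l (q \<otimes>\<^bsub>point_group G\<^esub> p) k = ip (\<phi> (kact q (kact p k)))
        (\<lambda>r. cscale (conj_if (sg q) (l p k) * l q (kact p k)) (\<phi> (kact q (kact p k)) r))"
      unfolding l_def [of "q \<otimes>\<^bsub>point_group G\<^esub> p"] kact_mult [OF q p]
      by (intro cell_inner_AE_cong phiL hL locally_L2_cscale pg.m_closed q p) simp_all
    then show ?thesis by (simp add: cell_inner_cscale_right ip_self_unit phi)
  qed
  \<comment> \<open>The cocycle defect is a multiple of 2 pi for each \<open>k\<close> and
    continuous, hence constant.\<close>
  have "\<exists>D. \<forall>k. \<theta> (q \<otimes>\<^bsub>point_group G\<^esub> p) k - sg q * \<theta> p k - \<theta> q (kact p k) = D" if q: "q \<in> P" and p: "p \<in> P" for q p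
  proof -
    let ?h = "\<lambda>k. \<theta> (q \<otimes>\<^bsub>point_group G\<^esub> p) k - sg q * \<theta> p k - \<theta> q (kact p k)"
    have c: "continuous_on UNIV ?h"
      by (intro continuous_intros thc pg.m_closed p q continuous_on_compose2 [OF thc [OF q] continuous_on_kact]) simp
    have "cis (?h k) = 1" for k
    proof -
      have "cis (\<theta> (q \<otimes>\<^bsub>point_group G\<^esub> p) k) = cis (sg q * \<theta> p k) * cis (\<theta> q (kact p k))"
        using l_mult [OF q p, of k] by (simp add: thl p q conj_if_cis [OF sg_cases])
      then show ?thesis by (simp add: cis_divide [symmetric])
    qed
    from continuous_cis_eq_1_constant [OF c this] show ?thesis by (intro exI [of _ "?h 0"] allI)
  qed
  then obtain D where D: "\<And>q p k. q \<in> P \<Longrightarrow> p \<in> P \<Longrightarrow>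
      \<theta> (q \<otimes>\<^bsub>point_group G\<^esub> p) k - sg q * \<theta> p k - \<theta> q (kact p k) = D q p"
    by metis
  define n where "n = real (card P)"
  have n: "0 < n" unfolding n_def using finite_P pg.one_closed by (auto simp: card_gt_0_iff)
  \<comment> \<open>The weights \<open>sg q\<close> undo the twist in the cocycle relation:
    \<open>sg q * sg q = 1\<close> frees the term \<open>\<theta> p k\<close> from \<open>q\<close>,
    and the remaining sum is reindexed by right multiplication with \<open>p\<close>. The constant
    \<open>e p\<close> collects the defects \<open>D\<close>.\<close>
  define B where "B k = (\<Sum>q\<in>P. sg q * \<theta> q k) / n" for k
  define e where "e p = - (\<Sum>q\<in>P. sg q * D q p) / n" for p
  have B_act: "B (kact p k) = sg p * B k - \<theta> p k + e p" if p: "p \<in> P" for p k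
  proof -
    have "(\<Sum>q\<in>P. sg q * \<theta> q (kact p k))
        = (\<Sum>q\<in>P. sg p * (sg (q \<otimes>\<^bsub>point_group G\<^esub> p) * \<theta> (q \<otimes>\<^bsub>point_group G\<^esub> p) k) - \<theta> p k - sg q * D q p)"
    proof (rule sum.cong)
      fix q assume q: "q \<in> P"
      have "sg q * \<theta> q (kact p k) = sg q * (\<theta> (q \<otimes>\<^bsub>point_group G\<^esub> p) k - sg q * \<theta> p k - D q p)"
        using D [OF q p, of k] by simp
      also have "\<dots> = sg q * \<theta> (q \<otimes>\<^bsub>point_group G\<^esub> p) k - (sg q * sg q) * \<theta> p k - sg q * D q p"
        by (simp only: right_diff_distrib mult.assoc)
      also have "sg q * \<theta> (q \<otimes>\<^bsub>point_group G\<^esub> p) k = sg p * (sg (q \<otimes>\<^bsub>point_group G\<^esub> p) * \<theta> (q \<otimes>\<^bsub>point_group G\<^esub> p) k)"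
        using sg_mult_cancel [OF p] by (simp add: sg_mult q p mult.assoc mult.left_commute)
      finally show "sg q * \<theta> q (kact p k)
          = sg p * (sg (q \<otimes>\<^bsub>point_group G\<^esub> p) * \<theta> (q \<otimes>\<^bsub>point_group G\<^esub> p) k) - \<theta> p k - sg q * D q p"
        by (simp add: q)
    qed simp
    also have "\<dots> = sg p * (\<Sum>q\<in>P. sg (q \<otimes>\<^bsub>point_group G\<^esub> p) * \<theta> (q \<otimes>\<^bsub>point_group G\<^esub> p) k)
        - n * \<theta> p k - (\<Sum>q\<in>P. sg q * D q p)"
      by (simp add: sum_subtractf sum_distrib_left n_def)
    also have "(\<Sum>q\<in>P. sg (q \<otimes>\<^bsub>point_group G\<^esub> p) * \<theta> (q \<otimes>\<^bsub>point_group G\<^esub> p) k) = (\<Sum>q\<in>P. sg q * \<theta> q k)"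
      by (rule sum.reindex_bij_witness [of _ "\<lambda>q. q \<otimes>\<^bsub>point_group G\<^esub> inv\<^bsub>point_group G\<^esub> p"
            "\<lambda>q. q \<otimes>\<^bsub>point_group G\<^esub> p"])
        (simp_all add: p pg.m_assoc)
    finally have s: "(\<Sum>q\<in>P. sg q * \<theta> q (kact p k))
        = sg p * (\<Sum>q\<in>P. sg q * \<theta> q k) - n * \<theta> p k - (\<Sum>q\<in>P. sg q * D q p)" .
    show ?thesis unfolding B_def e_def s using n by (simp add: diff_divide_distrib)
  qed
  have B_shift: "B (k + K) = B k + (B K - B 0)" if K: "K \<in> reciprocal G" for k K
  proof -
    have "(\<Sum>q\<in>P. sg q * \<theta> q (k + K)) = (\<Sum>q\<in>P. sg q * \<theta> q k + (sg q * \<theta> q K - sg q * \<theta> q 0))"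
      by (intro sum.cong refl) (subst th_shift [OF _ K], simp_all add: algebra_simps)
    then have "(\<Sum>q\<in>P. sg q * \<theta> q (k + K)) = (\<Sum>q\<in>P. sg q * \<theta> q k) + ((\<Sum>q\<in>P. sg q * \<theta> q K) - (\<Sum>q\<in>P. sg q * \<theta> q 0))"
      by (simp add: sum.distrib sum_subtractf)
    then show ?thesis by (simp add: B_def add_divide_distrib diff_divide_distrib)
  qed
  have B_cont: "continuous_on UNIV B"
    unfolding B_def [abs_def] by (intro continuous_intros thc) (use n in simp_all)
  \<comment> \<open>By \<open>B_shift\<close> the increments of \<open>B\<close> over the reciprocal
    lattice are additive, hence given by a vector \<open>w\<close>.\<close>
  have "\<exists>w. \<forall>K\<in>reciprocal G. B K - B 0 = K \<bullet> w"
    by (rule dual.additive_on_lattice_inner) (subst B_shift, simp_all)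
  then obtain w where w: "\<And>K. K \<in> reciprocal G \<Longrightarrow> B K - B 0 = K \<bullet> w" by blast
  \<comment> \<open>\<open>- B\<close> removes the phases \<open>\<theta>\<close> up to constants;
    \<open>k \<bullet> w\<close> restores the periodicity that \<open>B\<close> spoils.\<close>
  define a where "a k = k \<bullet> w - B k" for k
  have a_shift: "a (k + K) = a k" if "K \<in> reciprocal G" for k K
    using w [OF that] by (simp add: a_def B_shift [OF that] inner_add_left)
  define \<phi>' where "\<phi>' = (\<lambda>k r. cscale (cis (a k)) (\<phi> k r))"
  have sec': "continuous_unit_section G E \<phi>'"
    unfolding \<phi>'_def by (rule section_phase [OF band sec]) (unfold a_def, intro continuous_intros B_cont)
  have phi': "\<phi>' k \<in> E k" "nm (\<phi>' k) = 1" for k using sec' by (auto simp: continuous_unit_section_def)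
  note span' = simple_band_span [OF band phi']
  have phiL': "\<phi>' k \<in> locally_L2" for k by (rule bloch_locally_L2 [OF span'(1)])
  have per': "AE r in lborel. \<phi>' (k + K) r = \<phi>' k r" if K: "K \<in> reciprocal G" for k K
    using per [OF K, of k] by eventually_elim (simp add: \<phi>'_def a_shift [OF K])
  define t where "t p = A p *v w - w" for p
  \<comment> \<open>The linear term is not compatible with \<open>kact\<close>; its defect is the
    phase \<open>kact p k \<bullet> t p\<close>.\<close>
  have rel': "AE r in lborel. hat G (p, 0) (\<phi>' k) r = cscale (cis (e p + kact p k \<bullet> t p)) (\<phi>' (kact p k) r)"
    if p: "p \<in> P" for p k
  proof -
    have kw: "kact p k \<bullet> (A p *v w) = sg p * (k \<bullet> w)" by (simp add: kact_inner p rot_cancel)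
    have eq: "sg p * a k + \<theta> p k = (e p + kact p k \<bullet> t p) + a (kact p k)"
      by (simp add: a_def t_def B_act [OF p] inner_diff_right kw right_diff_distrib)
    have "AE r in lborel. hat G (p, 0) (\<phi>' k) r = cscale (cis (sg p * a k)) (hat G (p, 0) (\<phi> k) r)"
      unfolding \<phi>'_def hat_cscale [OF p L_closed(1)] conj_if_cis [OF sg_cases [OF p]] by simp
    then show ?thesis
      using rel [OF p, of k]
    proof eventually_elim
      case (elim r)
      have "hat G (p, 0) (\<phi>' k) r = cscale (cis (sg p * a k + \<theta> p k)) (\<phi> (kact p k) r)"
        using elim by (simp add: thl [OF p] cis_mult)
      then show ?case unfolding eq by (simp add: \<phi>'_def cis_mult)
    qed
  qed
  have hL': "hat G (p, 0) (\<phi>' k) \<in> locally_L2" if "p \<in> P" for p k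
    by (rule hat_locally_L2 [OF that _ phiL']) simp
  \<comment> \<open>All other factors being periodic, so is the phase
    \<open>kact p k \<bullet> t p\<close>. Thus \<open>t p\<close> pairs with the reciprocal lattice
    in multiples of 2 pi and lies in the double dual.\<close>
  have tL: "t p \<in> bravais G" if p: "p \<in> P" for p
  proof -
    have c: "cis (e p + kact p k \<bullet> t p) = ip (\<phi>' (kact p k)) (hat G (p, 0) (\<phi>' k))" for k
    proof -
      have "ip (\<phi>' (kact p k)) (hat G (p, 0) (\<phi>' k))
          = ip (\<phi>' (kact p k)) (\<lambda>r. cscale (cis (e p + kact p k \<bullet> t p)) (\<phi>' (kact p k) r))"
        by (intro cell_inner_AE_cong phiL' hL' p locally_L2_cscale rel') simp
      then show ?thesis by (simp add: cell_inner_cscale_right ip_self_unit phi')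
    qed
    have "t p \<in> dual_lattice (reciprocal G)"
      unfolding dual_lattice_def
    proof (intro CollectI ballI)
      fix K assume K: "K \<in> reciprocal G"
      define K1 where "K1 = kact (inv\<^bsub>point_group G\<^esub> p) K"
      have K1: "K1 \<in> reciprocal G" "kact p K1 = K" using p K by (simp_all add: K1_def kact_dual kact_inv)
      have "ip (\<phi>' (kact p (0 + K1))) (hat G (p, 0) (\<phi>' (0 + K1))) = ip (\<phi>' (kact p 0)) (hat G (p, 0) (\<phi>' 0))"
      proof (rule cell_inner_AE_cong)
        show "AE r in lborel. \<phi>' (kact p (0 + K1)) r = \<phi>' (kact p 0) r"
          using per' [OF kact_dual [OF p K1(1)], of "kact p 0"] unfolding kact_simps .
        show "AE r in lborel. hat G (p, 0) (\<phi>' (0 + K1)) r = hat G (p, 0) (\<phi>' 0) r"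
          by (rule hat_AE [OF p L_closed(1) per' [OF K1(1)]])
      qed (intro phiL' hL' p)+
      then have "cis (e p + K \<bullet> t p) = cis (e p + kact p 0 \<bullet> t p)"
        unfolding c [symmetric] by (simp add: K1(2))
      moreover have "kact p 0 = 0" by (simp add: kact_def)
      ultimately have "cis (e p) * cis (K \<bullet> t p) = cis (e p) * 1" by (simp add: cis_mult)
      then have "cis (K \<bullet> t p) = 1" by (simp only: mult_cancel_left cis_neq_zero) simp
      then show "\<exists>n::int. t p \<bullet> K = 2 * pi * real_of_int n"
        using cis_eq_1_imp by (simp add: inner_commute)
    qed
    then show ?thesis by (simp add: reciprocal_def dual_dual)
  qed
  show ?thesis
  proof (rule that [OF sec' per'])
    show "A p *v w - w \<in> bravais G" if "p \<in> P" for p using tL [OF that] by (simp add: t_def)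
    show "cmod (cis (e p)) = 1" for p by simp
    fix p k assume p: "p \<in> P"
    \<comment> \<open>Translation by the lattice vector \<open>t p\<close> multiplies a Bloch
      function by a phase that cancels the one left over.\<close>
    have "AE r in lborel. hat G (p, 0) (\<phi>' k) (r + - t p) = cscale (cis (kact p k \<bullet> (- t p))) (hat G (p, 0) (\<phi>' k) r)"
      by (rule bloch_AE [OF hat_bloch [OF p L_closed(1) span'(1)]]) (simp add: tL p)
    then have "AE r in lborel. hat G (p, t p) (\<phi>' k) r = cscale (cis (e p)) (\<phi>' (kact p k) r)"
      using rel' [OF p, of k]
    proof eventually_elim
      case (elim r)
      have "hat G (\<one>\<^bsub>point_group G\<^esub>, t p) (hat G (p, 0) (\<phi>' k)) = hat G (p, t p) (\<phi>' k)"
        by (subst hat_hat) (simp_all add: p tL)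
      then have "hat G (p, t p) (\<phi>' k) r = hat G (p, 0) (\<phi>' k) (r - t p)"
        using hat_translation [OF tL [OF p]] by metis
      then show ?case using elim by (simp add: cis_mult)
    qed
    then show "AE r in lborel. hat G (p, A p *v w - w) (\<phi>' k) r = cscale (cis (e p)) (\<phi>' (kact p k) r)"
      by (simp add: t_def)
  qed
qed

end

subsection \<open>Amplitudes of compactly supported functions\<close>

lemma bounded_support_norm:
  "bounded {r. f r \<noteq> 0} \<longleftrightarrow> (\<exists>\<rho>. \<forall>r. f r \<noteq> 0 \<longrightarrow> norm r \<le> \<rho>)"
  by (auto simp: bounded_iff)

lemma indicator_locally_L2:
  assumes f: "f \<in> locally_L2" and A: "A \<in> sets borel"
  shows "(\<lambda>r. indicator A r *\<^sub>R f r) \<in> locally_L2"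
proof (rule locally_L2_dominated1 [OF _ f, of _ 1])
  show "(\<lambda>r. indicator A r *\<^sub>R f r) \<in> borel_measurable borel"
    by (intro borel_measurable_scaleR borel_measurable_indicator A locally_L2_measurable [OF f])
  show "AE r in lborel. norm (indicator A r *\<^sub>R f r) \<le> 1 * norm (f r)"
    by (rule AE_I2) (simp add: indicator_def)
qed

context lattice
begin

text \<open>A pairing over all of space, not over a cell; \<open>f\<close> will have bounded
  support, since \<open>u\<close> is only locally square integrable.\<close>

definition amp :: "(real^'d \<Rightarrow> complex^'v::finite^'m::finite) \<Rightarrow> (real^'d \<Rightarrow> complex^'v^'m) \<Rightarrow> complex" where
  "amp u f = (LINT r|lborel. winner (u r) (f r))"

lemma amp_AE_cong:
  assumes "u \<in> locally_L2" "u' \<in> locally_L2" "f \<in> locally_L2" "AE r in lborel. u r = u' r"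
  shows "amp u f = amp u' f"
  unfolding amp_def
proof (rule integral_cong_AE)
  note [measurable] = assms(1-3)[THEN locally_L2_measurable]
  show "(\<lambda>r. winner (u r) (f r)) \<in> borel_measurable lborel" "(\<lambda>r. winner (u' r) (f r)) \<in> borel_measurable lborel"
    by measurable
qed (use assms(4) in \<open>eventually_elim, simp\<close>)

lemma amp_cscale_left: "amp (\<lambda>r. cscale c (u r)) f = cnj c * amp u f"
  by (simp add: amp_def winner_cscale_left)

text \<open>Cutting the support of \<open>f\<close> into cells and translating back leaves finitely
  many cell inner products with characters of \<open>k\<close> as factors. Continuity in
  \<open>k\<close> and the effect of periodization are read off from this.\<close>

lemma amp_cells:
  assumes u: "u \<in> bloch L k" and f: "f \<in> locally_L2" "\<And>r. f r \<noteq> 0 \<Longrightarrow> norm r \<le> \<rho>"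
  shows "amp u f = (\<Sum>R\<in>{R \<in> L. norm R \<le> cell_radius + \<rho>}. cis (- (k \<bullet> R)) * cell_inner L u (\<lambda>r. f (r + R)))"
proof -
  let ?S = "{R \<in> L. norm R \<le> cell_radius + \<rho>}"
  have uL: "u \<in> locally_L2" by (rule bloch_locally_L2 [OF u])
  have bd: "bounded {r. f r \<noteq> 0}" unfolding bounded_support_norm using f(2) by blast
  have "amp u f = (\<Sum>R\<in>?S. LINT r:cell|lborel. winner (u (r + R)) (f (r + R)))"
    unfolding amp_def
  proof (rule integral_sum_over_cells [OF winner_integrable [OF uL f(1) disjI2 [OF bd]] finite_L_cball])
    fix r R assume r: "r \<in> cell" and R: "R \<in> L" and nz: "winner (u (r + R)) (f (r + R)) \<noteq> 0"
    have "f (r + R) \<noteq> 0" using nz by auto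
    then have "norm (r + R) \<le> \<rho>" by (rule f(2))
    moreover have "norm R \<le> norm (r + R) + norm r" using norm_triangle_ineq4 [of "r + R" r] by simp
    ultimately show "R \<in> ?S" using norm_cell_le [OF r] R by simp
  qed auto
  also have "\<dots> = (\<Sum>R\<in>?S. cis (- (k \<bullet> R)) * cell_inner L u (\<lambda>r. f (r + R)))"
  proof (rule sum.cong)
    fix R assume "R \<in> ?S"
    then have R: "R \<in> L" by simp
    have fR: "(\<lambda>r. f (r + R)) \<in> locally_L2" and uR: "(\<lambda>r. u (r + R)) \<in> locally_L2"
      by (rule locally_L2_translate [OF f(1)], rule locally_L2_translate [OF uL])
    have "cell_inner L (\<lambda>r. u (r + R)) (\<lambda>r. f (r + R)) = cell_inner L (\<lambda>r. cscale (cis (k \<bullet> R)) (u r)) (\<lambda>r. f (r + R))"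
      by (rule cell_inner_AE_cong [OF uR locally_L2_cscale [OF uL] fR fR bloch_AE [OF u R]]) simp
    then show "(LINT r:cell|lborel. winner (u (r + R)) (f (r + R))) = cis (- (k \<bullet> R)) * cell_inner L u (\<lambda>r. f (r + R))"
      by (simp add: cell_inner_cscale_left cis_cnj cell_inner_def [of L "\<lambda>r. u (r + R)"])
  qed simp
  finally show ?thesis .
qed

text \<open>At \<open>k = 0\<close> the phases in \<open>amp_cells\<close> are 1, and the translates
  add up to the periodization.\<close>

lemma cell_inner_periodize:
  assumes u: "u \<in> bloch L 0" and f: "f \<in> locally_L2" "\<And>r. f r \<noteq> 0 \<Longrightarrow> norm r \<le> \<rho>"
  shows "cell_inner L u (periodize f) = amp u f"
proof -
  let ?S = "{R \<in> L. norm R \<le> cell_radius + \<rho>}"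
  have uL: "u \<in> locally_L2" by (rule bloch_locally_L2 [OF u])
  have fR: "(\<lambda>r. f (r - R)) \<in> locally_L2" for R using locally_L2_translate [OF f(1), of "- R"] by simp
  have eq: "indicator cell r *\<^sub>R winner (u r) (periodize f r) = indicator cell r *\<^sub>R winner (u r) (\<Sum>R\<in>?S. f (r - R))" for r
    by (cases "r \<in> cell") (simp_all add: periodize_eq_on_cball [OF f norm_cell_le])
  have "cell_inner L u (periodize f) = cell_inner L u (\<lambda>r. \<Sum>R\<in>?S. f (r - R))"
    unfolding cell_inner_def set_lebesgue_integral_def eq ..
  also have "\<dots> = (\<Sum>R\<in>?S. cell_inner L u (\<lambda>r. f (r - R)))"
    by (rule cell_inner_sum_right [OF uL fR])
  also have "\<dots> = (\<Sum>R\<in>?S. cell_inner L u (\<lambda>r. f (r + R)))"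
    by (rule sum.reindex_bij_witness [of _ uminus uminus]) auto
  also have "\<dots> = amp u f" by (simp add: amp_cells [OF u f])
  finally show ?thesis .
qed

lemma continuous_on_amp:
  assumes u: "ncont u" "\<And>k. u k \<in> bloch L k" and f: "f \<in> locally_L2" "bounded {r. f r \<noteq> 0}"
  shows "continuous_on UNIV (\<lambda>k. amp (u k) f)"
proof -
  obtain \<rho> where \<rho>: "\<And>r. f r \<noteq> 0 \<Longrightarrow> norm r \<le> \<rho>" using f(2) unfolding bounded_support_norm by blast
  have "ncont (\<lambda>k :: real^'d. (\<lambda>r. f (r + R)))" for R
    by (rule ncont_I) (simp_all add: locally_L2_translate [OF f(1)])
  then have "continuous_on UNIV (\<lambda>k. \<Sum>R\<in>{R \<in> L. norm R \<le> cell_radius + \<rho>}.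
      cis (- (k \<bullet> R)) * cell_inner L (u k) (\<lambda>r. f (r + R)))"
    by (intro continuous_intros continuous_on_cell_inner u(1))
  then show ?thesis by (simp add: amp_cells [OF u(2) f(1) \<rho>])
qed

lemma phase_mult_amp: "amp (phase_mult k u) (phase_mult k f) = amp u f"
  by (simp add: amp_def)

end

section \<open>Overlaps with test functions and their localisation in wavevector space\<close>

context msg
begin

text \<open>All functions of \<open>k\<close> that some test function realises. The lemmas below
  make this a module over the trigonometric polynomials with frequencies in the lattice, which is
  what permits localisation.\<close>

definition amplitudes :: "(real^'d \<Rightarrow> ('d, 'v, 'm::finite) wavefun) \<Rightarrow> (real^'d \<Rightarrow> complex) set" where
  "amplitudes \<phi> = {a. \<exists>f. f \<in> locally_L2 \<and> bounded {r. f r \<noteq> 0} \<and> (\<forall>k. a k = amp (\<phi> k) f)}"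

context
  fixes \<phi> :: "real^'d \<Rightarrow> ('d, 'v, 'm::finite) wavefun"
  assumes phib: "\<And>k. \<phi> k \<in> bloch (bravais G) k"
begin

lemma phi_L2: "\<phi> k \<in> locally_L2"
  by (rule bloch_locally_L2 [OF phib])

lemma amplitudes_zero: "(\<lambda>k. 0) \<in> amplitudes \<phi>"
  unfolding amplitudes_def by (intro CollectI exI [of _ "\<lambda>r. 0"]) (simp add: amp_def)

lemma amplitudes_add:
  assumes "a \<in> amplitudes \<phi>" "b \<in> amplitudes \<phi>"
  shows "(\<lambda>k. a k + b k) \<in> amplitudes \<phi>"
proof -
  obtain f where f: "f \<in> locally_L2" "bounded {r. f r \<noteq> 0}" "\<And>k. a k = amp (\<phi> k) f"
    using assms(1) by (auto simp: amplitudes_def)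
  obtain g where g: "g \<in> locally_L2" "bounded {r. g r \<noteq> 0}" "\<And>k. b k = amp (\<phi> k) g"
    using assms(2) by (auto simp: amplitudes_def)
  have "bounded {r. f r + g r \<noteq> 0}"
    by (rule bounded_subset [OF bounded_Un [THEN iffD2, OF conjI [OF f(2) g(2)]]]) auto
  moreover have "a k + b k = amp (\<phi> k) (\<lambda>r. f r + g r)" for k
    unfolding f(3) g(3) amp_def winner_add_right
    by (rule Bochner_Integration.integral_add [symmetric]) (intro winner_integrable phi_L2 f(1) g(1) disjI2 f(2) g(2))+
  ultimately show ?thesis
    unfolding amplitudes_def using locally_L2_plus [OF f(1) g(1)] by blast
qed

lemma amplitudes_cmult:
  assumes "a \<in> amplitudes \<phi>"
  shows "(\<lambda>k. c * a k) \<in> amplitudes \<phi>"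
proof -
  obtain f where f: "f \<in> locally_L2" "bounded {r. f r \<noteq> 0}" "\<And>k. a k = amp (\<phi> k) f"
    using assms by (auto simp: amplitudes_def)
  have "bounded {r. cscale c (f r) \<noteq> 0}"
    by (rule bounded_subset [OF f(2)]) auto
  moreover have "c * a k = amp (\<phi> k) (\<lambda>r. cscale c (f r))" for k
    unfolding f(3) amp_def winner_cscale_right by simp
  ultimately show ?thesis
    unfolding amplitudes_def using locally_L2_cscale [OF f(1)] by blast
qed

text \<open>Translating the test function by a lattice vector multiplies its overlaps by a character
  of \<open>k\<close>.\<close>

lemma amplitudes_translate:
  assumes "a \<in> amplitudes \<phi>" and R: "R \<in> bravais G"
  shows "(\<lambda>k. cis (k \<bullet> R) * a k) \<in> amplitudes \<phi>"
proof -
  obtain f where f: "f \<in> locally_L2" "bounded {r. f r \<noteq> 0}" "\<And>k. a k = amp (\<phi> k) f"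
    using assms by (auto simp: amplitudes_def)
  obtain \<rho> where \<rho>: "\<And>r. f r \<noteq> 0 \<Longrightarrow> norm r \<le> \<rho>" using f(2) unfolding bounded_support_norm by blast
  have "bounded {r. f (r + R) \<noteq> 0}"
    unfolding bounded_support_norm
  proof (intro exI allI impI)
    fix r assume "f (r + R) \<noteq> 0"
    then show "norm r \<le> \<rho> + norm R" using \<rho> [of "r + R"] norm_triangle_ineq4 [of "r + R" R] by simp
  qed
  moreover have "cis (k \<bullet> R) * a k = amp (\<phi> k) (\<lambda>r. f (r + R))" for k
  proof -
    note [measurable] = phi_L2 [of k, THEN locally_L2_measurable] f(1)[THEN locally_L2_measurable]
    have ae: "AE r in lborel. \<phi> k (r - R) = cscale (cis (- (k \<bullet> R))) (\<phi> k r)"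
      using bloch_AE [OF phib, of "- R" k] R by simp
    have "amp (\<phi> k) (\<lambda>r. f (r + R)) = (LINT r|lborel. (\<lambda>r. winner (\<phi> k (r - R)) (f r)) (r + R))"
      by (simp add: amp_def)
    also have "\<dots> = (LINT r|lborel. winner (\<phi> k (r - R)) (f r))"
      by (rule lborel_integral_translate) measurable
    also have "\<dots> = amp (\<lambda>r. \<phi> k (r - R)) f" by (simp add: amp_def)
    also have "\<dots> = amp (\<lambda>r. cscale (cis (- (k \<bullet> R))) (\<phi> k r)) f"
      by (rule amp_AE_cong [OF _ locally_L2_cscale [OF phi_L2] f(1) ae])
        (use locally_L2_translate [OF phi_L2, of k "- R"] in simp)
    finally show ?thesis by (simp add: amp_cscale_left cis_cnj f(3))
  qed
  ultimately show ?thesis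
    unfolding amplitudes_def using locally_L2_translate [OF f(1)] by blast
qed

lemma amplitudes_sum:
  "(\<And>i. i \<in> I \<Longrightarrow> a i \<in> amplitudes \<phi>) \<Longrightarrow> (\<lambda>k. \<Sum>i\<in>I. a i k) \<in> amplitudes \<phi>"
  by (induction I rule: infinite_finite_induct) (simp_all add: amplitudes_zero amplitudes_add)

text \<open>A trigonometric polynomial with frequencies in the lattice and values between 0 and 1,
  equal to 1 exactly on the reciprocal lattice. These properties are what makes its powers
  localise.\<close>

definition peak :: "real^'d \<Rightarrow> real" where
  "peak x = (\<Sum>i\<in>UNIV. 1 + cos (x \<bullet> (lbasis $ i))) / (2 * real CARD('d))"

lemma lbasis_mem: "lbasis $ i \<in> bravais G"
proof -
  have "lbasis $ i = comb (\<chi> j. if j = i then 1 else 0)"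
    by (simp add: comb_eq if_distrib [where f = "\<lambda>x. x *\<^sub>R _"] cong: if_cong)
  then have "coord (lbasis $ i) = (\<chi> j. if j = i then 1 else 0)" by simp
  then show ?thesis by (simp add: mem_L_iff)
qed

lemma amplitudes_peak:
  assumes a: "a \<in> amplitudes \<phi>"
  shows "(\<lambda>k. complex_of_real (peak (k - k0)) * a k) \<in> amplitudes \<phi>"
proof -
  let ?b = "\<lambda>i. lbasis $ i"
  \<comment> \<open>Each cosine is half the sum of two characters; the constant phases in
    \<open>k0\<close> move the peak to \<open>k0\<close>.\<close>
  have "(\<lambda>k. (1 / (2 * of_nat CARD('d))) * (\<Sum>i\<in>UNIV. a k + ((cis (- (k0 \<bullet> ?b i)) / 2) * (cis (k \<bullet> ?b i) * a k)
      + (cis (k0 \<bullet> ?b i) / 2) * (cis (k \<bullet> (- ?b i)) * a k)))) \<in> amplitudes \<phi>"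
    by (intro amplitudes_cmult amplitudes_sum amplitudes_add a amplitudes_translate L_closed lbasis_mem)
  moreover have "a k + ((cis (- (k0 \<bullet> b)) / 2) * (cis (k \<bullet> b) * a k) + (cis (k0 \<bullet> b) / 2) * (cis (k \<bullet> (- b)) * a k))
      = complex_of_real (1 + cos ((k - k0) \<bullet> b)) * a k" for k b
  proof -
    have "(cis (- (k0 \<bullet> b)) / 2) * cis (k \<bullet> b) + (cis (k0 \<bullet> b) / 2) * cis (k \<bullet> (- b))
        = (cis ((k - k0) \<bullet> b) + cis (- ((k - k0) \<bullet> b))) / 2"
      by (simp add: cis_mult inner_diff_left add_divide_distrib)
    also have "\<dots> = complex_of_real (cos ((k - k0) \<bullet> b))"
      by (simp add: complex_eq_iff)
    finally have "((cis (- (k0 \<bullet> b)) / 2) * cis (k \<bullet> b) + (cis (k0 \<bullet> b) / 2) * cis (k \<bullet> (- b))) * a k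
        = complex_of_real (cos ((k - k0) \<bullet> b)) * a k" by simp
    then show ?thesis by (simp add: algebra_simps)
  qed
  ultimately show ?thesis
    by (simp add: peak_def sum_distrib_right [symmetric] of_real_divide)
qed

lemma amplitudes_peak_power:
  "a \<in> amplitudes \<phi> \<Longrightarrow> (\<lambda>k. complex_of_real (peak (k - k0)) ^ n * a k) \<in> amplitudes \<phi>"
  by (induction n) (simp_all add: amplitudes_peak mult.assoc)

text \<open>The test function is \<open>\<phi> k0\<close> cut off outside the cell.\<close>

lemma amplitudes_cell: "(\<lambda>k. ip (\<phi> k) (\<phi> k0)) \<in> amplitudes \<phi>"
  unfolding amplitudes_def
proof (intro CollectI exI conjI allI)
  show "(\<lambda>r. indicator cell r *\<^sub>R \<phi> k0 r) \<in> locally_L2" by (rule indicator_locally_L2 [OF phi_L2 cell_borel])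
  show "bounded {r. indicator cell r *\<^sub>R \<phi> k0 r \<noteq> 0}"
    by (rule bounded_subset [OF bounded_cell]) (auto simp: indicator_def split: if_splits)
  show "ip (\<phi> k) (\<phi> k0) = amp (\<phi> k) (\<lambda>r. indicator cell r *\<^sub>R \<phi> k0 r)" for k
    by (simp add: cell_inner_def amp_def set_lebesgue_integral_def winner_scaleR_right
        scaleR_conv_of_real [where ?'a = complex])
qed

lemma peak_bounds: "0 \<le> peak x" "peak x \<le> 1"
proof -
  have "0 \<le> (\<Sum>i\<in>UNIV. 1 + cos (x \<bullet> (lbasis $ i)))"
  proof (rule sum_nonneg)
    fix i show "0 \<le> 1 + cos (x \<bullet> (lbasis $ i))"
      using cos_ge_minus_one [of "x \<bullet> (lbasis $ i)"] by linarith
  qed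
  then show "0 \<le> peak x" by (simp add: peak_def)
  have "(\<Sum>i\<in>UNIV. 1 + cos (x \<bullet> (lbasis $ i))) \<le> (\<Sum>i\<in>(UNIV :: 'd set). 2)"
    by (intro sum_mono) simp
  then show "peak x \<le> 1" by (simp add: peak_def divide_le_eq)
qed

text \<open>The maximum forces every cosine to be 1, so \<open>x\<close> pairs with each basis
  vector in a multiple of 2 pi.\<close>

lemma peak_eq_1:
  assumes "peak x = 1"
  shows "x \<in> reciprocal G"
proof -
  have "(\<Sum>i\<in>UNIV. 1 - cos (x \<bullet> (lbasis $ i))) = 0"
    using assms by (simp add: peak_def sum_subtractf sum.distrib field_simps)
  then have "\<forall>i\<in>UNIV. 1 - cos (x \<bullet> (lbasis $ i)) = 0"
    by (subst (asm) sum_nonneg_eq_0_iff) simp_all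
  then have "cis (x \<bullet> (lbasis $ i)) = 1" for i
  proof -
    have c: "cos (x \<bullet> (lbasis $ i)) = 1" using \<open>\<forall>i\<in>UNIV. _\<close> by simp
    then have "(sin (x \<bullet> (lbasis $ i)))\<^sup>2 = 0" using sin_squared_eq [of "x \<bullet> (lbasis $ i)"] by simp
    then show ?thesis using c by (simp add: complex_eq_iff)
  qed
  then have "\<forall>i. \<exists>n::int. x \<bullet> (lbasis $ i) = 2 * pi * real_of_int n" using cis_eq_1_imp by blast
  then obtain n :: "'d \<Rightarrow> int" where n: "\<forall>i. x \<bullet> (lbasis $ i) = 2 * pi * real_of_int (n i)"
    by (rule choice [THEN exE])
  show ?thesis
    unfolding reciprocal_def dual_lattice_def
  proof (intro CollectI ballI)
    fix R assume "R \<in> bravais G"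
    then obtain m where m: "R = comb (\<chi> i. real_of_int (m i))" by (rule L_coordE)
    have "x \<bullet> R = (\<Sum>i\<in>UNIV. real_of_int (m i) * (2 * pi * real_of_int (n i)))"
      by (simp add: m comb_eq inner_sum_right n)
    also have "\<dots> = 2 * pi * real_of_int (\<Sum>i\<in>UNIV. m i * n i)"
      by (simp add: sum_distrib_left algebra_simps)
    finally show "\<exists>n::int. x \<bullet> R = 2 * pi * real_of_int n" by blast
  qed
qed

lemma continuous_on_peak: "continuous_on S peak"
  unfolding peak_def [abs_def] by (intro continuous_intros) simp_all

text \<open>Powers of \<open>peak\<close> localise near the reciprocal lattice, where \<open>\<langle>\<phi>\<^sub>k, \<phi>\<^sub>t\<rangle>\<close> is close to 1 by
  periodicity; a finite net of points \<open>t\<close> then gives a positive amplitude.\<close>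

lemma positive_amplitude:
  assumes nc: "ncont \<phi>" and unit: "\<And>k. nm (\<phi> k) = 1"
    and per: "\<And>k K. K \<in> reciprocal G \<Longrightarrow> AE r in lborel. \<phi> (k + K) r = \<phi> k r"
  shows "\<exists>a\<in>amplitudes \<phi>. \<forall>k. 0 < Re (a k)"
proof -
  define c where "c k t = ip (\<phi> k) (\<phi> t)" for k t
  have c_per: "c (k - K) t = c k t" if "K \<in> reciprocal G" for k K t
    unfolding c_def
    by (rule cell_inner_AE_cong [OF phi_L2 phi_L2 phi_L2 phi_L2])
      (use per [OF that, of "k - K"] in \<open>simp_all add: eq_commute\<close>)
  have c_diag: "c k k = 1" for k unfolding c_def by (rule ip_self_unit [OF unit])
  have c_le: "cmod (c k t) \<le> 1" for k t
    using cell_inner_le [OF phi_L2 phi_L2, of k t] by (simp add: c_def unit)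
  define \<rho> where "\<rho> = dual.cell_radius"
  \<comment> \<open>Large enough for all points of the ball of radius \<rho> and for translates of
    such points that come within distance 1 of the ball.\<close>
  define B where "B = (cball 0 (\<rho> + 1) :: (real^'d) set)"
  have "continuous_on UNIV (\<lambda>x. ip (\<phi> (fst x)) (\<phi> (snd x)))"
    by (intro continuous_on_cell_inner ncont_compose [OF nc] continuous_intros)
  then have cc: "continuous_on (B \<times> B) (\<lambda>x. c (fst x) (snd x))"
    unfolding c_def by (rule continuous_on_subset) simp
  have "uniformly_continuous_on (B \<times> B) (\<lambda>x. c (fst x) (snd x))"
    by (rule compact_uniformly_continuous [OF cc]) (intro compact_Times; simp add: B_def)
  then obtain \<epsilon>0 where e0: "0 < \<epsilon>0" "\<And>x x'. x \<in> B \<times> B \<Longrightarrow> x' \<in> B \<times> B \<Longrightarrow> dist x' x < \<epsilon>0 \<Longrightarrow>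
      dist (c (fst x') (snd x')) (c (fst x) (snd x)) < 1 / 2"
    unfolding uniformly_continuous_on_def by (metis half_gt_zero zero_less_one)
  define \<epsilon> where "\<epsilon> = min \<epsilon>0 1"
  have e: "0 < \<epsilon>" "\<epsilon> \<le> 1" using e0 by (auto simp: \<epsilon>_def)
  have near: "1 / 2 \<le> Re (c k t)" if "k \<in> B" "t \<in> B" "norm (k - t) < \<epsilon>" for k t
  proof -
    have "dist (k, t) (t, t) < \<epsilon>0" using that by (simp add: dist_Pair_Pair dist_norm \<epsilon>_def)
    then have "dist (c k t) (c t t) < 1 / 2" using e0(2) [of "(t, t)" "(k, t)"] that by simp
    then have "cmod (c k t - 1) < 1 / 2" by (simp add: dist_norm c_diag)
    then have "\<bar>Re (c k t - 1)\<bar> < 1 / 2" using abs_Re_le_cmod [of "c k t - 1"] by linarith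
    then show ?thesis by (simp add: abs_if split: if_splits)
  qed
  \<comment> \<open>Differences of points of the ball that stay away from the reciprocal lattice. By
    compactness \<open>peak\<close> stays away from 1 on this set.\<close>
  define C where "C = {x \<in> cball 0 (2 * \<rho>). \<forall>K\<in>reciprocal G. \<epsilon> \<le> norm (x - K)}"
  have "compact C"
  proof -
    have "C = cball 0 (2 * \<rho>) \<inter> (\<Inter>K\<in>reciprocal G. {x. \<epsilon> \<le> norm (x - K)})" by (auto simp: C_def)
    moreover have "closed (\<Inter>K\<in>reciprocal G. {x. \<epsilon> \<le> norm (x - K)})"
      by (intro closed_INT ballI closed_Collect_le continuous_intros)
    ultimately show ?thesis by (simp add: compact_Int_closed)
  qed
  \<comment> \<open>The peak is at most \<open>1 - 2 * \<eta>\<close> far from the lattice, against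
    at least \<open>1 - \<eta>\<close> near it. As the former is at most the square of the latter,
    the ratio of high powers tends to 0. The bound 1/4 keeps both numbers positive.\<close>
  have "\<exists>\<eta>. 0 < \<eta> \<and> \<eta> \<le> 1 / 4 \<and> (\<forall>x\<in>C. peak x \<le> 1 - 2 * \<eta>)"
  proof (cases "C = {}")
    case True
    then show ?thesis by (intro exI [of _ "1/4"]) simp
  next
    case False
    obtain x0 where x0: "x0 \<in> C" "\<And>x. x \<in> C \<Longrightarrow> peak x \<le> peak x0"
      using continuous_attains_sup [OF \<open>compact C\<close> False continuous_on_peak] by blast
    have "peak x0 \<noteq> 1"
    proof
      assume "peak x0 = 1"
      then have "x0 \<in> reciprocal G" by (rule peak_eq_1)
      then have "\<epsilon> \<le> norm (x0 - x0)" using x0(1) unfolding C_def by blast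
      then show False using e by simp
    qed
    then have "peak x0 < 1" using peak_bounds(2) [of x0] by simp
    define m where "m = min (1 / 4) ((1 - peak x0) / 2)"
    have "0 < m" "m \<le> 1 / 4"
      using \<open>peak x0 < 1\<close> by (simp_all add: m_def)
    moreover have "m \<le> (1 - peak x0) / 2"
      unfolding m_def by (rule min.cobounded2)
    moreover have "peak x \<le> 1 - 2 * m" if "x \<in> C" for x
    proof -
      have "2 * m \<le> 1 - peak x0" using \<open>m \<le> (1 - peak x0) / 2\<close> by (simp add: field_simps)
      then have "peak x0 \<le> 1 - 2 * m" by (simp add: le_diff_eq add.commute)
      with x0(2) [OF that] show ?thesis by (rule order_trans)
    qed
    ultimately show ?thesis by blast
  qed
  then obtain \<eta> where eta: "0 < \<eta>" "\<eta> \<le> 1 / 4" "\<And>x. x \<in> C \<Longrightarrow> peak x \<le> 1 - 2 * \<eta>" by blast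
  have p0: "peak 0 = 1" by (simp add: peak_def)
  have "isCont peak 0" using continuous_on_peak [of UNIV] by (simp add: continuous_on_eq_continuous_at)
  then obtain \<delta>0 where d0: "0 < \<delta>0" "\<And>x. norm x < \<delta>0 \<Longrightarrow> \<bar>peak x - 1\<bar> < \<eta>"
    using eta(1) p0 unfolding continuous_at_eps_delta by (auto simp: dist_norm)
  define \<delta> where "\<delta> = min \<delta>0 \<epsilon>"
  have d: "0 < \<delta>" using d0 e by (simp add: \<delta>_def)
  have "\<exists>T. finite T \<and> T \<subseteq> cball (0 :: real^'d) \<rho> \<and> cball 0 \<rho> \<subseteq> (\<Union>t\<in>T. ball t \<delta>)"
    using seq_compact_imp_totally_bounded [OF compact_imp_seq_compact [OF compact_cball]] d by blast
  then obtain T where T: "finite T" "T \<subseteq> cball (0 :: real^'d) \<rho>" "cball 0 \<rho> \<subseteq> (\<Union>t\<in>T. ball t \<delta>)" by blast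
  define J where "J = real (card T)"
  \<comment> \<open>Makes the at most \<open>J\<close> terms that may be negative together smaller
    than the one term known to be positive.\<close>
  obtain n where n: "(1 - \<eta>) ^ n < 1 / (2 * (J + 1))"
    using real_arch_pow_inv [of "1 / (2 * (J + 1))" "1 - \<eta>"] eta by (auto simp: J_def)
  define a where "a k = (\<Sum>t\<in>T. complex_of_real (peak (k - t)) ^ n * c k t)" for k
  have aA: "a \<in> amplitudes \<phi>"
    unfolding a_def [abs_def] c_def by (intro amplitudes_sum amplitudes_peak_power amplitudes_cell)
  have pos_ball: "0 < Re (a k)" if k: "k \<in> cball 0 \<rho>" for k
  proof -
    obtain t0 where t0: "t0 \<in> T" "norm (k - t0) < \<delta>"
      using T(3) k by (auto simp: dist_norm norm_minus_commute)
    have TB: "t \<in> B" if "t \<in> T" for t using T(2) that by (force simp: B_def)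
    have kB: "k \<in> B" using k by (simp add: B_def)
    let ?g = "\<lambda>t. peak (k - t) ^ n * Re (c k t)"
    have g0: "(1 - \<eta>) ^ n / 2 \<le> ?g t0"
    proof -
      have "1 - \<eta> \<le> peak (k - t0)" using d0(2) [of "k - t0"] t0(2) by (simp add: \<delta>_def)
      then have "(1 - \<eta>) ^ n \<le> peak (k - t0) ^ n" using eta by (intro power_mono) simp_all
      moreover have "1 / 2 \<le> Re (c k t0)"
        by (rule near [OF kB TB [OF t0(1)]]) (use t0(2) in \<open>simp add: \<delta>_def\<close>)
      ultimately have "(1 - \<eta>) ^ n * (1 / 2) \<le> ?g t0"
        using peak_bounds(1) by (intro mult_mono) simp_all
      then show ?thesis by simp
    qed
    \<comment> \<open>Either \<open>k - t\<close> is far from the reciprocal lattice and the peak is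
      small, or a reciprocal translate of \<open>k\<close> is near \<open>t\<close> and the real
      part is at least 1/2.\<close>
    have g: "- ((1 - 2 * \<eta>) ^ n) \<le> ?g t" if t: "t \<in> T" for t
    proof (cases "k - t \<in> C")
      case True
      have "peak (k - t) ^ n \<le> (1 - 2 * \<eta>) ^ n" by (intro power_mono eta(3) True peak_bounds(1))
      moreover have "- 1 \<le> Re (c k t)" using abs_Re_le_cmod [of "c k t"] c_le [of k t] by linarith
      then have "peak (k - t) ^ n * (- 1) \<le> ?g t"
        using peak_bounds(1) by (intro mult_left_mono) simp_all
      ultimately show ?thesis by linarith
    next
      case False
      have "norm (k - t) \<le> 2 * \<rho>"
        using norm_triangle_ineq4 [of k t] k T(2) t by force
      then obtain K where K: "K \<in> reciprocal G" "norm (k - t - K) < \<epsilon>"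
        using False unfolding C_def by force
      have kK: "norm ((k - K) - t) < \<epsilon>" using K(2) by (simp add: algebra_simps)
      have "norm (k - K) \<le> norm ((k - K) - t) + norm t" using norm_triangle_ineq [of "(k - K) - t" t] by simp
      also have "\<dots> \<le> \<rho> + 1" using kK e T(2) t by force
      finally have "1 / 2 \<le> Re (c (k - K) t)" by (intro near [OF _ TB [OF t] kK]) (simp add: B_def)
      then have "0 \<le> ?g t" using peak_bounds(1) by (simp add: c_per [OF K(1)])
      moreover have "0 \<le> (1 - 2 * \<eta>) ^ n" using eta by simp
      ultimately show ?thesis by linarith
    qed
    have "(1 - 2 * \<eta>) ^ n \<le> ((1 - \<eta>)\<^sup>2) ^ n"
      using eta by (intro power_mono) (simp_all add: power2_eq_square algebra_simps)
    also have "\<dots> = (1 - \<eta>) ^ n * (1 - \<eta>) ^ n"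
      by (simp add: power2_eq_square power_mult_distrib)
    also have "\<dots> \<le> (1 - \<eta>) ^ n * (1 / (2 * (J + 1)))"
      using n eta by (intro mult_left_mono) simp_all
    finally have small: "(1 - 2 * \<eta>) ^ n \<le> (1 - \<eta>) ^ n / (2 * (J + 1))" by simp
    have J0: "0 \<le> J" by (simp add: J_def)
    have "J * (1 - 2 * \<eta>) ^ n \<le> J * ((1 - \<eta>) ^ n / (2 * (J + 1)))"
      by (rule mult_left_mono [OF small J0])
    also have "\<dots> < (1 - \<eta>) ^ n / 2"
      using J0 eta by (simp add: field_simps)
    finally have small': "J * (1 - 2 * \<eta>) ^ n < (1 - \<eta>) ^ n / 2" .
    have "(\<Sum>t\<in>T - {t0}. - ((1 - 2 * \<eta>) ^ n)) \<le> (\<Sum>t\<in>T - {t0}. ?g t)"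
      by (intro sum_mono g) simp
    moreover have "(\<Sum>t\<in>T - {t0}. - ((1 - 2 * \<eta>) ^ n)) = - (real (card (T - {t0})) * (1 - 2 * \<eta>) ^ n)"
      by simp
    moreover have "real (card (T - {t0})) * (1 - 2 * \<eta>) ^ n \<le> J * (1 - 2 * \<eta>) ^ n"
      unfolding J_def using eta T(1) by (intro mult_right_mono) (simp_all add: card_mono)
    ultimately have "- (J * (1 - 2 * \<eta>) ^ n) \<le> (\<Sum>t\<in>T - {t0}. ?g t)" by linarith
    moreover have "(\<Sum>t\<in>T. ?g t) = ?g t0 + (\<Sum>t\<in>T - {t0}. ?g t)"
      by (rule sum.remove [OF T(1) t0(1)])
    ultimately have "0 < (\<Sum>t\<in>T. ?g t)" using g0 small' by linarith
    moreover have "Re (a k) = (\<Sum>t\<in>T. ?g t)"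
      by (simp add: a_def Re_sum flip: of_real_power)
    ultimately show ?thesis by simp
  qed
  \<comment> \<open>Every \<open>k\<close> has a reciprocal translate in the ball, and the amplitude
    of a periodic family is periodic.\<close>
  have "0 < Re (a k)" for k
  proof -
    obtain K where K: "K \<in> reciprocal G" "norm (k - K) \<le> \<rho>"
      using dual.ex_near_L [of k] unfolding \<rho>_def by blast
    obtain f where f: "f \<in> locally_L2" "\<And>k. a k = amp (\<phi> k) f"
      using aA by (auto simp: amplitudes_def)
    have "a (k - K) = a k"
      unfolding f(2) by (rule amp_AE_cong [OF phi_L2 phi_L2 f(1)])
        (use per [OF K(1), of "k - K"] in \<open>simp add: eq_commute\<close>)
    then show ?thesis using pos_ball [of "k - K"] K(2) by simp
  qed
  then show ?thesis using aA by blast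
qed

end

end

subsection \<open>Analytic covariant sections\<close>

context msg
begin

lemma amp_hat:
  assumes p: "p \<in> P" "R \<in> bravais G" and L2: "u \<in> locally_L2" "f \<in> locally_L2"
  shows "amp (hat G (p, R) u) (hat G (p, R) f) = conj_if (sg p) (amp u f)"
proof -
  have "amp (hat G (p, R) u) (hat G (p, R) f) = (LINT r|lborel. conj_if (sg p) (winner (u r) (f r)))"
    using integral_hat [OF p L2, of "\<lambda>_. 1"] by (simp add: amp_def)
  then show ?thesis by (cases "sg p = 1") (simp_all add: amp_def conj_if_def)
qed

lemma bounded_support_hat:
  assumes p: "p \<in> P" "R \<in> bravais G" and f: "bounded {r. f r \<noteq> 0}"
  shows "bounded {r. hat G (p, R) f r \<noteq> 0}"
proof -
  obtain \<rho> where \<rho>: "\<And>r. f r \<noteq> 0 \<Longrightarrow> norm r \<le> \<rho>" using f unfolding bounded_support_norm by blast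
  show ?thesis
    unfolding bounded_support_norm
  proof (intro exI allI impI)
    fix r assume "hat G (p, R) f r \<noteq> 0"
    then have "f (transpose (A p) *v (r - R)) \<noteq> 0"
      by (auto simp: hat_eq p lift_op_0 [OF semi])
    then have "norm (transpose (A p) *v (r - R)) \<le> \<rho>" by (rule \<rho>)
    then have "norm (r - R) \<le> \<rho>"
      by (simp add: orthogonal_matrix_norm orth p)
    then show "norm r \<le> \<rho> + norm R" using norm_triangle_ineq [of "r - R" R] by simp
  qed
qed

text \<open>The test function is averaged over its images \<open>g p\<close>. Covariance of \<phi>
  turns the overlap with \<open>g p\<close> into \<open>a\<close> at the inverse image of
  \<open>k\<close>, conjugated when \<open>sg p = -1\<close>. Conjugation keeps real parts, so
  positivity survives the sum.\<close>

lemma covariant_amplitude: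
  fixes \<phi> :: "real^'d \<Rightarrow> ('d, 'v, 'm::finite) wavefun"
  assumes phib: "\<And>k. \<phi> k \<in> bloch (bravais G) k" and a: "a \<in> amplitudes \<phi>" "\<And>k. 0 < Re (a k)"
    and t: "\<And>p. p \<in> P \<Longrightarrow> t p \<in> bravais G" and \<gamma>: "\<And>p. p \<in> P \<Longrightarrow> cmod (\<gamma> p) = 1"
    and cov: "\<And>p k. p \<in> P \<Longrightarrow> AE r in lborel. hat G (p, t p) (\<phi> k) r = cscale (\<gamma> p) (\<phi> (kact p k) r)"
  obtains b where "b \<in> amplitudes \<phi>" "\<And>k. 0 < Re (b k)" "\<And>p k. p \<in> P \<Longrightarrow> b (kact p k) = conj_if (sg p) (b k)"
proof -
  have phiL: "\<phi> k \<in> locally_L2" for k by (rule bloch_locally_L2 [OF phib])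
  obtain f where f: "f \<in> locally_L2" "bounded {r. f r \<noteq> 0}" "\<And>k. a k = amp (\<phi> k) f"
    using a(1) by (auto simp: amplitudes_def)
  define g where "g p = (\<lambda>r. cscale (cnj (\<gamma> p)) (hat G (p, t p) f r))" for p
  have gL: "g p \<in> locally_L2" if "p \<in> P" for p
    unfolding g_def by (rule locally_L2_cscale [OF hat_locally_L2 [OF that t [OF that] f(1)]])
  have gb: "bounded {r. g p r \<noteq> 0}" if "p \<in> P" for p
    by (rule bounded_subset [OF bounded_support_hat [OF that t [OF that] f(2)]]) (auto simp: g_def)
  have gg: "\<gamma> p * cnj (\<gamma> p) = 1" if "p \<in> P" for p
    using \<gamma> [OF that] complex_norm_square [of "\<gamma> p"] by simp
  have key: "amp (\<phi> (kact p k)) (g p) = conj_if (sg p) (a k)" if p: "p \<in> P" for p k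
  proof -
    have hL: "hat G (p, t p) (\<phi> k) \<in> locally_L2" by (rule hat_locally_L2 [OF p t [OF p] phiL])
    have "AE r in lborel. \<phi> (kact p k) r = cscale (cnj (\<gamma> p)) (hat G (p, t p) (\<phi> k) r)"
      using cov [OF p, of k] by eventually_elim (simp add: gg [OF p] mult.commute)
    then have "amp (\<phi> (kact p k)) (g p) = amp (\<lambda>r. cscale (cnj (\<gamma> p)) (hat G (p, t p) (\<phi> k) r)) (g p)"
      by (rule amp_AE_cong [OF phiL locally_L2_cscale [OF hL] gL [OF p]])
    also have "\<dots> = \<gamma> p * (cnj (\<gamma> p) * amp (hat G (p, t p) (\<phi> k)) (hat G (p, t p) f))"
      by (simp add: g_def amp_def winner_cscale_left winner_cscale_right)
    also have "\<dots> = amp (hat G (p, t p) (\<phi> k)) (hat G (p, t p) f)"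
      by (simp add: mult.assoc [symmetric] gg [OF p])
    also have "\<dots> = conj_if (sg p) (a k)"
      by (simp add: amp_hat [OF p t [OF p] phiL f(1)] f(3))
    finally show ?thesis .
  qed
  define b where "b k = (\<Sum>p\<in>P. amp (\<phi> k) (g p))" for k
  have b_eq: "b k = (\<Sum>p\<in>P. conj_if (sg p) (a (kact (inv\<^bsub>point_group G\<^esub> p) k)))" for k
    unfolding b_def
  proof (rule sum.cong)
    fix p assume p: "p \<in> P"
    show "amp (\<phi> k) (g p) = conj_if (sg p) (a (kact (inv\<^bsub>point_group G\<^esub> p) k))"
      using key [OF p, of "kact (inv\<^bsub>point_group G\<^esub> p) k"] by (simp add: kact_inv p)
  qed simp
  show ?thesis
  proof (rule that [of b])
    have "(\<lambda>k. amp (\<phi> k) (g p)) \<in> amplitudes \<phi>" if "p \<in> P" for p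
      unfolding amplitudes_def using gL [OF that] gb [OF that] by blast
    then show "b \<in> amplitudes \<phi>"
      unfolding b_def [abs_def] by (rule amplitudes_sum [OF phib])
    show "0 < Re (b k)" for k
      unfolding b_eq Re_sum using a(2) finite_P pg.one_closed by (intro sum_pos) auto
    fix q k assume q: "q \<in> P"
    \<comment> \<open>Left multiplication by \<open>q\<close> permutes the summands, at the cost of
      one outer \<open>conj_if (sg q)\<close>.\<close>
    have "b (kact q k) = (\<Sum>p\<in>P. conj_if (sg q) (conj_if (sg p) (a (kact (inv\<^bsub>point_group G\<^esub> p) k))))"
      unfolding b_eq
    proof (rule sum.reindex_bij_witness [of _ "\<lambda>p. q \<otimes>\<^bsub>point_group G\<^esub> p"
          "\<lambda>p. inv\<^bsub>point_group G\<^esub> q \<otimes>\<^bsub>point_group G\<^esub> p"])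
      fix p assume p: "p \<in> P"
      show "q \<otimes>\<^bsub>point_group G\<^esub> (inv\<^bsub>point_group G\<^esub> q \<otimes>\<^bsub>point_group G\<^esub> p) = p"
        "inv\<^bsub>point_group G\<^esub> q \<otimes>\<^bsub>point_group G\<^esub> (q \<otimes>\<^bsub>point_group G\<^esub> p) = p"
        "inv\<^bsub>point_group G\<^esub> q \<otimes>\<^bsub>point_group G\<^esub> p \<in> P" "q \<otimes>\<^bsub>point_group G\<^esub> p \<in> P"
        using p q by (simp_all add: pg.m_assoc [symmetric])
      define p' where "p' = inv\<^bsub>point_group G\<^esub> q \<otimes>\<^bsub>point_group G\<^esub> p"
      have p': "p' \<in> P" "q \<otimes>\<^bsub>point_group G\<^esub> p' = p"
        using p q by (simp_all add: p'_def pg.m_assoc [symmetric])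
      have "kact (inv\<^bsub>point_group G\<^esub> p) (kact q k) = kact (inv\<^bsub>point_group G\<^esub> p') k"
        unfolding p'(2) [symmetric]
        by (simp add: pg.inv_mult_group q p'(1) kact_mult kact_inv)
      moreover have "conj_if (sg p) x = conj_if (sg q) (conj_if (sg p') x)" for x
        unfolding p'(2) [symmetric] by (simp add: sg_mult q p'(1) conj_if_conj_if sg_cases)
      ultimately show "conj_if (sg q) (conj_if (sg (inv\<^bsub>point_group G\<^esub> q \<otimes>\<^bsub>point_group G\<^esub> p))
            (a (kact (inv\<^bsub>point_group G\<^esub> (inv\<^bsub>point_group G\<^esub> q \<otimes>\<^bsub>point_group G\<^esub> p)) k)))
          = conj_if (sg p) (a (kact (inv\<^bsub>point_group G\<^esub> p) (kact q k)))"
        unfolding p'_def by simp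
    qed
    then show "b (kact q k) = conj_if (sg q) (b k)"
      by (simp add: b_eq conj_if_sum)
  qed
qed

text \<open>Projecting the periodized test function onto the fibre gives \<open>b k\<close> times
  the periodic part \<open>U k\<close> of the continuous section, and this product is analytic
  although neither factor is known to be. Division by its length, whose inverse is analytic as well,
  changes the section by the phase of \<open>b\<close> only.\<close>

lemma analytic_section:
  fixes E :: "('d, 'v, 'm::finite) fibres"
  assumes band: "band G 1 E" and chern: "(\<lambda>K K'. 0) \<in> first_chern_class G E"
  obtains \<psi> w \<gamma> where "\<And>k. \<psi> k \<in> E k" "\<And>k. nm (\<psi> k) = 1" "ncont \<psi>"
    "real_analytic (bloch (bravais G) 0) nm (\<lambda>k. phase_mult (- k) (\<psi> k))"
    "\<And>k K. K \<in> reciprocal G \<Longrightarrow> AE r in lborel. \<psi> (k + K) r = \<psi> k r"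
    "\<And>p. p \<in> P \<Longrightarrow> A p *v w - w \<in> bravais G"
    "\<And>p. p \<in> P \<Longrightarrow> cmod (\<gamma> p) = 1"
    "\<And>p k. p \<in> P \<Longrightarrow> AE r in lborel. hat G (p, A p *v w - w) (\<psi> k) r = cscale (\<gamma> p) (\<psi> (kact p k) r)"
proof -
  obtain \<phi>0 where \<phi>0: "continuous_unit_section G E \<phi>0"
    "\<And>k K. K \<in> reciprocal G \<Longrightarrow> AE r in lborel. \<phi>0 (k + K) r = \<phi>0 k r"
    by (rule periodic_section [OF band chern]) blast
  obtain \<phi> w \<gamma> where sec: "continuous_unit_section G E \<phi>"
    and per: "\<And>k K. K \<in> reciprocal G \<Longrightarrow> AE r in lborel. \<phi> (k + K) r = \<phi> k r"
    and w: "\<And>p. p \<in> P \<Longrightarrow> A p *v w - w \<in> bravais G"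
    and \<gamma>: "\<And>p. p \<in> P \<Longrightarrow> cmod (\<gamma> p) = 1"
    and cov: "\<And>p k. p \<in> P \<Longrightarrow> AE r in lborel. hat G (p, A p *v w - w) (\<phi> k) r = cscale (\<gamma> p) (\<phi> (kact p k) r)"
    by (rule covariant_section [OF band \<phi>0(1)], erule \<phi>0(2), blast)
  have phi: "\<phi> k \<in> E k" "nm (\<phi> k) = 1" for k using sec by (auto simp: continuous_unit_section_def)
  note span = simple_band_span [OF band phi]
  have phiL: "\<phi> k \<in> locally_L2" for k by (rule bloch_locally_L2 [OF span(1)])
  define U where "U k = phase_mult (- k) (\<phi> k)" for k
  have Ub: "U k \<in> bloch (bravais G) 0" for k unfolding U_def by (rule phase_mult_bloch_0 [OF span(1)])
  have UL: "U k \<in> locally_L2" for k by (rule bloch_locally_L2 [OF Ub])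
  have Un: "nm (U k) = 1" for k by (simp add: U_def phi)
  have Uphi: "phase_mult k (U k) = \<phi> k" for k by (simp add: U_def)
  have "ncont (\<lambda>k. phase_mult k (U k))"
    by (rule ncont_phase_mult) (unfold U_def [abs_def], rule section_ncont [OF sec span(1)])
  then have nc: "ncont \<phi>" unfolding Uphi by simp
  obtain a where a: "a \<in> amplitudes \<phi>" "\<forall>k. 0 < Re (a k)"
    using positive_amplitude [OF span(1) nc phi(2) per] by blast
  obtain b where b: "b \<in> amplitudes \<phi>" "\<And>k. 0 < Re (b k)" "\<And>p k. p \<in> P \<Longrightarrow> b (kact p k) = conj_if (sg p) (b k)"
    by (rule covariant_amplitude [OF span(1) a(1), of "\<lambda>p. A p *v w - w" \<gamma>])
      (rule a(2) [rule_format], erule w, erule \<gamma>, erule cov, blast)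
  obtain f where f: "f \<in> locally_L2" "bounded {r. f r \<noteq> 0}" "\<And>k. b k = amp (\<phi> k) f"
    using b(1) by (auto simp: amplitudes_def)
  obtain \<rho> where \<rho>: "\<And>r. f r \<noteq> 0 \<Longrightarrow> norm r \<le> \<rho>" using f(2) unfolding bounded_support_norm by blast
  have pf: "phase_mult (- k) f \<in> locally_L2" for k by (rule phase_mult_locally_L2 [OF f(1)])
  have ps: "norm r \<le> \<rho>" if "phase_mult (- k) f r \<noteq> 0" for k r
  proof (rule \<rho>)
    show "f r \<noteq> 0" using that by (auto simp: phase_mult_def)
  qed
  define V where "V k = periodize (phase_mult (- k) f)" for k
  have Vb: "V k \<in> bloch (bravais G) 0" for k unfolding V_def by (rule periodize_bloch [OF pf ps])
  have V_an: "real_analytic (bloch (bravais G) 0) nm V"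
    unfolding V_def [abs_def] by (rule real_analytic_periodize [OF f(1) \<rho>])
  have UV: "ip (U k) (V k) = b k" for k
    unfolding V_def by (subst cell_inner_periodize [OF Ub pf ps]) (simp_all add: U_def phase_mult_amp f(3))
  \<comment> \<open>The projection conjugated to periodic functions, in exactly the form whose
    analyticity is part of \<open>band\<close>.\<close>
  define Q where "Q k u = phase_mult (- k) (proj (bravais G) (E k) (phase_mult k u))" for k u
  have Qb: "Q k u \<in> bloch (bravais G) 0" and Qae: "AE r in lborel. Q k u r = cscale (ip (U k) u) (U k r)"
    if u: "u \<in> bloch (bravais G) 0" for k u
  proof -
    have ku: "phase_mult k u \<in> bloch (bravais G) k" using phase_mult_bloch [OF u, of k] by simp
    note pr = simple_band_proj [OF band phi ku]
    show "Q k u \<in> bloch (bravais G) 0"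
      unfolding Q_def using span(2) [OF pr(1)] by (intro phase_mult_bloch_0) blast
    have eqn: "ip (\<phi> k) (phase_mult k u) = ip (U k) u"
      using cell_inner_phase_mult [of k "U k" u] by (simp only: Uphi)
    have Qr: "Q k u r = cscale (cis (- (k \<bullet> r))) (proj (bravais G) (E k) (phase_mult k u) r)" for r
      by (simp add: Q_def phase_mult_def [of "- k"])
    have Ur: "U k r = cscale (cis (- (k \<bullet> r))) (\<phi> k r)" for r
      by (simp add: U_def phase_mult_def)
    show "AE r in lborel. Q k u r = cscale (ip (U k) u) (U k r)"
      using pr(2) by eventually_elim (simp add: eqn Qr Ur mult.commute)
  qed
  have QL: "Q k u \<in> locally_L2" if "u \<in> bloch (bravais G) 0" for k u
    by (rule bloch_locally_L2 [OF Qb [OF that]])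
  have Q_ops: "Q k \<in> bounded_ops (bravais G)" for k
  proof (rule bounded_ops_I)
    fix u v :: "('d, 'v, 'm) wavefun" and c assume u: "u \<in> bloch (bravais G) 0"
    note uL = bloch_locally_L2 [OF u]
    show "Q k u \<in> bloch (bravais G) 0" by (rule Qb [OF u])
    have cu: "(\<lambda>x. cscale c (u x)) \<in> bloch (bravais G) 0" by (rule bloch_cscale [OF u])
    show "AE r in lborel. Q k (\<lambda>x. cscale c (u x)) r = cscale c (Q k u r)"
      using Qae [OF cu, of k] Qae [OF u, of k] by eventually_elim (simp add: cell_inner_cscale_right)
    have "nm (Q k u) = nm (\<lambda>r. cscale (ip (U k) u) (U k r))"
      by (rule cell_norm_AE_cong [OF QL [OF u] locally_L2_cscale [OF UL] Qae [OF u]])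
    also have "\<dots> \<le> nm (U k) * nm u" using cell_inner_le [OF UL uL, of k] by (simp add: Un)
    finally show "nm (Q k u) \<le> 1 * nm u" by (simp add: Un)
    assume v: "v \<in> bloch (bravais G) 0"
    have eqn: "ip (U k) (u + v) = ip (U k) u + ip (U k) v"
      using cell_inner_add_right [OF UL uL bloch_locally_L2 [OF v]] by (simp add: plus_fun_def)
    show "AE r in lborel. Q k (u + v) r = Q k u r + Q k v r"
      using Qae [OF plus_bloch [OF u v], of k] Qae [OF u, of k] Qae [OF v, of k]
      by eventually_elim (simp add: eqn cscale_add_left)
  qed
  have Q_an: "real_analytic (bounded_ops (bravais G)) (op_norm (bravais G)) Q"
    using band unfolding band_def Q_def [abs_def] by blast
  define X where "X k = Q k (V k)" for k
  have Xb: "X k \<in> bloch (bravais G) 0" for k unfolding X_def by (rule Qb [OF Vb])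
  have Xae: "AE r in lborel. X k r = cscale (b k) (U k r)" for k
    using Qae [OF Vb, of k k] by (simp add: X_def UV)
  have X_an: "real_analytic (bloch (bravais G) 0) nm X"
    unfolding X_def [abs_def] by (rule real_analytic_apply [OF Q_an Q_ops V_an Vb])
  have b0: "0 < cmod (b k)" for k using b(2) [of k] by auto
  \<comment> \<open>An inner product of two analytic families that equals the squared length of
    \<open>X\<close>; the inverse length is therefore analytic as an inverse square root.\<close>
  have VX: "Re (ip (V k) (X k)) = (cmod (b k))\<^sup>2" for k
  proof -
    have "ip (V k) (X k) = ip (V k) (\<lambda>r. cscale (b k) (U k r))"
      by (rule cell_inner_AE_cong [OF _ _ _ locally_L2_cscale [OF UL] _ Xae])
        (simp_all add: bloch_locally_L2 [OF Vb] bloch_locally_L2 [OF Xb])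
    also have "\<dots> = b k * ip (V k) (U k)" by (rule cell_inner_cscale_right)
    also have "ip (V k) (U k) = cnj (b k)" by (metis UV cell_inner_commute)
    finally show ?thesis by (metis complex_norm_square Re_complex_of_real)
  qed
  have "real_analytic UNIV abs (\<lambda>k. Re (ip (V k) (X k)))"
    by (rule real_analytic_inner [OF V_an Vb X_an Xb])
  then have "real_analytic UNIV abs (\<lambda>k. (cmod (b k))\<^sup>2)" by (simp add: VX)
  then have "real_analytic UNIV abs (\<lambda>k. 1 / sqrt ((cmod (b k))\<^sup>2))"
    by (rule real_analytic_inverse_sqrt) (use b0 in simp)
  then have "real_analytic UNIV abs (\<lambda>k. 1 / cmod (b k))" by simp
  then have Y_an: "real_analytic (bloch (bravais G) 0) nm (\<lambda>k. (1 / cmod (b k)) *\<^sub>R X k)"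
    by (rule real_analytic_scaleR [OF _ X_an Xb])
  \<comment> \<open>Dividing \<open>X\<close>, which is \<open>b\<close> times \<open>U\<close>, by
    its length leaves this phase.\<close>
  define c where "c k = b k / cmod (b k)" for k
  have c1: "cmod (c k) = 1" for k using b0 [of k] by (simp add: c_def norm_divide)
  have b_cont: "continuous_on UNIV b"
    using continuous_on_amp [OF nc span(1) f(1,2)] by (simp add: f(3) [symmetric])
  have c_cont: "continuous_on UNIV c"
    unfolding c_def [abs_def] by (intro continuous_intros b_cont) (use b0 in \<open>simp add: less_imp_neq [symmetric]\<close>)
  define \<psi> where "\<psi> = (\<lambda>k r. cscale (c k) (\<phi> k r))"
  show ?thesis
  proof (rule that [of \<psi> w \<gamma>])
    show "\<psi> k \<in> E k" for k
      unfolding \<psi>_def by (rule span(3) [of _ k "c k"]) (simp_all add: bloch_cscale span(1))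
    show "nm (\<psi> k) = 1" for k by (simp add: \<psi>_def c1 phi)
    show "ncont \<psi>" unfolding \<psi>_def by (rule ncont_cscale [OF nc c_cont])
    have pw: "phase_mult (- k) (\<psi> k) = (\<lambda>r. cscale (c k) (U k r))" for k
      by (simp add: \<psi>_def U_def phase_mult_simps)
    show "real_analytic (bloch (bravais G) 0) nm (\<lambda>k. phase_mult (- k) (\<psi> k))"
    proof (rule seminormed.real_analytic_cong [OF seminormed_bloch Y_an])
      fix k
      show 1: "phase_mult (- k) (\<psi> k) \<in> bloch (bravais G) 0" unfolding pw by (rule bloch_cscale [OF Ub])
      show 2: "(1 / cmod (b k)) *\<^sub>R X k \<in> bloch (bravais G) 0" by (rule scaleR_bloch [OF Xb])
      show "nm (phase_mult (- k) (\<psi> k) - (1 / cmod (b k)) *\<^sub>R X k) = 0"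
      proof (rule cell_norm_diff_null [OF bloch_locally_L2 [OF 1] bloch_locally_L2 [OF 2]])
        show "AE r in lborel. phase_mult (- k) (\<psi> k) r = ((1 / cmod (b k)) *\<^sub>R X k) r"
          using Xae [of k] by eventually_elim (simp add: pw c_def scaleR_cscale)
      qed
    qed
    fix k K assume K: "K \<in> reciprocal G"
    have eqn: "b (k + K) = b k"
      unfolding f(3) by (rule amp_AE_cong [OF phiL phiL f(1) per [OF K]])
    show "AE r in lborel. \<psi> (k + K) r = \<psi> k r"
      using per [OF K, of k] by eventually_elim (simp add: eqn \<psi>_def c_def)
  next
    fix p k assume p: "p \<in> P"
    \<comment> \<open>The phase of \<open>b\<close> transforms as a scalar does under the semilinear
      operator, so \<gamma> and \<open>w\<close> carry over unchanged.\<close>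
    have eqn: "c (kact p k) = conj_if (sg p) (c k)" by (simp add: c_def b(3) [OF p])
    show "AE r in lborel. hat G (p, A p *v w - w) (\<psi> k) r = cscale (\<gamma> p) (\<psi> (kact p k) r)"
      using cov [OF p, of k] unfolding \<psi>_def hat_cscale [OF p w [OF p]]
      by eventually_elim (simp add: eqn mult.commute)
  qed (use w \<gamma> in simp_all)
qed

end

subsection \<open>Wannier functions of a covariant section\<close>

context msg
begin

lemma amp_commute: "amp f u = cnj (amp u f)"
proof -
  have "amp f u = (LINT r|lborel. cnj (winner (u r) (f r)))"
    unfolding amp_def by (rule Bochner_Integration.integral_cong) (simp_all add: winner_commute [symmetric])
  then show ?thesis by (simp add: amp_def)
qed

lemma amp_cscale_right: "amp u (\<lambda>r. cscale c (f r)) = c * amp u f"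
  by (simp add: amp_commute [of u] amp_cscale_left)

text \<open>\<open>kact p\<close> carries the cell of the reciprocal lattice to another fundamental
  domain, and the integrand is periodic.\<close>

lemma integral_dual_cell_kact:
  fixes H :: "real^'d \<Rightarrow> complex"
  assumes p: "p \<in> P" and H: "continuous_on UNIV H"
    and per: "\<And>k K. K \<in> reciprocal G \<Longrightarrow> H (k + K) = H k"
  shows "(LINT k:dual.cell|lborel. H (kact p k)) = (LINT k:dual.cell|lborel. H k)"
proof -
  let ?p' = "inv\<^bsub>point_group G\<^esub> p"
  have p': "?p' \<in> P" using p by simp
  define D where "D = {k. kact ?p' k \<in> dual.cell}"
  have kact_norm: "norm (kact q k) = norm k" if "q \<in> P" for q k
    using sg_cases [OF that] by (auto simp: kact_def orthogonal_matrix_norm orth that)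
  have D: "D \<in> sets borel"
    using measurable_sets_borel [OF borel_measurable_continuous_onI [OF continuous_on_kact], of dual.cell ?p']
    by (simp add: D_def vimage_def)
  have bD: "bounded D"
    unfolding bounded_iff
  proof (intro exI ballI)
    fix k assume "k \<in> D"
    then show "norm k \<le> dual.cell_radius"
      using dual.norm_cell_le [of "kact ?p' k"] by (simp add: D_def kact_norm p')
  qed
  have uD: "\<exists>!K. K \<in> reciprocal G \<and> k + K \<in> D" for k
  proof -
    obtain K1 where K1: "K1 \<in> reciprocal G" "kact ?p' k + K1 \<in> dual.cell"
      "\<And>K2. K2 \<in> reciprocal G \<Longrightarrow> kact ?p' k + K2 \<in> dual.cell \<Longrightarrow> K2 = K1"
      using dual.cell_ex1 [of "kact ?p' k"] by blast
    show ?thesis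
    proof (intro ex1I [of _ "kact p K1"] conjI)
      show "kact p K1 \<in> reciprocal G" by (rule kact_dual [OF p K1(1)])
      show "k + kact p K1 \<in> D" using K1(2) by (simp add: D_def kact_inv p)
      fix K assume K: "K \<in> reciprocal G \<and> k + K \<in> D"
      then have "kact ?p' K = K1" by (intro K1(3)) (auto simp: D_def kact_dual p')
      then show "K = kact p K1" using kact_inv(2) [OF p, of K] by simp
    qed
  qed
  \<comment> \<open>The action on wavevectors as one orthogonal matrix, sign included, so that the
    change of variables for isometries applies.\<close>
  define M where "M = sg p *\<^sub>R A p"
  have M: "M *v k = kact p k" for k by (simp add: M_def kact_def scaleR_matrix_vector_assoc)
  have oM: "orthogonal_matrix M"
    using orth [OF p] sg_cases [OF p] unfolding M_def orthogonal_matrix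
    by (auto simp: transpose_def matrix_matrix_mult_def vec_eq_iff)
  have Hb: "H \<in> borel_measurable borel" by (rule borel_measurable_continuous_onI [OF H])
  have Bb: "(\<lambda>k. indicator D k *\<^sub>R H k) \<in> borel_measurable borel"
    by (intro borel_measurable_scaleR borel_measurable_indicator D Hb)
  have "(LINT k:dual.cell|lborel. H (kact p k)) = (LINT k|lborel. (\<lambda>k. indicator D k *\<^sub>R H k) (M *v k + 0))"
    unfolding set_lebesgue_integral_def
    by (rule Bochner_Integration.integral_cong) (simp_all add: M D_def indicator_def kact_inv p)
  also have "\<dots> = (LINT k|lborel. indicator D k *\<^sub>R H k)"
    by (rule lborel_integral_isometry [OF oM Bb])
  also have "\<dots> = (LINT k:D|lborel. H k)" by (simp add: set_lebesgue_integral_def)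
  also have "\<dots> = (LINT k:dual.cell|lborel. H k)"
    by (rule dual.integral_fundamental_domain [OF D bD uD])
      (simp_all add: per borel_integrable_compact set_integrable_def [symmetric] continuous_on_subset [OF H]
        borel_integrable_compact [OF compact_cball continuous_on_subset [OF H subset_UNIV], unfolded set_integrable_def [symmetric]])
  finally show ?thesis .
qed

text \<open>Two space group elements with the same point part differ by a lattice translation, which
  acts on a Bloch function by a phase.\<close>

lemma hat_covariant:
  assumes p: "p \<in> P" and R: "R \<in> bravais G" and t: "t \<in> bravais G" and \<psi>: "\<And>k. \<psi> k \<in> bloch (bravais G) k"
    and cov: "AE r in lborel. hat G (p, t) (\<psi> k) r = cscale \<gamma> (\<psi> (kact p k) r)"
  shows "AE r in lborel. hat G (p, R) (\<psi> k) r = cscale (\<gamma> * cis (kact p k \<bullet> (t - R))) (\<psi> (kact p k) r)"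
proof -
  have "AE r in lborel. hat G (p, t) (\<psi> k) (r + (t - R)) = cscale \<gamma> (\<psi> (kact p k) (r + (t - R)))"
    by (rule AE_lborel_translate [OF cov])
  then show ?thesis
    using bloch_AE [OF \<psi> L_closed(3) [OF t R], of "kact p k"]
    by eventually_elim (simp add: hat_eq p R t)
qed

text \<open>Tested against \<theta>, a Wannier function is an integral over wavevectors of overlaps.
  Covariance of the section and the substitution of \<open>kact p k\<close> turn the integral for
  the label \<open>R\<close> into the one for the image label; the constant \<gamma> comes out of
  the integral.\<close>

lemma is_wannier_hat:
  fixes \<psi> :: "real^'d \<Rightarrow> ('d, 'v, 'm::finite) wavefun"
  assumes p: "p \<in> P" and R0: "R0 \<in> bravais G" and R: "R \<in> bravais G" and t: "t \<in> bravais G"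
    and \<psi>: "\<And>k. \<psi> k \<in> bloch (bravais G) k" "ncont \<psi>"
      "\<And>k K. K \<in> reciprocal G \<Longrightarrow> AE r in lborel. \<psi> (k + K) r = \<psi> k r"
    and \<gamma>: "cmod \<gamma> = 1"
    and cov: "\<And>k. AE r in lborel. hat G (p, t) (\<psi> k) r = cscale \<gamma> (\<psi> (kact p k) r)"
    and w: "is_wannier G \<psi> R w"
  shows "is_wannier G \<psi> (A p *v R + R0 - t) (\<lambda>r. cscale (cnj \<gamma>) (hat G (p, R0) w r))"
proof -
  let ?c = "complex_of_real (measure lborel (unit_cell (reciprocal G)) powr (-1/2))"
  let ?R' = "A p *v R + R0 - t"
  have wL: "w \<in> locally_L2" using w by (simp add: is_wannier_def)
  have \<psi>L: "\<psi> k \<in> locally_L2" for k by (rule bloch_locally_L2 [OF \<psi>(1)])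
  have R': "?R' \<in> bravais G" by (intro L_closed rot_mem p R R0 t)
  have g: "(p, R0) \<in> carrier (space_group G)" by (simp add: space_group_simps p R0)
  have gg: "cnj \<gamma> * \<gamma> = 1" using \<gamma> by (simp add: complex_norm_square [symmetric] mult.commute)
  have hw: "hat G (p, R0) w \<in> locally_L2" by (rule hat_locally_L2 [OF p R0 wL])
  show ?thesis
    unfolding is_wannier_def
  proof (intro conjI ballI impI)
    show "(\<lambda>r. cscale (cnj \<gamma>) (hat G (p, R0) w r)) \<in> locally_L2" by (rule locally_L2_cscale [OF hw])
    fix \<theta> :: "('d, 'v, 'm) wavefun"
    assume \<theta>: "\<theta> \<in> locally_L2" and b\<theta>: "bounded {r. \<theta> r \<noteq> 0}"
    \<comment> \<open>The group element is moved from the Wannier function to the test function,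
      where the weak definition can be applied.\<close>
    define \<theta>1 where "\<theta>1 = hat G (inv\<^bsub>space_group G\<^esub> (p, R0)) \<theta>"
    have p': "inv\<^bsub>point_group G\<^esub> p \<in> P" and R0': "- (transpose (A p) *v R0) \<in> bravais G"
      using p R0 by (simp_all add: rot_transpose_mem)
    have \<theta>1: "\<theta>1 \<in> locally_L2" "bounded {r. \<theta>1 r \<noteq> 0}"
      unfolding \<theta>1_def space_group_inv [OF p R0]
      by (rule hat_locally_L2 [OF p' R0' \<theta>], rule bounded_support_hat [OF p' R0' b\<theta>])
    have \<theta>_eq: "\<theta> = hat G (p, R0) \<theta>1" unfolding \<theta>1_def by (simp add: hat_inv_cancel [OF g])
    define H where "H k = cis (- (k \<bullet> ?R')) * amp \<theta> (\<psi> k)" for k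
    have H_cont: "continuous_on UNIV H"
      unfolding H_def amp_commute [of \<theta>]
      by (intro continuous_intros continuous_on_cnj continuous_on_amp [OF \<psi>(2,1) \<theta> b\<theta>])
    have H_per: "H (k + K) = H k" if K: "K \<in> reciprocal G" for k K
    proof -
      have "amp (\<psi> (k + K)) \<theta> = amp (\<psi> k) \<theta>" by (rule amp_AE_cong [OF \<psi>L \<psi>L \<theta> \<psi>(3) [OF K]])
      moreover have "cis (- ((k + K) \<bullet> ?R')) = cis (- (k \<bullet> ?R')) * cis (- K \<bullet> ?R')"
        by (simp only: cis_mult inner_add_left inner_minus_left minus_add_distrib)
      moreover have "cis (- K \<bullet> ?R') = 1"
        using cis_dual [OF _ R'] dual.L_closed(4) [OF K] by (simp only: reciprocal_def)
      ultimately show ?thesis by (simp only: H_def amp_commute [of \<theta>] mult_1_right)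
    qed
    \<comment> \<open>The phases of the old label and of the lattice translation
      \<open>t - R0\<close> combine to the phase of the new label at the transformed
      wavevector.\<close>
    have step: "cnj \<gamma> * conj_if (sg p) (cis (- (k \<bullet> R)) * amp \<theta>1 (\<psi> k)) = H (kact p k)" for k
    proof -
      have kR: "kact p k \<bullet> (A p *v R) = sg p * (k \<bullet> R)" by (simp add: kact_inner p rot_cancel)
      have "conj_if (sg p) (amp \<theta>1 (\<psi> k)) = amp \<theta> (hat G (p, R0) (\<psi> k))"
        unfolding \<theta>_eq by (rule amp_hat [OF p R0 \<theta>1(1) \<psi>L, symmetric])
      also have "\<dots> = cnj (amp (\<lambda>r. cscale (\<gamma> * cis (kact p k \<bullet> (t - R0))) (\<psi> (kact p k) r)) \<theta>)"
        unfolding amp_commute [of \<theta>]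
        by (subst amp_AE_cong [OF hat_locally_L2 [OF p R0 \<psi>L] locally_L2_cscale [OF \<psi>L] \<theta>
              hat_covariant [OF p R0 t \<psi>(1) cov]]) simp
      also have "\<dots> = \<gamma> * cis (kact p k \<bullet> (t - R0)) * amp \<theta> (\<psi> (kact p k))"
        by (simp add: amp_commute [of \<theta>] amp_cscale_left)
      finally have 1: "conj_if (sg p) (amp \<theta>1 (\<psi> k)) = \<gamma> * cis (kact p k \<bullet> (t - R0)) * amp \<theta> (\<psi> (kact p k))" .
      have 2: "conj_if (sg p) (cis (- (k \<bullet> R))) = cis (- (kact p k \<bullet> (A p *v R)))"
        by (simp add: conj_if_cis [OF sg_cases [OF p]] kR)
      have 3: "cis (- (kact p k \<bullet> (A p *v R))) * cis (kact p k \<bullet> (t - R0)) = cis (- (kact p k \<bullet> ?R'))"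
        unfolding cis_mult by (intro arg_cong [where f = cis]) (simp add: inner_diff_right inner_add_right)
      have "cnj \<gamma> * conj_if (sg p) (cis (- (k \<bullet> R)) * amp \<theta>1 (\<psi> k))
          = (cnj \<gamma> * \<gamma>) * (cis (- (kact p k \<bullet> (A p *v R))) * cis (kact p k \<bullet> (t - R0))) * amp \<theta> (\<psi> (kact p k))"
        by (simp add: conj_if_simps 1 2)
      then show ?thesis by (simp only: gg 3 H_def mult_1_left)
    qed
    have "(LINT r|lborel. winner (\<theta> r) (cscale (cnj \<gamma>) (hat G (p, R0) w r)))
        = cnj \<gamma> * amp (hat G (p, R0) \<theta>1) (hat G (p, R0) w)"
      using amp_cscale_right [of \<theta> "cnj \<gamma>" "hat G (p, R0) w"] by (simp add: amp_def \<theta>_eq [symmetric])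
    also have "\<dots> = cnj \<gamma> * conj_if (sg p) (amp \<theta>1 w)"
      by (simp only: amp_hat [OF p R0 \<theta>1(1) wL])
    also have "amp \<theta>1 w = ?c * (LINT k:dual.cell|lborel. cis (- (k \<bullet> R)) * amp \<theta>1 (\<psi> k))"
      using w \<theta>1 unfolding is_wannier_def amp_def by blast
    also have "cnj \<gamma> * conj_if (sg p) \<dots>
        = ?c * (LINT k:dual.cell|lborel. cnj \<gamma> * conj_if (sg p) (cis (- (k \<bullet> R)) * amp \<theta>1 (\<psi> k)))"
      by (cases "sg p = 1") (simp_all add: conj_if_def set_lebesgue_integral_def flip: Bochner_Integration.integral_cnj)
    also have "\<dots> = ?c * (LINT k:dual.cell|lborel. H (kact p k))" by (simp only: step)
    also have "\<dots> = ?c * (LINT k:dual.cell|lborel. H k)" by (simp only: integral_dual_cell_kact [OF p H_cont H_per])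
    finally show "(LINT r|lborel. winner (\<theta> r) (cscale (cnj \<gamma>) (hat G (p, R0) w r)))
        = ?c * (LINT k:dual.cell|lborel. cis (- (k \<bullet> ?R')) * (LINT r|lborel. winner (\<theta> r) (\<psi> k r)))"
      by (simp add: H_def amp_def)
  qed
qed

lemma wannier_span_1:
  "f \<in> wannier_span G 1 (\<lambda>\<alpha>. \<psi>) R \<longleftrightarrow>
    f \<in> locally_L2 \<and> (\<exists>c w. is_wannier G \<psi> R w \<and> (AE r in lborel. f r = cscale c (w r)))"
proof
  assume f: "f \<in> locally_L2 \<and> (\<exists>c w. is_wannier G \<psi> R w \<and> (AE r in lborel. f r = cscale c (w r)))"
  then obtain c w where cw: "is_wannier G \<psi> R w" "AE r in lborel. f r = cscale c (w r)" by blast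
  show "f \<in> wannier_span G 1 (\<lambda>\<alpha>. \<psi>) R"
    unfolding wannier_span_def
    using f cw by (intro CollectI conjI exI [of _ "\<lambda>_. c"] exI [of _ "\<lambda>_. w"]) auto
next
  assume "f \<in> wannier_span G 1 (\<lambda>\<alpha>. \<psi>) R"
  then obtain c :: "nat \<Rightarrow> complex" and w where "f \<in> locally_L2" "is_wannier G \<psi> R (w 0)"
    "AE r in lborel. f r = cscale (c 0) (w 0 r)"
    unfolding wannier_span_def by auto
  then show "f \<in> locally_L2 \<and> (\<exists>c w. is_wannier G \<psi> R w \<and> (AE r in lborel. f r = cscale c (w r)))"
    by blast
qed

text \<open>One Wannier function for each point of the orbit of \<open>- w\<close>: the point part
  \<open>p\<close> maps \<open>- w + R\<close> to \<open>- w + (A p *v R - (A p *v w - w))\<close>,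
  and this is the rule by which \<open>is_wannier_hat\<close> changes labels.\<close>

lemma simple_band_rep:
  fixes E :: "('d, 'v, 'm::finite) fibres"
  assumes band: "band G 1 E" and chern: "\<not> nonvanishing_chern G E"
  shows "band_rep G 1 E"
proof -
  have chern0: "(\<lambda>K K'. 0) \<in> first_chern_class G E" using chern by (simp add: nonvanishing_chern_def)
  obtain \<psi> w \<gamma> where \<psi>E: "\<And>k. \<psi> k \<in> E k" and \<psi>1: "\<And>k. nm (\<psi> k) = 1" and nc: "ncont \<psi>"
    and an: "real_analytic (bloch (bravais G) 0) nm (\<lambda>k. phase_mult (- k) (\<psi> k))"
    and per: "\<And>k K. K \<in> reciprocal G \<Longrightarrow> AE r in lborel. \<psi> (k + K) r = \<psi> k r"
    and w: "\<And>p. p \<in> P \<Longrightarrow> A p *v w - w \<in> bravais G"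
    and \<gamma>: "\<And>p. p \<in> P \<Longrightarrow> cmod (\<gamma> p) = 1"
    and cov: "\<And>p k. p \<in> P \<Longrightarrow> AE r in lborel. hat G (p, A p *v w - w) (\<psi> k) r = cscale (\<gamma> p) (\<psi> (kact p k) r)"
    by (rule analytic_section [OF band chern0], blast)
  note span = simple_band_span [OF band \<psi>E \<psi>1]
  define X where "X = {- w + R | (n::nat) R. n < 1 \<and> R \<in> bravais G}"
  define W where "W x = \<Union>{wannier_span G 1 (\<lambda>\<alpha>. \<psi>) R | (n::nat) R. n < 1 \<and> R \<in> bravais G \<and> x = - w + R}" for x
  have X: "x \<in> X \<longleftrightarrow> x + w \<in> bravais G" for x
  proof
    assume "x + w \<in> bravais G"
    then show "x \<in> X" unfolding X_def by (intro CollectI exI [of _ 0] exI [of _ "x + w"]) simp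
  qed (auto simp: X_def)
  have Wx: "f \<in> W x \<longleftrightarrow> x + w \<in> bravais G \<and> f \<in> wannier_span G 1 (\<lambda>\<alpha>. \<psi>) (x + w)" for f x
  proof
    assume "x + w \<in> bravais G \<and> f \<in> wannier_span G 1 (\<lambda>\<alpha>. \<psi>) (x + w)"
    then show "f \<in> W x"
      unfolding W_def
      by (intro UnionI [of "wannier_span G 1 (\<lambda>\<alpha>. \<psi>) (x + w)"] CollectI exI [of _ 0] exI [of _ "x + w"]) simp_all
  qed (auto simp: W_def)
  have act_shift: "act G (p, R0) x + w = A p *v (x + w) + R0 - (A p *v w - w)" for p R0 x
    by (simp add: act_def matrix_vector_right_distrib)
  have act_X: "act G g x \<in> X" if g: "g \<in> carrier (space_group G)" and x: "x \<in> X" for g x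
  proof -
    obtain p R0 where [simp]: "g = (p, R0)" and p: "p \<in> P" and R0: "R0 \<in> bravais G"
      using g by (cases g) (auto simp: space_group_simps)
    show ?thesis
      unfolding X \<open>g = (p, R0)\<close> act_shift
      by (rule L_closed(3) [OF L_closed(2) [OF rot_mem [OF p x [unfolded X]] R0] w [OF p]])
  qed
  have sub: "hat G g f \<in> W (act G g x)"
    if g: "g \<in> carrier (space_group G)" and x: "x \<in> X" and f: "f \<in> W x" for g x f
  proof -
    obtain p R0 where geq: "g = (p, R0)" and p: "p \<in> P" and R0: "R0 \<in> bravais G"
      using g by (cases g) (auto simp: space_group_simps)
    have R: "x + w \<in> bravais G" using x by (simp add: X)
    obtain c v where fL: "f \<in> locally_L2" and v: "is_wannier G \<psi> (x + w) v"
      and ae: "AE r in lborel. f r = cscale c (v r)"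
      using f unfolding Wx wannier_span_1 by blast
    have gg: "\<gamma> p * cnj (\<gamma> p) = 1"
      using \<gamma> [OF p] by (simp add: complex_norm_square [symmetric])
    have v': "is_wannier G \<psi> (act G (p, R0) x + w) (\<lambda>r. cscale (cnj (\<gamma> p)) (hat G (p, R0) v r))"
      unfolding act_shift by (rule is_wannier_hat [OF p R0 R w [OF p] span(1) nc per \<gamma> [OF p] cov [OF p] v])
    have "AE r in lborel. hat G (p, R0) f r
        = cscale (conj_if (sg p) c * \<gamma> p) (cscale (cnj (\<gamma> p)) (hat G (p, R0) v r))"
      using hat_AE [OF p R0 ae] unfolding hat_cscale [OF p R0]
      by eventually_elim (simp add: mult.assoc gg)
    then have "hat G (p, R0) f \<in> wannier_span G 1 (\<lambda>\<alpha>. \<psi>) (act G (p, R0) x + w)"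
      unfolding wannier_span_1 using hat_locally_L2 [OF p R0 fL] v' by blast
    then show ?thesis using act_X [OF g x] unfolding Wx X geq by blast
  qed
  \<comment> \<open>The inclusion \<open>sub\<close>, applied to the inverse element as well, gives
    equality.\<close>
  have W_eq: "hat G g ` W x = W (act G g x)" if g: "g \<in> carrier (space_group G)" and x: "x \<in> X" for g x
  proof
    show "hat G g ` W x \<subseteq> W (act G g x)" using sub [OF g x] by blast
    show "W (act G g x) \<subseteq> hat G g ` W x"
    proof
      fix f assume f: "f \<in> W (act G g x)"
      have gi: "inv\<^bsub>space_group G\<^esub> g \<in> carrier (space_group G)" using g by simp
      obtain p R0 where geq: "g = (p, R0)" and p: "p \<in> P" and R0: "R0 \<in> bravais G"
        using g by (cases g) (auto simp: space_group_simps)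
      have "act G (inv\<^bsub>space_group G\<^esub> g) (act G g x) = x"
        by (simp add: geq space_group_inv p R0 act_def rot_inv matrix_vector_right_distrib rot_cancel)
      then have "hat G (inv\<^bsub>space_group G\<^esub> g) f \<in> W x"
        using sub [OF gi act_X [OF g x] f] by simp
      then show "f \<in> hat G g ` W x"
        using hat_inv_cancel(1) [OF g, of f] by (metis image_eqI)
    qed
  qed
  have I: "{(n, \<alpha>). n < (1::nat) \<and> \<alpha> < (1::nat)} = {(0, 0)}" by auto
  have basis: "orthonormal_basis (bravais G) k {(0::nat, 0::nat)} (\<lambda>i. \<psi> k) (E k)" for k
  proof -
    have "f \<in> E k \<longleftrightarrow> f \<in> bloch (bravais G) k \<and>
        (\<exists>c :: nat \<times> nat \<Rightarrow> complex. AE r in lborel. f r = (\<Sum>i\<in>{(0, 0)}. cscale (c i) (\<psi> k r)))" for f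
    proof
      assume "f \<in> E k"
      from span(2) [OF this] show "f \<in> bloch (bravais G) k \<and>
        (\<exists>c :: nat \<times> nat \<Rightarrow> complex. AE r in lborel. f r = (\<Sum>i\<in>{(0, 0)}. cscale (c i) (\<psi> k r)))"
        by (intro conjI exI [of _ "\<lambda>_. ip (\<psi> k) f"]) simp_all
    qed (use span(3) in auto)
    then show ?thesis
      unfolding orthonormal_basis_def by (auto simp: span(1) ip_self_unit \<psi>1)
  qed
  have frame: "analytic_periodic_frame G E {(n, \<alpha>). n < (1::nat) \<and> \<alpha> < (1::nat)} (\<lambda>i. \<psi>)"
    unfolding analytic_periodic_frame_def I
    by (intro conjI allI ballI) (rule basis, rule an, erule per)
  show ?thesis
    unfolding band_rep_def Let_def
  proof (intro conjI band exI [of _ "1::nat"] exI [of _ "\<lambda>_. - w"] exI [of _ "\<lambda>_. 1::nat"] exI [of _ "\<lambda>_. \<psi>"])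
    show "\<forall>g\<in>carrier (space_group G). \<forall>x\<in>{- w + R |n R. (n::nat) < 1 \<and> R \<in> bravais G}. act G g x \<in> {- w + R |n R. (n::nat) < 1 \<and> R \<in> bravais G}"
      by (intro ballI) (rule act_X [unfolded X_def])
    show "\<forall>g\<in>carrier (space_group G). \<forall>x\<in>{- w + R |n R. (n::nat) < 1 \<and> R \<in> bravais G}.
        hat G g ` \<Union> {wannier_span G 1 (\<lambda>\<alpha>. \<psi>) R |n R. (n::nat) < 1 \<and> R \<in> bravais G \<and> x = - w + R}
        = \<Union> {wannier_span G 1 (\<lambda>\<alpha>. \<psi>) R |n R. (n::nat) < 1 \<and> R \<in> bravais G \<and> act G g x = - w + R}"
      by (intro ballI) (rule W_eq [unfolded X_def W_def])
  qed (use frame in simp_all)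
qed

end

subsection \<open>Continuity of analytic families\<close>

context seminormed
begin

text \<open>Every monomial except the constant one is at most \<open>norm x / \<rho>\<close> times
  \<open>\<rho> ^ total_degree \<alpha>\<close>, so the distance to the constant coefficient is at
  most linear in \<open>norm x\<close>. The value at 0 may differ from that coefficient by a null
  element.\<close>

lemma power_series_on_tendsto:
  fixes v :: "real^'d::finite \<Rightarrow> 'x"
  assumes ps: "power_series_on S N \<rho> v a" and rho: "0 < \<rho>" and v: "\<And>x. v x \<in> S"
  shows "((\<lambda>x. N (v x - v 0)) \<longlongrightarrow> 0) (at 0)"
proof -
  let ?z = "(\<lambda>i. 0) :: 'd \<Rightarrow> nat"
  let ?C = "infsum (\<lambda>\<alpha>. N (a \<alpha>) * \<rho> ^ total_degree \<alpha>) UNIV"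
  have a: "a \<alpha> \<in> S" for \<alpha> using ps by (auto simp: power_series_on_def)
  have sm: "(\<lambda>\<alpha>. N (a \<alpha>) * \<rho> ^ total_degree \<alpha>) summable_on UNIV"
    using ps by (simp add: power_series_on_def)
  have near: "N (v x - a ?z) \<le> norm x / \<rho> * ?C" if x: "norm x < \<rho>" for x
  proof -
    let ?s = "\<lambda>B. \<Sum>\<alpha>\<in>B. monomial x \<alpha> *\<^sub>R a \<alpha>"
    have xi: "\<bar>x $ i\<bar> \<le> norm x" for i by (rule component_le_norm_cart)
    have mono: "\<bar>monomial x \<alpha>\<bar> \<le> norm x / \<rho> * \<rho> ^ total_degree \<alpha>" if nz: "\<alpha> \<noteq> ?z" for \<alpha>
    proof -
      obtain n where n: "total_degree \<alpha> = Suc n"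
        using nz total_degree_eq_0 [of \<alpha>] by (cases "total_degree \<alpha>") auto
      have "\<bar>monomial x \<alpha>\<bar> \<le> norm x ^ total_degree \<alpha>" by (rule abs_monomial_le [OF xi])
      also have "\<dots> \<le> norm x * \<rho> ^ n"
        unfolding n using power_mono [of "norm x" \<rho> n] x by (simp add: mult_left_mono)
      also have "\<dots> = norm x / \<rho> * \<rho> ^ total_degree \<alpha>" using rho by (simp add: n)
      finally show ?thesis .
    qed
    have mem: "?s B \<in> S" for B by (intro sum_mem scaleR_mem a)
    have bound: "N (v x - a ?z) \<le> N (v x - ?s B) + norm x / \<rho> * ?C" if B: "finite B" "?z \<in> B" for B
    proof -
      have "?s B = a ?z + ?s (B - {?z})" using sum.remove [OF B, of "\<lambda>\<alpha>. monomial x \<alpha> *\<^sub>R a \<alpha>"] by simp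
      then have eq: "v x - a ?z = (v x - ?s B) + ?s (B - {?z})" by simp
      have "N (v x - a ?z) \<le> N (v x - ?s B) + N (?s (B - {?z}))"
        unfolding eq by (rule N_triangle [OF diff_mem [OF v mem] mem])
      also have "N (?s (B - {?z})) \<le> (\<Sum>\<alpha>\<in>B - {?z}. N (monomial x \<alpha> *\<^sub>R a \<alpha>))"
        by (rule N_sum) (intro scaleR_mem a)
      also have "\<dots> \<le> (\<Sum>\<alpha>\<in>B - {?z}. norm x / \<rho> * (N (a \<alpha>) * \<rho> ^ total_degree \<alpha>))"
      proof (rule sum_mono)
        fix \<alpha> assume "\<alpha> \<in> B - {?z}"
        then have "\<alpha> \<noteq> ?z" by simp
        from mult_right_mono [OF mono [OF this] N_nonneg [OF a [of \<alpha>]]]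
        show "N (monomial x \<alpha> *\<^sub>R a \<alpha>) \<le> norm x / \<rho> * (N (a \<alpha>) * \<rho> ^ total_degree \<alpha>)"
          by (simp add: N_scaleR a mult_ac)
      qed
      also have "\<dots> = norm x / \<rho> * (\<Sum>\<alpha>\<in>B - {?z}. N (a \<alpha>) * \<rho> ^ total_degree \<alpha>)"
        by (simp add: sum_distrib_left)
      also have "\<dots> \<le> norm x / \<rho> * ?C"
        by (intro mult_left_mono finite_sum_le_infsum [OF sm]) (use B rho N_nonneg a in auto)
      finally show ?thesis by simp
    qed
    have "\<forall>i. \<bar>x $ i\<bar> < \<rho>" using xi x by (meson le_less_trans)
    then have "((\<lambda>B. N (v x - ?s B)) \<longlongrightarrow> 0) (finite_subsets_at_top UNIV)"
      using ps unfolding power_series_on_def by blast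
    then have lim: "((\<lambda>B. N (v x - ?s B) + norm x / \<rho> * ?C) \<longlongrightarrow> 0 + norm x / \<rho> * ?C) (finite_subsets_at_top UNIV)"
      by (intro tendsto_add tendsto_const)
    have "\<forall>\<^sub>F B in finite_subsets_at_top UNIV. N (v x - a ?z) \<le> N (v x - ?s B) + norm x / \<rho> * ?C"
      unfolding eventually_finite_subsets_at_top using bound by (intro exI [of _ "{?z}"]) auto
    from tendsto_lowerbound [OF lim this] show ?thesis by simp
  qed
  have v0: "N (v 0 - a ?z) = 0"
    using near [of 0] rho N_nonneg [OF diff_mem [OF v [of 0] a [of ?z]]] by simp
  show ?thesis
  proof (rule Lim_null_comparison)
    have "((\<lambda>x :: real^'d. norm x / \<rho> * ?C) \<longlongrightarrow> norm (0 :: real^'d) / \<rho> * ?C) (at 0)"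
      by (intro tendsto_intros) (use rho in simp)
    then show "((\<lambda>x :: real^'d. norm x / \<rho> * ?C) \<longlongrightarrow> 0) (at 0)" by simp
    have "N (v x - v 0) \<le> norm x / \<rho> * ?C" if "norm x < \<rho>" for x
    proof -
      have "N (v x - v 0) = N ((v x - a ?z) - (v 0 - a ?z))" by simp
      also have "\<dots> \<le> N (v x - a ?z) + N (v 0 - a ?z)" by (intro N_diff diff_mem v a)
      finally show ?thesis using near [OF that] v0 by simp
    qed
    moreover have "0 \<le> N (v x - v 0)" for x by (intro N_nonneg diff_mem v)
    ultimately show "\<forall>\<^sub>F x in at 0. norm (N (v x - v 0)) \<le> norm x / \<rho> * ?C"
      unfolding eventually_at by (intro exI [of _ \<rho>]) (use rho in simp)
  qed
qed

end

lemma (in lattice) real_analytic_ncont: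
  fixes u :: "real^'d \<Rightarrow> real^'d \<Rightarrow> complex^'v::finite^'m::finite"
  assumes an: "real_analytic (bloch L 0) (cell_norm L) u" and u: "\<And>k. u k \<in> bloch L 0"
  shows "ncont u"
proof (rule ncont_I)
  show "u k \<in> locally_L2" for k by (rule bloch_locally_L2 [OF u])
  fix k0
  obtain \<rho> a where "0 < \<rho>" "power_series_on (bloch L 0) (cell_norm L) \<rho> (\<lambda>x. u (k0 + x)) a"
    using an unfolding real_analytic_iff by blast
  then have "((\<lambda>x. cell_norm L (u (k0 + x) - u (k0 + 0))) \<longlongrightarrow> 0) (at 0)"
    by (intro seminormed.power_series_on_tendsto [OF seminormed_bloch] u)
  then show "((\<lambda>k. cell_norm L (\<lambda>r. u k r - u k0 r)) \<longlongrightarrow> 0) (at k0)"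
    by (intro LIM_offset_zero_cancel [of _ k0]) (simp add: fun_diff_def)
qed

subsection \<open>Determinants of unitary arrays\<close>

text \<open>The size is a number that depends on the band, so the determinants of matrices indexed
  by a type do not apply.\<close>

definition leibniz :: "nat \<Rightarrow> (nat \<Rightarrow> nat \<Rightarrow> complex) \<Rightarrow> complex" where
  "leibniz n M = (\<Sum>p\<in>{p. p permutes {..<n}}. of_int (sign p) * (\<Prod>j<n. M j (p j)))"

lemma leibniz_cong:
  assumes "\<And>j i. j < n \<Longrightarrow> i < n \<Longrightarrow> M j i = M' j i"
  shows "leibniz n M = leibniz n M'"
  unfolding leibniz_def
proof (intro sum.cong refl arg_cong2 [where f = "(*)"] prod.cong)
  fix p j assume "p \<in> {p. p permutes {..<n}}" "j \<in> {..<n}"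
  then have "p j \<in> {..<n}" by (simp only: mem_Collect_eq permutes_in_image)
  then show "M j (p j) = M' j (p j)" using assms \<open>j \<in> {..<n}\<close> by simp
qed

lemma permutation_lessThan: "p permutes {..<n::nat} \<Longrightarrow> permutation p"
  by (rule permutation_permutes [THEN iffD2]) (auto intro!: exI [of _ "{..<n}"])

text \<open>Composing with the transposition flips the sign but not the product, so the sum equals
  its own negative.\<close>

lemma leibniz_equal_rows:
  assumes "a < n" "b < n" "a \<noteq> b" and eq: "\<And>i. i < n \<Longrightarrow> M a i = M b i"
  shows "leibniz n M = 0"
proof -
  let ?t = "Transposition.transpose a b"
  have t: "?t permutes {..<n}" using assms by (simp add: permutes_swap_id)
  have tt: "?t \<circ> ?t = id" by (rule transpose_comp_involutory)
  have pt: "(p \<circ> ?t) \<circ> ?t = p" for p :: "nat \<Rightarrow> nat" by (simp add: comp_assoc tt)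
  have "leibniz n M = (\<Sum>p\<in>{p. p permutes {..<n}}. - (of_int (sign p) * (\<Prod>j<n. M j (p j))))"
    unfolding leibniz_def
  proof (rule sum.reindex_bij_witness [of _ "\<lambda>p. p \<circ> ?t" "\<lambda>p. p \<circ> ?t"])
    fix p assume "p \<in> {p. p permutes {..<n}}"
    then have p: "p permutes {..<n}" by simp
    show "p \<circ> ?t \<in> {p. p permutes {..<n}}" "p \<circ> ?t \<in> {p. p permutes {..<n}}"
      by (simp_all add: permutes_compose [OF t p])
    show "(p \<circ> ?t) \<circ> ?t = p" "(p \<circ> ?t) \<circ> ?t = p" by (rule pt, rule pt)
    have "sign (p \<circ> ?t) = - sign p"
      using \<open>a \<noteq> b\<close> by (simp add: sign_compose permutation_lessThan [OF p] permutation_swap_id sign_swap_id)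
    moreover have "(\<Prod>j<n. M j ((p \<circ> ?t) j)) = (\<Prod>j<n. M j (p j))"
    proof -
      have "(\<Prod>j<n. M j ((p \<circ> ?t) j)) = (\<Prod>j<n. M (?t j) (p (?t j)))"
      proof (rule prod.cong)
        fix j assume j: "j \<in> {..<n}"
        have "p (?t j) \<in> {..<n}" using j by (simp only: permutes_in_image [OF p] permutes_in_image [OF t])
        then show "M j ((p \<circ> ?t) j) = M (?t j) (p (?t j))"
          using eq by (auto simp: Transposition.transpose_def)
      qed simp
      also have "\<dots> = (\<Prod>j<n. M j (p j))" using prod.permute [OF t, of "\<lambda>j. M j (p j)"] by simp
      finally show ?thesis .
    qed
    ultimately show "- (of_int (sign (p \<circ> ?t)) * (\<Prod>j<n. M j ((p \<circ> ?t) j))) = of_int (sign p) * (\<Prod>j<n. M j (p j))"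
      by simp
  qed
  then show ?thesis by (simp add: leibniz_def sum_negf)
qed

text \<open>Expansion along row \<open>j0\<close>. The coefficients are the cofactors, written as
  determinants whose row \<open>j0\<close> is a unit vector, so that they do not involve row
  \<open>j0\<close> of \<open>M\<close>.\<close>

lemma leibniz_row:
  assumes j0: "j0 < n"
  shows "leibniz n (M(j0 := y)) = (\<Sum>i<n. y i * leibniz n (M(j0 := \<lambda>l. if l = i then 1 else 0)))"
proof -
  let ?Q = "\<lambda>p. \<Prod>j\<in>{..<n} - {j0}. M j (p j)"
  have split: "(\<Prod>j<n. (M(j0 := z)) j (p j)) = z (p j0) * ?Q p" for z p
    using prod.remove [of "{..<n}" j0 "\<lambda>j. (M(j0 := z)) j (p j)"] j0 by simp
  have "(\<Sum>i<n. y i * leibniz n (M(j0 := \<lambda>l. if l = i then 1 else 0)))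
      = (\<Sum>i<n. \<Sum>p\<in>{p. p permutes {..<n}}. y i * (of_int (sign p) * ((if p j0 = i then 1 else 0) * ?Q p)))"
    unfolding leibniz_def split sum_distrib_left ..
  also have "\<dots> = (\<Sum>p\<in>{p. p permutes {..<n}}. \<Sum>i<n. y i * (of_int (sign p) * ((if p j0 = i then 1 else 0) * ?Q p)))"
    by (rule sum.swap)
  also have "\<dots> = (\<Sum>p\<in>{p. p permutes {..<n}}. of_int (sign p) * (y (p j0) * ?Q p))"
  proof (rule sum.cong)
    fix p assume "p \<in> {p. p permutes {..<n}}"
    then have "p j0 \<in> {..<n}" using j0 permutes_in_image [of p "{..<n}" j0] by simp
    have "(\<Sum>i<n. y i * (of_int (sign p) * ((if p j0 = i then 1 else 0) * ?Q p)))
        = (\<Sum>i<n. if p j0 = i then y i * (of_int (sign p) * ?Q p) else 0)"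
      by (intro sum.cong refl) simp
    also have "\<dots> = of_int (sign p) * (y (p j0) * ?Q p)"
      using \<open>p j0 \<in> {..<n}\<close> by (subst sum.delta') (simp_all add: mult_ac)
    finally show "(\<Sum>i<n. y i * (of_int (sign p) * ((if p j0 = i then 1 else 0) * ?Q p)))
        = of_int (sign p) * (y (p j0) * ?Q p)" .
  qed simp
  finally show ?thesis unfolding leibniz_def split ..
qed

text \<open>The rows on the left are the columns of \<open>M\<close> in the order \<open>p\<close>;
  reindexing by \<open>p\<close> after the inverse of \<open>q\<close> treats transposition and
  permutation at once.\<close>

lemma leibniz_permuted:
  assumes p: "p permutes {..<n}"
  shows "leibniz n (\<lambda>j i. M i (p j)) = of_int (sign p) * leibniz n M"
  unfolding leibniz_def sum_distrib_left
proof (rule sum.reindex_bij_witness [of _ "\<lambda>q. inv_into UNIV q \<circ> p" "\<lambda>q. p \<circ> inv_into UNIV q"])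
  fix q assume "q \<in> {q. q permutes {..<n}}"
  then have q: "q permutes {..<n}" by simp
  note iq = permutes_inv [OF q] and perm = permutation_lessThan [OF p] permutation_lessThan [OF q]
  show "inv_into UNIV (p \<circ> inv_into UNIV q) \<circ> p = q" "p \<circ> inv_into UNIV (inv_into UNIV q \<circ> p) = q"
    using permutes_bij [OF p] permutes_bij [OF q]
    by (simp_all add: o_inv_distrib bij_imp_bij_inv inv_inv_eq o_assoc [symmetric] permutes_inv_o [OF p] permutes_inv_o [OF q])
      (simp_all add: o_assoc permutes_inv_o [OF p])
  show "p \<circ> inv_into UNIV q \<in> {p. p permutes {..<n}}" "inv_into UNIV q \<circ> p \<in> {q. q permutes {..<n}}"
    by (simp_all add: permutes_compose [OF iq p] permutes_compose [OF p iq])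
  have "(\<Prod>j<n. M (q j) (p j)) = (\<Prod>j<n. M j ((p \<circ> inv_into UNIV q) j))"
    using prod.permute [OF q, of "\<lambda>j. M j ((p \<circ> inv_into UNIV q) j)"] by (simp add: permutes_inverses [OF q])
  moreover have "sign p * sign (p \<circ> inv_into UNIV q) = sign q"
    using sign_idempotent [of p]
    by (simp add: sign_compose perm permutation_inverse sign_inverse mult.assoc [symmetric])
  ultimately show "of_int (sign p) * (of_int (sign (p \<circ> inv_into UNIV q)) * (\<Prod>j<n. M j ((p \<circ> inv_into UNIV q) j)))
      = of_int (sign q) * (\<Prod>j<n. M (q j) (p j))"
    by (simp only: mult.assoc [symmetric] of_int_mult [symmetric])
qed

text \<open>The product of the determinant with its conjugate is a sum over permutations
  \<open>p\<close> of \<open>H p\<close>, a conjugated product times a determinant of permuted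
  columns. \<open>H\<close> makes sense for every map \<open>f\<close>, and over all maps the sum
  factors into inner products of rows.\<close>

lemma cmod_leibniz_unitary:
  assumes orth: "\<And>j l. j < n \<Longrightarrow> l < n \<Longrightarrow> (\<Sum>i<n. cnj (M j i) * M l i) = (if j = l then 1 else 0)"
  shows "cmod (leibniz n M) = 1"
proof -
  let ?P = "{p. p permutes {..<n}}" and ?F = "PiE {..<n} (\<lambda>_. {..<n})"
  define H where "H f = (\<Prod>j<n. cnj (M j (f j))) * leibniz n (\<lambda>j i. M i (f j))" for f
  have H_cong: "H f = H g" if "\<And>j. j < n \<Longrightarrow> f j = g j" for f g
    unfolding H_def using that by (intro arg_cong2 [where f = "(*)"] prod.cong leibniz_cong) auto
  have "cnj (leibniz n M) * leibniz n M = (\<Sum>p\<in>?P. H p)"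
    unfolding leibniz_def [of n M, THEN arg_cong [where f = cnj]] cnj_sum sum_distrib_right
  proof (rule sum.cong)
    fix p assume "p \<in> ?P"
    then show "cnj (of_int (sign p) * (\<Prod>j<n. M j (p j))) * leibniz n M = H p"
      by (simp add: H_def leibniz_permuted mult_ac)
  qed simp
  also have "\<dots> = (\<Sum>f\<in>{f \<in> ?F. inj_on f {..<n}}. H f)"
  proof (rule sum.reindex_bij_witness [of _ "\<lambda>f i. if i < n then f i else i" "\<lambda>p. restrict p {..<n}"])
    fix p assume "p \<in> ?P"
    then have p: "p permutes {..<n}" by simp
    show "(\<lambda>i. if i < n then restrict p {..<n} i else i) = p"
      using permutes_not_in [OF p] by (auto simp: fun_eq_iff)
    show "restrict p {..<n} \<in> {f \<in> ?F. inj_on f {..<n}}"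
      using permutes_in_image [OF p] permutes_inj_on [OF p, of "{..<n}"] by (auto simp: inj_on_restrict_eq)
    show "H (restrict p {..<n}) = H p" by (rule H_cong) simp
  next
    fix f assume f: "f \<in> {f \<in> ?F. inj_on f {..<n}}"
    then show "restrict (\<lambda>i. if i < n then f i else i) {..<n} = f"
      by (auto simp: fun_eq_iff PiE_def extensional_def)
    have "f ` {..<n} = {..<n}" using f by (intro endo_inj_surj) (auto simp: PiE_def)
    then have "bij_betw (\<lambda>i. if i < n then f i else i) {..<n} {..<n}"
      using f by (auto simp: bij_betw_def inj_on_def)
    then show "(\<lambda>i. if i < n then f i else i) \<in> ?P"
      by (auto intro!: bij_imp_permutes split: if_splits)
  qed
  \<comment> \<open>A map that is not injective repeats a row in the determinant, so the additional
    summands vanish.\<close>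
  also have "\<dots> = (\<Sum>f\<in>?F. H f)"
  proof (rule sum.mono_neutral_left)
    show "finite ?F" by (rule finite_PiE) simp_all
    show "\<forall>f\<in>?F - {f \<in> ?F. inj_on f {..<n}}. H f = 0"
    proof
      fix f assume "f \<in> ?F - {f \<in> ?F. inj_on f {..<n}}"
      then obtain a b where "a < n" "b < n" "a \<noteq> b" "f a = f b" by (auto simp: inj_on_def)
      then have "leibniz n (\<lambda>j i. M i (f j)) = 0" by (intro leibniz_equal_rows [of a n b]) simp_all
      then show "H f = 0" by (simp add: H_def)
    qed
  qed auto
  also have "\<dots> = (\<Sum>f\<in>?F. \<Sum>q\<in>?P. of_int (sign q) * (\<Prod>j<n. cnj (M j (f j)) * M (q j) (f j)))"
    by (simp add: H_def leibniz_def sum_distrib_left prod.distrib mult_ac)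
  also have "\<dots> = (\<Sum>q\<in>?P. of_int (sign q) * (\<Sum>f\<in>?F. \<Prod>j<n. cnj (M j (f j)) * M (q j) (f j)))"
    by (subst sum.swap) (simp add: sum_distrib_left)
  also have "\<dots> = (\<Sum>q\<in>?P. of_int (sign q) * (\<Prod>j<n. \<Sum>i<n. cnj (M j i) * M (q j) i))"
    by (subst prod_sum_PiE) simp_all
  \<comment> \<open>By orthonormality of the rows the product is nonzero only if \<open>q\<close>
    fixes every index.\<close>
  also have "\<dots> = (\<Sum>q\<in>?P. if q = id then 1 else 0)"
  proof (rule sum.cong)
    fix q assume "q \<in> ?P"
    then have q: "q permutes {..<n}" by simp
    have "(\<Prod>j<n. \<Sum>i<n. cnj (M j i) * M (q j) i) = (\<Prod>j<n. if j = q j then 1 else 0)"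
    proof (rule prod.cong)
      fix j assume "j \<in> {..<n}"
      moreover from this have "q j \<in> {..<n}" by (simp only: permutes_in_image [OF q])
      ultimately show "(\<Sum>i<n. cnj (M j i) * M (q j) i) = (if j = q j then 1 else 0)" by (simp add: orth)
    qed simp
    also have "\<dots> = (if q = id then 1 else 0)"
    proof (cases "q = id")
      case False
      then obtain j where "q j \<noteq> j" by (auto simp: fun_eq_iff)
      then have "j < n" using permutes_not_in [OF q, of j] by force
      then show ?thesis using False \<open>q j \<noteq> j\<close> by (auto intro!: prod_zero bexI [of _ j])
    qed simp
    finally show "of_int (sign q) * (\<Prod>j<n. \<Sum>i<n. cnj (M j i) * M (q j) i) = (if q = id then 1 else (0::complex))"
      by (simp add: sign_id)
  qed simp
  also have "\<dots> = 1" by (simp add: permutes_id finite_permutations)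
  finally have "complex_of_real ((cmod (leibniz n M))\<^sup>2) = 1"
    unfolding complex_norm_square by (simp add: mult.commute)
  then have "(cmod (leibniz n M))\<^sup>2 = 1" by (simp only: of_real_eq_1_iff)
  then show ?thesis by (simp add: power2_eq_1_iff) (use norm_ge_zero [of "leibniz n M"] in linarith)
qed

lemma continuous_on_leibniz:
  assumes "\<And>j i. j < n \<Longrightarrow> i < n \<Longrightarrow> continuous_on S (\<lambda>k. M k j i)"
  shows "continuous_on S (\<lambda>k. leibniz n (M k))"
  unfolding leibniz_def
proof (intro continuous_on_sum continuous_on_mult continuous_on_const continuous_on_prod)
  fix p j assume "p \<in> {p. p permutes {..<n}}" "j \<in> {..<n}"
  then have "p j \<in> {..<n}" by (simp only: mem_Collect_eq permutes_in_image)
  then show "continuous_on S (\<lambda>k. M k j (p j))" using assms \<open>j \<in> {..<n}\<close> by simp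
qed

subsection \<open>Splitting into simple bands\<close>

context lattice
begin

lemma orthonormal_basis_expand:
  assumes ob: "orthonormal_basis L k I b S" and f: "f \<in> S"
  shows "AE r in lborel. f r = (\<Sum>i\<in>I. cscale (cell_inner L (b i) f) (b i r))"
proof -
  have b: "b i \<in> locally_L2" if "i \<in> I" for i
    using ob that by (auto simp: orthonormal_basis_def intro: bloch_locally_L2)
  obtain c where c: "AE r in lborel. f r = (\<Sum>i\<in>I. cscale (c i) (b i r))" and fb: "f \<in> bloch L k"
    using ob f unfolding orthonormal_basis_def by blast
  have fin: "finite I" using ob by (simp add: orthonormal_basis_def)
  have fL: "f \<in> locally_L2" by (rule bloch_locally_L2 [OF fb])
  have "cell_inner L (b i) f = c i" if i: "i \<in> I" for i
  proof -
    have "cell_inner L (b i) f = cell_inner L (b i) (\<lambda>r. \<Sum>j\<in>I. cscale (c j) (b j r))"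
      by (rule cell_inner_AE_cong [OF b [OF i] b [OF i] fL _ _ c])
        (intro locally_L2_sum locally_L2_cscale b, simp_all)
    also have "\<dots> = (\<Sum>j\<in>I. c j * cell_inner L (b i) (b j))"
      by (subst cell_inner_sum_right) (simp_all add: b i locally_L2_cscale cell_inner_cscale_right)
    also have "\<dots> = (\<Sum>j\<in>I. if i = j then c j else 0)"
      by (intro sum.cong refl) (use ob i in \<open>simp add: orthonormal_basis_def\<close>)
    finally show ?thesis using fin i by simp
  qed
  then show ?thesis using c by simp
qed

lemma orthonormal_basis_inner:
  assumes ob: "orthonormal_basis L k I b S" and f: "f \<in> S" and g: "g \<in> locally_L2"
  shows "cell_inner L f g = (\<Sum>i\<in>I. cnj (cell_inner L (b i) f) * cell_inner L (b i) g)"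
proof -
  have b: "b i \<in> locally_L2" if "i \<in> I" for i
    using ob that by (auto simp: orthonormal_basis_def intro: bloch_locally_L2)
  have fL: "f \<in> locally_L2"
    using ob f unfolding orthonormal_basis_def by (auto intro: bloch_locally_L2)
  have "cell_inner L f g = cell_inner L (\<lambda>r. \<Sum>i\<in>I. cscale (cell_inner L (b i) f) (b i r)) g"
    by (rule cell_inner_AE_cong [OF fL _ g g orthonormal_basis_expand [OF ob f]])
      (intro locally_L2_sum locally_L2_cscale b, simp_all)
  also have "\<dots> = (\<Sum>i\<in>I. cnj (cell_inner L (b i) f) * cell_inner L (b i) g)"
    by (subst cell_inner_sum_left) (simp_all add: b g locally_L2_cscale cell_inner_cscale_left)
  finally show ?thesis .
qed

lemma orthonormal_basis_mem:
  assumes ob: "orthonormal_basis L k I b S" and i: "i \<in> I"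
  shows "b i \<in> S"
proof -
  have fin: "finite I" using ob by (simp add: orthonormal_basis_def)
  have "b i r = (\<Sum>j\<in>I. cscale (if j = i then 1 else 0) (b j r))" for r
  proof -
    have "(\<Sum>j\<in>I. cscale (if j = i then 1 else 0) (b j r)) = (\<Sum>j\<in>I. if j = i then b j r else 0)"
      by (intro sum.cong refl) simp
    then show ?thesis using fin i by simp
  qed
  then have "\<exists>c. AE r in lborel. b i r = (\<Sum>j\<in>I. cscale (c j) (b j r))"
    by (intro exI [of _ "\<lambda>j. if j = i then 1 else 0"] AE_I2)
  then show ?thesis using ob i unfolding orthonormal_basis_def by blast
qed

text \<open>Both cardinalities equal the double sum of the squared moduli of the inner products
  between the two bases.\<close>

lemma orthonormal_basis_card:
  assumes I: "orthonormal_basis L k I b S" and J: "orthonormal_basis L k' J c S"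
  shows "card I = card J"
proof -
  have L2: "f \<in> locally_L2" if "f \<in> S" for f
    using I that unfolding orthonormal_basis_def by (auto intro: bloch_locally_L2)
  note mem = orthonormal_basis_mem [OF I] orthonormal_basis_mem [OF J]
  have "complex_of_nat (card I) = (\<Sum>i\<in>I. cell_inner L (b i) (b i))"
    using I by (simp add: orthonormal_basis_def)
  also have "\<dots> = (\<Sum>i\<in>I. \<Sum>j\<in>J. cnj (cell_inner L (c j) (b i)) * cell_inner L (c j) (b i))"
    by (intro sum.cong refl orthonormal_basis_inner [OF J] mem L2)
  also have "\<dots> = (\<Sum>j\<in>J. \<Sum>i\<in>I. cnj (cell_inner L (b i) (c j)) * cell_inner L (b i) (c j))"
    by (subst sum.swap) (simp add: cell_inner_commute [of "b _" "c _"] mult.commute)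
  also have "\<dots> = (\<Sum>j\<in>J. cell_inner L (c j) (c j))"
    by (intro sum.cong refl orthonormal_basis_inner [OF I, symmetric] mem L2)
  also have "\<dots> = complex_of_nat (card J)"
    using J by (simp add: orthonormal_basis_def)
  finally show ?thesis by (simp only: of_nat_eq_iff)
qed

end

context msg
begin

lemma splitting_basis:
  fixes E :: "('d, 'v, 'm::finite) fibres"
  assumes split: "splits_into G E l F" and band: "\<And>j. j < l \<Longrightarrow> band G 1 (F j)"
    and b: "\<And>j. j < l \<Longrightarrow> b j \<in> F j k" "\<And>j. j < l \<Longrightarrow> nm (b j) = 1"
  shows "orthonormal_basis (bravais G) k {..<l} b (E k)"
proof -
  note span = simple_band_span [OF band b]
  have orth: "ip f g = 0" if "i < l" "j < l" "i \<noteq> j" "f \<in> F i k" "g \<in> F j k" for i j f g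
    using split that unfolding splits_into_def by blast
  have E: "E k = {f \<in> bloch (bravais G) k. \<exists>h. (\<forall>j<l. h j \<in> F j k) \<and> (AE r in lborel. f r = (\<Sum>j<l. h j r))}"
    using split unfolding splits_into_def by blast
  have "f \<in> E k \<longleftrightarrow> f \<in> bloch (bravais G) k \<and> (\<exists>c. AE r in lborel. f r = (\<Sum>j<l. cscale (c j) (b j r)))" for f
  proof
    assume "f \<in> E k"
    then obtain h where f: "f \<in> bloch (bravais G) k" and h: "\<And>j. j < l \<Longrightarrow> h j \<in> F j k"
      and sum: "AE r in lborel. f r = (\<Sum>j<l. h j r)" unfolding E by blast
    have "AE r in lborel. \<forall>j\<in>{..<l}. h j r = cscale (ip (b j) (h j)) (b j r)"
      by (rule AE_finite_allI) (use span(2) h in auto)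
    with sum have "AE r in lborel. f r = (\<Sum>j<l. cscale (ip (b j) (h j)) (b j r))"
      by eventually_elim simp
    with f show "f \<in> bloch (bravais G) k \<and> (\<exists>c. AE r in lborel. f r = (\<Sum>j<l. cscale (c j) (b j r)))"
      by (intro conjI exI [of _ "\<lambda>j. ip (b j) (h j)"])
  next
    assume f: "f \<in> bloch (bravais G) k \<and> (\<exists>c. AE r in lborel. f r = (\<Sum>j<l. cscale (c j) (b j r)))"
    then obtain c where c: "AE r in lborel. f r = (\<Sum>j<l. cscale (c j) (b j r))" by blast
    have "(\<lambda>r. cscale (c j) (b j r)) \<in> F j k" if "j < l" for j
      by (rule span(3) [OF that that that bloch_cscale [OF span(1) [OF that that that]], where c = "c j"]) simp
    with f c show "f \<in> E k"
      unfolding E by (intro CollectI conjI exI [of _ "\<lambda>j r. cscale (c j) (b j r)"]) auto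
  qed
  then show ?thesis
    unfolding orthonormal_basis_def using span(1) orth b by (auto simp: ip_self_unit)
qed

text \<open>A periodic section has trivial transition functions, so the logarithms 0 produce the
  zero cocycle.\<close>

lemma chern_vanishes_periodic:
  assumes "continuous_unit_section G E \<phi>"
    and "\<And>k K. K \<in> reciprocal G \<Longrightarrow> AE r in lborel. \<phi> (k + K) r = \<phi> k r"
  shows "\<not> nonvanishing_chern G E"
proof -
  have "(\<lambda>K K'. 0) \<in> first_chern_class G E"
    unfolding first_chern_class_def
    using assms by (intro CollectI exI [of _ \<phi>] exI [of _ "\<lambda>K k. 0"]) simp
  then show ?thesis by (simp add: nonvanishing_chern_def)
qed

text \<open>A frame of the whole band and sections of all simple summands but one determine a section of
  the remaining one by Cramer's rule: its coefficients are the conjugate cofactors.\<close>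

lemma chern_vanishes_of_complement:
  fixes E :: "('d, 'v, 'm::finite) fibres"
  assumes split: "splits_into G E s F" and band: "\<And>j. j < s \<Longrightarrow> band G 1 (F j)"
    and frame: "analytic_periodic_frame G E I \<psi>"
    and j0: "j0 < s" and others: "\<And>j. j < s \<Longrightarrow> j \<noteq> j0 \<Longrightarrow> \<not> nonvanishing_chern G (F j)"
  shows "\<not> nonvanishing_chern G (F j0)"
proof -
  have "\<exists>\<phi>. continuous_unit_section G (F j) \<phi> \<and>
      (\<forall>k. \<forall>K\<in>reciprocal G. AE r in lborel. \<phi> (k + K) r = \<phi> k r)" if j: "j < s" "j \<noteq> j0" for j
  proof -
    have "(\<lambda>K K'. 0) \<in> first_chern_class G (F j)" using others [OF j] by (simp add: nonvanishing_chern_def)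
    then show ?thesis by (rule periodic_section [OF band [OF j(1)]]) blast
  qed
  then have "\<forall>j. \<exists>\<phi>. j < s \<and> j \<noteq> j0 \<longrightarrow> continuous_unit_section G (F j) \<phi> \<and>
      (\<forall>k. \<forall>K\<in>reciprocal G. AE r in lborel. \<phi> (k + K) r = \<phi> k r)" by blast
  then obtain \<phi> where \<phi>: "\<forall>j. j < s \<and> j \<noteq> j0 \<longrightarrow> continuous_unit_section G (F j) (\<phi> j) \<and>
      (\<forall>k. \<forall>K\<in>reciprocal G. AE r in lborel. \<phi> j (k + K) r = \<phi> j k r)"
    by (rule choice [THEN exE])
  have sec: "continuous_unit_section G (F j) (\<phi> j)" if "j < s" "j \<noteq> j0" for j using \<phi> that by blast
  have \<phi>_per: "AE r in lborel. \<phi> j (k + K) r = \<phi> j k r" if "j < s" "j \<noteq> j0" "K \<in> reciprocal G" for j k K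
    using \<phi> that by blast
  have "\<exists>b. b \<in> F j0 k \<and> nm b = 1" for k
    by (rule simple_band_frame [OF band [OF j0], of k]) blast
  then have "\<forall>k. \<exists>b. b \<in> F j0 k \<and> nm b = 1" ..
  then obtain \<chi>0 where \<chi>0: "\<forall>k. \<chi>0 k \<in> F j0 k \<and> nm (\<chi>0 k) = 1" by (rule choice [THEN exE])
  \<comment> \<open>On the remaining line an arbitrary unit vector completes the sections to a
    basis; it serves to identify \<open>X\<close> and does not enter its definition.\<close>
  define b where "b k j = (if j = j0 then \<chi>0 k else \<phi> j k)" for k j
  have b: "b k j \<in> F j k" "nm (b k j) = 1" if "j < s" for k j
    using \<chi>0 sec [OF that] by (auto simp: b_def continuous_unit_section_def)
  have basis: "orthonormal_basis (bravais G) k {..<s} (b k) (E k)" for k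
    by (rule splitting_basis [OF split band b])
  have bE: "b k j \<in> E k" if "j < s" for k j by (rule orthonormal_basis_mem [OF basis]) (simp add: that)
  have bb: "b k j \<in> bloch (bravais G) k" if "j < s" for k j
    by (rule simple_band_span(1) [OF band [OF that] b [OF that]])
  have bL: "b k j \<in> locally_L2" if "j < s" for k j by (rule bloch_locally_L2 [OF bb [OF that]])
  have fr: "orthonormal_basis (bravais G) k I (\<lambda>i. \<psi> i k) (E k)" for k
    using frame by (simp add: analytic_periodic_frame_def)
  have cardI: "card I = s" using orthonormal_basis_card [OF fr [of 0] basis [of 0]] by simp
  have finI: "finite I" using fr [of 0] by (simp add: orthonormal_basis_def)
  \<comment> \<open>\<open>leibniz\<close> is indexed by numbers, while the frame has its own index
    set, of size \<open>s\<close> by comparison of the two bases.\<close>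
  obtain e where e: "bij_betw e {..<s} I"
    using ex_bij_betw_nat_finite [OF finI] cardI by (auto simp: atLeast0LessThan)
  have eI: "e i \<in> I" if "i < s" for i using e that by (auto simp: bij_betw_def)
  define \<xi> where "\<xi> i k = \<psi> (e i) k" for i k
  have \<xi>b: "\<xi> i k \<in> bloch (bravais G) k" if "i < s" for i k
    using fr eI [OF that] by (simp add: orthonormal_basis_def \<xi>_def)
  have \<xi>L: "\<xi> i k \<in> locally_L2" if "i < s" for i k by (rule bloch_locally_L2 [OF \<xi>b [OF that]])
  have \<xi>_per: "AE r in lborel. \<xi> i (k + K) r = \<xi> i k r" if "i < s" "K \<in> reciprocal G" for i k K
    using frame eI [OF that(1)] that(2) by (simp add: analytic_periodic_frame_def \<xi>_def)
  have \<xi>_inner: "ip f g = (\<Sum>i<s. cnj (ip (\<xi> i k) f) * ip (\<xi> i k) g)" if "f \<in> E k" "g \<in> locally_L2" for f g k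
    unfolding orthonormal_basis_inner [OF fr that] \<xi>_def
    by (rule sum.reindex_bij_betw [OF e, symmetric])
  define M where "M k j i = ip (\<xi> i k) (b k j)" for k j i
  \<comment> \<open>Cofactors of row \<open>j0\<close>. They involve only the other rows, so they
    are continuous and periodic although nothing of the kind is known of
    \<open>\<chi>0\<close>.\<close>
  define C where "C k i = leibniz s ((M k)(j0 := \<lambda>l. if l = i then 1 else 0))" for k i
  define X where "X k r = (\<Sum>i<s. cscale (cnj (C k i)) (\<xi> i k r))" for k r
  have M_orth: "(\<Sum>i<s. cnj (M k j i) * M k l i) = (if j = l then 1 else 0)" if "j < s" "l < s" for k j l
    unfolding M_def \<xi>_inner [OF bE [OF that(1)] bL [OF that(2)], symmetric]
    using basis [of k] that by (simp add: orthonormal_basis_def)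
  have XL: "X k \<in> locally_L2" for k
    unfolding X_def [abs_def] by (intro locally_L2_sum locally_L2_cscale \<xi>L) simp
  \<comment> \<open>Replacing row \<open>j0\<close> by row \<open>j\<close> makes two rows equal
    unless \<open>j = j0\<close>: thus \<open>X\<close> is orthogonal to all other lines and lies in
    the remaining one.\<close>
  have bX: "ip (b k j) (X k) = cnj (if j = j0 then leibniz s (M k) else 0)" if j: "j < s" for k j
  proof -
    have "ip (X k) (b k j) = (\<Sum>i<s. C k i * M k j i)"
      unfolding X_def [abs_def] M_def
      by (subst cell_inner_sum_left) (simp_all add: \<xi>L bL j locally_L2_cscale cell_inner_cscale_left)
    also have "\<dots> = leibniz s ((M k)(j0 := M k j))"
      unfolding leibniz_row [OF j0, of "M k" "M k j"] C_def by (simp add: mult.commute)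
    also have "\<dots> = (if j = j0 then leibniz s (M k) else 0)"
    proof (cases "j = j0")
      case False
      then show ?thesis using leibniz_equal_rows [OF j0 j, of "(M k)(j0 := M k j)"] by simp
    qed simp
    finally show ?thesis by (subst cell_inner_commute) simp
  qed
  have XE: "X k \<in> E k" for k
  proof -
    have "X k r = (\<Sum>x\<in>I. cscale (cnj (C k (inv_into {..<s} e x))) (\<psi> x k r))" for r
      unfolding X_def \<xi>_def sum.reindex_bij_betw [OF e, symmetric]
      by (intro sum.cong refl) (simp add: inv_into_f_f [OF bij_betw_imp_inj_on [OF e]])
    then have "\<exists>c. AE r in lborel. X k r = (\<Sum>x\<in>I. cscale (c x) (\<psi> x k r))"
      by (intro exI [of _ "\<lambda>x. cnj (C k (inv_into {..<s} e x))"] AE_I2)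
    moreover have "X k \<in> bloch (bravais G) k"
      unfolding X_def [abs_def] by (intro bloch_sum bloch_cscale \<xi>b) simp
    ultimately show ?thesis using fr [of k] unfolding orthonormal_basis_def by blast
  qed
  have X_eq: "AE r in lborel. X k r = cscale (cnj (leibniz s (M k))) (b k j0 r)" for k
  proof -
    have "(\<Sum>j<s. cscale (ip (b k j) (X k)) (b k j r)) = (\<Sum>j<s. if j = j0 then cscale (cnj (leibniz s (M k))) (b k j0 r) else 0)" for r
      by (intro sum.cong refl) (simp add: bX)
    then show ?thesis using orthonormal_basis_expand [OF basis XE, of k] j0 by simp
  qed
  have Xb: "X k \<in> bloch (bravais G) k" for k
    using XE [of k] fr [of k] unfolding orthonormal_basis_def by blast
  have XF: "X k \<in> F j0 k" for k
    by (rule simple_band_span(3) [OF band [OF j0] b [OF j0] Xb X_eq])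
  \<comment> \<open>The determinant is unimodular because both bases are orthonormal, so
    \<open>X\<close> vanishes nowhere.\<close>
  have X1: "nm (X k) = 1" for k
  proof -
    have "nm (X k) = nm (\<lambda>r. cscale (cnj (leibniz s (M k))) (b k j0 r))"
      by (rule cell_norm_AE_cong [OF XL locally_L2_cscale [OF bL [OF j0]] X_eq])
    then show ?thesis using cmod_leibniz_unitary [OF M_orth] by (simp add: b j0)
  qed
  define u where "u i k = phase_mult (- k) (\<xi> i k)" for i k
  have u_cont: "ncont (u i)" if i: "i < s" for i
    unfolding u_def [abs_def]
  proof (rule real_analytic_ncont)
    show "real_analytic (bloch (bravais G) 0) nm (\<lambda>k. phase_mult (- k) (\<xi> i k))"
      using frame eI [OF i] by (simp add: analytic_periodic_frame_def \<xi>_def)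
    show "phase_mult (- k) (\<xi> i k) \<in> bloch (bravais G) 0" for k by (rule phase_mult_bloch_0 [OF \<xi>b [OF i]])
  qed
  have M_cont: "continuous_on UNIV (\<lambda>k. M k j i)" if j: "j < s" "j \<noteq> j0" and i: "i < s" for j i
  proof -
    have \<phi>b: "\<phi> j k \<in> bloch (bravais G) k" for k using bb [OF j(1), of k] j(2) by (simp add: b_def)
    have "M k j i = ip (u i k) (phase_mult (- k) (\<phi> j k))" for k
      by (simp add: M_def b_def j(2) u_def)
    then show ?thesis
      using continuous_on_cell_inner [OF u_cont [OF i] section_ncont [OF sec [OF j] \<phi>b]] by simp
  qed
  have C_cont: "continuous_on UNIV (\<lambda>k. C k i)" for i
    unfolding C_def
  proof (rule continuous_on_leibniz)
    fix j l assume "j < s" "l < s"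
    then show "continuous_on UNIV (\<lambda>k. ((M k)(j0 := \<lambda>l. if l = i then 1 else 0)) j l)"
      using M_cont [of j l] by (cases "j = j0") simp_all
  qed
  have "ncont (\<lambda>k r. \<Sum>i<s. cscale (cnj (C k i)) (u i k r))"
    by (intro ncont_sum ncont_cscale u_cont continuous_on_cnj C_cont) simp
  moreover have "phase_mult (- k) (X k) = (\<lambda>r. \<Sum>i<s. cscale (cnj (C k i)) (u i k r))" for k
    by (rule ext) (simp add: phase_mult_def X_def u_def cscale_sum_right mult.commute)
  ultimately have X_cont: "ncont (\<lambda>k. phase_mult (- k) (X k))" by simp
  show ?thesis
  proof (rule chern_vanishes_periodic)
    show "continuous_unit_section G (F j0) X"
      unfolding continuous_unit_section_def
      using XF X1 ncont_tendsto [OF X_cont] by (simp add: fun_diff_def)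
    fix k K assume K: "K \<in> reciprocal G"
    have "M (k + K) j i = M k j i" if "j < s" "j \<noteq> j0" "i < s" for j i
      unfolding M_def
    proof (rule cell_inner_AE_cong)
      show "AE r in lborel. b (k + K) j r = b k j r"
        using \<phi>_per [OF that(1,2) K] that(2) by (simp add: b_def)
    qed (intro \<xi>L bL \<xi>_per that K)+
    then have C: "C (k + K) i = C k i" for i
      unfolding C_def by (intro leibniz_cong) auto
    have "AE r in lborel. \<forall>i\<in>{..<s}. \<xi> i (k + K) r = \<xi> i k r"
      by (rule AE_finite_allI) (use \<xi>_per K in auto)
    then show "AE r in lborel. X (k + K) r = X k r"
      by eventually_elim (simp add: X_def C)
  qed
qed

end

theorem mainTheorem4:
  fixes G :: "('p, 'd::finite, 'v::finite) msg"
    and E :: "('d, 'v, 'm::finite) fibres"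
    and s :: nat
  assumes "symmorphic_msg G"
    and "spinless G \<or> spinful G"
    and "elementary_band_rep G s E"
  shows "(\<forall>l F j. splits_into G E l F \<and> j < l \<and> simple_band G (F j) \<and> \<not> band_rep G 1 (F j)
            \<longrightarrow> nonvanishing_chern G (F j))
       \<and> (2 \<le> s \<longrightarrow> (\<forall>F. splits_into G E s F \<and> (\<forall>j<s. simple_band G (F j))
            \<longrightarrow> 2 \<le> card {j. j < s \<and> nonvanishing_chern G (F j)}
              \<and> (s = 2 \<longrightarrow> nonvanishing_chern G (F 0) \<and> nonvanishing_chern G (F 1))))"
proof -
  interpret msg G by (rule msg.intro) (rule assms(1))
  have rep: "band_rep G s E"
    and elem: "\<And>l F. splits_into G E l F \<Longrightarrow> (\<forall>j<l. \<exists>N<s. band_rep G N (F j)) \<Longrightarrow> False"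
    using assms(3) unfolding elementary_band_rep_def by blast+
  have "\<exists>(I :: (nat \<times> nat) set) \<psi>. analytic_periodic_frame G E I \<psi>"
    using rep unfolding band_rep_def Let_def by (elim conjE exE) (intro exI, assumption)
  then obtain I :: "(nat \<times> nat) set" and \<psi> where frame: "analytic_periodic_frame G E I \<psi>"
    by (elim exE)
  show ?thesis
  proof (intro conjI allI impI)
    fix l F j
    assume "splits_into G E l F \<and> j < l \<and> simple_band G (F j) \<and> \<not> band_rep G 1 (F j)"
    \<comment> \<open>Contrapositive of \<open>simple_band_rep\<close>.\<close>
    then show "nonvanishing_chern G (F j)" using simple_band_rep by (auto simp: simple_band_def)
  next
    fix F
    assume s: "2 \<le> s" and *: "splits_into G E s F \<and> (\<forall>j<s. simple_band G (F j))"
    then have split: "splits_into G E s F" and band: "\<And>j. j < s \<Longrightarrow> band G 1 (F j)"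
      by (simp_all add: simple_band_def)
    let ?S = "{j. j < s \<and> nonvanishing_chern G (F j)}"
    have fin: "finite ?S" by simp
    have ne: "?S \<noteq> {}"
    proof
      assume "?S = {}"
      then have "band_rep G 1 (F j)" if "j < s" for j
        using simple_band_rep [OF band [OF that]] that by blast
      \<comment> \<open>All summands would be band representations of rank 1, which is less than
        \<open>s\<close>, against elementarity.\<close>
      then show False using elem [OF split] s by (metis One_nat_def Suc_1 Suc_le_lessD)
    qed
    have ns: "?S \<noteq> {j0}" for j0
    proof
      assume S: "?S = {j0}"
      then have j0: "j0 < s" "nonvanishing_chern G (F j0)" by blast+
      have "\<not> nonvanishing_chern G (F j)" if "j < s" "j \<noteq> j0" for j using S that by blast
      from chern_vanishes_of_complement [OF split band frame j0(1) this] show False using j0(2) by blast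
    qed
    have "card ?S \<noteq> 0" using ne card_0_eq [OF fin] by blast
    moreover have "card ?S \<noteq> 1"
    proof
      assume "card ?S = 1"
      then obtain j0 where "?S = {j0}" by (rule card_1_singletonE)
      then show False by (rule ns [THEN notE])
    qed
    ultimately show card: "2 \<le> card ?S" by linarith
    assume s2: "s = 2"
    have "?S \<subseteq> {..<2}" using s2 by auto
    then have S: "?S = {..<2}" using card by (intro card_seteq) auto
    have "0 \<in> ?S" "1 \<in> ?S" unfolding S by simp_all
    then show "nonvanishing_chern G (F 0)" "nonvanishing_chern G (F 1)" by simp_all
  qed
qed

end
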